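(* Let $n\ge3$ and let $\Omega\subset\mathbb{R}^n$ be any bounded domain with smooth boundary. Then $\Omega$ admits a conformal deformation of the Euclidean metric such that the resulting metric has constant scalar curvature, and the deformation can be chosen so that the sign of the scalar curvature is either positive or negative (that is, each of the two signs can be realized). Furthermore, the deformation can be arranged so that the metric of the boundary remains invariant, that is, $\partial\Omega$ keeps the metric it inherits from $\mathbb{R}^n$.
   Context: A conformal deformation of the Euclidean metric $g$ on $\Omega$ is a metric $\tilde g=e^{2f}g$ with $f$ a smooth real-valued function. The boundary metric is invariant when $f=0$ on $\partial\Omega$. *)

theory Defs
  imports "HOL-Analysis.Analysis"
begin

section \<open>Smooth functions and domains with smooth boundary\<close>

definition partial_deriv :: "'n::finite \<Rightarrow> (real^'n \<Rightarrow> real) \<Rightarrow> real^'n \<Rightarrow> real" where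
  "partial_deriv i f x = frechet_derivative f (at x) (axis i 1)"

text \<open>Intended for open \<open>U\<close>, since the derivatives are taken in the full space.\<close>

fun C_k_on :: "nat \<Rightarrow> (real^'n::finite) set \<Rightarrow> (real^'n \<Rightarrow> real) \<Rightarrow> bool" where
  "C_k_on 0 U f \<longleftrightarrow> continuous_on U f"
| "C_k_on (Suc k) U f \<longleftrightarrow>
     (\<forall>x\<in>U. f differentiable (at x)) \<and> (\<forall>i. C_k_on k U (partial_deriv i f))"

text \<open>
  Smoothness on an arbitrary set: near each point the function is the restriction of a
  function that is smooth on an open neighbourhood. On the closure of a domain with smooth
  boundary this is smoothness up to the boundary, in the sense of manifolds with boundary.
\<close>

definition smooth_fun_on :: "(real^'n::finite) set \<Rightarrow> (real^'n \<Rightarrow> real) \<Rightarrow> bool" where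
  "smooth_fun_on S f \<longleftrightarrow>
     (\<forall>x\<in>S. \<exists>U h. open U \<and> x \<in> U \<and> (\<forall>k. C_k_on k U h) \<and> (\<forall>y\<in>U \<inter> S. h y = f y))"

text \<open>
  Locally, \<open>\<Omega>\<close> is the negativity set of a smooth function whose gradient does not vanish, so it
  lies on one side of its boundary, which is a smooth hypersurface.
\<close>

definition smooth_boundary :: "(real^'n::finite) set \<Rightarrow> bool" where
  "smooth_boundary \<Omega> \<longleftrightarrow>
     (\<forall>p\<in>frontier \<Omega>. \<exists>U \<rho>. open U \<and> p \<in> U \<and> smooth_fun_on U \<rho> \<and>
        (\<exists>i. partial_deriv i \<rho> p \<noteq> 0) \<and> \<Omega> \<inter> U = {x\<in>U. \<rho> x < 0})"

definition bounded_smooth_domain :: "(real^'n::finite) set \<Rightarrow> bool" where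
  "bounded_smooth_domain \<Omega> \<longleftrightarrow>
     open \<Omega> \<and> connected \<Omega> \<and> \<Omega> \<noteq> {} \<and> bounded \<Omega> \<and> smooth_boundary \<Omega>"

section \<open>Scalar curvature of a metric in Euclidean coordinates\<close>

text \<open>A metric \<open>g\<close> is given by its matrix of coefficients \<open>g x $ i $ j\<close> in the standard coordinates.\<close>

type_synonym 'n metric_field = "real^'n \<Rightarrow> real^'n^'n"

definition flat_metric :: "'n::finite metric_field" where
  "flat_metric x = mat 1"

definition conformal_change ::
    "(real^'n \<Rightarrow> real) \<Rightarrow> 'n::finite metric_field \<Rightarrow> 'n metric_field" where
  "conformal_change f g x = exp (2 * f x) *\<^sub>R g x"

text \<open>\<open>christoffel g k i j\<close> is the symbol with upper index \<open>k\<close> and lower indices \<open>i\<close>, \<open>j\<close>.\<close>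

definition christoffel :: "'n::finite metric_field \<Rightarrow> 'n \<Rightarrow> 'n \<Rightarrow> 'n \<Rightarrow> real^'n \<Rightarrow> real" where
  "christoffel g k i j x =
     (1/2) * (\<Sum>l\<in>UNIV. matrix_inv (g x) $ k $ l *
        (partial_deriv i (\<lambda>y. g y $ j $ l) x + partial_deriv j (\<lambda>y. g y $ i $ l) x
         - partial_deriv l (\<lambda>y. g y $ i $ j) x))"

text \<open>
  \<open>riemann_curv g l k i j\<close> is the \<open>l\<close>-th component of \<open>R(\<partial>\<^sub>i, \<partial>\<^sub>j) \<partial>\<^sub>k\<close>, where
  \<open>R(X, Y) = [\<nabla>\<^sub>X, \<nabla>\<^sub>Y] - \<nabla>\<^bsub>[X, Y]\<^esub>\<close>; with the trace below, round spheres have positive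
  scalar curvature.
\<close>

definition riemann_curv ::
    "'n::finite metric_field \<Rightarrow> 'n \<Rightarrow> 'n \<Rightarrow> 'n \<Rightarrow> 'n \<Rightarrow> real^'n \<Rightarrow> real" where
  "riemann_curv g l k i j x =
     partial_deriv i (christoffel g l j k) x - partial_deriv j (christoffel g l i k) x
     + (\<Sum>m\<in>UNIV. christoffel g l i m x * christoffel g m j k x
                  - christoffel g l j m x * christoffel g m i k x)"

definition ricci_curv :: "'n::finite metric_field \<Rightarrow> 'n \<Rightarrow> 'n \<Rightarrow> real^'n \<Rightarrow> real" where
  "ricci_curv g j k x = (\<Sum>i\<in>UNIV. riemann_curv g i k i j x)"

definition scalar_curv :: "'n::finite metric_field \<Rightarrow> real^'n \<Rightarrow> real" where
  "scalar_curv g x = (\<Sum>j\<in>UNIV. \<Sum>k\<in>UNIV. matrix_inv (g x) $ j $ k * ricci_curv g j k x)"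

end

theory Submission
  imports Defs "HOL-Analysis.Analysis"
begin

text \<open>
  Put \<open>exp (2 * f) = u powr (4 / (n - 2))\<close>. The curvature is constant iff \<open>\<Delta>u\<close> is a constant multiple of
  \<open>u powr ((n + 2) / (n - 2))\<close>, with the opposite sign, and the boundary metric is unchanged iff \<open>u = 1\<close> on
  the boundary. For a small multiple of either sign such a \<open>u\<close> close to \<open>1\<close> is found by iterating the
  linear Dirichlet problem. Everything is based on the maximum principle: the linear problem is
  solved on the grids of mesh \<open>1 / 2 ^ k\<close>, where interior bounds for all difference quotients and
  barriers at the boundary allow passing to the limit. Smoothness up to the boundary comes from
  weighted estimates in powers of the distance to the boundary, gaining one tangential derivative at
  a time; the normal derivatives are then read off from the equation, and a Seeley reflection
  extends \<open>u\<close> smoothly across the boundary.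
\<close>

text \<open>Only one small constant of each sign is asked for. Near \<open>u = 1\<close> the
  iteration is a contraction for either sign, so no sign-dependent theory of the nonlinear equation
  is needed. The exponent 4/(n - 2) is the one for which the gradient terms of the curvature cancel.
  Two obstacles shape the proof. A grid solution satisfies its equation only at its own mesh, so
  different meshes are compared by fourth differences. Grid functions are defined on all of R^n,
  every translate of the lattice being solved independently; this avoids interpolation, but
  continuity of the limit has to be earned by comparing a solution with its translates. At the
  boundary, interior estimates degenerate and a differentiated solution is not known to vanish.
  Difference quotients along flows that preserve the distance function do vanish there, with bounds
  independent of the step, and this is how a tangential derivative inherits the boundary
  condition.\<close>

abbreviation pd :: "'n::finite => (real^'n => real) => real^'n => real" where
 "pd == partial_deriv"

abbreviation step :: "real => 'n::finite => real^'n"  (infixr "*." 75) where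
 "t *. i == t *\<^sub>R axis i 1"

section \<open>Smooth functions\<close>

abbreviation ax :: "'n::finite => real^'n" where
 "ax i \<equiv> axis i 1"

definition smooth_in :: "(real^'n::finite) set => (real^'n => real) => bool" where
 "smooth_in U f \<longleftrightarrow> (\<forall>k. C_k_on k U f)"

definition lap :: "(real^'n::finite => real) => real^'n => real" where
 "lap f x = (\<Sum>i\<in>UNIV. pd i (pd i f) x)"

fun pds :: "'n::finite list => (real^'n => real) => real^'n => real" where
 "pds [] f = f"
| "pds (i # is) f = pds is (pd i f)"

lemma pd_eqI: "(f has_derivative f') (at x) ==> pd i f x = f' (ax i)"
 unfolding partial_deriv_def using frechet_derivative_at by metis

lemma has_derivative_pd:
 fixes f :: "real^'n::finite => real"
 assumes "f differentiable (at x)"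
 shows "(f has_derivative (%v. \<Sum>i\<in>UNIV. v $ i * pd i f x)) (at x)"
proof -
 let ?D = "frechet_derivative f (at x)"
 have D: "(f has_derivative ?D) (at x)"
  using assms frechet_derivative_works by blast
 hence lin: "linear ?D" by (rule has_derivative_linear)
 have "?D v = (\<Sum>i\<in>UNIV. v $ i * pd i f x)" for v
 proof -
  have "?D v = ?D (\<Sum>i\<in>UNIV. (v$i) *. i)"
   using basis_expansion[of v] by (simp add: scalar_mult_eq_scaleR)
  also have "... = (\<Sum>i\<in>UNIV. v $ i * pd i f x)"
   using lin by (simp add: linear_sum linear_cmul partial_deriv_def)
  finally show ?thesis .
 qed
 hence "?D = (%v. \<Sum>i\<in>UNIV. v $ i * pd i f x)" by blast
 with D show ?thesis by simp
qed

lemma pd_cong: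
 fixes f g :: "real^'n::finite => real"
 assumes "open U" "x \<in> U" "!!y. y \<in> U ==> f y = g y"
 shows "pd i f x = pd i g x"
proof -
 have "(f has_derivative D) (at x) \<longleftrightarrow> (g has_derivative D) (at x)" for D
  using assms has_derivative_transform_within_open[of f D x UNIV U g]
   has_derivative_transform_within_open[of g D x UNIV U f] by auto
 thus ?thesis unfolding partial_deriv_def frechet_derivative_def by simp
qed

lemma differentiable_cong_open:
 fixes f g :: "real^'n::finite => real"
 assumes "open U" "x \<in> U" "!!y. y \<in> U ==> f y = g y" "f differentiable (at x)"
 shows "g differentiable (at x)"
 using assms has_derivative_transform_within_open[of f _ x UNIV U g]
 unfolding differentiable_def by blast

lemma C_k_on_cong:
 assumes "open U" "!!x. x \<in> U ==> f x = g x" "C_k_on k U f"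
 shows "C_k_on k U g"
 using assms(2,3)
proof (induction k arbitrary: f g)
 case 0
 thus ?case using continuous_on_cong[of U U f g] by simp
next
 case (Suc k)
 have "g differentiable (at x)" if "x \<in> U" for x
  using differentiable_cong_open[OF assms(1) that Suc.prems(1)] Suc.prems(2) that by simp
 moreover have "C_k_on k U (pd i g)" for i
  using Suc.IH[of "pd i f" "pd i g"] pd_cong[OF assms(1) _ Suc.prems(1)]
   Suc.prems(2) by simp
 ultimately show ?case by simp
qed

lemma C_k_on_imp_continuous:
 assumes "C_k_on k U f"
 shows "continuous_on U f"
 using assms
proof (cases k)
 case (Suc m)
 with assms show ?thesis
  by (simp add: continuous_at_imp_continuous_on differentiable_imp_continuous_within)
qed simp

lemma C_k_on_Suc_D: "C_k_on (Suc k) U f ==> C_k_on k U f"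
proof (induction k arbitrary: f)
 case 0
 from C_k_on_imp_continuous[OF 0] show ?case by simp
next
 case (Suc k)
 have "C_k_on (Suc k) U (pd i f)" for i using Suc.prems by simp
 from Suc.IH[OF this] Suc.prems show ?case by simp
qed

lemma C_k_on_subset: "C_k_on k U f ==> V \<subseteq> U ==> C_k_on k V f"
 by (induction k arbitrary: f) (auto intro: continuous_on_subset)

lemma smooth_in_subset: "smooth_in U f ==> V \<subseteq> U ==> smooth_in V f"
 unfolding smooth_in_def using C_k_on_subset by blast

lemma smooth_in_cong:
 "open U ==> (!!x. x \<in> U ==> f x = g x) ==> smooth_in U f ==> smooth_in U g"
 unfolding smooth_in_def using C_k_on_cong by blast

lemma smooth_in_diff: "smooth_in U f ==> x \<in> U ==> f differentiable (at x)"
 unfolding smooth_in_def using C_k_on.simps(2)[of 0 U f] by blast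

lemma smooth_in_pd: "smooth_in U f ==> smooth_in U (pd i f)"
 unfolding smooth_in_def using C_k_on.simps(2)[of _ U f] by blast

lemma smooth_in_continuous: "smooth_in U f ==> continuous_on U f"
 unfolding smooth_in_def using C_k_on_imp_continuous by blast

lemma smooth_in_pds: "smooth_in U f ==> smooth_in U (pds is f)"
 by (induction "is" arbitrary: f) (auto intro: smooth_in_pd)

text \<open>Coinduction over a family closed under partial derivatives, up to equality on
  \<open>U\<close>. It serves limits and series whose derivatives are only known to be of the same
  kind as the function itself.\<close>

lemma smooth_in_coinduct:
 assumes "P f" "open U"
  and "!!f x. P f ==> x \<in> U ==> f differentiable (at x)"
  and "!!f i. P f ==> \<exists>g. P g & (\<forall>x\<in>U. pd i f x = g x)"
 shows "smooth_in U f"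
proof -
 have "C_k_on k U f" for k
  using assms(1)
 proof (induction k arbitrary: f)
  case 0
  thus ?case using assms(3)
   by (simp add: continuous_at_imp_continuous_on differentiable_imp_continuous_within)
 next
  case (Suc k)
  have "C_k_on k U (pd i f)" for i
  proof -
   obtain g where "P g" "\<forall>x\<in>U. pd i f x = g x" using assms(4) Suc by blast
   thus ?thesis using Suc.IH C_k_on_cong[OF assms(2), of g] by metis
  qed
  thus ?case using assms(3) Suc.prems by simp
 qed
 thus ?thesis by (simp add: smooth_in_def)
qed

lemma smooth_in_local:
 assumes "!!x. x \<in> U ==> \<exists>V. open V & x \<in> V & smooth_in V f"
 shows "smooth_in U f"
proof -
 have "C_k_on k U f" if "!!x. x \<in> U ==> \<exists>V. open V & x \<in> V & C_k_on k V f" for k f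
  using that
 proof (induction k arbitrary: f)
  case 0
  have "isCont f x" if "x \<in> U" for x
   using 0[OF that] continuous_on_eq_continuous_at by auto
  thus ?case by (simp add: continuous_at_imp_continuous_on)
 next
  case (Suc k)
  show ?case
  proof (simp, intro conjI ballI allI)
   show "f differentiable (at x)" if "x \<in> U" for x using Suc.prems[OF that] by auto
   show "C_k_on k U (pd i f)" for i
    
   proof (rule Suc.IH)
    fix x assume "x \<in> U"
    then obtain V where "open V" "x \<in> V" "C_k_on (Suc k) V f" using Suc.prems by blast
    thus "\<exists>V. open V & x \<in> V & C_k_on k V (pd i f)"
     by (intro exI[of _ V]) simp
   qed
  qed
 qed
 thus ?thesis using assms unfolding smooth_in_def by meson
qed

lemma pd_const [simp]: "pd i (%x. c) = (%x. 0)"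
 by (rule ext) (simp add: pd_eqI[OF has_derivative_const])

lemma pd_component [simp]: "pd i (%x. x $ j) = (%x. if i = j then 1 else 0)"
proof
 fix x :: "real^'a"
 have "((%x. x $ j) has_derivative (%x. x $ j)) (at x)"
  by (rule bounded_linear_imp_has_derivative) (simp add: bounded_linear_vec_nth)
 thus "pd i (%x. x $ j) x = (if i = j then 1 else 0)"
  by (simp add: pd_eqI axis_def)
qed

lemma pd_add:
 assumes "f differentiable (at x)" "g differentiable (at x)"
 shows "pd i (%x. f x + g x) x = pd i f x + pd i g x"
 by (simp add: pd_eqI[OF has_derivative_add[OF has_derivative_pd[OF assms(1)] has_derivative_pd[OF assms(2)]]]
   axis_def if_distrib if_distribR sum.delta cong: if_cong)

lemma pd_mult:
 assumes "f differentiable (at x)" "g differentiable (at x)"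
 shows "pd i (%x. f x * g x) x = pd i f x * g x + f x * pd i g x"
 by (simp add: pd_eqI[OF has_derivative_mult[OF has_derivative_pd[OF assms(1)] has_derivative_pd[OF assms(2)]]]
   axis_def if_distrib if_distribR sum.delta cong: if_cong)

lemma pd_cmult:
 assumes "f differentiable (at x)"
 shows "pd i (%x. c * f x) x = c * pd i f x"
 using pd_mult[of "%_. c" x f i] assms by simp

lemma pd_minus:
 assumes "f differentiable (at x)"
 shows "pd i (%x. - f x) x = - pd i f x"
 using pd_cmult[OF assms, of i "-1"] by simp

lemma pd_diff:
 assumes "f differentiable (at x)" "g differentiable (at x)"
 shows "pd i (%x. f x - g x) x = pd i f x - pd i g x"
 using pd_add[of f x "%x. - g x" i] pd_minus[OF assms(2)] assms by simp

lemma pd_sum: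
 assumes "finite A" "!!a. a \<in> A ==> f a differentiable (at x)"
 shows "pd i (%x. \<Sum>a\<in>A. f a x) x = (\<Sum>a\<in>A. pd i (f a) x)"
 using assms
proof (induction A rule: finite_induct)
 case (insert a A)
 have "(%x. \<Sum>a\<in>A. f a x) differentiable (at x)"
  using insert by (intro differentiable_sum) auto
 thus ?case using insert by (simp add: pd_add)
qed simp

lemma pd_compose_real:
 assumes "(F has_real_derivative F') (at (u x))" "u differentiable (at x)"
 shows "pd i (%x. F (u x)) x = F' * pd i u x"
  and "(%x. F (u x)) differentiable (at x)"
proof -
 have "((%x. F (u x)) has_derivative (%v. F' * (\<Sum>i\<in>UNIV. v $ i * pd i u x))) (at x)"
  using has_derivative_compose[OF has_derivative_pd[OF assms(2)] assms(1)[unfolded has_field_derivative_def]]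
  by simp
 from pd_eqI[OF this, of i] this show "pd i (%x. F (u x)) x = F' * pd i u x"
   "(%x. F (u x)) differentiable (at x)"
  by (auto simp: axis_def if_distrib if_distribR sum.delta differentiable_def cong: if_cong)
qed

lemma pd_compose:
 fixes f :: "real^'n::finite => real" and \<Phi> :: "real^'m::finite => real^'n"
 assumes "f differentiable (at (\<Phi> x))" "!!j. (%x. \<Phi> x $ j) differentiable (at x)"
 shows "pd i (%x. f (\<Phi> x)) x
    = (\<Sum>j\<in>UNIV. pd i (%x. \<Phi> x $ j) x * pd j f (\<Phi> x))"
  and "(%x. f (\<Phi> x)) differentiable (at x)"
proof -
 let ?D = "%v. \<chi> j. \<Sum>i\<in>UNIV. v $ i * pd i (%x. \<Phi> x $ j) x"
 have "(\<Phi> has_derivative ?D) (at x)"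
  unfolding has_derivative_componentwise_within[of \<Phi>]
 proof
  fix b :: "real^'n" assume "b \<in> Basis"
  then obtain j where b: "b = ax j" by (auto simp: Basis_vec_def)
  show "((%x. \<Phi> x \<bullet> b) has_derivative (%v. ?D v \<bullet> b)) (at x)"
   using has_derivative_pd[OF assms(2), of j] by (simp add: b inner_axis)
 qed
 from has_derivative_compose[OF this has_derivative_pd[OF assms(1)]]
 have "((%x. f (\<Phi> x)) has_derivative (%v. \<Sum>j\<in>UNIV. ?D v $ j * pd j f (\<Phi> x))) (at x)" .
 from pd_eqI[OF this, of i] this show "pd i (%x. f (\<Phi> x)) x
    = (\<Sum>j\<in>UNIV. pd i (%x. \<Phi> x $ j) x * pd j f (\<Phi> x))"
   "(%x. f (\<Phi> x)) differentiable (at x)"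
  by (auto simp: axis_def if_distrib if_distribR sum.delta differentiable_def cong: if_cong)
qed

lemma C_k_on_const [simp]: "C_k_on k U (%x. c)"
 by (induction k arbitrary: c) auto

lemma C_k_on_component: "C_k_on k U (%x. x $ j)"
proof (cases k)
 case (Suc m)
 have "(%x::real^'a. x $ j) differentiable (at x)" for x
  by (simp add: bounded_linear_vec_nth bounded_linear_imp_differentiable)
 thus ?thesis by (simp add: Suc)
qed (simp add: continuous_on_component)

lemma C_k_on_add:
 assumes "open U" "C_k_on k U f" "C_k_on k U g"
 shows "C_k_on k U (%x. f x + g x)"
 using assms(2,3)
proof (induction k arbitrary: f g)
 case (Suc k)
 have "C_k_on k U (pd i (%x. f x + g x))" for i
  by (rule C_k_on_cong[OF assms(1), of "%x. pd i f x + pd i g x"])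
    (use Suc in "auto simp: pd_add")
 thus ?case using Suc.prems by simp
qed (simp add: continuous_on_add)

lemma C_k_on_mult:
 assumes "open U" "C_k_on k U f" "C_k_on k U g"
 shows "C_k_on k U (%x. f x * g x)"
 using assms(2,3)
proof (induction k arbitrary: f g)
 case (Suc k)
 have "C_k_on k U (pd i (%x. f x * g x))" for i
  by (rule C_k_on_cong[OF assms(1), of "%x. pd i f x * g x + f x * pd i g x"])
    (use Suc C_k_on_Suc_D[OF Suc.prems(1)] C_k_on_Suc_D[OF Suc.prems(2)]
    in "auto simp: pd_mult intro!: C_k_on_add[OF assms(1)]")
 thus ?case using Suc.prems by simp
qed (simp add: continuous_on_mult)

text \<open>The outer function comes with all its derivatives as one sequence \<open>Fs\<close>: the
  chain rule then stays in the family \<open>Fs j (u x)\<close>, and the induction on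
  \<open>k\<close> closes with \<open>j\<close> arbitrary. Powers, reciprocals and logarithms are
  brought into this format below.\<close>

lemma C_k_on_compose_real:
 assumes "open U" "!!j t. t \<in> J ==> (Fs j has_real_derivative Fs (Suc j) t) (at t)"
  "u ` U \<subseteq> J" "C_k_on k U u"
 shows "C_k_on k U (%x. Fs j (u x))"
 using assms(4)
proof (induction k arbitrary: j)
 case 0
 have "continuous_on J (Fs j)"
  using assms(2) DERIV_isCont continuous_at_imp_continuous_on by blast
 thus ?case using 0 assms(3) continuous_on_compose2[of J "Fs j" U u] by simp
next
 case (Suc k)
 have d: "(Fs j has_real_derivative Fs (Suc j) (u x)) (at (u x))" "u differentiable (at x)"
  if "x \<in> U" for x
  using that assms(2,3) Suc.prems by auto
 have "C_k_on k U (pd i (%x. Fs j (u x)))" for i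
  by (rule C_k_on_cong[OF assms(1), of "%x. Fs (Suc j) (u x) * pd i u x"])
    (use Suc C_k_on_Suc_D[OF Suc.prems] pd_compose_real(1)[OF d]
    in "auto intro!: C_k_on_mult[OF assms(1)]")
 thus ?case using pd_compose_real(2)[OF d] by simp
qed

lemma C_k_on_sum:
 assumes "open U" "!!a. a \<in> A ==> C_k_on k U (f a)"
 shows "C_k_on k U (%x. \<Sum>a\<in>A. f a x)"
 using assms(2)
proof (induction A rule: infinite_finite_induct)
 case (insert x F)
 thus ?case using C_k_on_add[OF assms(1)] by simp
qed auto

lemma C_k_on_compose:
 fixes f :: "real^'n::finite => real" and \<Phi> :: "real^'m::finite => real^'n"
 assumes "open U" "\<Phi> ` U \<subseteq> V" "C_k_on k V f" "!!j. C_k_on k U (%x. \<Phi> x $ j)"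
 shows "C_k_on k U (%x. f (\<Phi> x))"
 using assms(3,4)
proof (induction k arbitrary: f)
 case 0
 have "continuous_on U \<Phi>"
  using 0(2) continuous_on_vec_lambda[of U "%j x. \<Phi> x $ j"] by simp
 thus ?case using 0(1) assms(2) continuous_on_compose2[of V f U \<Phi>] by simp
next
 case (Suc k)
 have d: "f differentiable (at (\<Phi> x))" "!!j. (%x. \<Phi> x $ j) differentiable (at x)"
  if "x \<in> U" for x
  using that assms(2) Suc.prems by auto
 have "C_k_on k U (pd i (%x. f (\<Phi> x)))" for i
  by (rule C_k_on_cong[OF assms(1), of "%x. \<Sum>j\<in>UNIV. pd i (%x. \<Phi> x $ j) x * pd j f (\<Phi> x)"])
    (use Suc C_k_on_Suc_D[OF Suc.prems(2)] pd_compose(1)[OF d]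
    in "auto intro!: C_k_on_mult[OF assms(1)] C_k_on_sum[OF assms(1)]")
 thus ?case using pd_compose(2)[OF d] by simp
qed

lemma smooth_in_const [simp]: "smooth_in U (%x. c)"
 and smooth_in_component [simp]: "smooth_in U (%x. x $ j)"
 by (simp_all add: smooth_in_def C_k_on_component)

lemma smooth_in_add: "open U ==> smooth_in U f ==> smooth_in U g ==> smooth_in U (%x. f x + g x)"
 and smooth_in_mult: "open U ==> smooth_in U f ==> smooth_in U g ==> smooth_in U (%x. f x * g x)"
 by (simp_all add: smooth_in_def C_k_on_add C_k_on_mult)

lemma smooth_in_sum:
 "open U ==> (!!a. a \<in> A ==> smooth_in U (f a)) ==> smooth_in U (%x. \<Sum>a\<in>A. f a x)"
 by (simp add: smooth_in_def C_k_on_sum)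

lemma smooth_in_minus: "open U ==> smooth_in U f ==> smooth_in U (%x. - f x)"
 using smooth_in_mult[of U "%_. -1" f] by simp

lemma smooth_in_diff_fun:
 "open U ==> smooth_in U f ==> smooth_in U g ==> smooth_in U (%x. f x - g x)"
 using smooth_in_add[of U f "%x. - g x"] smooth_in_minus[of U g] by simp

lemma smooth_in_compose_real:
 assumes "open U" "!!j t. t \<in> J ==> (Fs j has_real_derivative Fs (Suc j) t) (at t)"
  "u ` U \<subseteq> J" "smooth_in U u"
 shows "smooth_in U (%x. Fs j (u x))"
 using C_k_on_compose_real[where Fs = Fs and J = J and U = U and u = u and j = j] assms
 unfolding smooth_in_def by simp

lemma smooth_in_compose:
 fixes f :: "real^'n::finite => real" and \<Phi> :: "real^'m::finite => real^'n"
 assumes "open U" "\<Phi> ` U \<subseteq> V" "smooth_in V f" "!!j. smooth_in U (%x. \<Phi> x $ j)"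
 shows "smooth_in U (%x. f (\<Phi> x))"
 using C_k_on_compose[OF assms(1,2), of _ f] assms(3,4) unfolding smooth_in_def by simp

section \<open>The discrete Dirichlet problem\<close>

text \<open>The factor 1/h^2 is left out, so the discrete equation reads
  \<open>Dlap h u x = h^2 * g x\<close>. Arguments range over all of R^n, but a point only meets its
  own translate of the lattice.\<close>

definition Dlap :: "real => (real^'n::finite => real) => real^'n => real" where
 "Dlap h f x = (\<Sum>i\<in>UNIV. f (x + h *. i) + f (x - h *. i) - 2 * f x)"

lemma Dlap_diff: "Dlap h (%x. f x - g x) x = Dlap h f x - Dlap h g x"
 unfolding Dlap_def sum_subtractf[symmetric] by (rule sum.cong) auto

lemma Dlap_add: "Dlap h (%x. f x + g x) x = Dlap h f x + Dlap h g x"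
 unfolding Dlap_def sum.distrib[symmetric] by (rule sum.cong) auto

lemma Dlap_cmult: "Dlap h (%x. c * f x) x = c * Dlap h f x"
 unfolding Dlap_def sum_distrib_left by (rule sum.cong) (auto simp: algebra_simps)

lemma Dlap_minus: "Dlap h (%x. - f x) x = - Dlap h f x"
 using Dlap_cmult[of h "-1" f x] by simp

lemma Dlap_const [simp]: "Dlap h (%x. c) x = 0"
 by (simp add: Dlap_def)

lemma Dlap_eq_sum:
 "Dlap h f (x::real^'n::finite)
  = (\<Sum>i\<in>UNIV. f (x + h *. i) + f (x - h *. i)) - 2 * real CARD('n) * f x"
 by (simp add: Dlap_def sum_subtractf)

text \<open>Second differences are exact on quadratics, so |y - a|^2 can enter comparison functions
  at every mesh without a consistency error.\<close>

lemma Dlap_sq: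
 fixes x a :: "real^'n::finite"
 shows "Dlap h (%y. (y - a) \<bullet> (y - a)) x = 2 * real CARD('n) * h^2"
proof -
 have "(x + h *. i - a) \<bullet> (x + h *. i - a) + (x - h *. i - a) \<bullet> (x - h *. i - a)
   - 2 * ((x - a) \<bullet> (x - a)) = 2 * h^2" for i
  by (simp add: inner_axis_axis algebra_simps inner_commute power2_eq_square)
 thus ?thesis by (simp add: Dlap_def)
qed

text \<open>\<open>D\<close> is a subset of R^n and not of a lattice, so a supremum over it need not
  be attained. Adding a small multiple of |y|^2 makes the inequality strict by a fixed amount at
  every point, which contradicts the definition of the supremum instead.\<close>

lemma Dlap_comparison:
 fixes w :: "real^'n::finite => real"
 assumes "h > 0" "bounded D"
  and sub: "!!x. x \<in> D ==> Dlap h w x >= 0"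
  and nb: "!!x y. x \<in> D ==> y \<notin> D ==> dist x y <= h ==> w y <= 0"
  and bd: "!!x. x \<in> D ==> w x <= M"
  and "x0 \<in> D"
 shows "w x0 <= 0"
proof (rule ccontr)
 assume "\<not> w x0 <= 0"
 hence pos: "w x0 > 0" by simp
 obtain R where R: "!!x. x \<in> D ==> norm x <= R" "R > 0"
  using `bounded D` unfolding bounded_pos by blast
 \<comment> \<open>Small enough that the value at \<open>x0\<close> stays positive after subtracting
   \<open>e * (R + h)^2\<close>, while the total correction is nonpositive on the
   \<open>h\<close>-neighbourhood of \<open>D\<close>.\<close>
 define e where "e = w x0 / (2 * (R + h)\<^sup>2)"
 have e: "e > 0" "e * (R + h)\<^sup>2 < w x0"
  using pos R(2) `h > 0` by (auto simp: e_def divide_simps)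
 define v where "v y = w y + (e * (y \<bullet> y) - e * (R + h)\<^sup>2)" for y
 define S where "S = Sup (v ` D)"
 have vw: "v y <= w y" if "norm y <= R + h" for y
 proof -
  have "y \<bullet> y <= (R + h)\<^sup>2"
   using that power_mono[OF that, of 2] by (simp add: power2_norm_eq_inner)
  thus ?thesis using e(1) by (simp add: v_def mult_left_mono)
 qed
 have bdd: "bdd_above (v ` D)"
  using bd vw R(1) `h > 0` by (intro bdd_aboveI2[of _ _ M]) (meson add_increasing2 less_imp_le order_trans)
 have leS: "v x <= S" if "x \<in> D" for x
  unfolding S_def using bdd that by (simp add: cSUP_upper)
 have "v x0 > 0"
 proof -
  have "0 <= e * (x0 \<bullet> x0)" using e(1) by simp
  thus ?thesis unfolding v_def using e(2) by linarith
 qed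
 hence "S > 0" using leS[OF `x0 \<in> D`] by simp
 have "v x <= S - e * h^2" if "x \<in> D" for x
 proof -
  have nb': "v y <= S" if "dist x y <= h" for y
  proof (cases "y \<in> D")
   case False
   have "norm y <= R + h"
    using R(1)[OF `x \<in> D`] that norm_triangle_sub[of y x] by (simp add: dist_norm norm_minus_commute)
   thus ?thesis using vw nb[OF `x \<in> D` False that] `S > 0` by fastforce
  qed (rule leS)
  have "Dlap h v x = Dlap h w x + e * (2 * real CARD('n) * h^2)"
   unfolding v_def Dlap_add Dlap_diff Dlap_cmult using Dlap_sq[of h 0 x] by simp
  hence "e * (2 * real CARD('n) * h^2) <= Dlap h v x"
   using sub[OF that] by simp
  also have "Dlap h v x <= (\<Sum>i\<in>(UNIV::'n set). 2 * S) - 2 * real CARD('n) * v x"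
   unfolding Dlap_eq_sum
   by (intro diff_right_mono sum_mono) (use nb' `h > 0` in "auto simp: dist_norm intro!: add_mono[of _ S _ S, simplified]")
  finally have "2 * real CARD('n) * (v x + e * h^2) <= 2 * real CARD('n) * S"
   by (simp add: algebra_simps)
  thus ?thesis by simp
 qed
 hence "S <= S - e * h^2"
  unfolding S_def using `x0 \<in> D` by (intro cSUP_least) auto
 moreover have "e * h^2 > 0" using e(1) `h > 0` by simp
 ultimately show False by simp
qed

text \<open>Perron's method: \<open>u\<close> is the pointwise supremum of discrete subsolutions.
  The paraboloid \<open>q\<close> is one of them and \<open>- q\<close> bounds them all, which gives
  \<open>G * R^2\<close>. The margin \<open>norm x + 1 \<le> R\<close> together with
  \<open>h \<le> 1\<close> keeps the neighbours of \<Omega> where \<open>q \<le> 0\<close>.\<close>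

lemma Dlap_dirichlet_exists:
 fixes g :: "real^'n::finite => real"
 assumes "0 < h" "h <= 1" and bd: "!!x. x \<in> \<Omega> ==> norm x + 1 <= R" and g: "!!x. x \<in> \<Omega> ==> abs(g x) <= G"
 shows "\<exists>u. (\<forall>x. x \<notin> \<Omega> --> u x = 0) & (\<forall>x\<in>\<Omega>. Dlap h u x = h^2 * g x)
     & (\<forall>x\<in>\<Omega>. abs(u x) <= G * R^2)"
proof (cases "\<Omega> = {}")
 case True
 thus ?thesis by auto
next
 case False
 let ?N = "real CARD('n)"
 have N: "?N >= 1" using zero_less_card_finite[where 'a='n] by linarith
 have G: "G >= 0" using g False by fastforce
 define q where "q x = G / (2 * ?N) * (x \<bullet> x - R\<^sup>2)" for x :: "real^'n"
 have Dq: "Dlap h q x = h^2 * G" for x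
  unfolding q_def Dlap_cmult Dlap_diff using Dlap_sq[of h 0 x] N by (simp add: field_simps)
 have q0: "q x <= 0" if "norm x <= R" for x
 proof -
  have "x \<bullet> x <= R^2" using power_mono[OF that, of 2] by (simp add: power2_norm_eq_inner)
  thus ?thesis using G N unfolding q_def by (intro mult_nonneg_nonpos) auto
 qed
 have qn: "q (x + h *. i) <= 0" "q (x - h *. i) <= 0" "q x <= 0" if "x \<in> \<Omega>" for x i
 proof -
  have "norm (x + h *. i) <= R" "norm (x - h *. i) <= R" "norm x <= R"
   using bd[OF that] norm_triangle_ineq[of x "h *. i"] norm_triangle_ineq4[of x "h *. i"] assms(1,2)
   by auto
  thus "q (x + h *. i) <= 0" "q (x - h *. i) <= 0" "q x <= 0" using q0 by auto
 qed
 define W where "W = {w. (\<forall>x. x \<notin> \<Omega> --> w x = 0) & (\<forall>x\<in>\<Omega>. w x <= - q x) \<and>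
            (\<forall>x\<in>\<Omega>. Dlap h w x >= h^2 * g x)}"
 define w0 where "w0 x = (if x \<in> \<Omega> then q x else 0)" for x
 have "w0 \<in> W"
 proof -
  have "Dlap h w0 x >= h^2 * g x" if "x \<in> \<Omega>" for x
  proof -
   have "h^2 * g x <= h^2 * G" using g[OF that] by (intro mult_left_mono) auto
   also have "... = Dlap h q x" by (simp add: Dq)
   also have "... <= Dlap h w0 x"
    unfolding Dlap_def by (intro sum_mono diff_mono add_mono) (use that qn[OF that] in "auto simp: w0_def")
   finally show ?thesis .
  qed
  thus ?thesis using qn(3) by (fastforce simp: W_def w0_def)
 qed
 define u where "u x = (SUP w\<in>W. w x)" for x
 have ub: "w x <= (if x \<in> \<Omega> then - q x else 0)" if "w \<in> W" for w x
  using that by (auto simp: W_def)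
 hence bdd: "bdd_above ((%w. w x) ` W)" for x by (intro bdd_aboveI2)
 have le_u: "w x <= u x" if "w \<in> W" for w x
  unfolding u_def using bdd that by (rule cSUP_upper2) simp
 have u_le: "u x <= (if x \<in> \<Omega> then - q x else 0)" for x
  unfolding u_def using `w0 \<in> W` ub by (intro cSUP_least) blast+
 have u0: "u x = 0" if "x \<notin> \<Omega>" for x
  using u_le[of x] le_u[OF `w0 \<in> W`, of x] that by (simp add: w0_def)
 have usub: "Dlap h u x >= h^2 * g x" if "x \<in> \<Omega>" for x
 proof -
  let ?s = "\<Sum>i\<in>(UNIV::'n set). u (x + h *. i) + u (x - h *. i)"
  have "w x <= (?s - h\<^sup>2 * g x) / (2 * ?N)" if "w \<in> W" for w
  proof -
   have "h^2 * g x <= Dlap h w x" using `x \<in> \<Omega>` that by (simp add: W_def)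
   also have "... <= ?s - 2 * ?N * w x"
    unfolding Dlap_eq_sum by (intro diff_right_mono sum_mono add_mono le_u that)
   finally show ?thesis using N by (simp add: field_simps)
  qed
  hence "u x <= (?s - h\<^sup>2 * g x) / (2 * ?N)"
   unfolding u_def[of x] using `w0 \<in> W` by (intro cSUP_least) auto
  thus ?thesis using N unfolding Dlap_eq_sum by (simp add: field_simps)
 qed
 have "Dlap h u x = h^2 * g x" if x: "x \<in> \<Omega>" for x
 proof (rule ccontr)
  assume "Dlap h u x ~= h^2 * g x"
  hence strict: "Dlap h u x > h^2 * g x" using usub[OF x] by simp
  let ?s = "\<Sum>i\<in>(UNIV::'n set). u (x + h *. i) + u (x - h *. i)"
  \<comment> \<open>The value at \<open>x\<close> that turns the inequality into the equation. No
    neighbour coincides with \<open>x\<close>, so raising \<open>u\<close> there makes the equation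
    at \<open>x\<close> exact and only increases the second differences elsewhere: a subsolution
    above the supremum.\<close>
  define c where "c = (?s - h\<^sup>2 * g x) / (2 * ?N)"
  have cu: "c > u x" using strict N unfolding Dlap_eq_sum c_def by (simp add: field_simps)
  define w where "w = u(x := c)"
  have ne: "x + h *. i ~= x" "x - h *. i ~= x" for i using `h > 0` by auto
  have "c <= - q x"
  proof -
   have un: "u y <= - q y" if "q y <= 0" for y
    using u_le[of y] that by (auto split: if_splits)
   have "?s <= (\<Sum>i\<in>(UNIV::'n set). - q (x + h *. i) + - q (x - h *. i))"
    by (intro sum_mono add_mono un qn x)
   also have "... = - Dlap h q x - 2 * ?N * q x"
    unfolding Dlap_eq_sum by (simp add: sum_negf sum.distrib sum_subtractf)
   finally have "?s <= - h\<^sup>2 * G - 2 * ?N * q x" by (simp add: Dq)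
   moreover have "- h\<^sup>2 * g x <= h^2 * G"
    using g[OF x] mult_left_mono[of "- g x" G "h^2"] by auto
   ultimately have "?s - h\<^sup>2 * g x <= 2 * ?N * (- q x)" by simp
   thus ?thesis unfolding c_def using N by (simp add: field_simps)
  qed
  moreover have "Dlap h w y >= h^2 * g y" if "y \<in> \<Omega>" for y
  proof (cases "y = x")
   case True
   thus ?thesis unfolding Dlap_eq_sum using ne N by (simp add: w_def c_def)
  next
   case False
   have "Dlap h u y <= Dlap h w y"
    unfolding Dlap_eq_sum
    using False cu by (auto simp: w_def intro!: sum_mono add_mono)
   thus ?thesis using usub[OF that] by simp
  qed
  moreover have "u y <= - q y" if "y \<in> \<Omega>" for y using u_le[of y] that by simp
  ultimately have "w \<in> W" using u0 x by (auto simp: W_def w_def)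
  thus False using le_u[of w x] cu by (simp add: w_def)
 qed
 moreover have "abs(u x) <= G * R^2" if "x \<in> \<Omega>" for x
 proof -
  have "abs(u x) <= - q x" using u_le[of x] le_u[OF `w0 \<in> W`, of x] that by (auto simp: w0_def)
  also have "- q x = G * ((R^2 - x \<bullet> x) / (2 * ?N))" by (simp add: q_def field_simps)
  also have "... <= G * R^2"
  proof (rule mult_left_mono[OF _ G])
   have "R^2 - x \<bullet> x <= R^2" by simp
   also have "R^2 <= R^2 * (2 * ?N)" by (rule mult_left_mono[of 1 "2 * ?N" "R^2", simplified mult_1_right]) (use N in linarith, simp)
   finally show "(R^2 - x \<bullet> x) / (2 * ?N) <= R^2" using N by (simp add: divide_le_eq)
  qed
  finally show ?thesis .
 qed
 ultimately show ?thesis using u0 by blast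
qed

lemma discrete_gradient_one_sided:
 fixes u :: "real^'n::finite => real"
 assumes "0 < h" "h <= d" "0 < M" "0 <= N0"
  and A: "!!y. (!!j. abs(y $ j - x $ j) <= 3 * d) ==> abs(u y) <= M & abs(Dlap h u y) <= h^2 * N0"
 shows "u (x + h *. i) - u x <= h * ((4 * real CARD('n) + 1) * M / d + 2 * d * N0)"
proof -
 let ?N = "real CARD('n)"
 have N: "?N >= 1" using zero_less_card_finite[where 'a='n] by linarith
 have d: "d > 0" using assms by simp
 \<comment> \<open>In coordinates centred at the midpoint \<open>c\<close> of the grid step,
   \<open>R\<close> is the reflection in the hyperplane bisecting the step. \<phi> is odd under
   \<open>R\<close>, and its value at \<open>(h/2) *. i\<close> is the difference to be
   estimated.\<close>
 define c where "c = x + (h/2) *. i"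
 define R where "R y = y - (2 * y $ i) *. i" for y :: "real^'n"
 define \<phi> where "\<phi> y = u (c + y) - u (c + R y)" for y
 \<comment> \<open>\<open>B * d^2 = 2 * M\<close> lets the quadratic part of \<psi> dominate \<phi>
   on the lateral faces, \<kappa> gives \<open>w\<close> a positive second difference despite the
   \<open>N0\<close> and \<open>B\<close> terms, and \<open>L\<close> makes \<psi> at least
   \<open>2 * M\<close> on the far face.\<close>
 define B where "B = 2 * M / d^2"
 define \<kappa> where "\<kappa> = 2 * N0 + 2 * B * ?N"
 define L where "L = 2 * d * \<kappa> + 2 * M / d"
 have B: "B > 0" using `0 < M` d by (simp add: B_def)
 have \<kappa>: "\<kappa> > 0" using B N `0 <= N0` by (simp add: \<kappa>_def add_nonneg_pos)
 define \<psi> where "\<psi> y = L * y $ i - (\<kappa> + B) * (y $ i)\<^sup>2 + B * (y \<bullet> y)" for y :: "real^'n"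
 \<comment> \<open>The hyperplane lies halfway between two grid planes, so the heights are h/2,
   3h/2, ... and no grid point lies on the hyperplane itself.\<close>
 define D where "D = {y::real^'n. (\<exists>k::nat. y $ i = h/2 + real k * h) & y $ i < d & (\<forall>j. j ~= i --> abs(y $ j) < d)}"
 define w where "w y = \<phi> y - \<psi> y" for y
 have Rc: "R y $ j = (if j = i then - y $ i else y $ j)" for y j
  by (simp add: R_def axis_def)
 have RR: "R (R y) = y" for y by (simp add: vec_eq_iff Rc)
 have Rp: "R (y + t *. j) = R y + (if j = i then - t else t) *. j" for y t j
  by (auto simp: vec_eq_iff Rc axis_def)
 have cc: "c $ j = x $ j + (if j = i then h/2 else 0)" for j
  by (simp add: c_def axis_def)
 have psi_alt: "\<psi> y = y $ i * (L - \<kappa> * y $ i) + B * (\<Sum>j\<in>UNIV-{i}. (y $ j)\<^sup>2)" for y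
 proof -
  have "y \<bullet> y = (y $ i)\<^sup>2 + (\<Sum>j\<in>UNIV-{i}. (y $ j)\<^sup>2)"
   by (simp add: inner_vec_def power2_eq_square sum.remove[of UNIV i])
  thus ?thesis by (simp add: \<psi>_def algebra_simps power2_eq_square)
 qed
 have Dpsi: "Dlap h \<psi> y = h^2 * (2 * B * ?N - 2 * (\<kappa> + B))" for y
 proof -
  have 1: "Dlap h (%y. y $ i) y = 0" by (simp add: Dlap_def)
  have "Dlap h (%y. (y $ i)\<^sup>2) y = (\<Sum>j\<in>UNIV. if j = i then 2 * h^2 else 0)"
   unfolding Dlap_def by (rule sum.cong) (auto simp: axis_def power2_eq_square algebra_simps)
  hence 2: "Dlap h (%y. (y $ i)\<^sup>2) y = 2 * h^2" by simp
  show ?thesis unfolding \<psi>_def Dlap_add Dlap_diff Dlap_cmult 1 2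
   using Dlap_sq[of h 0 y] by (simp add: algebra_simps)
 qed
 have Dphi: "Dlap h \<phi> y = Dlap h u (c + y) - Dlap h u (c + R y)" for y
  unfolding Dlap_def sum_subtractf[symmetric]
  by (rule sum.cong) (auto simp: \<phi>_def Rp[of y h] Rp[of y "-h", simplified] algebra_simps)
 have box: "abs(c $ j + y $ j - x $ j) <= 3 * d" if "abs(y $ j) <= 2 * d" for y j
  using that `0 < h` `h <= d` by (auto simp: cc)
 have boxD: "abs(z $ j) <= 2 * d" if "y \<in> D" "z = y | z = y + h *. k | z = y - h *. k" for y z j k
 proof -
  have "abs(y $ j) <= d" using that(1) `0 < h` by (cases "j = i") (auto simp: D_def less_imp_le)
  moreover have "abs(z $ j - y $ j) <= h" using that(2) `0 < h` by (auto simp: axis_def)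
  ultimately show ?thesis using `h <= d` by linarith
 qed
 have phi_le: "\<phi> y <= 2 * M" if "!!j. abs(y $ j) <= 2 * d" for y
 proof -
  have "abs(u (c + y)) <= M" "abs(u (c + R y)) <= M"
   using A[of "c + y"] A[of "c + R y"] box[of y] box[of "R y"] that by (auto simp: Rc)
  thus ?thesis by (simp add: \<phi>_def)
 qed
 have Dw: "Dlap h w y >= \<kappa> * h^2" if "y \<in> D" for y
 proof -
  have b: "abs(y $ j) <= 2 * d" for j using boxD[OF that] by blast
  have "abs(Dlap h u (c + y)) <= h^2 * N0" "abs(Dlap h u (c + R y)) <= h^2 * N0"
   using A[of "c + y"] A[of "c + R y"] box[of y] box[of "R y"] b by (auto simp: Rc)
  hence "Dlap h \<phi> y >= - 2 * (h^2 * N0)" by (simp add: Dphi)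
  hence "Dlap h w y >= - 2 * (h^2 * N0) - h\<^sup>2 * (2 * B * ?N - 2 * (\<kappa> + B))"
   unfolding w_def Dlap_diff Dpsi by simp
  also have "- 2 * (h^2 * N0) - h\<^sup>2 * (2 * B * ?N - 2 * (\<kappa> + B)) = \<kappa> * h^2 + 2 * B * h^2"
   by (simp add: \<kappa>_def algebra_simps)
  also have "... >= \<kappa> * h^2" using B by simp
  finally show ?thesis .
 qed
 have psi_nonneg: "y $ i * (L - \<kappa> * y $ i) >= 0" if "0 < y $ i" "y $ i <= 2 * d" for y
 proof -
  have "\<kappa> * y $ i <= \<kappa> * (2 * d)" using that \<kappa> by (intro mult_left_mono) auto
  also have "... <= L" using d `0 < M` by (simp add: L_def algebra_simps)
  finally show ?thesis using that by simp
 qed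
 have w_out: "w z <= 0" if "0 < z $ i" "!!j. abs(z $ j) <= 2 * d" "d <= z $ i | (\<exists>j. j ~= i & d <= abs(z $ j))" for z
 proof -
  have zi: "z $ i <= 2 * d" using that(2)[of i] by simp
  have sq: "(\<Sum>j\<in>UNIV-{i}. (z $ j)\<^sup>2) >= 0" by (intro sum_nonneg) auto
  have "\<psi> z >= 2 * M"
   using that(3)
  proof
   assume "d <= z $ i"
   have "\<kappa> * z $ i <= \<kappa> * (2 * d)" using zi \<kappa> by (intro mult_left_mono) auto
   hence "2 * M / d <= L - \<kappa> * z $ i" by (simp add: L_def algebra_simps)
   hence "d * (2 * M / d) <= z $ i * (L - \<kappa> * z $ i)"
    using `d <= z $ i` d `0 < M` by (intro mult_mono) auto
   thus ?thesis using sq B d by (simp add: psi_alt add_increasing2)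
  next
   assume "\<exists>j. j ~= i & d <= abs(z $ j)"
   then obtain j where j: "j ~= i" "d <= abs(z $ j)" by blast
   have "d^2 <= (z $ j)\<^sup>2" using j(2) d power_mono[of d "abs(z $ j)" 2] by simp
   also have "... <= (\<Sum>j\<in>UNIV-{i}. (z $ j)\<^sup>2)" using j(1) by (intro member_le_sum) auto
   finally have "B * d^2 <= B * (\<Sum>j\<in>UNIV-{i}. (z $ j)\<^sup>2)" using B by simp
   moreover have "B * d^2 = 2 * M" using d by (simp add: B_def)
   ultimately show ?thesis using psi_nonneg[OF that(1) zi] by (simp add: psi_alt)
  qed
  thus ?thesis using phi_le[OF that(2)] by (simp add: w_def)
 qed
 have Dpos: "0 < y $ i" "y $ i < d" if "y \<in> D" for y
  using that `0 < h` by (auto simp: D_def add_pos_nonneg)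
 have w_le: "w y <= 2 * M" if "y \<in> D" for y
 proof -
  have "(\<Sum>j\<in>UNIV-{i}. (y $ j)\<^sup>2) >= 0" by (intro sum_nonneg) auto
  hence "\<psi> y >= 0" unfolding psi_alt using psi_nonneg Dpos[OF that] B d by simp
  moreover have "\<phi> y <= 2 * M" using phi_le boxD[OF that] by blast
  ultimately show ?thesis by (simp add: w_def)
 qed
 have w_neg: "w y <= 0" if y: "y \<in> D" for y
 proof (rule ccontr)
  assume "\<not> w y <= 0"
  define S where "S = Sup (w ` D)"
  have bdd: "bdd_above (w ` D)" using w_le by (intro bdd_aboveI2) auto
  have leS: "w z <= S" if "z \<in> D" for z
   unfolding S_def using bdd that by (simp add: cSUP_upper)
  have Spos: "S > 0" using leS[OF y] `\<not> w y <= 0` by simp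
  have nbS: "w z <= S" if "y \<in> D" "z = y + h *. k | z = y - h *. k" "0 < z $ i" for y z k
  proof (cases "z \<in> D")
   case False
   have b: "!!j. abs(z $ j) <= 2 * d" using boxD[OF that(1)] that(2) by blast
   obtain m :: nat where m: "y $ i = h/2 + real m * h" using `y \<in> D` by (auto simp: D_def)
   have "\<exists>m'::nat. z $ i = h/2 + real m' * h"
   proof (cases "k = i")
    case True
    have "z = y + h *. k ==> z $ i = h/2 + real (Suc m) * h"
     using m True by (simp add: algebra_simps)
    moreover have "z $ i = h/2 + real (m - 1) * h" if "z = y - h *. k"
    proof -
     have "m ~= 0" using that `0 < z $ i` m True `0 < h` by auto
     hence "real (m - 1) = real m - 1" by (simp add: of_nat_diff)
     moreover have "z $ i = y $ i - h" using that True by simp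
     ultimately show ?thesis using m by (simp add: algebra_simps)
    qed
    ultimately show ?thesis using that(2) by blast
   next
    case False
    thus ?thesis using that(2) m by (auto simp: axis_def)
   qed
   hence "d <= z $ i | (\<exists>j. j ~= i & d <= abs(z $ j))" using False by (auto simp: D_def not_less)
   thus ?thesis using w_out[OF that(3) b] Spos by simp
  qed (rule leS)
  have step: "w z <= S - \<kappa> * h^2 / (4 * ?N + 2)" if z: "z \<in> D" for z
  proof -
   have other: "w (z + h *. j) + w (z - h *. j) - 2 * w z <= 2 * (S - w z)" if "j ~= i" for j
    using nbS[OF z, of "z + h *. j" j] nbS[OF z, of "z - h *. j" j] Dpos[OF z] that
    by (auto simp: axis_def)
   \<comment> \<open>Only at height \<open>h/2\<close> does a neighbour leave the half space. That
     neighbour is the mirror image of \<open>z\<close>, and oddness of \<phi> replaces the missing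
     boundary value, at the cost of a factor 3 in place of 2.\<close>
   have own: "w (z + h *. i) + w (z - h *. i) - 2 * w z <= 3 * (S - w z) + \<kappa> * h^2 / 2"
   proof -
    have up: "w (z + h *. i) <= S"
     using nbS[OF z, of "z + h *. i" i] Dpos[OF z] `0 < h` by auto
    show ?thesis
    proof (cases "0 < z $ i - h")
     case True
     hence "w (z - h *. i) <= S"
      using nbS[OF z, of "z - h *. i" i] by auto
     thus ?thesis using up leS[OF z] \<kappa> by (smt (verit) zero_le_power2 mult_nonneg_nonneg divide_nonneg_nonneg)
    next
     case False
     obtain m :: nat where m: "z $ i = h/2 + real m * h" using z by (auto simp: D_def)
     have "m = 0"
     proof (rule ccontr)
      assume "m ~= 0"
      hence "1 * h <= real m * h" using `0 < h` by (intro mult_right_mono) auto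
      thus False using False m `0 < h` by simp
     qed
     hence zi: "z $ i = h/2" using m by simp
     have Rz: "z - h *. i = R z" using zi by (simp add: R_def)
     have "\<phi> (R z) = - \<phi> z" by (simp add: \<phi>_def RR)
     moreover have "\<psi> z + \<psi> (R z) >= - \<kappa> * h^2 / 2"
     proof -
      have "(\<Sum>j\<in>UNIV-{i}. (R z $ j)\<^sup>2) = (\<Sum>j\<in>UNIV-{i}. (z $ j)\<^sup>2)"
       by (rule sum.cong) (auto simp: Rc)
      hence "\<psi> z + \<psi> (R z) = - \<kappa> * h^2 / 2 + 2 * (B * (\<Sum>j\<in>UNIV-{i}. (z $ j)\<^sup>2))"
       unfolding psi_alt by (simp add: Rc zi algebra_simps power2_eq_square)
      moreover have "B * (\<Sum>j\<in>UNIV-{i}. (z $ j)\<^sup>2) >= 0" using B by (simp add: sum_nonneg)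
      ultimately show ?thesis by simp
     qed
     ultimately have "w (R z) <= - w z + \<kappa> * h^2 / 2" by (simp add: w_def)
     thus ?thesis using up Rz Spos by simp
    qed
   qed
   have "\<kappa> * h^2 <= Dlap h w z" using Dw[OF z] .
   also have "Dlap h w z = (w (z + h *. i) + w (z - h *. i) - 2 * w z)
     + (\<Sum>j\<in>UNIV-{i}. w (z + h *. j) + w (z - h *. j) - 2 * w z)"
    unfolding Dlap_def by (simp add: sum.remove[of UNIV i])
   also have "... <= (3 * (S - w z) + \<kappa> * h^2 / 2) + (\<Sum>j\<in>UNIV-{i}. 2 * (S - w z))"
    by (intro add_mono own sum_mono other) auto
   also have "(\<Sum>j\<in>UNIV-{i}. 2 * (S - w z)) = (?N - 1) * (2 * (S - w z))"
    using N by (simp add: of_nat_diff)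
   finally have "\<kappa> * h^2 <= (2 * ?N + 1) * (S - w z) + \<kappa> * h^2 / 2" by (simp add: algebra_simps)
   hence "\<kappa> * h^2 / 2 <= (2 * ?N + 1) * (S - w z)" by simp
   thus ?thesis using N by (simp add: field_simps)
  qed
  have "S <= S - \<kappa> * h^2 / (4 * ?N + 2)"
   using y step unfolding S_def by (intro cSUP_least) auto
  moreover have "\<kappa> * h^2 / (4 * ?N + 2) > 0" using \<kappa> `0 < h` N by (intro divide_pos_pos mult_pos_pos) auto
  ultimately show False by simp
 qed
 let ?y = "(h/2) *. i"
 have "?y \<in> D" using `0 < h` `h <= d` d by (auto simp: D_def axis_def intro: exI[of _ 0])
 from w_neg[OF this] have "\<phi> ?y <= \<psi> ?y" by (simp add: w_def)
 moreover have "c + ?y = x + h *. i" "c + R ?y = x"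
  by (auto simp: c_def R_def vec_eq_iff axis_def)
 moreover have "\<psi> ?y <= L * h / 2"
 proof -
  have "(\<Sum>j\<in>UNIV-{i}. (?y $ j)\<^sup>2) = 0" by (intro sum.neutral) (auto simp: axis_def)
  thus ?thesis unfolding psi_alt using \<kappa> `0 < h` by (simp add: algebra_simps)
 qed
 ultimately have "u (x + h *. i) - u x <= L * h / 2" by (simp add: \<phi>_def)
 also have "L * h / 2 = h * ((4 * ?N + 1) * M / d + 2 * d * N0)"
  using d by (simp add: L_def \<kappa>_def B_def field_simps power2_eq_square)
 finally show ?thesis .
qed

text \<open>
 Brandt's argument: the difference of a grid function and its mirror image in the bisecting
 hyperplane of a grid step vanishes on that hyperplane, so a quadratic barrier on the half cube bounds
 it by a multiple of the distance.
\<close>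

lemma discrete_gradient:
 fixes u :: "real^'n::finite => real"
 assumes "0 < h" "h <= d" "0 < M" "0 <= N0"
  and A: "!!y. (!!j. abs(y $ j - x $ j) <= 3 * d) ==> abs(u y) <= M & abs(Dlap h u y) <= h^2 * N0"
 shows "abs(u (x + h *. i) - u x) <= h * ((4 * real CARD('n) + 1) * M / d + 2 * d * N0)"
proof -
 have "- u (x + h *. i) - (- u x) <= h * ((4 * real CARD('n) + 1) * M / d + 2 * d * N0)"
  by (rule discrete_gradient_one_sided[OF assms(1-4)]) (use A Dlap_minus[of h u] in auto)
 moreover have "u (x + h *. i) - u x <= h * ((4 * real CARD('n) + 1) * M / d + 2 * d * N0)"
  by (rule discrete_gradient_one_sided[OF assms(1-4)]) (use A in auto)
 ultimately show ?thesis by linarith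
qed

section \<open>Finite differences\<close>

definition dlt :: "'n::finite => real => (real^'n => real) => real^'n => real" where
 "dlt i t f x = f (x + t *. i) - f x"

fun dlts :: "('n::finite \<times> real) list => (real^'n => real) => real^'n => real" where
 "dlts [] f = f"
| "dlts (p # l) f = dlts l (dlt (fst p) (snd p) f)"

lemma dlt_commute: "dlt i s (dlt j t f) = dlt j t (dlt i s f)"
 by (rule ext) (simp add: dlt_def algebra_simps)

lemma dlts_dlt: "dlts l (dlt i t f) = dlt i t (dlts l f)"
proof (induction l arbitrary: f)
 case (Cons p l)
 thus ?case by (simp add: dlt_commute[of "fst p" "snd p" i t])
qed simp


lemma dlts_cmult: "dlts l (%x. c * f x) x = c * dlts l f x"
 by (induction l arbitrary: x) (simp_all add: dlts_dlt, simp add: dlt_def algebra_simps)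

lemma dlts_tendsto:
 assumes "!!y. dist x y <= sum_list (map snd l) ==> (%k. q k y) \<longlonglongrightarrow> Q y"
  and "!!p. p \<in> set l ==> snd p >= 0"
 shows "(%k. dlts l (q k) x) \<longlonglongrightarrow> dlts l Q x"
 using assms
proof (induction l arbitrary: x)
 case (Cons p l)
 let ?t = "snd p" and ?i = "fst p"
 have t: "?t >= 0" using Cons.prems(2) by simp
 have s: "sum_list (map snd l) >= 0" by (rule sum_list_nonneg) (use Cons.prems(2) in fastforce)
 have "(%k. dlts l (q k) (x + ?t *\<^sub>R ax ?i)) \<longlonglongrightarrow> dlts l Q (x + ?t *\<^sub>R ax ?i)"
 proof (rule Cons.IH)
  fix y assume y: "dist (x + ?t *\<^sub>R ax ?i) y <= sum_list (map snd l)"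
  have "dist x y <= dist x (x + ?t *\<^sub>R ax ?i) + dist (x + ?t *\<^sub>R ax ?i) y" by (rule dist_triangle)
  also have "dist x (x + ?t *\<^sub>R ax ?i) = ?t" using t by (simp add: dist_norm)
  finally show "(%k. q k y) \<longlonglongrightarrow> Q y" using y by (intro Cons.prems) auto
 qed (use Cons.prems in auto)
 moreover have "(%k. dlts l (q k) x) \<longlonglongrightarrow> dlts l Q x"
 proof (rule Cons.IH)
  fix y assume "dist x y <= sum_list (map snd l)"
  thus "(%k. q k y) \<longlonglongrightarrow> Q y" using t by (intro Cons.prems) simp
 qed (use Cons.prems in auto)
 ultimately show ?case by (auto simp: dlts_dlt dlt_def intro: tendsto_diff)
qed simp

lemma pd_shift:
 fixes f :: "real^'n::finite => real"
 assumes "f differentiable (at (x + v))"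
 shows "pd i (%x. f (x + v)) x = pd i f (x + v)"
  and "(%x. f (x + v)) differentiable (at x)"
proof -
 have 1: "((%x. x + v) has_derivative (%x. x)) (at x)" by (auto intro!: derivative_eq_intros)
 have "((%x. f (x + v)) has_derivative (%w. \<Sum>i\<in>UNIV. w $ i * pd i f (x + v))) (at x)"
  using has_derivative_compose[OF 1 has_derivative_pd[OF assms]] by simp
 from this pd_eqI[OF this, of i] show "pd i (%x. f (x + v)) x = pd i f (x + v)"
   "(%x. f (x + v)) differentiable (at x)"
  by (auto simp: differentiable_def axis_def if_distrib if_distribR sum.delta cong: if_cong)
qed

lemma line_deriv:
 fixes f :: "real^'n::finite => real"
 assumes "f differentiable (at (x + t *. i))"
 shows "((%t. f (x + t *. i)) has_real_derivative pd i f (x + t *. i)) (at t)"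
proof -
 have 1: "((%t. x + t *. i) has_derivative (%s. s *. i)) (at t)" by (auto intro!: derivative_eq_intros)
 from has_derivative_compose[OF 1 has_derivative_pd[OF assms]]
 have "((%t. f (x + t *. i)) has_derivative (%s. s * pd i f (x + t *. i))) (at t)"
  by (simp add: axis_def if_distrib if_distribR sum.delta cong: if_cong)
 thus ?thesis by (simp add: has_field_derivative_def mult_commute_abs)
qed

lemma dlt_mvt:
 fixes f :: "real^'n::finite => real"
 assumes "t > 0" "!!s. 0 <= s ==> s <= t ==> f differentiable (at (x + s *. i))"
 shows "\<exists>s. 0 < s & s < t & dlt i t f x = t * pd i f (x + s *. i)"
proof -
 have "\<exists>z>0. z < t & f (x + t *. i) - f (x + 0 *. i) = (t - 0) * pd i f (x + z *. i)"
  by (rule MVT2[OF `t > 0`]) (use assms(2) in "auto intro!: line_deriv")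
 thus ?thesis by (auto simp: dlt_def)
qed

lemma dist_step [simp]: "dist x (x + t *. i) = abs(t)" "dist (x + t *. i) x = abs(t)"
 "dist x (x - t *. i) = abs(t)" "dist (x - t *. i) x = abs(t)"
 by (simp_all add: dist_norm)

lemma pd_dlts:
 fixes f :: "real^'n::finite => real"
 assumes "!!p. p \<in> set l ==> snd p >= 0"
  and "!!y. dist x y <= sum_list (map snd l) ==> f differentiable (at y)"
 shows "pd i (dlts l f) x = dlts l (pd i f) x & dlts l f differentiable (at x)"
 using assms
proof (induction l arbitrary: x)
 case (Cons p l)
 let ?t = "snd p" and ?v = "snd p *\<^sub>R ax (fst p)"
 have t: "?t >= 0" using Cons.prems(1) by simp
 have s: "sum_list (map snd l) >= 0" by (rule sum_list_nonneg) (use Cons.prems(1) in fastforce)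
 have 1: "pd i (dlts l f) x = dlts l (pd i f) x" "dlts l f differentiable (at x)"
  using Cons.IH[of x] Cons.prems t by auto
 have y: "dist x y <= ?t + sum_list (map snd l)" if "dist (x + ?v) y <= sum_list (map snd l)" for y
  using dist_triangle[of x y "x + ?v"] that t by simp
 have 2: "pd i (dlts l f) (x + ?v) = dlts l (pd i f) (x + ?v)"
   "dlts l f differentiable (at (x + ?v))"
  using Cons.IH[of "x + ?v"] Cons.prems y by auto
 have "dlts (p # l) f = (%x. dlts l f (x + ?v) - dlts l f x)"
  by (rule ext) (simp add: dlts_dlt dlt_def)
 thus ?case
  using pd_diff[OF pd_shift(2)[OF 2(2)] 1(2), of i] pd_shift(1)[OF 2(2), of i] pd_shift(2)[OF 2(2)] 1 2
  by (simp add: dlts_dlt dlt_def)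
qed simp

lemma dlts_bound:
 fixes f :: "real^'n::finite => real"
 assumes "smooth_in U f" "!!p. p \<in> set l ==> snd p > 0"
  and "!!y. dist x y <= sum_list (map snd l) ==> y \<in> U & abs(pds (map fst l) f y) <= C"
 shows "abs(dlts l f x) <= C * prod_list (map snd l)"
 using assms
proof (induction l arbitrary: f x)
 case (Cons p l)
 let ?t = "snd p" and ?i = "fst p"
 have t: "?t > 0" using Cons.prems(2) by simp
 have l0: "!!p. p \<in> set l ==> snd p > 0" using Cons.prems(2) by simp
 have near: "dist x y <= ?t + sum_list (map snd l)"
  if "0 <= s" "s <= ?t" "dist (x + s *\<^sub>R ax ?i) y <= sum_list (map snd l)" for s y
  using dist_triangle[of x y "x + s *\<^sub>R ax ?i"] that by simp
 have d: "pd j (dlts l f) (x + s *\<^sub>R ax ?i) = dlts l (pd j f) (x + s *\<^sub>R ax ?i) \<and>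
    dlts l f differentiable (at (x + s *\<^sub>R ax ?i))" if "0 <= s" "s <= ?t" for s j
  by (rule pd_dlts) (use l0 near[OF that] Cons.prems in "auto intro: less_imp_le smooth_in_diff")
 obtain s where s: "0 < s" "s < ?t" "dlt ?i ?t (dlts l f) x = ?t * pd ?i (dlts l f) (x + s *\<^sub>R ax ?i)"
  using dlt_mvt[of ?t "dlts l f" x ?i] t d by blast
 have "abs(dlts l (pd ?i f) (x + s *\<^sub>R ax ?i)) <= C * prod_list (map snd l)"
  by (rule Cons.IH) (use Cons.prems l0 near[of s] s in "auto intro: smooth_in_pd")
 hence "?t * abs(pd ?i (dlts l f) (x + s *\<^sub>R ax ?i)) <= ?t * (C * prod_list (map snd l))"
  using d[of s ?i] s t by (intro mult_left_mono) auto
 thus ?case using s t by (simp add: dlts_dlt abs_mult algebra_simps)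
qed simp

lemma dlt2_mvt:
 fixes f :: "real^'n::finite => real"
 assumes "s > 0" "t > 0" "smooth_in U f" "cball x (s + t) \<subseteq> U"
 shows "\<exists>z\<in>cball x (s + t). dlt i s (dlt j t f) x = s * (t * pd j (pd i f) z)"
proof -
 have d: "pd i (dlt j t f) (x + r *. i) = dlt j t (pd i f) (x + r *. i) \<and>
    dlt j t f differentiable (at (x + r *. i))" if "0 <= r" "r <= s" for r
 proof -
  have "dist x y <= s + t" if "dist (x + r *. i) y <= t" for y
   using dist_triangle[of x y "x + r *. i"] that `0 <= r` `r <= s` by simp
  thus ?thesis using pd_dlts[of "[(j,t)]" "x + r *. i" f i] assms
   by (auto simp: subset_iff intro: smooth_in_diff)
 qed
 obtain r where r: "0 < r" "r < s" "dlt i s (dlt j t f) x = s * pd i (dlt j t f) (x + r *. i)"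
  using dlt_mvt[of s "dlt j t f" x i] d `s > 0` by blast
 have in_ball: "x + r *. i + q *. j \<in> cball x (s + t)" if "0 <= q" "q <= t" for q
  using dist_triangle[of x "x + r *. i + q *. j" "x + r *. i"] that r by simp
 obtain q where q: "0 < q" "q < t"
   "dlt j t (pd i f) (x + r *. i) = t * pd j (pd i f) (x + r *. i + q *. j)"
  using dlt_mvt[of t "pd i f" "x + r *. i" j] `t > 0` in_ball assms(4)
   smooth_in_diff[OF smooth_in_pd[OF assms(3)]] by blast
 show ?thesis using in_ball[of q] q r d[of r] by auto
qed

text \<open>The same second difference, divided by the squared step, equals either mixed derivative
  at some nearby point; continuity of both then forces equality.\<close>

lemma pd_commute:
 fixes f :: "real^'n::finite => real"
 assumes "open U" "smooth_in U f" "x \<in> U"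
 shows "pd i (pd j f) x = pd j (pd i f) x"
proof (rule ccontr)
 let ?a = "pd i (pd j f)" and ?b = "pd j (pd i f)"
 assume ne: "?a x ~= ?b x"
 define e where "e = abs(?a x - ?b x) / 2"
 have e: "e > 0" using ne by (simp add: e_def)
 have "continuous_on U ?a" "continuous_on U ?b" using assms smooth_in_continuous smooth_in_pd by blast+
 then obtain d1 d2 where d: "d1 > 0" "d2 > 0" "!!y. dist y x < d1 ==> dist (?a y) (?a x) < e"
   "!!y. dist y x < d2 ==> dist (?b y) (?b x) < e"
  using e `x \<in> U` `open U` by (metis continuous_on_eq_continuous_at continuous_at_eps_delta)
 obtain d0 where d0: "d0 > 0" "cball x d0 \<subseteq> U" using assms open_contains_cball by blast
 define t where "t = min d0 (min (d1/2) (d2/2)) / 2"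
 have t: "t > 0" "t + t <= d0" "t + t < d1" "t + t < d2" using d d0 by (auto simp: t_def min_def)
 hence sub: "cball x (t + t) \<subseteq> U" using d0(2) by (meson cball_subset_cball_iff dual_order.trans subset_cball)
 obtain y where y: "y \<in> cball x (t + t)" "dlt i t (dlt j t f) x = t * (t * ?b y)"
  using dlt2_mvt[OF t(1) t(1) assms(2) sub] by blast
 obtain z where z: "z \<in> cball x (t + t)" "dlt j t (dlt i t f) x = t * (t * ?a z)"
  using dlt2_mvt[OF t(1) t(1) assms(2) sub] by blast
 have "?b y = ?a z" using y(2) z(2) dlt_commute[of i t j t f] t(1) by simp
 moreover have "dist (?b y) (?b x) < e" "dist (?a z) (?a x) < e"
  using d(3)[of z] d(4)[of y] y(1) z(1) t by (simp_all add: dist_commute[of x])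
 moreover have "abs(?a x - ?b x) <= abs(?a z - ?a x) + abs(?a z - ?b x)" by simp
 ultimately show False unfolding e_def dist_real_def by simp
qed

lemma second_diff_mvt:
 fixes f :: "real^'n::finite => real"
 assumes "h > 0" "smooth_in U f" "cball x (3 * h) \<subseteq> U"
 shows "\<exists>z\<in>cball x (3 * h). f (x + h *. i) + f (x - h *. i) - 2 * f x
      = h^2 * pd i (pd i f) z"
proof -
 have "y \<in> cball x (3 * h)" if "y \<in> cball (x - h *. i) (h + h)" for y
  using dist_triangle[of x y "x - h *. i"] that `h > 0` by simp
 hence sub: "cball (x - h *. i) (h + h) \<subseteq> cball x (3 * h)" by blast
 have "f (x + h *. i) + f (x - h *. i) - 2 * f x = dlt i h (dlt i h f) (x - h *. i)"
  by (simp add: dlt_def)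
 moreover obtain z where "z \<in> cball (x - h *. i) (h + h)"
   "dlt i h (dlt i h f) (x - h *. i) = h * (h * pd i (pd i f) z)"
  using dlt2_mvt[OF assms(1,1,2), of "x - h *. i" i i] sub assms(3) by blast
 ultimately show ?thesis using sub by (intro bexI[of _ z]) (auto simp: power2_eq_square)
qed

lemma finite_uniform_pos:
 fixes P :: "'i::finite => real => bool"
 assumes "!!i. \<exists>d>0. \<forall>h. 0 < h --> h <= d --> P i h"
 shows "\<exists>d>0. \<forall>i h. 0 < h --> h <= d --> P i h"
proof -
 obtain d where d: "!!i. d i > 0" "!!i h. 0 < h ==> h <= d i ==> P i h" using assms by metis
 show ?thesis
  by (intro exI[of _ "Min (range d)"]) (use d in auto)
qed

lemma compact_enlarge:
 fixes K :: "(real^'n::finite) set"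
 assumes "compact K" "open U" "K \<subseteq> U"
 obtains e K' where "e > 0" "compact K'" "K' \<subseteq> U" "!!x. x \<in> K ==> cball x e \<subseteq> K'"
proof -
 obtain e where e: "e > 0" "(\<Union>x\<in>K. cball x e) \<subseteq> U"
  using compact_subset_open_imp_cball_epsilon_subset[OF assms] by blast
 have eq: "(\<Union>x\<in>K. cball x e) = {x + y |x y. x \<in> K & y \<in> cball 0 e}"
 proof safe
  fix x y :: "real^'n" assume "x \<in> K" "y \<in> cball x e"
  thus "\<exists>a b. y = a + b & a \<in> K & b \<in> cball 0 e"
   by (intro exI[of _ x] exI[of _ "y - x"]) (auto simp: dist_norm norm_minus_commute)
 next
  fix x y :: "real^'n" assume "x \<in> K" "y \<in> cball 0 e"
  thus "x + y \<in> (\<Union>x\<in>K. cball x e)" by (auto simp: dist_norm intro!: bexI[of _ x])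
 qed
 show ?thesis
 proof (rule that[OF e(1) _ e(2)])
  show "compact (\<Union>x\<in>K. cball x e)" unfolding eq using assms(1) compact_cball by (rule compact_sums)
 qed auto
qed

lemma Dlap_laplacian:
 fixes f :: "real^'n::finite => real"
 assumes "open U" "smooth_in U f" "compact K" "K \<subseteq> U" "e > 0"
 shows "\<exists>h0>0. \<forall>h x. 0 < h --> h <= h0 --> x \<in> K --> abs(Dlap h f x - h\<^sup>2 * lap f x) <= e * h^2"
proof -
 let ?N = "real CARD('n)"
 have N: "?N > 0" by simp
 obtain r K' where r: "r > 0" "compact K'" "K' \<subseteq> U" "!!x. x \<in> K ==> cball x r \<subseteq> K'"
  using compact_enlarge[OF assms(3,1,4)] by blast
 have "\<exists>d>0. \<forall>h. 0 < h --> h <= d --> (\<forall>x\<in>K.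
   abs(f (x + h *. i) + f (x - h *. i) - 2 * f x - h\<^sup>2 * pd i (pd i f) x) <= e / ?N * h^2)" for i
 proof -
  let ?D = "pd i (pd i f)"
  have "continuous_on K' ?D"
   using smooth_in_continuous[OF smooth_in_pd[OF smooth_in_pd[OF assms(2)]]] r(3) continuous_on_subset by blast
  hence "uniformly_continuous_on K' ?D" using r(2) compact_uniformly_continuous by blast
  then obtain d where d: "d > 0" "!!x y. x \<in> K' ==> y \<in> K' ==> dist y x < d ==> dist (?D y) (?D x) < e / ?N"
   unfolding uniformly_continuous_on_def using `e > 0` N by (metis divide_pos_pos)
  show ?thesis
  proof (intro exI[of _ "min (r/3) (d/4)"] conjI allI impI ballI)
   fix h x assume h: "0 < h" "h <= min (r/3) (d/4)" and x: "x \<in> K"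
   have sub: "cball x (3 * h) \<subseteq> K'" using r(4)[OF x] h by (auto simp: subset_iff)
   then obtain z where z: "z \<in> cball x (3 * h)" "f (x + h *. i) + f (x - h *. i) - 2 * f x = h^2 * ?D z"
    using second_diff_mvt[OF h(1) assms(2), of x i] r(3) by blast
   have "dist (?D z) (?D x) < e / ?N"
    using d(2)[of x z] z(1) sub h by (auto simp: dist_commute subset_iff)
   hence "h^2 * abs(?D z - ?D x) <= h^2 * (e / ?N)" by (intro mult_left_mono) (auto simp: dist_real_def)
   thus "abs(f (x + h *. i) + f (x - h *. i) - 2 * f x - h\<^sup>2 * ?D x) <= e / ?N * h^2"
    unfolding z(2) right_diff_distrib[symmetric] by (simp add: abs_mult mult.commute)
  qed (use r d in auto)
 qed
 from finite_uniform_pos[of "%i h. \<forall>x\<in>K.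
   abs(f (x + h *. i) + f (x - h *. i) - 2 * f x - h\<^sup>2 * pd i (pd i f) x) <= e / ?N * h^2", OF this]
 obtain d where d: "d > 0" "!!i h x. 0 < h ==> h <= d ==> x \<in> K ==>
   abs(f (x + h *. i) + f (x - h *. i) - 2 * f x - h\<^sup>2 * pd i (pd i f) x) <= e / ?N * h^2"
  by blast
 show ?thesis
 proof (intro exI[of _ d] conjI allI impI d(1))
  fix h x assume h: "0 < h" "h <= d" "x \<in> K"
  have "abs(Dlap h f x - h\<^sup>2 * lap f x)
    = abs(\<Sum>i\<in>UNIV. f (x + h *. i) + f (x - h *. i) - 2 * f x - h\<^sup>2 * pd i (pd i f) x)"
   by (simp add: Dlap_def lap_def sum_subtractf sum_distrib_left)
  also have "... <= (\<Sum>i\<in>(UNIV::'n set). e / ?N * h^2)"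
   by (rule order_trans[OF sum_abs sum_mono]) (use d(2)[OF h] in auto)
  also have "... = e * h^2" using N by simp
  finally show "abs(Dlap h f x - h\<^sup>2 * lap f x) <= e * h^2" .
 qed
qed

text \<open>\<open>partial_deriv\<close> reads off the Frechet derivative and so carries no
  information before differentiability is known. Partial derivatives are therefore given here as
  derivatives along lines, and their continuity yields the total derivative.\<close>

lemma has_derivative_partials:
 fixes f :: "real^'n::finite => real"
 assumes "open U"
  and der: "!!y i. y \<in> U ==> ((%t. f (y + t *. i)) has_real_derivative G i y) (at 0)"
  and cont: "!!i. continuous_on U (G i)"
  and "x \<in> U"
 shows "(f has_derivative (%v. \<Sum>i\<in>UNIV. v $ i * G i x)) (at x)"
proof -
 have line: "((%t. f (y + t *. i)) has_real_derivative G i (y + s *. i)) (at s)"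
  if "y + s *. i \<in> U" for y s i
 proof -
  have "((%t. f (y + s *. i + (t - s) *. i)) has_real_derivative G i (y + s *. i) * 1) (at s)"
   by (rule DERIV_chain2[of "%t. f (y + s *. i + t *. i)"])
     (use der[OF that, of i] in "auto intro!: derivative_eq_intros")
  thus ?thesis by (simp add: algebra_simps)
 qed
 \<comment> \<open>The increment is built up one coordinate at a time, the mean value theorem
   handling each new coordinate; hence the induction over finite sets of coordinates.\<close>
 have claim: "\<forall>e>0. \<exists>d>0. \<forall>v. norm v < d -->
   abs(f (x + (\<Sum>i\<in>A. (v$i) *. i)) - f x - (\<Sum>i\<in>A. v $ i * G i x)) <= e * norm v" if "finite A" for A
  using that
 proof (induction A rule: finite_induct)
  case empty
  thus ?case by (auto intro!: exI[of _ 1])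
 next
  case (insert a A)
  show ?case
  proof (intro allI impI)
   fix e :: real assume "e > 0"
   obtain d1 where d1: "d1 > 0" "!!v. norm v < d1 ==>
    abs(f (x + (\<Sum>i\<in>A. (v$i) *. i)) - f x - (\<Sum>i\<in>A. v $ i * G i x)) <= e / 2 * norm v"
    using insert.IH `e > 0` by (meson half_gt_zero)
   obtain d2 where d2: "d2 > 0" "!!y. dist y x < d2 ==> dist (G a y) (G a x) < e / 2"
    using cont[of a] `x \<in> U` `open U` `e > 0`
    by (metis continuous_on_eq_continuous_at continuous_at_eps_delta half_gt_zero)
   obtain d3 where d3: "d3 > 0" "ball x d3 \<subseteq> U" using `x \<in> U` `open U` open_contains_ball by blast
   define n where "n = real (card A) + 1"
   have n: "n > 0" by (simp add: n_def add_nonneg_pos)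
   define d where "d = min d1 (min (d2 / n) (d3 / n))"
   have "abs(f (x + (\<Sum>i\<in>insert a A. (v$i) *. i)) - f x - (\<Sum>i\<in>insert a A. v $ i * G i x)) <= e * norm v"
    if v: "norm v < d" for v
   proof -
    define y where "y = x + (\<Sum>i\<in>A. (v$i) *. i)"
    have near: "dist (y + s *. a) x < min d2 d3" if "abs(s) <= abs(v $ a)" for s
    proof -
     have "dist (y + s *. a) x <= norm (\<Sum>i\<in>A. (v$i) *. i) + abs(s)"
      using norm_triangle_ineq[of "\<Sum>i\<in>A. (v$i) *. i" "s *. a"] by (simp add: y_def dist_norm add.assoc)
     also have "norm (\<Sum>i\<in>A. (v$i) *. i) <= (\<Sum>i\<in>A. norm v)"
      by (rule order_trans[OF norm_sum sum_mono]) (simp add: component_le_norm_cart)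
     also have "abs(s) <= norm v" using that component_le_norm_cart[of v a] by simp
     finally have "dist (y + s *. a) x <= n * norm v" by (simp add: n_def algebra_simps)
     also have "n * norm v < n * d" using v n by simp
     also have "n * d <= min d2 d3" using n by (simp add: d_def min_def field_simps)
     finally show ?thesis by simp
    qed
    have step: "abs(f (y + (v$a) *. a) - f y - v $ a * G a x) <= e / 2 * abs(v $ a)"
    proof -
     have inU: "y + s *. a \<in> U" if "abs(s) <= abs(v $ a)" for s
      using near[OF that] d3(2) by (auto simp: dist_commute)
     have "\<exists>s. abs(s) <= abs(v $ a) & f (y + (v$a) *. a) - f y = v $ a * G a (y + s *. a)"
     proof (cases "v $ a" "0::real" rule: linorder_cases)
      case less
      have "\<exists>z>v $ a. z < 0 & f (y + 0 *. a) - f (y + (v$a) *. a) = (0 - v $ a) * G a (y + z *. a)"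
       by (rule MVT2[OF less]) (use less in "auto intro!: line inU")
      then obtain z where "z > v $ a" "z < 0" "f y - f (y + (v$a) *. a) = (0 - v $ a) * G a (y + z *. a)" by auto
      thus ?thesis by (intro exI[of _ z]) auto
     next
      case equal
      thus ?thesis by auto
     next
      case greater
      have "\<exists>z>0. z < v $ a & f (y + (v$a) *. a) - f (y + 0 *. a) = (v $ a - 0) * G a (y + z *. a)"
       by (rule MVT2[OF greater]) (use greater in "auto intro!: line inU")
      then obtain z where "z > 0" "z < v $ a" "f (y + (v$a) *. a) - f y = (v $ a - 0) * G a (y + z *. a)" by auto
      thus ?thesis by (intro exI[of _ z]) auto
     qed
     then obtain s where s: "abs(s) <= abs(v $ a)" "f (y + (v$a) *. a) - f y = v $ a * G a (y + s *. a)" by blast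
     have "dist (G a (y + s *. a)) (G a x) < e / 2" using near[OF s(1)] d2(2) by simp
     hence "abs(v $ a) * abs(G a (y + s *. a) - G a x) <= abs(v $ a) * (e / 2)"
      by (intro mult_left_mono) (auto simp: dist_real_def)
     thus ?thesis unfolding s(2) right_diff_distrib[symmetric] by (simp add: abs_mult mult.commute)
    qed
    have "abs(f y - f x - (\<Sum>i\<in>A. v $ i * G i x)) <= e / 2 * norm v"
     unfolding y_def by (rule d1(2)) (use v in "simp add: d_def")
    moreover have "e / 2 * abs(v $ a) <= e / 2 * norm v"
     using `e > 0` component_le_norm_cart[of v a] by (intro mult_left_mono) auto
    moreover have "f (x + (\<Sum>i\<in>insert a A. (v$i) *. i)) - f x - (\<Sum>i\<in>insert a A. v $ i * G i x)
      = (f (y + (v$a) *. a) - f y - v $ a * G a x) + (f y - f x - (\<Sum>i\<in>A. v $ i * G i x))"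
     using insert.hyps by (simp add: y_def algebra_simps)
    moreover have "e / 2 * norm v + e / 2 * norm v = e * norm v" by simp
    ultimately show ?thesis
     using step abs_triangle_ineq[of "f (y + (v$a) *. a) - f y - v $ a * G a x" "f y - f x - (\<Sum>i\<in>A. v $ i * G i x)"]
     by linarith
   qed
   moreover have "d > 0" using d1 d2 d3 n by (simp add: d_def)
   ultimately show "\<exists>d>0. \<forall>v. norm v < d --> abs(f (x + (\<Sum>i\<in>insert a A. (v$i) *. i)) - f x
     - (\<Sum>i\<in>insert a A. v $ i * G i x)) <= e * norm v" by blast
  qed
 qed
 have sumv: "(\<Sum>i\<in>UNIV. (v$i) *. i) = v" for v :: "real^'n"
  using basis_expansion[of v] by (simp add: scalar_mult_eq_scaleR)
 have lin: "bounded_linear (%v::real^'n. \<Sum>i\<in>UNIV. v $ i * G i x)"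
  by (intro bounded_linear_sum bounded_linear_mult_const bounded_linear_vec_nth)
 show ?thesis
  unfolding has_derivative_at_alt
 proof (intro conjI lin allI impI)
  fix e :: real assume "e > 0"
  then obtain d where d: "d > 0" "!!v. norm v < d ==> abs(f (x + v) - f x - (\<Sum>i\<in>UNIV. v $ i * G i x)) <= e * norm v"
   using claim[OF finite, of UNIV] unfolding sumv by blast
  show "\<exists>d>0. \<forall>y. norm (y - x) < d --> norm (f y - f x - (\<Sum>i\<in>UNIV. (y - x) $ i * G i x)) <= e * norm (y - x)"
  proof (intro exI[of _ d] conjI allI impI d(1))
   fix y assume "norm (y - x) < d"
   from d(2)[OF this] show "norm (f y - f x - (\<Sum>i\<in>UNIV. (y - x) $ i * G i x)) <= e * norm (y - x)" by simp
  qed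
 qed
qed

section \<open>Smoothness from bounded dyadic difference quotients\<close>

definition dyad :: "real => bool" where
 "dyad t \<longleftrightarrow> (\<exists>a k :: nat. a > 0 & t = real a / 2 ^ k)"

abbreviation dyad_steps :: "real => real list => bool" where
 "dyad_steps \<eta> ts == (\<forall>t\<in>set ts. dyad t & t \<le> \<eta>)"

abbreviation grid_steps :: "nat => real => real list => bool" where
 "grid_steps k \<eta> ts == (\<forall>t\<in>set ts. 0 < t & t \<le> \<eta> & (\<exists>a::nat. t = real a / 2 ^ k))"

lemma dyad_pos: "dyad t ==> t > 0"
 by (auto simp: dyad_def)

text \<open>
 Only dyadic steps are admitted: the discrete solutions live on grids of mesh \<open>1 / 2 ^ k\<close>.
\<close>

definition dbdd :: "(real^'n::finite) set => (real^'n => real) => bool" where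
 "dbdd U f \<longleftrightarrow> (\<forall>is K. compact K & K \<subseteq> U --> (\<exists>C \<eta>. \<eta> > 0 \<and>
   (\<forall>x\<in>K. \<forall>ts. length ts = length is --> dyad_steps \<eta> ts -->
    abs(dlts (zip is ts) f x) <= C * prod_list ts)))"

lemma dbddD:
 assumes "dbdd U f" "compact K" "K \<subseteq> U"
 shows "\<exists>C \<eta>. \<eta> > 0 & C > 0 & (\<forall>x\<in>K. \<forall>ts. length ts = length is --> dyad_steps \<eta> ts -->
    abs(dlts (zip is ts) f x) <= C * prod_list ts)"
proof -
 obtain C \<eta> where C: "\<eta> > 0" "!!x ts. x \<in> K ==> length ts = length is ==> dyad_steps \<eta> ts
    ==> abs(dlts (zip is ts) f x) <= C * prod_list ts"
  using assms unfolding dbdd_def by meson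
 have "abs(dlts (zip is ts) f x) <= (abs(C) + 1) * prod_list ts"
  if "x \<in> K" "length ts = length is" "\<forall>t\<in>set ts. dyad t & t <= \<eta>" for x ts
 proof -
  have "prod_list ts >= 0" using that(3) by (intro prod_list_nonneg) (fastforce dest: dyad_pos)
  hence "C * prod_list ts <= (abs(C) + 1) * prod_list ts" by (intro mult_right_mono) auto
  thus ?thesis using C(2)[OF that] by linarith
 qed
 thus ?thesis by (intro exI[of _ "abs(C) + 1"] exI[of _ \<eta>]) (use C(1) in auto)
qed

lemma geometric_limit:
 fixes a :: "nat => real"
 assumes "!!k. k >= m ==> abs(a k - a (Suc k)) <= C / 2 ^ k"
 shows "convergent a" "k >= m ==> abs(a k - lim a) <= 2 * C / 2 ^ k"
proof -
 have C: "C >= 0"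
 proof -
  have "0 <= C / 2 ^ m * 2 ^ m" using order_trans[OF abs_ge_zero assms[of m]] by (intro mult_nonneg_nonneg) auto
  thus ?thesis by simp
 qed
 have step: "abs(a k - a (k + j)) <= 2 * C / 2 ^ k - 2 * C / 2 ^ (k + j)" if "k >= m" for k j
 proof (induction j)
  case (Suc j)
  have "abs(a (k + j) - a (Suc (k + j))) <= C / 2 ^ (k + j)" using that by (intro assms) simp
  thus ?case using Suc by (simp add: abs_le_iff)
 qed simp
 have le: "abs(a k - a (k + j)) <= 2 * C / 2 ^ k" if "k >= m" for k j
  using step[OF that, of j] C by (smt (verit) divide_nonneg_pos zero_less_power)
 have "Cauchy a"
 proof (rule CauchyI')
  fix e :: real assume "e > 0"
  have "(%k. 2 * C * (1/2) ^ k) \<longlonglongrightarrow> 2 * C * 0"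
   by (intro tendsto_mult_left LIMSEQ_power_zero) simp
  hence "\<forall>\<^sub>F k in sequentially. 2 * C * (1/2) ^ k < e" using `e > 0` order_tendstoD(2) by fastforce
  then obtain k0 where k0: "!!k. k >= k0 ==> 2 * C * (1/2) ^ k < e" unfolding eventually_sequentially by blast
  show "\<exists>M. \<forall>m\<ge>M. \<forall>n>m. dist (a m) (a n) < e"
  proof (intro exI[of _ "max m k0"] allI impI)
   fix p n assume "p >= max m k0" "n > p"
   thus "dist (a p) (a n) < e"
   proof -
    have "2 * C / 2 ^ p = 2 * C * (1/2) ^ p" by (simp add: power_one_over)
    thus ?thesis using `p >= max m k0` `n > p` le[of p "n - p"] k0[of p] by (simp add: dist_real_def)
   qed
  qed
 qed
 thus "convergent a" by (simp add: Cauchy_convergent_iff)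
 hence L: "a \<longlonglongrightarrow> lim a" by (simp add: convergent_LIMSEQ_iff)
 assume "k >= m"
 have "(%j. abs(a k - a (j + k))) \<longlonglongrightarrow> abs(a k - lim a)"
  using L by (intro tendsto_intros LIMSEQ_ignore_initial_segment)
 thus "abs(a k - lim a) <= 2 * C / 2 ^ k"
  by (rule tendsto_upperbound) (use le[OF `k >= m`] in "auto simp: add.commute")
qed

lemma pow2_small: "(e::real) > 0 ==> \<exists>m::nat. \<forall>k\<ge>m. 1 / 2 ^ k <= e"
proof -
 assume "e > 0"
 have "(%k. (1/2::real) ^ k) \<longlonglongrightarrow> 0" by (intro LIMSEQ_power_zero) simp
 hence "\<forall>\<^sub>F k in sequentially. (1/2::real) ^ k < e" using `e > 0` order_tendstoD(2) by fastforce
 thus ?thesis unfolding eventually_sequentially by (metis less_imp_le power_one_over)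
qed

text \<open>The estimate is one-sided in \<open>t\<close> but holds at all base points near
  \<open>x\<close>. A negative increment \<open>h\<close> is handled by starting from
  \<open>x + h *. i\<close> and using continuity of \<open>G\<close>.\<close>

lemma deriv_at0:
 fixes f :: "real^'n::finite => real"
 assumes "r > 0" and est: "!!y t. dist x y < r ==> 0 < t ==> t < r ==> abs(f (y + t *. i) - f y - t * G y) <= C * t^2"
  and cont: "isCont G x"
 shows "((%t. f (x + t *. i)) has_real_derivative G x) (at 0)"
proof -
 have C: "C >= 0"
 proof -
  have "0 <= C * (r/2)\<^sup>2" using est[of x "r/2"] `r > 0` by (auto intro: order_trans[OF abs_ge_zero])
  thus ?thesis using `r > 0` by (simp add: zero_le_mult_iff)
 qed
 have "(%h. (f (x + h *. i) - f x) / h) \<midarrow>0\<rightarrow> G x"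
 proof (rule LIM_I)
  fix e :: real assume "e > 0"
  obtain d where d: "d > 0" "!!y. dist y x < d ==> dist (G y) (G x) < e / 2"
   using cont `e > 0` by (metis continuous_at_eps_delta half_gt_zero)
  define s where "s = min (min r d) (e / (2 * (C + 1)))"
  have pos: "abs((f (y + t *. i) - f y) / t - G y) <= e / 2" if "dist x y < r" "0 < t" "t < s" for y t
  proof -
   have "(f (y + t *. i) - f y) / t - G y = (f (y + t *. i) - f y - t * G y) / t"
    using `0 < t` by (simp add: field_simps)
   hence "abs((f (y + t *. i) - f y) / t - G y) <= (C * t^2) / t"
    using est[OF that(1,2)] that by (auto simp: s_def intro!: divide_right_mono)
   also have "... = C * t" using `0 < t` by (simp add: power2_eq_square)
   also have "... <= (C + 1) * (e / (2 * (C + 1)))" using that C by (intro mult_mono) (auto simp: s_def)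
   also have "... = e / 2" using C by (simp add: field_simps)
   finally show ?thesis .
  qed
  show "\<exists>s>0. \<forall>h. h ~= 0 & norm (h - 0) < s --> norm ((f (x + h *. i) - f x) / h - G x) < e"
  proof (intro exI[of _ s] conjI allI impI)
   show "s > 0" using `r > 0` d `e > 0` C by (simp add: s_def)
   fix h :: real assume h: "h ~= 0 & norm (h - 0) < s"
   show "norm ((f (x + h *. i) - f x) / h - G x) < e"
   proof (cases "h > 0")
    case True
    thus ?thesis using pos[of x h] h `r > 0` `e > 0` by simp
   next
    case False
    let ?y = "x + h *. i"
    have hn: "h < 0" using False h by simp
    have "abs((f (?y + (- h) *. i) - f ?y) / (- h) - G ?y) <= e / 2"
     using pos[of ?y "- h"] h hn by (simp add: s_def)
    moreover have "(f (?y + (- h) *. i) - f ?y) / (- h) = (f ?y - f x) / h"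
     using hn by (simp add: field_simps)
    moreover have "dist (G ?y) (G x) < e / 2" using d(2)[of ?y] h hn by (simp add: s_def)
    ultimately show ?thesis unfolding dist_real_def real_norm_def by linarith
   qed
  qed
 qed
 thus ?thesis by (simp add: DERIV_def)
qed

lemma sum_list_le_length:
 fixes ts :: "real list"
 assumes "!!t. t \<in> set ts ==> t <= \<eta>"
 shows "sum_list ts <= real (length ts) * \<eta>"
 using assms
proof (induction ts)
 case (Cons a ts)
 hence "a <= \<eta>" "sum_list ts <= real (length ts) * \<eta>" by auto
 thus ?case by (simp add: algebra_simps)
qed simp

lemma map_snd_zip': "length ts = length is ==> map snd (zip is ts) = ts"
 by (induction "is" ts rule: list_induct2') auto

lemma dyad_pow [simp]: "dyad (1 / 2 ^ k)"
 unfolding dyad_def by (intro exI[of _ 1] exI[of _ k]) auto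

text \<open>Bounded second differences make the quotients over steps 1/2^k converge geometrically
  and locally uniformly. The limit \<open>G\<close> inherits all difference bounds, because
  differences of the quotients are differences of \<open>f\<close> with one more index
  \<open>i\<close>; so the step can be iterated.\<close>

lemma dbdd_step:
 fixes f :: "real^'n::finite => real"
 assumes "open U" and cont: "continuous_on U f" and bd: "dbdd U f"
 shows "\<exists>G. continuous_on U G & dbdd U G \<and>
  (\<forall>y\<in>U. ((%t. f (y + t *. i)) has_real_derivative G y) (at 0))"
proof -
 define q where "q k x = 2 ^ k * dlt i (1 / 2 ^ k) f x" for k :: nat and x
 have qd: "\<exists>C m. \<forall>k\<ge>m. \<forall>x\<in>K. abs(q k x - q (Suc k) x) <= C / 2 ^ k" if K: "compact K" "K \<subseteq> U" for K
 proof -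
  obtain C \<eta> where C: "\<eta> > 0" "C > 0"
   "!!x ts. x \<in> K ==> length ts = length [i,i] ==> dyad_steps \<eta> ts
     ==> abs(dlts (zip [i,i] ts) f x) <= C * prod_list ts"
   using dbddD[OF bd K, of "[i,i]"] by meson
  obtain m where m: "!!k. k >= m ==> 1 / 2 ^ k <= \<eta>" using pow2_small[OF C(1)] by blast
  show ?thesis
  proof (intro exI[of _ C] exI[of _ m] allI impI ballI)
   fix k x assume k: "k >= m" and x: "x \<in> K"
   let ?s = "1 / 2 ^ Suc k :: real"
   have s: "?s <= \<eta>" using m[of "Suc k"] k by simp
   have "q k x - q (Suc k) x = 2 ^ k * dlts (zip [i,i] [?s,?s]) f x"
    by (simp add: q_def dlt_def algebra_simps flip: scaleR_left_distrib)
   also have "abs(...) = 2 ^ k * abs(dlts (zip [i,i] [?s,?s]) f x)" by (simp only: abs_mult) simp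
   also have "... <= 2 ^ k * (C * prod_list [?s,?s])"
    by (intro mult_left_mono C(3) x) (use s dyad_pow[of "Suc k"] in auto)
   also have "... = C / 2 ^ k / 4" by (simp add: field_simps power2_eq_square)
   also have "... <= C / 2 ^ k"
   proof -
    have q: "x / 4 <= x" if "x >= 0" for x :: real using that by simp
    show ?thesis by (rule q) (use C(2) in simp)
   qed
   finally show "abs(q k x - q (Suc k) x) <= C / 2 ^ k" .
  qed
 qed
 define G where "G x = lim (%k. q k x)" for x
 have Gu: "\<exists>C m. C >= 0 & (\<forall>k\<ge>m. \<forall>x\<in>K. abs(q k x - G x) <= C / 2 ^ k)" if K: "compact K" "K \<subseteq> U" for K
 proof -
  obtain C m where C: "!!k x. k >= m ==> x \<in> K ==> abs(q k x - q (Suc k) x) <= C / 2 ^ k" using qd[OF K] by blast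
  have "abs(q k x - G x) <= 2 * abs(C) / 2 ^ k" if "k >= m" "x \<in> K" for k x
  proof -
   have "abs(q k x - G x) <= 2 * C / 2 ^ k" unfolding G_def by (rule geometric_limit(2)[of m]) (use C that in auto)
   also have "... <= 2 * abs(C) / 2 ^ k" by (intro divide_right_mono) auto
   finally show ?thesis .
  qed
  thus ?thesis by (intro exI[of _ "2 * abs(C)"] exI[of _ m]) auto
 qed
 have Glim: "(%k. q k x) \<longlonglongrightarrow> G x" if "x \<in> U" for x
 proof -
  obtain C m where C: "!!k y. k >= m ==> y \<in> {x} ==> abs(q k y - q (Suc k) y) <= C / 2 ^ k"
   using qd[of "{x}"] `x \<in> U` by auto
  have "convergent (%k. q k x)" by (rule geometric_limit(1)[of m _ C]) (use C in auto)
  thus ?thesis by (simp add: G_def convergent_LIMSEQ_iff)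
 qed
 have Gcont: "continuous_on U G"
 proof (rule continuous_at_imp_continuous_on, rule ballI)
  fix x assume "x \<in> U"
  then obtain r where r: "r > 0" "cball x r \<subseteq> U" using `open U` open_contains_cball by blast
  obtain C m where C: "C >= 0" "!!k y. k >= m ==> y \<in> cball x r ==> abs(q k y - G y) <= C / 2 ^ k"
   using Gu[OF compact_cball r(2)] by blast
  obtain p where p: "!!k. k >= p ==> 1 / 2 ^ k <= r / 2" using pow2_small[of "r/2"] r(1) by auto
  have "uniform_limit (ball x (r/2)) q G sequentially"
  proof (rule uniform_limitI)
   fix e :: real assume "e > 0"
   obtain p where p: "!!k. k >= p ==> 1 / 2 ^ k <= e / (C + 1) / 2"
    using pow2_small[of "e / (C + 1) / 2"] `e > 0` C(1) by auto
   have "dist (q k y) (G y) < e" if "k >= max m p" "y \<in> ball x (r/2)" for k y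
   proof -
    have "y \<in> cball x r" using that(2) r(1) by simp
    hence "abs(q k y - G y) <= C * (1 / 2 ^ k)" using C(2)[of k y] that by auto
    also have "... <= (C + 1) * (e / (C + 1) / 2)" using p[of k] that C(1) by (intro mult_mono) auto
    also have "... = e / 2"
    proof -
     have q: "c * (e / c / 2) = e / 2" if "c > 0" for c :: real using that by simp
     show ?thesis by (rule q) (use C(1) in simp)
    qed
    also have "... < e" using `e > 0` by simp
    finally show ?thesis by (simp add: dist_real_def)
   qed
   thus "\<forall>\<^sub>F k in sequentially. \<forall>y\<in>ball x (r/2). dist (q k y) (G y) < e"
    unfolding eventually_sequentially by blast
  qed
  moreover have "continuous_on (ball x (r/2)) (q k)" if "k >= p" for k
  proof -
   have "y + (1 / 2 ^ k) *. i \<in> U" if "y \<in> ball x (r/2)" for y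
    using dist_triangle[of x "y + (1 / 2 ^ k) *. i" y] that p[OF `k >= p`] r(2) by (auto simp: subset_iff)
   moreover have "ball x (r/2) \<subseteq> U" using r by (auto simp: subset_iff)
   ultimately show ?thesis unfolding q_def dlt_def
    by (intro continuous_intros continuous_on_compose2[OF cont]) auto
  qed
  ultimately have "continuous_on (ball x (r/2)) G"
   using uniform_limit_theorem[where F = sequentially and f = q and l = G and A = "ball x (r/2)"]
   by (auto simp: eventually_sequentially)
  thus "isCont G x" using r(1) by (simp add: continuous_on_eq_continuous_at)
 qed
 have Gbd: "dbdd U G"
  unfolding dbdd_def
 proof (intro allI impI, elim conjE)
  fix "is" :: "'n list" and K :: "(real^'n) set" assume K: "compact K" "K \<subseteq> U"
  obtain C \<eta> where C: "\<eta> > 0" "C > 0"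
   "!!x ts. x \<in> K ==> length ts = length (i # is) ==> dyad_steps \<eta> ts
     ==> abs(dlts (zip (i # is) ts) f x) <= C * prod_list ts"
   using dbddD[OF bd K, of "i # is"] by meson
  obtain e K' where e: "e > 0" "K' \<subseteq> U" "!!x. x \<in> K ==> cball x e \<subseteq> K'"
   using compact_enlarge[OF K(1) `open U` K(2)] by metis
  define \<eta>' where "\<eta>' = min \<eta> (e / (real (length is) + 1))"
  obtain m where m: "!!k. k >= m ==> 1 / 2 ^ k <= \<eta>" using pow2_small[OF C(1)] by blast
  have "abs(dlts (zip is ts) G x) <= C * prod_list ts"
   if x: "x \<in> K" and ts: "length ts = length is" "\<forall>t\<in>set ts. dyad t & t <= \<eta>'" for x ts
  proof -
   have "sum_list ts <= real (length ts) * \<eta>'" using ts by (intro sum_list_le_length) auto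
   also have "... <= real (length is) * (e / (real (length is) + 1))" unfolding ts(1)
    by (intro mult_left_mono) (auto simp: \<eta>'_def)
   also have "... <= e" using e(1) by (simp add: field_simps)
   finally have sum: "sum_list ts <= e" .
   have pos: "snd p >= 0" if "p \<in> set (zip is ts)" for p
    using that ts(2) set_zip_rightD[of "fst p" "snd p" "is" ts] by (auto simp: dyad_def)
   have "(%k. dlts (zip is ts) (q k) x) \<longlonglongrightarrow> dlts (zip is ts) G x"
   proof (rule dlts_tendsto[OF _ pos])
    fix y assume "dist x y <= sum_list (map snd (zip is ts))"
    hence "y \<in> U" using e(2) e(3)[OF x] sum by (auto simp: map_snd_zip'[OF ts(1)] subset_iff)
    thus "(%k. q k y) \<longlonglongrightarrow> G y" by (rule Glim)
   qed
   hence "(%k. abs(dlts (zip is ts) (q k) x)) \<longlonglongrightarrow> abs(dlts (zip is ts) G x)" by (rule tendsto_rabs)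
   moreover have "abs(dlts (zip is ts) (q k) x) <= C * prod_list ts" if "k >= m" for k
   proof -
    have "dlts (zip is ts) (q k) x = 2 ^ k * dlts (zip (i # is) (1 / 2 ^ k # ts)) f x"
     unfolding q_def dlts_cmult by simp
    also have "abs(...) = 2 ^ k * abs(dlts (zip (i # is) (1 / 2 ^ k # ts)) f x)" by (simp add: abs_mult)
    also have "... <= 2 ^ k * (C * prod_list (1 / 2 ^ k # ts))"
     by (intro mult_left_mono C(3) x) (use ts m[OF that] in "auto simp: \<eta>'_def")
    finally show ?thesis by simp
   qed
   ultimately show ?thesis
    by (intro tendsto_upperbound[of _ "abs(dlts (zip is ts) G x)" sequentially])
      (auto simp: eventually_sequentially)
  qed
  thus "\<exists>C \<eta>. \<eta> > 0 & (\<forall>x\<in>K. \<forall>ts. length ts = length is --> dyad_steps \<eta> ts -->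
    abs(dlts (zip is ts) G x) <= C * prod_list ts)"
   using C(1) e(1) by (intro exI[of _ C] exI[of _ \<eta>']) (auto simp: \<eta>'_def)
 qed
 have "((%t. f (x + t *. i)) has_real_derivative G x) (at 0)" if "x \<in> U" for x
 proof -
  obtain r where r: "r > 0" "cball x r \<subseteq> U" using `open U` open_contains_cball `x \<in> U` by blast
  have sub: "cball x (r/2) \<subseteq> U" using r by (auto simp: subset_iff)
  obtain C \<eta> where C: "\<eta> > 0" "C > 0"
   "!!x' ts. x' \<in> cball x (r/2) ==> length ts = length [i,i] ==> dyad_steps \<eta> ts
     ==> abs(dlts (zip [i,i] ts) f x') <= C * prod_list ts"
   using dbddD[OF bd compact_cball sub, of "[i,i]"] by meson
  obtain m where m: "!!k. k >= m ==> 1 / 2 ^ k <= \<eta>" using pow2_small[OF C(1)] by blast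
  \<comment> \<open>For dyadic \<open>t\<close> the increment telescopes into \<open>A\<close> steps
    of length \<open>s\<close>. Each of these minus the first is a mixed second difference with
    steps \<open>s\<close> and \<open>b * s\<close>, so the sum is at most
    \<open>A * (C * (s * t)) = C * t^2\<close>.\<close>
  have est: "abs(f (y + t *. i) - f y - t * G y) <= C * t^2"
   if y: "y \<in> cball x (r/2)" and t: "dyad t" "t <= \<eta>" for y t
  proof -
   obtain a p :: nat where ap: "a > 0" "t = real a / 2 ^ p" using t(1) by (auto simp: dyad_def)
   have "t > 0" using ap by simp
   have "abs(f (y + t *. i) - f y - t * q k y) <= C * t^2" if k: "k >= max m p" for k
   proof -
    define s :: real where "s = 1 / 2 ^ k"
    define A where "A = a * 2 ^ (k - p)"
    have s: "s > 0" "dyad s" "s <= \<eta>" using m[of k] k by (auto simp: s_def)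
    have At: "real A * s = t"
    proof -
     have "(2::real) ^ k = 2 ^ p * 2 ^ (k - p)" using k by (simp flip: power_add)
     thus ?thesis by (simp add: A_def s_def ap(2) field_simps)
    qed
    have "f (y + t *. i) - f y = (\<Sum>b<A. f (y + (real (Suc b) * s) *. i) - f (y + (real b * s) *. i))"
     by (subst sum_lessThan_telescope) (simp add: At)
    also have "... = (\<Sum>b<A. dlt i s f (y + (real b * s) *. i))"
     by (rule sum.cong) (auto simp: dlt_def algebra_simps)
    finally have tel: "f (y + t *. i) - f y - t * q k y
      = (\<Sum>b<A. dlt i s f (y + (real b * s) *. i) - dlt i s f y)"
     by (simp add: sum_subtractf q_def At[symmetric] s_def)
    have "abs(dlt i s f (y + (real b * s) *. i) - dlt i s f y) <= C * (s * t)" if "b < A" for b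
    proof (cases "b = 0")
     case True
     thus ?thesis using C(2) s(1) `t > 0` by simp
    next
     case False
     have bt: "real b * s <= t" unfolding At[symmetric] using that s(1) by simp
     have "dyad (real b * s)" unfolding dyad_def s_def
      using False by (intro exI[of _ b] exI[of _ k]) auto
     hence "abs(dlts (zip [i,i] [s, real b * s]) f y) <= C * prod_list [s, real b * s]"
      using bt t s by (intro C(3) y) auto
     also have "... <= C * (s * t)" using bt s C(2) by (auto intro!: mult_left_mono)
     finally show ?thesis by (simp add: dlt_def)
    qed
    hence "abs(f (y + t *. i) - f y - t * q k y) <= (\<Sum>b<A. C * (s * t))"
     unfolding tel by (intro order_trans[OF sum_abs sum_mono]) auto
    also have "... = C * t^2" using At by (simp add: power2_eq_square)
    finally show ?thesis .
   qed
   moreover have "y \<in> U" using y sub by blast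
   hence "(%k. abs(f (y + t *. i) - f y - t * q k y)) \<longlonglongrightarrow> abs(f (y + t *. i) - f y - t * G y)"
    by (intro tendsto_intros Glim)
   ultimately show ?thesis
    by (intro tendsto_upperbound[of _ _ sequentially]) (auto simp: eventually_sequentially intro!: exI[of _ "max m p"])
  qed
  define r' where "r' = min \<eta> (r/2)"
  \<comment> \<open>Other \<open>t\<close> are approximated from below by the dyadic numbers
    \<open>T n\<close>; here continuity of \<open>f\<close> enters.\<close>
  have est2: "abs(f (y + t *. i) - f y - t * G y) <= C * t^2" if y: "dist x y < r'" and t: "0 < t" "t < r'" for y t
  proof -
   define T where "T n = real (nat \<lfloor>t * 2 ^ n\<rfloor>) / 2 ^ n" for n
   have T: "T n <= t" "t - 1 / 2 ^ n <= T n" for n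
   proof -
    have e: "real (nat \<lfloor>t * 2 ^ n\<rfloor>) = real_of_int \<lfloor>t * 2 ^ n\<rfloor>" using t(1) by simp
    have "real_of_int \<lfloor>t * 2 ^ n\<rfloor> <= t * 2 ^ n" by linarith
    thus "T n <= t" by (simp add: T_def e field_simps)
    have "t * 2 ^ n - 1 <= real_of_int \<lfloor>t * 2 ^ n\<rfloor>" by linarith
    hence "(t * 2 ^ n - 1) / 2 ^ n <= real_of_int \<lfloor>t * 2 ^ n\<rfloor> / 2 ^ n" by (intro divide_right_mono) auto
    thus "t - 1 / 2 ^ n <= T n" by (simp add: T_def e diff_divide_distrib)
   qed
   have Tlim: "T \<longlonglongrightarrow> t"
   proof (rule tendsto_sandwich[of "%n. t - (1/2) ^ n" _ _ "%_. t"])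
    have "(%n. t - (1/2) ^ n) \<longlonglongrightarrow> t - 0" by (intro tendsto_intros LIMSEQ_power_zero) simp
    thus "(%n. t - (1/2) ^ n) \<longlonglongrightarrow> t" by simp
   qed (use T in "auto simp: power_one_over")
   have "\<forall>\<^sub>F n in sequentially. T n > 0" using order_tendstoD(1)[OF Tlim t(1)] .
   hence ev: "\<forall>\<^sub>F n in sequentially. abs(f (y + T n *. i) - f y - T n * G y) <= C * (T n)\<^sup>2"
   proof eventually_elim
    case (elim n)
    have "dyad (T n)" unfolding dyad_def using elim
     by (intro exI[of _ "nat \<lfloor>t * 2 ^ n\<rfloor>"] exI[of _ n]) (auto simp: T_def zero_less_divide_iff)
    thus ?case using est[of y "T n"] y t T(1)[of n] by (auto simp: r'_def)
   qed
   have "y + t *. i \<in> U"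
    using dist_triangle[of x "y + t *. i" y] y t r(2) by (auto simp: r'_def subset_iff)
   hence "isCont f (y + t *. i)" using cont `open U` by (simp add: continuous_on_eq_continuous_at)
   hence "(%n. f (y + T n *. i)) \<longlonglongrightarrow> f (y + t *. i)"
    by (rule isCont_tendsto_compose) (intro tendsto_intros Tlim)
   hence "(%n. abs(f (y + T n *. i) - f y - T n * G y)) \<longlonglongrightarrow> abs(f (y + t *. i) - f y - t * G y)"
    by (intro tendsto_intros Tlim)
   moreover have "(%n. C * (T n)\<^sup>2) \<longlonglongrightarrow> C * t^2" by (intro tendsto_intros Tlim)
   ultimately show ?thesis using ev by (intro tendsto_le[of sequentially]) auto
  qed
  show ?thesis
   by (rule deriv_at0[of r' x f i G C])
     (use C(1) r(1) est2 Gcont `x \<in> U` `open U` in "auto simp: r'_def continuous_on_eq_continuous_at")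
 qed
 thus ?thesis using Gcont Gbd by blast
qed

theorem dbdd_imp_smooth:
 fixes f :: "real^'n::finite => real"
 assumes "open U" "continuous_on U f" "dbdd U f"
 shows "smooth_in U f"
proof (rule smooth_in_coinduct[where P = "%f. continuous_on U f & dbdd U f"])
 fix f :: "real^'n => real" assume f: "continuous_on U f & dbdd U f"
 then obtain G where G: "!!i. continuous_on U (G i) & dbdd U (G i) \<and>
  (\<forall>y\<in>U. ((%t. f (y + t *. i)) has_real_derivative G i y) (at 0))"
  using dbdd_step[OF `open U`] by metis
 have D: "(f has_derivative (%v. \<Sum>i\<in>UNIV. v $ i * G i x)) (at x)" if "x \<in> U" for x
  by (rule has_derivative_partials[OF `open U` _ _ that]) (use G in auto)
 show "f differentiable at x" if "x \<in> U" for x using D[OF that] by (auto simp: differentiable_def)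
 show "\<exists>g. (continuous_on U g & dbdd U g) & (\<forall>x\<in>U. pd i f x = g x)" for i
 proof (intro exI[of _ "G i"] conjI ballI)
  fix x assume "x \<in> U"
  from pd_eqI[OF D[OF this], of i] show "pd i f x = G i x"
   by (simp add: axis_def if_distrib if_distribR sum.delta cong: if_cong)
 qed (use G in auto)
qed (use assms in auto)

definition ubdd :: "(real^'n::finite) set => (nat => real^'n => real) => bool" where
 "ubdd U u \<longleftrightarrow> (\<forall>is K. compact K & K \<subseteq> U --> (\<exists>C \<eta> k0. \<eta> > 0 & C > 0 \<and>
   (\<forall>k\<ge>k0. \<forall>x\<in>K. \<forall>ts. length ts = length is --> grid_steps k \<eta> ts -->
    abs(dlts (zip is ts) (u k) x) <= C * prod_list ts)))"

lemma ubddD: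
 assumes "ubdd U u" "compact K" "K \<subseteq> U"
 shows "\<exists>C \<eta> k0. \<eta> > 0 & C > 0 \<and>
   (\<forall>k\<ge>k0. \<forall>x\<in>K. \<forall>ts. length ts = length is --> grid_steps k \<eta> ts -->
    abs(dlts (zip is ts) (u k) x) <= C * prod_list ts)"
 using assms unfolding ubdd_def by simp

lemma ubdd_limit:
 fixes u :: "nat => real^'n::finite => real"
 assumes "open U" "ubdd U u" and lim: "!!x. x \<in> U ==> (%k. u k x) \<longlonglongrightarrow> v x"
 shows "dbdd U v"
 unfolding dbdd_def
proof (intro allI impI, elim conjE)
 fix "is" :: "'n list" and K :: "(real^'n) set" assume K: "compact K" "K \<subseteq> U"
 from ubddD[OF assms(2) K, of "is"] obtain C \<eta> k0 where C0: "\<eta> > 0 & C > 0 \<and>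
   (\<forall>k\<ge>k0. \<forall>x\<in>K. \<forall>ts. length ts = length is --> grid_steps k \<eta> ts -->
    abs(dlts (zip is ts) (u k) x) <= C * prod_list ts)"
  by (elim exE)
 hence C: "\<eta> > 0" "C > 0"
  "!!k x ts. k >= k0 ==> x \<in> K ==> length ts = length is ==> grid_steps k \<eta> ts
    ==> abs(dlts (zip is ts) (u k) x) <= C * prod_list ts"
  by auto
 obtain e K' where e: "e > 0" "K' \<subseteq> U" "!!x. x \<in> K ==> cball x e \<subseteq> K'"
  using compact_enlarge[OF K(1) `open U` K(2)] by metis
 define \<eta>' where "\<eta>' = min \<eta> (e / (real (length is) + 1))"
 have "abs(dlts (zip is ts) v x) <= C * prod_list ts"
  if x: "x \<in> K" and ts: "length ts = length is" "\<forall>t\<in>set ts. dyad t & t <= \<eta>'" for x ts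
 proof -
  have "sum_list ts <= real (length ts) * \<eta>'" using ts by (intro sum_list_le_length) auto
  also have "... <= real (length is) * (e / (real (length is) + 1))" unfolding ts(1)
   by (intro mult_left_mono) (auto simp: \<eta>'_def)
  also have "... <= e" using e(1) by (simp add: field_simps)
  finally have sum: "sum_list ts <= e" .
  have pos: "snd p >= 0" if "p \<in> set (zip is ts)" for p
   using that ts(2) set_zip_rightD[of "fst p" "snd p" "is" ts] by (auto simp: dyad_def)
  have "(%k. dlts (zip is ts) (u k) x) \<longlonglongrightarrow> dlts (zip is ts) v x"
  proof (rule dlts_tendsto[OF _ pos])
   fix y assume "dist x y <= sum_list (map snd (zip is ts))"
   hence "y \<in> U" using e(2) e(3)[OF x] sum by (auto simp: map_snd_zip'[OF ts(1)] subset_iff)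
   thus "(%k. u k y) \<longlonglongrightarrow> v y" by (rule lim)
  qed
  hence "(%k. abs(dlts (zip is ts) (u k) x)) \<longlonglongrightarrow> abs(dlts (zip is ts) v x)" by (rule tendsto_rabs)
  \<comment> \<open>Any given dyadic steps become multiples of 1/2^k once \<open>k\<close> is large,
    so the bounds for \<open>u k\<close> apply to them eventually.\<close>
  moreover have "\<exists>m. \<forall>k\<ge>m. \<forall>t\<in>set ts. \<exists>a::nat. t = real a / 2 ^ k"
   using ts(2)
  proof (induction ts)
   case (Cons t ts)
   obtain a p :: nat where ap: "t = real a / 2 ^ p" using Cons.prems by (auto simp: dyad_def)
   obtain m where m: "\<forall>k\<ge>m. \<forall>t\<in>set ts. \<exists>a::nat. t = real a / 2 ^ k" using Cons by auto
   have "\<exists>a::nat. t = real a / 2 ^ k" if "k >= p" for k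
   proof -
    have "(2::real) ^ k = 2 ^ p * 2 ^ (k - p)" using that by (simp flip: power_add)
    thus ?thesis by (intro exI[of _ "a * 2 ^ (k - p)"]) (simp add: ap)
   qed
   thus ?case using m by (intro exI[of _ "max m p"]) auto
  qed simp
  then obtain m where m: "!!k t. k >= m ==> t \<in> set ts ==> \<exists>a::nat. t = real a / 2 ^ k" by blast
  have "abs(dlts (zip is ts) (u k) x) <= C * prod_list ts" if "k >= max m k0" for k
   by (rule C(3)) (use that x ts m[of k] in "auto simp: \<eta>'_def dyad_def")
  ultimately show ?thesis
   by (intro tendsto_upperbound[of _ "abs(dlts (zip is ts) v x)" sequentially])
     (auto simp: eventually_sequentially intro!: exI[of _ "max m k0"])
 qed
 thus "\<exists>C \<eta>. \<eta> > 0 & (\<forall>x\<in>K. \<forall>ts. length ts = length is --> dyad_steps \<eta> ts -->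
   abs(dlts (zip is ts) v x) <= C * prod_list ts)"
  using C(1) e(1) by (intro exI[of _ C] exI[of _ \<eta>']) (auto simp: \<eta>'_def)
qed

text \<open>Doubling the step costs exactly a sum of fourth differences. This compares two meshes by
  difference bounds alone, with no derivatives of \<open>f\<close> at hand.\<close>

lemma Dlap_double:
 fixes f :: "real^'n::finite => real"
 assumes "!!i. abs(dlts [(i,s),(i,s),(i,s),(i,s)] f (x - (2 * s) *. i)) <= B"
 shows "abs(Dlap (2 * s) f x - 4 * Dlap s f x) <= real CARD('n) * B"
proof -
 have "Dlap (2 * s) f x - 4 * Dlap s f x = (\<Sum>i\<in>UNIV. dlts [(i,s),(i,s),(i,s),(i,s)] f (x - (2 * s) *. i))"
  unfolding Dlap_def sum_distrib_left sum_subtractf[symmetric]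
 proof (rule sum.cong)
  fix i :: 'n
  have p: "x - (2 * s) *. i + s *. i = x - s *. i"
   "x - s *. i + s *. i = x" "x + s *. i + s *. i = x + (2 * s) *. i"
   by (auto simp: vec_eq_iff algebra_simps)
  show "f (x + (2 * s) *. i) + f (x - (2 * s) *. i) - 2 * f x
    - 4 * (f (x + s *. i) + f (x - s *. i) - 2 * f x)
    = dlts [(i,s),(i,s),(i,s),(i,s)] f (x - (2 * s) *. i)"
   by (simp add: dlt_def p)
 qed auto
 also have "abs(...) <= (\<Sum>i\<in>(UNIV::'n set). B)" by (rule order_trans[OF sum_abs sum_mono]) (use assms in auto)
 finally show ?thesis by simp
qed

text \<open>The comparison of a step with its double is summed over the meshes between
  \<open>j\<close> and \<open>k\<close>. Fourth differences of size \<open>C * s^4\<close> leave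
  errors decaying like 1/4^l, so the coarsest mesh dominates.\<close>

lemma Dlap_consistent:
 fixes f :: "real^'n::finite => real"
 assumes "j <= k" "C >= 0"
  and "!!l i. j < l ==> l <= k ==>
    abs(dlts [(i,1/2^l),(i,1/2^l),(i,1/2^l),(i,1/2^l)] f (x - (2 * (1/2^l)) *. i)) <= C * (1/2^l)^4"
 shows "abs(4 ^ j * Dlap (1/2^j) f x - 4 ^ k * Dlap (1/2^k) f x) <= real CARD('n) * C / 4 ^ j"
proof -
 let ?a = "%l. 4 ^ l * Dlap (1/2^l) f x" and ?c = "real CARD('n) * C"
 have step: "abs(?a l - ?a (Suc l)) <= ?c / 4 ^ l / 2" if "j <= l" "Suc l <= k" for l
 proof -
  let ?s = "1 / 2 ^ Suc l :: real"
  have "abs(Dlap (2 * ?s) f x - 4 * Dlap ?s f x) <= real CARD('n) * (C * ?s ^ 4)"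
   by (rule Dlap_double) (use assms(3)[of "Suc l"] that in auto)
  hence le: "4 ^ l * abs(Dlap (1/2^l) f x - 4 * Dlap ?s f x) <= 4 ^ l * (real CARD('n) * (C * ?s ^ 4))"
   by (intro mult_left_mono) auto
  have "?a l - ?a (Suc l) = 4 ^ l * (Dlap (1/2^l) f x - 4 * Dlap ?s f x)" by (simp add: algebra_simps)
  hence "abs(?a l - ?a (Suc l)) = 4 ^ l * abs(Dlap (1/2^l) f x - 4 * Dlap ?s f x)"
   by (simp only: abs_mult) simp
  also note le
  also have "4 ^ l * (real CARD('n) * (C * ?s ^ 4)) = ?c / 4 ^ l / 16"
  proof -
   have "(2::real) ^ l * 2 ^ l = 4 ^ l" by (simp flip: power_mult_distrib)
   hence "(2 ^ l :: real) ^ 4 = 4 ^ l * 4 ^ l" by (simp add: numeral_eq_Suc algebra_simps)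
   thus ?thesis by (simp add: power_divide power_mult_distrib)
  qed
  also have "?c / 4 ^ l / 16 <= ?c / 4 ^ l / 2" using `C >= 0` by (intro divide_left_mono) auto
  finally show ?thesis .
 qed
 have "abs(?a j - ?a (j + m)) <= ?c / 4 ^ j - ?c / 4 ^ (j + m)" if "j + m <= k" for m
  using that
 proof (induction m)
  case (Suc m)
  have "abs(?a (j + m) - ?a (Suc (j + m))) <= ?c / 4 ^ (j + m) / 2" by (rule step) (use Suc in auto)
  moreover have "?c / 4 ^ (j + m) / 2 <= ?c / 4 ^ (j + m) - ?c / 4 ^ Suc (j + m)"
  proof -
   have q: "x / 2 <= x - y" if "x >= 0" "y = x / 4" for x y :: real using that by simp
   show ?thesis by (rule q) (use `C >= 0` in auto)
  qed
  ultimately show ?case using Suc by simp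
 qed simp
 from this[of "k - j"] have "abs(?a j - ?a k) <= ?c / 4 ^ j - ?c / 4 ^ k" using `j <= k` by simp
 also have "... <= ?c / 4 ^ j" using `C >= 0` by simp
 finally show ?thesis .
qed

lemma ubdd_consistent:
 fixes u :: "nat => real^'n::finite => real"
 assumes "open U" "ubdd U u" "compact K" "K \<subseteq> U"
 shows "\<exists>C>0. \<exists>j0. \<forall>j\<ge>j0. \<forall>k\<ge>j. \<forall>x\<in>K. abs(4 ^ j * Dlap (1/2^j) (u k) x - 4 ^ k * Dlap (1/2^k) (u k) x) <= C / 4 ^ j"
proof -
 obtain e K' where e: "e > 0" "compact K'" "K' \<subseteq> U" "!!x. x \<in> K ==> cball x e \<subseteq> K'"
  using compact_enlarge[OF assms(3,1,4)] by metis
 define P where "P i C \<eta> k0 \<longleftrightarrow> \<eta> > 0 & C > 0 \<and>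
  (\<forall>k\<ge>k0. \<forall>x\<in>K'. \<forall>ts. length ts = length [i,i,i,i] --> grid_steps k \<eta> ts -->
    abs(dlts (zip [i,i,i,i] ts) (u k) x) <= C * prod_list ts)" for i C \<eta> k0
 have "\<exists>C \<eta> k0. P i C \<eta> k0" for i
  unfolding P_def by (rule ubddD[OF assms(2) e(2,3), of "[i,i,i,i]"])
 then obtain C \<eta> k0 where P: "!!i. P i (C i) (\<eta> i) (k0 i)" by metis
 have C: "!!i. \<eta> i > 0" "!!i. C i > 0"
  "!!i k x ts. k >= k0 i ==> x \<in> K' ==> length ts = length [i,i,i,i] ==> grid_steps k (\<eta> i) ts ==>
    abs(dlts (zip [i,i,i,i] ts) (u k) x) <= C i * prod_list ts"
  using P unfolding P_def by blast+
 define C' where "C' = Max (range C)"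
 define \<eta>' where "\<eta>' = min (Min (range \<eta>)) (e / 2)"
 define k0' where "k0' = Max (range k0)"
 have C': "C' > 0" "C i <= C'" "\<eta>' > 0" "\<eta>' <= \<eta> i" "k0 i <= k0'" "\<eta>' <= e / 2" for i
  using C(1,2) e(1) by (auto simp: C'_def \<eta>'_def k0'_def Max_gr_iff min_le_iff_disj)
 obtain m where m: "!!k. k >= m ==> 1 / 2 ^ k <= \<eta>'" using pow2_small[OF C'(3)] by blast
 have "abs(4 ^ j * Dlap (1/2^j) (u k) x - 4 ^ k * Dlap (1/2^k) (u k) x) <= real CARD('n) * C' / 4 ^ j"
  if "j >= max m k0'" "k >= j" "x \<in> K" for j k x
 proof (rule Dlap_consistent[OF that(2)])
  fix l i assume l: "j < l" "l <= k"
  let ?s = "1 / 2 ^ l :: real"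
  have s: "?s <= \<eta>'" using m[of l] l that by simp
  have "x - (2 * ?s) *. i \<in> K'" using e(4)[OF that(3)] s C'(6) by (auto simp: subset_iff)
  moreover have "\<exists>a::nat. ?s = real a / 2 ^ k"
  proof (intro exI[of _ "2 ^ (k - l)"])
   have "(2::real) ^ k = 2 ^ l * 2 ^ (k - l)" using l by (simp flip: power_add)
   thus "?s = real (2 ^ (k - l)) / 2 ^ k" by simp
  qed
  ultimately have "abs(dlts (zip [i,i,i,i] [?s,?s,?s,?s]) (u k) (x - (2 * ?s) *. i)) <= C i * prod_list [?s,?s,?s,?s]"
   using C'(4)[of i] C'(5)[of i] s that by (intro C(3)) auto
  also have "... <= C' * ?s ^ 4" using C'(2)[of i]
   by (simp add: numeral_eq_Suc divide_right_mono)
  finally show "abs(dlts [(i,?s),(i,?s),(i,?s),(i,?s)] (u k) (x - (2 * ?s) *. i)) <= C' * ?s ^ 4" by simp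
 qed (use C' in auto)
 moreover have "real CARD('n) * C' > 0" using C'(1) by simp
 ultimately show ?thesis by blast
qed

text \<open>In the hypothesis on \<open>g\<close> the mesh shrinks together with the index, so the
  limit cannot be taken inside the second difference. The expression is first moved to a fixed
  coarser mesh \<open>j\<close> with error C/4^j independent of \<open>k\<close>; then
  \<open>k\<close> and afterwards \<open>j\<close> tend to infinity.\<close>

theorem ubdd_limit_laplacian:
 fixes u :: "nat => real^'n::finite => real"
 assumes "open U" "ubdd U u" and lim: "!!x. x \<in> U ==> (%k. u k x) \<longlonglongrightarrow> v x"
  and "continuous_on U v"
  and g: "!!x. x \<in> U ==> (%k. 4 ^ k * Dlap (1/2^k) (u k) x) \<longlonglongrightarrow> g x"
 shows "smooth_in U v" "!!x. x \<in> U ==> lap v x = g x"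
proof -
 show sm: "smooth_in U v"
  using dbdd_imp_smooth[OF assms(1,4)] ubdd_limit[OF assms(1-3)] by blast
 fix x assume x: "x \<in> U"
 obtain C j0 where C: "C > 0" "!!j k. j >= j0 ==> k >= j ==>
   abs(4 ^ j * Dlap (1/2^j) (u k) x - 4 ^ k * Dlap (1/2^k) (u k) x) <= C / 4 ^ j"
  using ubdd_consistent[OF assms(1,2), of "{x}"] x by auto
 obtain r where r: "r > 0" "cball x r \<subseteq> U" using `open U` open_contains_cball x by blast
 obtain m where m: "!!k. k >= m ==> 1 / 2 ^ k <= r" using pow2_small[OF r(1)] by blast
 have est: "abs(4 ^ j * Dlap (1/2^j) v x - g x) <= C / 4 ^ j" if "j >= max j0 m" for j
 proof -
  have inU: "x + (1/2^j) *. i \<in> U" "x - (1/2^j) *. i \<in> U" for i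
   using r(2) m[of j] that by (auto simp: subset_iff)
  have "(%k. abs(4 ^ j * Dlap (1/2^j) (u k) x - 4 ^ k * Dlap (1/2^k) (u k) x)) \<longlonglongrightarrow> abs(4 ^ j * Dlap (1/2^j) v x - g x)"
   unfolding Dlap_def[of "1/2^j"]
   by (intro tendsto_rabs tendsto_diff g x tendsto_mult tendsto_const tendsto_sum tendsto_add lim inU)
  thus ?thesis
   by (rule tendsto_upperbound) (use C(2) that in "auto simp: eventually_sequentially intro!: exI[of _ j]")
 qed
 show "lap v x = g x"
 proof (rule ccontr)
  assume ne: "lap v x ~= g x"
  define e where "e = abs(lap v x - g x) / 3"
  have e: "e > 0" using ne by (simp add: e_def)
  obtain h0 where h0: "h0 > 0" "!!h. 0 < h ==> h <= h0 ==> abs(Dlap h v x - h\<^sup>2 * lap v x) <= e * h^2"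
   using Dlap_laplacian[OF `open U` sm, of "{x}" e] x e by auto
  obtain m1 where m1: "!!k. k >= m1 ==> 1 / 2 ^ k <= h0" using pow2_small[OF h0(1)] by blast
  obtain m2 where m2: "!!k. k >= m2 ==> 1 / 2 ^ k <= e / C" using pow2_small[of "e / C"] e C(1) by auto
  define j where "j = max (max j0 m) (max m1 m2)"
  have four: "(4::real) ^ j = 2 ^ j * 2 ^ j" by (simp flip: power_mult_distrib)
  have "abs(4 ^ j * Dlap (1/2^j) v x - g x) <= C / 4 ^ j" by (rule est) (simp add: j_def)
  also have "C / 4 ^ j <= C * (1 / 2 ^ j)"
   unfolding four using C(1) by (simp add: divide_simps mult_le_cancel_left1)
  also have "... <= e" using m2[of j] C(1) by (simp add: j_def field_simps)
  finally have 1: "abs(4 ^ j * Dlap (1/2^j) v x - g x) <= e" .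
  have "abs(Dlap (1/2^j) v x - (1/2^j)\<^sup>2 * lap v x) <= e * (1/2^j)\<^sup>2"
   by (rule h0(2)) (use m1[of j] in "auto simp: j_def")
  hence "4 ^ j * abs(Dlap (1/2^j) v x - (1/2^j)\<^sup>2 * lap v x) <= 4 ^ j * (e * (1/2^j)\<^sup>2)"
   by (intro mult_left_mono) auto
  also have "4 ^ j * (e * (1/2^j)\<^sup>2) = e" unfolding four by (simp add: power2_eq_square)
  also have "4 ^ j * abs(Dlap (1/2^j) v x - (1/2^j)\<^sup>2 * lap v x) = abs(4 ^ j * Dlap (1/2^j) v x - lap v x)"
  proof -
   have "4 ^ j * Dlap (1/2^j) v x - lap v x = 4 ^ j * (Dlap (1/2^j) v x - (1/2^j)\<^sup>2 * lap v x)"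
    unfolding four by (simp add: power2_eq_square right_diff_distrib)
   thus ?thesis by (simp only: abs_mult) simp
  qed
  finally have "abs(4 ^ j * Dlap (1/2^j) v x - lap v x) <= e" .
  moreover have "abs(L - G) <= abs(X - L) + abs(X - G)" for X L G :: real by simp
  ultimately have "abs(lap v x - g x) <= e + e" using 1 by (meson add_mono order_trans)
  moreover have "abs(lap v x - g x) = 3 * e" by (simp add: e_def)
  ultimately show False using e by simp
 qed
qed

section \<open>Discrete interior estimates\<close>

text \<open>The points at distance at least \<delta> from the complement. Taking the open ball makes
  the set closed, hence compact when \<Omega> is bounded.\<close>

definition inner_part :: "(real^'n::finite) set => real => (real^'n) set" where
 "inner_part \<Omega> \<delta> = {x. ball x \<delta> \<subseteq> \<Omega>}"

lemma inner_part_subset: "\<delta> > 0 ==> inner_part \<Omega> \<delta> \<subseteq> \<Omega>"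
 by (auto simp: inner_part_def)

lemma compact_inner_part:
 assumes "bounded \<Omega>" "\<delta> > 0"
 shows "compact (inner_part \<Omega> \<delta>)"
proof -
 have "closed (inner_part \<Omega> \<delta>)"
  unfolding closed_sequential_limits
 proof (intro allI impI, elim conjE)
  fix X :: "nat => real^'a" and x assume X: "\<forall>n. X n \<in> inner_part \<Omega> \<delta>" "X \<longlonglongrightarrow> x"
  show "x \<in> inner_part \<Omega> \<delta>"
   unfolding inner_part_def
  proof (safe)
   fix y assume "y \<in> ball x \<delta>"
   hence "\<delta> - dist x y > 0" by simp
   then obtain n where "dist (X n) x < \<delta> - dist x y" using X(2) by (metis LIMSEQ_iff_nz dist_norm lim_sequentially order_refl)
   hence "y \<in> ball (X n) \<delta>" using dist_triangle[of "X n" y x] by simp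
   moreover have "ball (X n) \<delta> \<subseteq> \<Omega>" using X(1) by (simp add: inner_part_def)
   ultimately show "y \<in> \<Omega>" by blast
  qed
 qed
 moreover have "bounded (inner_part \<Omega> \<delta>)"
  by (rule bounded_subset[OF assms(1) inner_part_subset[OF assms(2)]])
 ultimately show ?thesis by (simp add: compact_eq_bounded_closed)
qed

lemma inner_part_shift:
 assumes "x \<in> inner_part \<Omega> \<delta>" "dist x y <= \<delta> - \<delta>'"
 shows "y \<in> inner_part \<Omega> \<delta>'"
proof -
 have "z \<in> ball x \<delta>" if "z \<in> ball y \<delta>'" for z
  using dist_triangle[of x z y] that assms(2) by simp
 thus ?thesis using assms(1) by (auto simp: inner_part_def)
qed

lemma compact_subset_inner_part:
 assumes "compact K" "open \<Omega>" "K \<subseteq> \<Omega>"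
 shows "\<exists>\<delta>>0. K \<subseteq> inner_part \<Omega> \<delta>"
proof -
 obtain e where "e > 0" "(\<Union>x\<in>K. ball x e) \<subseteq> \<Omega>"
  using compact_subset_open_imp_ball_epsilon_subset[OF assms] by blast
 thus ?thesis by (intro exI[of _ e]) (auto simp: inner_part_def)
qed

lemma dlts_cong:
 assumes "!!y. dist x y <= sum_list (map snd l) ==> f y = g y" "!!p. p \<in> set l ==> snd p >= 0"
 shows "dlts l f x = dlts l g x"
proof -
 have "(%k::nat. dlts l f x) \<longlonglongrightarrow> dlts l g x"
  by (rule dlts_tendsto[where q = "%_. f"]) (use assms in auto)
 thus ?thesis by (simp add: LIMSEQ_const_iff)
qed

lemma Dlap_dlt: "Dlap h (dlt i t f) = dlt i t (Dlap h f)"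
proof
 fix x
 have "Dlap h (dlt i t f) x = (\<Sum>j\<in>UNIV. (f (x + t *. i + h *. j) + f (x + t *. i - h *. j) - 2 * f (x + t *. i))
   - (f (x + h *. j) + f (x - h *. j) - 2 * f x))"
  unfolding Dlap_def dlt_def by (rule sum.cong) (auto simp: algebra_simps)
 thus "Dlap h (dlt i t f) x = dlt i t (Dlap h f) x"
  by (simp add: Dlap_def dlt_def sum_subtractf)
qed

lemma Dlap_dlts: "Dlap h (dlts l f) = dlts l (Dlap h f)"
 by (induction l arbitrary: f) (simp_all add: Dlap_dlt)

lemma dlts_multi:
 fixes f :: "real^'n::finite => real"
 assumes "h > 0"
  and "!!y. dist x y <= (\<Sum>p\<leftarrow>l. real (snd p) * h) ==> abs(dlts (map (%p. (fst p, h)) l) f y) <= B"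
 shows "abs(dlts (map (%p. (fst p, real (snd p) * h)) l) f x) <= B * (\<Prod>p\<leftarrow>l. real (snd p))"
 using assms(2)
proof (induction l arbitrary: f x)
 case (Cons p l)
 let ?i = "fst p" and ?a = "snd p" and ?l = "map (%p. (fst p, real (snd p) * h)) l"
 have s0: "(\<Sum>p\<leftarrow>l. real (snd p) * h) >= 0"
  using `h > 0` by (intro sum_list_nonneg) auto
 have bd: "abs(dlts ?l (dlt ?i h f) (x + (real b * h) *\<^sub>R ax ?i)) <= B * (\<Prod>p\<leftarrow>l. real (snd p))" if "b < ?a" for b
 proof (rule Cons.IH)
  fix y assume y: "dist (x + (real b * h) *\<^sub>R ax ?i) y <= (\<Sum>p\<leftarrow>l. real (snd p) * h)"
  have "dist x y <= real b * h + dist (x + (real b * h) *\<^sub>R ax ?i) y"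
   using dist_triangle[of x y "x + (real b * h) *\<^sub>R ax ?i"] `h > 0` by simp
  moreover have "real b * h <= real ?a * h" using that `h > 0` by simp
  ultimately show "abs(dlts (map (%p. (fst p, h)) l) (dlt ?i h f) y) <= B"
   using Cons.prems[of y] y by simp
 qed
 have "dlts ?l (dlt ?i (real ?a * h) f) x = dlt ?i (real ?a * h) (dlts ?l f) x" by (simp add: dlts_dlt)
 also have "... = (\<Sum>b<?a. dlts ?l f (x + (real (Suc b) * h) *\<^sub>R ax ?i) - dlts ?l f (x + (real b * h) *\<^sub>R ax ?i))"
  by (subst sum_lessThan_telescope) (simp add: dlt_def)
 also have "... = (\<Sum>b<?a. dlts ?l (dlt ?i h f) (x + (real b * h) *\<^sub>R ax ?i))"
  unfolding dlts_dlt by (rule sum.cong) (auto simp: dlt_def algebra_simps)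
 also have "abs(...) <= (\<Sum>b<?a. B * (\<Prod>p\<leftarrow>l. real (snd p)))"
  by (rule order_trans[OF sum_abs sum_mono]) (use bd in auto)
 finally show ?case by (simp add: algebra_simps)
qed simp

lemma pds_bounded:
 assumes "smooth_in U f" "compact K" "K \<subseteq> U"
 shows "\<exists>C>0. \<forall>x\<in>K. abs(pds is f x) <= C"
proof -
 have "continuous_on K (pds is f)"
  using smooth_in_continuous[OF smooth_in_pds[OF assms(1)]] assms(3) continuous_on_subset by blast
 hence "bounded (pds is f ` K)" using assms(2) compact_continuous_image compact_imp_bounded by blast
 then obtain C where "C > 0" "\<forall>y\<in>pds is f ` K. norm y <= C" unfolding bounded_pos by blast
 thus ?thesis by (intro exI[of _ C]) auto
qed

text \<open>Induction on the order. \<open>dlts\<close> commutes with \<open>Dlap\<close>, so a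
  difference of the solution solves the same equation with a difference of \<open>g\<close> on the
  right, and \<open>discrete_gradient\<close> gains one more factor \<open>h\<close> on a smaller
  set.\<close>

lemma discrete_interior:
 fixes U :: "real => real^'n::finite => real"
 assumes "open \<Omega>" "bounded \<Omega>" "smooth_in \<Omega> g"
  and eq: "!!h x. 0 < h ==> h <= 1 ==> x \<in> \<Omega> ==> Dlap h (U h) x = h^2 * g x"
  and bd: "!!h x. 0 < h ==> h <= 1 ==> x \<in> \<Omega> ==> abs(U h x) <= B"
  and "\<delta> > 0"
 shows "\<exists>C>0. \<exists>h0>0. \<forall>h x. 0 < h --> h <= h0 --> x \<in> inner_part \<Omega> \<delta> -->
      abs(dlts (map (%i. (i, h)) is) (U h) x) <= C * h ^ length is"
 using `\<delta> > 0`
proof (induction "is" arbitrary: \<delta>)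
 case Nil
 have "abs(U h x) <= abs(B) + 1" if "0 < h" "h <= 1" "x \<in> inner_part \<Omega> \<delta>" for h x
  using bd[OF that(1,2)] inner_part_subset[OF Nil] that(3) by fastforce
 thus ?case by (intro exI[of _ "abs(B) + 1"]) (auto intro!: exI[of _ 1])
next
 case (Cons i "is")
 let ?N = "real CARD('n)"
 have N: "?N >= 1" using zero_less_card_finite[where 'a='n] by linarith
 let ?l = "%h. map (%i. (i, h)) is" and ?n = "length is"
 have "\<delta> / 2 > 0" "\<delta> / 4 > 0" using Cons.prems by auto
 obtain C1 h1 where C1: "C1 > 0" "h1 > 0" "!!h x. 0 < h ==> h <= h1 ==> x \<in> inner_part \<Omega> (\<delta>/2) ==>
      abs(dlts (?l h) (U h) x) <= C1 * h ^ ?n"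
  using Cons.IH[OF `\<delta> / 2 > 0`] by auto
 obtain C2 where C2: "C2 > 0" "!!x. x \<in> inner_part \<Omega> (\<delta>/4) ==> abs(pds is g x) <= C2"
  using pds_bounded[OF assms(3) compact_inner_part[OF assms(2) `\<delta>/4 > 0`] inner_part_subset[OF `\<delta>/4 > 0`], of "is"]
  by auto
 \<comment> \<open>The cube of half side \<open>3 * d\<close> has l1-radius \<delta>/2 and so stays
   in the set of the induction hypothesis; \<open>h0\<close> keeps the sum of the steps below
   \<delta>/4 beyond that.\<close>
 define d where "d = \<delta> / (6 * ?N)"
 define h0 where "h0 = min (min h1 1) (min d (\<delta> / (4 * (real ?n + 1))))"
 have d: "d > 0" using Cons.prems N by (simp add: d_def)
 have h0: "h0 > 0" using C1 d Cons.prems by (simp add: h0_def add_nonneg_pos)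
 define C where "C = (4 * ?N + 1) * C1 / d + 2 * d * C2"
 have "C > 0" unfolding C_def using C1 C2 d N by (intro add_pos_pos divide_pos_pos mult_pos_pos) auto
 moreover have "abs(dlts (map (%i. (i, h)) (i # is)) (U h) x) <= C * h ^ length (i # is)"
  if h: "0 < h" "h <= h0" and x: "x \<in> inner_part \<Omega> \<delta>" for h x
 proof -
  have hle: "h <= h1" "h <= 1" "h <= d" "h <= \<delta> / (4 * (real ?n + 1))" using h(2) by (auto simp: h0_def)
  have sum: "sum_list (map snd (?l h)) <= \<delta> / 4"
  proof -
   have "sum_list (map snd (?l h)) = real ?n * h" by (simp add: sum_list_triv comp_def)
   also have "... <= (real ?n + 1) * (\<delta> / (4 * (real ?n + 1)))" using hle(4) h(1) by (intro mult_mono) auto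
   also have "... = \<delta> / 4"
   proof -
    have q: "c * (\<delta> / (4 * c)) = \<delta> / 4" if "c > 0" for c :: real using that by simp
    show ?thesis by (rule q) (simp add: add_nonneg_pos)
   qed
   finally show ?thesis .
  qed
  have "abs(dlts (?l h) (U h) (x + h *. i) - dlts (?l h) (U h) x)
    <= h * ((4 * ?N + 1) * (C1 * h ^ ?n) / d + 2 * d * (C2 * h ^ ?n))"
  proof (rule discrete_gradient[OF h(1) hle(3)])
   fix y assume y: "!!j. abs(y $ j - x $ j) <= 3 * d"
   have "dist x y <= (\<Sum>j\<in>UNIV. abs((y - x) $ j))" using norm_le_l1_cart[of "y - x"] by (simp add: dist_norm norm_minus_commute)
   also have "... <= (\<Sum>j\<in>(UNIV::'n set). 3 * d)" by (intro sum_mono) (use y in simp)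
   also have "... = \<delta> / 2" using N by (simp add: d_def)
   finally have y2: "y \<in> inner_part \<Omega> (\<delta>/2)" by (intro inner_part_shift[OF x]) simp
   have near: "z \<in> inner_part \<Omega> (\<delta>/4)" if "dist y z <= sum_list (map snd (?l h))" for z
    using that sum by (intro inner_part_shift[OF y2]) simp
   have "Dlap h (dlts (?l h) (U h)) y = dlts (?l h) (Dlap h (U h)) y" by (simp add: Dlap_dlts)
   also have "... = dlts (?l h) (%x. h\<^sup>2 * g x) y"
    by (rule dlts_cong) (use near inner_part_subset[OF `\<delta>/4 > 0`] h(1) hle(2) in "auto intro!: eq")
   also have "... = h^2 * dlts (?l h) g y" by (simp add: dlts_cmult)
   also have "abs(...) <= h^2 * (C2 * h ^ ?n)"
   proof -
    have "abs(dlts (?l h) g y) <= C2 * prod_list (map snd (?l h))"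
     by (rule dlts_bound[OF assms(3)])
       (use h(1) near C2(2) inner_part_subset[OF `\<delta>/4 > 0`] in "auto simp: comp_def")
    thus ?thesis by (simp add: abs_mult comp_def mult_left_mono map_replicate_const)
   qed
   finally show "abs(dlts (?l h) (U h) y) <= C1 * h ^ ?n & abs(Dlap h (dlts (?l h) (U h)) y) <= h^2 * (C2 * h ^ ?n)"
    using C1(3)[OF h(1) hle(1) y2] by simp
  qed (use C1 C2 h in auto)
  also have "... = C * h ^ length (i # is)" by (simp add: C_def algebra_simps add_divide_distrib)
  finally show ?thesis by (simp add: dlts_dlt dlt_def)
 qed
 ultimately show ?case using h0 by blast
qed

lemma discrete_ubdd:
 fixes U :: "real => real^'n::finite => real"
 assumes "open \<Omega>" "bounded \<Omega>" "smooth_in \<Omega> g"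
  and eq: "!!h x. 0 < h ==> h <= 1 ==> x \<in> \<Omega> ==> Dlap h (U h) x = h^2 * g x"
  and bd: "!!h x. 0 < h ==> h <= 1 ==> x \<in> \<Omega> ==> abs(U h x) <= B"
 shows "ubdd \<Omega> (%k. U (1/2^k))"
 unfolding ubdd_def
proof (intro allI impI, elim conjE)
 fix "is" :: "'n list" and K :: "(real^'n) set" assume K: "compact K" "K \<subseteq> \<Omega>"
 obtain \<delta> where \<delta>: "\<delta> > 0" "K \<subseteq> inner_part \<Omega> \<delta>" using compact_subset_inner_part[OF K(1) assms(1) K(2)] by blast
 have "\<delta> / 2 > 0" using \<delta> by simp
 obtain C h0 where C: "C > 0" "h0 > 0" "!!h x. 0 < h ==> h <= h0 ==> x \<in> inner_part \<Omega> (\<delta>/2) ==>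
      abs(dlts (map (%i. (i, h)) is) (U h) x) <= C * h ^ length is"
  using discrete_interior[OF assms(1-5) `\<delta> / 2 > 0`, of "is"] by auto
 obtain k0 where k0: "!!k. k >= k0 ==> 1 / 2 ^ k <= h0" using pow2_small[OF C(2)] by blast
 define \<eta> where "\<eta> = \<delta> / (2 * (real (length is) + 1))"
 have "abs(dlts (zip is ts) (U (1/2^k)) x) <= C * prod_list ts"
  if k: "k >= k0" and x: "x \<in> K" and ts: "length ts = length is"
   "\<forall>t\<in>set ts. 0 < t & t <= \<eta> & (\<exists>a::nat. t = real a / 2 ^ k)" for k x ts
 proof -
  define h :: real where "h = 1 / 2 ^ k"
  have h: "h > 0" "h <= h0" using k0[OF k] by (auto simp: h_def)
  define as where "as = map (%t. nat \<lfloor>t * 2 ^ k\<rfloor>) ts"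
  have ts_as: "ts = map (%a. real a * h) as"
   unfolding as_def map_map by (rule map_idI[symmetric]) (use ts(2) in "fastforce simp: h_def")
  define l where "l = zip is as"
  have len: "length as = length is" by (simp add: as_def ts(1))
  have z: "zip is ts = map (%p. (fst p, real (snd p) * h)) l"
   unfolding l_def by (subst ts_as) (simp add: zip_map2 case_prod_unfold)
  have m1: "map (%p. (fst p, h)) l = map (%i. (i, h)) is"
  proof -
   have "map (%p. (fst p, h)) l = map (%i. (i, h)) (map fst l)" by simp
   thus ?thesis using len by (simp add: l_def map_fst_zip)
  qed
  have m2: "map (%p. real (snd p) * h) l = ts"
  proof -
   have "map (%p. real (snd p) * h) l = map (%a. real a * h) (map snd l)" by simp
   thus ?thesis using len by (simp add: l_def map_snd_zip ts_as)
  qed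
  have "sum_list ts <= real (length ts) * \<eta>" using ts by (intro sum_list_le_length) auto
  also have "... <= (real (length is) + 1) * (\<delta> / (2 * (real (length is) + 1)))" unfolding ts(1)
   using \<delta>(1) by (intro mult_mono) (auto simp: \<eta>_def)
  also have "... = \<delta> / 2"
  proof -
   have q: "c * (\<delta> / (2 * c)) = \<delta> / 2" if "c > 0" for c :: real using that by simp
   show ?thesis by (rule q) (simp add: add_nonneg_pos)
  qed
  finally have sum: "sum_list ts <= \<delta> / 2" .
  have "abs(dlts (map (%p. (fst p, real (snd p) * h)) l) (U h) x) <= (C * h ^ length is) * (\<Prod>p\<leftarrow>l. real (snd p))"
  proof (rule dlts_multi[OF h(1)])
   fix y assume "dist x y <= (\<Sum>p\<leftarrow>l. real (snd p) * h)"
   hence "dist x y <= \<delta> - \<delta> / 2" using sum by (simp add: m2)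
   hence "y \<in> inner_part \<Omega> (\<delta>/2)" by (rule inner_part_shift[OF subsetD[OF \<delta>(2) x]])
   thus "abs(dlts (map (%p. (fst p, h)) l) (U h) y) <= C * h ^ length is"
    unfolding m1 using C(3) h by blast
  qed
  also have "... = C * prod_list ts"
  proof -
   have pl: "prod_list (map (%a. real a * h) xs) = h ^ length xs * (\<Prod>a\<leftarrow>xs. real a)" for xs :: "nat list"
    by (induction xs) auto
   have "(\<Prod>p\<leftarrow>l. real (snd p)) = (\<Prod>a\<leftarrow>map snd l. real a)" by (simp add: comp_def)
   also have "map snd l = as" using len by (simp add: l_def map_snd_zip)
   finally show ?thesis by (subst ts_as) (simp add: pl len)
  qed
  finally show ?thesis by (simp add: z h_def)
 qed
 thus "\<exists>C \<eta> k0. \<eta> > 0 & C > 0 \<and>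
   (\<forall>k\<ge>k0. \<forall>x\<in>K. \<forall>ts. length ts = length is --> grid_steps k \<eta> ts -->
    abs(dlts (zip is ts) (U (1/2^k)) x) <= C * prod_list ts)"
  using C(1) \<delta>(1) by (intro exI[of _ C] exI[of _ \<eta>] exI[of _ k0]) (auto simp: \<eta>_def)
qed

text \<open>Comparison with a paraboloid, two-sided: an error \<open>e\<close> outside
  \<open>D\<close> plus a defect \<omega> of the equation inside. It is meant for differences of
  grid functions, taken between two meshes or between two translates.\<close>

lemma Dlap_bound:
 fixes w :: "real^'n::finite => real"
 assumes "0 < h" "h <= 1" and R: "!!x. x \<in> D ==> norm x + 1 <= R"
  and lap: "!!x. x \<in> D ==> abs(Dlap h w x) <= h^2 * \<omega>"
  and out: "!!y. y \<notin> D ==> abs(w y) <= e" and bd: "!!x. x \<in> D ==> abs(w x) <= M"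
  and "\<omega> >= 0"
 shows "abs(w x) <= e + \<omega> * R^2 | D = {}"
proof -
 let ?N = "real CARD('n)"
 have N: "?N >= 1" using zero_less_card_finite[where 'a='n] by linarith
 have one: "v x <= e + \<omega> * R^2" if v: "v = w | v = (%x. - w x)" and x: "x \<in> D" for v x
 proof -
  define c where "c = \<omega> / (2 * ?N)"
  have c: "c >= 0" using `\<omega> >= 0` N by (simp add: c_def)
  define z where "z y = v y + (c * (y \<bullet> y) - (e + c * R^2))" for y
  have Dv: "Dlap h v y >= - (h^2 * \<omega>)" if "y \<in> D" for y
   using v lap[OF that] Dlap_minus[of h w y] by auto
  have sq: "y \<bullet> y <= R^2" if "norm y <= R" for y :: "real^'n"
   using power_mono[OF that, of 2] by (simp add: power2_norm_eq_inner)
  have bdd: "bounded D" using R by (intro boundedI[of _ R]) (smt (verit))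
  have "z x <= 0"
  proof (rule Dlap_comparison[OF `0 < h` bdd _ _ _ x])
   fix y assume y: "y \<in> D"
   have "Dlap h z y = Dlap h v y + c * (2 * ?N * h^2)"
    unfolding z_def Dlap_add Dlap_diff Dlap_cmult using Dlap_sq[of h 0 y] by simp
   also have "c * (2 * ?N * h^2) = h^2 * \<omega>" using N by (simp add: c_def)
   finally show "Dlap h z y >= 0" using Dv[OF y] by simp
  next
   fix a y assume a: "a \<in> D" and y: "y \<notin> D" and d: "dist a y <= h"
   have "norm y <= R" using R[OF a] d `h <= 1` norm_triangle_sub[of y a] by (simp add: dist_norm norm_minus_commute)
   hence "c * (y \<bullet> y) <= c * R^2" using c sq by (intro mult_left_mono) auto
   moreover have "v y <= e" using v out[OF y] by auto
   ultimately show "z y <= 0" by (simp add: z_def)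
  next
   fix y assume y: "y \<in> D"
   have "norm y <= R" using R[OF y] by simp
   hence "c * (y \<bullet> y) <= c * R^2" using c sq by (intro mult_left_mono) auto
   moreover have "v y <= M" using v bd[OF y] by auto
   ultimately show "z y <= M - e" by (simp add: z_def)
  qed
  hence "v x <= e + c * R^2 - c * (x \<bullet> x)" by (simp add: z_def)
  also have "... <= e + c * R^2" using c by simp
  also have "... <= e + \<omega> * R^2"
  proof -
   have "1 <= 2 * ?N" using N by linarith
   hence "\<omega> / (2 * ?N) <= \<omega> / 1" using `\<omega> >= 0` by (intro divide_left_mono) auto
   hence "c <= \<omega>" by (simp add: c_def)
   thus ?thesis by (simp add: mult_right_mono)
  qed
  finally show ?thesis .
 qed
 show ?thesis
 proof (cases "x \<in> D")
  case True
  thus ?thesis using one[of w x] one[of "%x. - w x" x] by auto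
 next
  case False
  thus ?thesis using out[OF False] `\<omega> >= 0` by (auto intro: order_trans)
 qed
qed

section \<open>Boundary barriers\<close>

text \<open>
 Local defining functions, with the domain on the positive side.
\<close>

definition ldf :: "(real^'n::finite) set => real^'n => (real^'n) set => (real^'n => real) => bool" where
 "ldf \<Omega> p U s \<longleftrightarrow> open U & p \<in> U & smooth_in U s & \<Omega> \<inter> U = {x\<in>U. s x > 0} & s p = 0
   & (\<exists>i. pd i s p ~= 0)"

lemma smooth_fun_on_open:
 assumes "open U" "smooth_fun_on U \<rho>"
 shows "smooth_in U \<rho>"
proof (rule smooth_in_local)
 fix x assume "x \<in> U"
 then obtain V h where V: "open V" "x \<in> V" "\<forall>k. C_k_on k V h" "\<forall>y\<in>V \<inter> U. h y = \<rho> y"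
  using assms(2) unfolding smooth_fun_on_def by blast
 have "smooth_in (V \<inter> U) h" by (rule smooth_in_subset[of V]) (use V(3) in "auto simp: smooth_in_def")
 hence "smooth_in (V \<inter> U) \<rho>" using smooth_in_cong[of "V \<inter> U" h \<rho>] V assms(1) by auto
 thus "\<exists>V. open V & x \<in> V & smooth_in V \<rho>"
  using V `x \<in> U` assms(1) by (intro exI[of _ "V \<inter> U"]) auto
qed

text \<open>Apart from the change of sign, the point is that \<rho> vanishes at \<open>p\<close>: it
  is not negative there because \<open>p\<close> lies outside \<Omega>, and not positive because
  points of \<Omega> accumulate at \<open>p\<close>.\<close>

lemma ldf_exists:
 assumes "bounded_smooth_domain \<Omega>" "p \<in> frontier \<Omega>"
 shows "\<exists>U s. ldf \<Omega> p U s"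
proof -
 have op: "open \<Omega>" using assms(1) by (simp add: bounded_smooth_domain_def)
 have "smooth_boundary \<Omega>" using assms(1) by (simp add: bounded_smooth_domain_def)
 from this[unfolded smooth_boundary_def, THEN bspec, OF assms(2)]
 obtain U \<rho> where U0: "open U & p \<in> U & smooth_fun_on U \<rho> & (\<exists>i. pd i \<rho> p ~= 0) & \<Omega> \<inter> U = {x\<in>U. \<rho> x < 0}"
  by (elim exE)
 then obtain i where U: "open U" "p \<in> U" "smooth_fun_on U \<rho>" "pd i \<rho> p ~= 0"
   "\<Omega> \<inter> U = {x\<in>U. \<rho> x < 0}"
  by (elim conjE exE)
 have sm: "smooth_in U \<rho>" by (rule smooth_fun_on_open[OF U(1,3)])
 have "p \<notin> \<Omega>" "p \<in> closure \<Omega>" using assms(2) op by (auto simp: frontier_def interior_open)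
 have cont: "isCont \<rho> p" using smooth_in_continuous[OF sm] U by (simp add: continuous_on_eq_continuous_at)
 have "\<rho> p = 0"
 proof (rule ccontr)
  assume "\<rho> p ~= 0"
  hence "\<rho> p > 0" using `p \<notin> \<Omega>` U(2,5) by fastforce
  then obtain d where d: "d > 0" "!!y. dist y p < d ==> dist (\<rho> y) (\<rho> p) < \<rho> p"
   using cont by (metis continuous_at_eps_delta)
  have "open (ball p d \<inter> U)" "p \<in> ball p d \<inter> U" using U d by auto
  hence "(ball p d \<inter> U) \<inter> \<Omega> ~= {}"
   using open_Int_closure_eq_empty[of "ball p d \<inter> U" \<Omega>] `p \<in> closure \<Omega>` by blast
  then obtain y where y: "y \<in> \<Omega>" "y \<in> ball p d \<inter> U" by blast
  hence "\<rho> y < 0" using U(5) by blast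
  thus False using d(2)[of y] y by (auto simp: dist_commute dist_real_def)
 qed
 moreover have "smooth_in U (%x. - \<rho> x)" using smooth_in_minus[OF U(1) sm] .
 moreover have "pd i (%x. - \<rho> x) p ~= 0"
  using pd_minus[OF smooth_in_diff[OF sm U(2)], of i] U(4) by simp
 ultimately have "ldf \<Omega> p U (%x. - \<rho> x)" unfolding ldf_def using U by auto
 thus ?thesis by blast
qed

lemma smooth_lipschitz:
 fixes f :: "real^'n::finite => real"
 assumes "smooth_in U f" "cball p r \<subseteq> U"
 shows "\<exists>L>0. \<forall>x\<in>cball p r. \<forall>y\<in>cball p r. abs(f x - f y) <= L * dist x y"
proof -
 have "\<exists>C>0. \<forall>x\<in>cball p r. abs(pd i f x) <= C" for i
  using pds_bounded[OF assms(1) compact_cball assms(2), of "[i]"] by simp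
 then obtain C where C: "!!i. C i > 0" "!!i x. x \<in> cball p r ==> abs(pd i f x) <= C i" by metis
 define L where "L = (\<Sum>i\<in>UNIV. C i)"
 have "norm (f x - f y) <= L * norm (x - y)" if "x \<in> cball p r" "y \<in> cball p r" for x y
 proof (rule differentiable_bound[OF convex_cball _ _ that])
  fix z assume z: "z \<in> cball p r"
  hence "f differentiable (at z)" using assms smooth_in_diff by blast
  thus "(f has_derivative (%v. \<Sum>i\<in>UNIV. v $ i * pd i f z)) (at z within cball p r)"
   by (rule has_derivative_at_withinI[OF has_derivative_pd])
  show "onorm (%v. \<Sum>i\<in>UNIV. v $ i * pd i f z) <= L"
  proof (rule onorm_le)
   fix v :: "real^'n"
   have "norm (\<Sum>i\<in>UNIV. v $ i * pd i f z) <= (\<Sum>i\<in>UNIV. norm v * C i)"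
    by (rule order_trans[OF norm_sum sum_mono])
      (auto simp: abs_mult component_le_norm_cart intro!: mult_mono C(2)[OF z])
   also have "... = L * norm v" by (simp add: L_def sum_distrib_left mult.commute)
   finally show "norm (\<Sum>i\<in>UNIV. v $ i * pd i f z) <= L * norm v" .
  qed
 qed
 moreover have "L > 0" unfolding L_def using C(1) by (intro sum_pos) auto
 ultimately show ?thesis by (intro exI[of _ L]) (auto simp: dist_norm)
qed

lemma laplacian_compose:
 fixes s :: "real^'n::finite => real"
 assumes "open U" "smooth_in U s" "x \<in> U"
  and F: "!!y. y \<in> U ==> (F has_real_derivative F' (s y)) (at (s y))"
  and F': "(F' has_real_derivative F'') (at (s x))"
 shows "lap (%x. F (s x)) x = F' (s x) * lap s x + F'' * (\<Sum>i\<in>UNIV. (pd i s x)\<^sup>2)"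
proof -
 have "pd i (pd i (%x. F (s x))) x
   = F' (s x) * pd i (pd i s) x + F'' * (pd i s x)\<^sup>2" for i
 proof -
  have "pd i (pd i (%x. F (s x))) x = pd i (%x. F' (s x) * pd i s x) x"
   by (rule pd_cong[OF assms(1,3)])
     (rule pd_compose_real(1)[OF F smooth_in_diff[OF assms(2)]])
  also have "... = (F'' * pd i s x) * pd i s x + F' (s x) * pd i (pd i s) x"
   using pd_mult[OF pd_compose_real(2)[OF F' smooth_in_diff[OF assms(2,3)]]
     smooth_in_diff[OF smooth_in_pd[OF assms(2)] assms(3)], of i i]
    pd_compose_real(1)[OF F' smooth_in_diff[OF assms(2,3)], of i] by simp
  finally show ?thesis by (simp add: power2_eq_square)
 qed
 thus ?thesis by (simp add: lap_def sum.distrib sum_distrib_left)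
qed

definition grad2 :: "(real^'n::finite => real) => real^'n => real" where
 "grad2 s x = (\<Sum>i\<in>UNIV. (pd i s x)\<^sup>2)"

lemma smooth_in_laplacian: "open U ==> smooth_in U f ==> smooth_in U (lap f)"
 unfolding lap_def[abs_def] by (intro smooth_in_sum smooth_in_pd)

lemma smooth_in_grad2: "open U ==> smooth_in U f ==> smooth_in U (grad2 f)"
 unfolding grad2_def[abs_def] power2_eq_square by (intro smooth_in_sum smooth_in_mult smooth_in_pd)

lemma ldf_nbhd:
 assumes "ldf \<Omega> p U s" "e > 0"
 shows "\<exists>r>0. \<exists>c>0. \<exists>S>0. cball p r \<subseteq> U & (\<forall>x\<in>cball p r. c <= grad2 s x & abs(lap s x) <= S)"
  and "\<exists>r>0. cball p r \<subseteq> U & (\<forall>x\<in>cball p r. abs(s x) <= e)"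
proof -
 have U: "open U" "p \<in> U" "smooth_in U s" "s p = 0" using assms(1) by (auto simp: ldf_def)
 obtain i where i: "pd i s p ~= 0" using assms(1) by (auto simp: ldf_def)
 obtain r0 where r0: "r0 > 0" "cball p r0 \<subseteq> U" using U open_contains_cball by blast
 have "(pd i s p)\<^sup>2 <= grad2 s p" unfolding grad2_def by (intro member_le_sum) auto
 hence g: "grad2 s p > 0" using i by (smt (z3) zero_less_power2)
 have "isCont (grad2 s) p" "isCont s p"
  using smooth_in_continuous[OF smooth_in_grad2[OF U(1,3)]] smooth_in_continuous[OF U(3)] U(1,2)
  by (auto simp: continuous_on_eq_continuous_at)
 then obtain d1 d2 where d: "d1 > 0" "!!y. dist y p < d1 ==> dist (grad2 s y) (grad2 s p) < grad2 s p / 2"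
   "d2 > 0" "!!y. dist y p < d2 ==> dist (s y) (s p) < e"
  using g assms(2) by (metis continuous_at_eps_delta half_gt_zero)
 have "continuous_on (cball p r0) (lap s)"
  using smooth_in_continuous[OF smooth_in_laplacian[OF U(1,3)]] r0(2) continuous_on_subset by blast
 hence "bounded (lap s ` cball p r0)" using compact_continuous_image compact_cball compact_imp_bounded by blast
 then obtain S where S: "S > 0" "\<forall>y\<in>lap s ` cball p r0. norm y <= S" unfolding bounded_pos by blast
 define r where "r = min r0 (d1 / 2)"
 have r: "r > 0" "cball p r \<subseteq> cball p r0" using r0 d by (auto simp: r_def)
 have "grad2 s p / 2 <= grad2 s x & abs(lap s x) <= S" if x: "x \<in> cball p r" for x
 proof
  have "dist (grad2 s x) (grad2 s p) < grad2 s p / 2" using x d(1) by (intro d(2)) (auto simp: r_def dist_commute)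
  thus "grad2 s p / 2 <= grad2 s x" by (simp add: dist_real_def abs_if split: if_splits)
  show "abs(lap s x) <= S" using x r(2) S(2) by auto
 qed
 thus "\<exists>r>0. \<exists>c>0. \<exists>S>0. cball p r \<subseteq> U & (\<forall>x\<in>cball p r. c <= grad2 s x & abs(lap s x) <= S)"
  using r r0(2) S(1) g by (intro exI[of _ r] conjI exI[of _ "grad2 s p / 2"] exI[of _ S]) auto
 have "abs(s x) <= e" if "x \<in> cball p (min r0 (d2/2))" for x
  using d(3) d(4)[of x] that U(4) by (auto simp: dist_commute dist_real_def intro: less_imp_le)
 thus "\<exists>r>0. cball p r \<subseteq> U & (\<forall>x\<in>cball p r. abs(s x) <= e)"
  using r0 d(3) by (intro exI[of _ "min r0 (d2/2)"]) auto
qed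

text \<open>The Laplacian of \<open>s - K * s^2\<close> contains -2K|grad s|^2, and the gradient
  stays away from zero near \<open>p\<close>; \<open>K\<close> is chosen to beat the bound
  \<open>S\<close> for the Laplacian of \<open>s\<close>. Keeping \<open>K * abs(s x)\<close> below
  1/2 makes the barrier comparable with \<open>s\<close>.\<close>

lemma local_barrier:
 assumes "ldf \<Omega> p U s"
 shows "\<exists>K>0. \<exists>r>0. cball p r \<subseteq> U & smooth_in U (%x. s x - K * (s x)\<^sup>2) \<and>
      (\<forall>x\<in>cball p r. lap (%x. s x - K * (s x)\<^sup>2) x <= -1 & K * abs(s x) <= 1/2)"
proof -
 have U: "open U" "p \<in> U" "smooth_in U s" "s p = 0" using assms(1) by (auto simp: ldf_def)
 obtain r1 c S where r1: "r1 > 0" "c > 0" "S > 0" "cball p r1 \<subseteq> U"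
   "!!x. x \<in> cball p r1 ==> c <= grad2 s x & abs(lap s x) <= S"
  using ldf_nbhd(1)[OF assms zero_less_one] by auto
 define K where "K = (S + 1) / c"
 have K: "K > 0" using r1 by (simp add: K_def)
 define e where "e = min (1 / (2 * K)) (1 / (2 * K * S))"
 have e: "e > 0" using K r1 by (simp add: e_def)
 obtain r2 where r2: "r2 > 0" "!!x. x \<in> cball p r2 ==> abs(s x) <= e" using ldf_nbhd(2)[OF assms e] by auto
 have "lap (%x. s x - K * (s x)\<^sup>2) x <= -1 & K * abs(s x) <= 1/2" if x: "x \<in> cball p (min r1 r2)" for x
 proof
  have x1: "x \<in> cball p r1" "x \<in> U" and x2: "abs(s x) <= e" using x r1(4) r2(2)[of x] by auto
  have "lap (%x. s x - K * (s x)\<^sup>2) x = (1 - 2 * K * s x) * lap s x + (- 2 * K) * grad2 s x"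
   unfolding grad2_def
   by (rule laplacian_compose[OF U(1,3) x1(2), where F = "%t. t - K * t^2" and F' = "%t. 1 - 2 * K * t"])
     (auto intro!: derivative_eq_intros)
  also have "... = lap s x - 2 * K * (s x * lap s x) - 2 * (K * grad2 s x)" by (simp add: algebra_simps)
  also have "... <= S + 1 - 2 * (S + 1)"
  proof -
   have "abs(s x * lap s x) <= (1 / (2 * K * S)) * S"
    unfolding abs_mult using r1(5)[OF x1(1)] x2 K r1(3) by (intro mult_mono) (auto simp: e_def)
   hence "(2 * K) * abs(s x * lap s x) <= (2 * K) * ((1 / (2 * K * S)) * S)"
    using K by (intro mult_left_mono) auto
   also have "... = 1" using K r1(3) by simp
   finally have "(2 * K) * abs(s x * lap s x) <= 1" .
   moreover have "(2 * K) * (- (s x * lap s x)) <= (2 * K) * abs(s x * lap s x)"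
    using K by (intro mult_left_mono abs_ge_minus_self) auto
   ultimately have "- (2 * K * (s x * lap s x)) <= 1" by simp
   moreover have "K * grad2 s x >= K * c" using r1(5)[OF x1(1)] K by (intro mult_left_mono) auto
   moreover have "K * c = S + 1" using r1(2) by (simp add: K_def)
   moreover have "lap s x <= S" using r1(5)[OF x1(1)] by auto
   moreover have "L - X - 2 * Y <= S + 1 - 2 * (S + 1)" if "- X <= 1" "S + 1 <= Y" "L <= S" for X Y L :: real
    using that by argo
   ultimately show ?thesis by simp
  qed
  also have "... <= -1" using r1(3) by simp
  finally show "lap (%x. s x - K * (s x)\<^sup>2) x <= -1" .
  have "K * abs(s x) <= K * (1 / (2 * K))" using x2 K by (intro mult_left_mono) (auto simp: e_def)
  thus "K * abs(s x) <= 1/2" using K by simp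
 qed
 moreover have "smooth_in U (%x. s x - K * (s x)\<^sup>2)"
  unfolding power2_eq_square using U by (intro smooth_in_diff_fun smooth_in_mult) auto
 ultimately show ?thesis using K r1(1,4) r2(1)
  by (intro exI[of _ K] conjI exI[of _ "min r1 r2"]) auto
qed

definition dsol :: "(real^'n::finite) set => real => real => real => (real^'n => real) => bool" where
 "dsol \<Omega> h G B u \<longleftrightarrow> (\<forall>x\<in>\<Omega>. abs(Dlap h u x) <= h^2 * G) & (\<forall>x\<in>\<Omega>. abs(u x) <= B) & (\<forall>x. x \<notin> \<Omega> --> u x = 0)"

lemma dsol_minus: "dsol \<Omega> h G B u ==> dsol \<Omega> h G B (%x. - u x)"
 by (auto simp: dsol_def Dlap_minus)

lemma discrete_boundary_local:
 fixes s :: "real^'n::finite => real"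
 assumes ldf: "ldf \<Omega> p U s" and "bounded \<Omega>" "G >= 0" "B > 0"
 shows "\<exists>r>0. \<exists>A>0. \<exists>h0>0. ball p r \<subseteq> U & (\<forall>h u x. 0 < h --> h <= h0 --> dsol \<Omega> h G B u --> x \<in> \<Omega> --> x \<in> ball p r -->
      abs(u x) <= A * s x + A * h)"
proof -
 let ?N = "real CARD('n)"
 have U: "open U" "p \<in> U" "smooth_in U s" "s p = 0" "\<Omega> \<inter> U = {x\<in>U. s x > 0}" using ldf by (auto simp: ldf_def)
 obtain K r1 where K: "K > 0" "r1 > 0" "cball p r1 \<subseteq> U" "smooth_in U (%x. s x - K * (s x)\<^sup>2)"
   "!!x. x \<in> cball p r1 ==> lap (%x. s x - K * (s x)\<^sup>2) x <= -1 & K * abs(s x) <= 1/2"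
  using local_barrier[OF ldf] by blast
 define \<zeta> where "\<zeta> x = s x - K * (s x)\<^sup>2" for x
 have z: "\<zeta> x <= s x" "s x >= 0 ==> \<zeta> x >= 0" "s x <= 0 ==> \<zeta> x >= - 2 * abs(s x)" if "x \<in> cball p r1" for x
 proof -
  have "K * (s x)\<^sup>2 = (K * abs(s x)) * abs(s x)" by (simp add: power2_eq_square)
  also have "... <= 1/2 * abs(s x)" using K(5)[OF that] by (intro mult_right_mono) auto
  finally have "K * (s x)\<^sup>2 <= 1/2 * abs(s x)" .
  thus "\<zeta> x <= s x" "s x >= 0 ==> \<zeta> x >= 0" "s x <= 0 ==> \<zeta> x >= - 2 * abs(s x)"
   using K(1) by (auto simp: \<zeta>_def)
 qed
 obtain h1 where h1: "h1 > 0" "!!h x. 0 < h ==> h <= h1 ==> x \<in> cball p r1 ==> abs(Dlap h \<zeta> x - h\<^sup>2 * lap \<zeta> x) <= 1/2 * h^2"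
  using Dlap_laplacian[OF U(1) _ compact_cball K(3), of \<zeta> "1/2"] K(4) unfolding \<zeta>_def[abs_def] by auto
 have Dz: "Dlap h \<zeta> x <= - (h^2 / 2)" if "0 < h" "h <= h1" "x \<in> cball p r1" for h x
 proof -
  have "lap \<zeta> x <= -1" using K(5)[OF that(3)] by (simp add: \<zeta>_def[abs_def])
  hence "h^2 * lap \<zeta> x <= h^2 * (-1)" by (intro mult_left_mono) auto
  moreover have "Dlap h \<zeta> x - h\<^sup>2 * lap \<zeta> x <= 1/2 * h^2" by (rule abs_le_D1[OF h1(2)[OF that]])
  ultimately show ?thesis by linarith
 qed
 obtain L where L: "L > 0" "!!x y. x \<in> cball p r1 ==> y \<in> cball p r1 ==> abs(s x - s y) <= L * dist x y"
  using smooth_lipschitz[OF U(3) K(3)] by blast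
 define r where "r = r1 / 3"
 have r: "r > 0" using K by (simp add: r_def)
 \<comment> \<open>The comparison function is \<open>A * \<zeta>\<close>, plus \<open>q\<close>
   times the squared distance to the evaluation point \<open>x0\<close>, which reaches
   \<open>B\<close> at distance \<open>r\<close>, plus \<open>2 * A * L * h\<close>. The last term
   is needed because a neighbour outside \<Omega> may have \<open>s\<close> as low as
   \<open>- L * h\<close>.\<close>
 define q where "q = B / r^2"
 have q: "q > 0" using `B > 0` r by (simp add: q_def)
 define A where "A = 2 * (2 * ?N * q + G)"
 have A: "A > 0" using q `G >= 0` by (simp add: A_def add_pos_nonneg)
 define h0 where "h0 = min h1 r"
 have h0: "h0 > 0" using h1 r by (simp add: h0_def)
 have main: "u x0 <= A * s x0 + 2 * A * L * h"
  if h: "0 < h" "h <= h0" and u: "dsol \<Omega> h G B u" and x0: "x0 \<in> \<Omega>" "x0 \<in> ball p r" for h u x0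
 proof -
  define D where "D = \<Omega> \<inter> ball x0 r"
  define w where "w y = u y - (A * \<zeta> y + q * ((y - x0) \<bullet> (y - x0)) + 2 * A * L * h)" for y
  have near: "y \<in> cball p r1" if "dist x0 y <= 2 * r" for y
   using dist_triangle[of p y x0] that x0(2) by (simp add: r_def)
  have c0: "2 * A * L * h >= 0" using A L h by simp
  have "w x0 <= 0"
  proof (rule Dlap_comparison[OF h(1)])
   show "bounded D" using `bounded \<Omega>` by (simp add: D_def bounded_Int)
   show "x0 \<in> D" using x0 r by (simp add: D_def)
   fix x assume x: "x \<in> D"
   hence x1: "x \<in> cball p r1" "x \<in> \<Omega>" using near[of x] r by (auto simp: D_def)
   have s0: "s x > 0" using x1 K(3) U(5) by blast
   have "Dlap h w x = Dlap h u x - (A * Dlap h \<zeta> x + q * (2 * ?N * h^2))"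
    unfolding w_def Dlap_diff Dlap_add Dlap_cmult Dlap_sq by simp
   moreover have "A * Dlap h \<zeta> x <= A * (- (h^2 / 2))" using Dz[of h x] h x1 A by (intro mult_left_mono) (auto simp: h0_def)
   moreover have "A * (- (h^2 / 2)) = - (2 * ?N * q * h^2) - h\<^sup>2 * G" by (simp add: A_def algebra_simps)
   moreover have "Dlap h u x >= - (h^2 * G)" using u x1(2) by (fastforce simp: dsol_def)
   ultimately show "0 <= Dlap h w x" by (simp add: algebra_simps)
   show "w x <= B"
   proof -
    have "A * \<zeta> x >= 0" using z(2)[OF x1(1)] s0 A by simp
    moreover have "q * ((x - x0) \<bullet> (x - x0)) >= 0" using q by simp
    moreover have "u x <= B" using u x1(2) by (fastforce simp: dsol_def)
    ultimately show ?thesis using c0 by (simp add: w_def)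
   qed
   fix y assume y: "y \<notin> D" "dist x y <= h"
   have "dist x0 y <= 2 * r" using dist_triangle[of x0 y x] x y h by (simp add: D_def h0_def)
   hence y1: "y \<in> cball p r1" by (rule near)
   have qy: "q * ((y - x0) \<bullet> (y - x0)) >= 0" using q by simp
   show "w y <= 0"
   proof (cases "y \<in> \<Omega>")
    case False
    hence "s y <= 0" using y1 K(3) U(5) by fastforce
    moreover have "abs(s x - s y) <= L * h"
     by (rule order_trans[OF L(2)[OF x1(1) y1] mult_left_mono]) (use y(2) L(1) in auto)
    ultimately have "abs(s y) <= L * h" using s0 by linarith
    hence "\<zeta> y >= - 2 * (L * h)" using z(3)[OF y1 `s y <= 0`] by linarith
    hence "A * \<zeta> y >= A * (- 2 * (L * h))" using A by (intro mult_left_mono) auto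
    moreover have "u y = 0" using u False by (simp add: dsol_def)
    ultimately show ?thesis using qy by (simp add: w_def algebra_simps)
   next
    case True
    hence "s y > 0" using y1 K(3) U(5) by blast
    hence "A * \<zeta> y >= 0" using z(2)[OF y1] A by simp
    moreover have "q * ((y - x0) \<bullet> (y - x0)) >= B"
    proof -
     have "r <= norm (y - x0)" using True y(1) by (simp add: D_def dist_norm norm_minus_commute)
     hence "r^2 <= (y - x0) \<bullet> (y - x0)" using power_mono[of r "norm (y - x0)" 2] r by (simp add: power2_norm_eq_inner)
     hence "q * r^2 <= q * ((y - x0) \<bullet> (y - x0))" using q by simp
     thus ?thesis using r by (simp add: q_def)
    qed
    moreover have "u y <= B" using u True by (fastforce simp: dsol_def)
    ultimately show ?thesis using c0 by (simp add: w_def)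
   qed
  qed
  hence "u x0 <= A * \<zeta> x0 + 2 * A * L * h" by (simp add: w_def)
  moreover have "\<zeta> x0 <= s x0" using z(1)[OF near[of x0]] r by simp
  hence "A * \<zeta> x0 <= A * s x0" using A by simp
  ultimately show ?thesis by linarith
 qed
 define A' where "A' = A + 2 * A * L"
 have "abs(u x) <= A' * s x + A' * h"
  if h: "0 < h" "h <= h0" and u: "dsol \<Omega> h G B u" and x: "x \<in> \<Omega>" "x \<in> ball p r" for h u x
 proof -
  have "x \<in> cball p r1" using x(2) K(2) by (simp add: r_def)
  hence "s x > 0" using x K(3) U(5) by blast
  have "abs(u x) <= A * s x + 2 * A * L * h"
   using main[OF h u x] main[OF h dsol_minus[OF u] x] by simp
  also have "... <= A' * s x + A' * h"
   using A L h(1) `s x > 0` by (simp add: A'_def algebra_simps)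
  finally show ?thesis .
 qed
 moreover have "ball p r \<subseteq> U" using K(2,3) by (auto simp: r_def subset_iff)
 moreover have "A' > 0" using A L by (simp add: A'_def add_pos_pos)
 ultimately show ?thesis using r h0 by blast
qed

text \<open>Compactness of the boundary: finitely many of the balls cover a whole layer of \<Omega>
  along it, which makes local boundary estimates uniform.\<close>

lemma frontier_inner_part:
 assumes "open \<Omega>" "bounded \<Omega>" "!!p. p \<in> frontier \<Omega> ==> r p > 0"
 shows "\<exists>\<delta>>0. \<exists>C. finite C & C \<subseteq> frontier \<Omega> & \<Omega> - inner_part \<Omega> \<delta> \<subseteq> (\<Union>p\<in>C. ball p (r p))"
proof -
 have "compact (frontier \<Omega>)" using assms(2) compact_frontier_bounded by blast
 then obtain C where C: "C \<subseteq> frontier \<Omega>" "finite C" "frontier \<Omega> \<subseteq> (\<Union>p\<in>C. ball p (r p))"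
  by (rule compactE_image[where C = "frontier \<Omega>" and f = "%p. ball p (r p)"]) (use assms(3) in auto)
 define K where "K = closure \<Omega> - (\<Union>p\<in>C. ball p (r p))"
 have "compact K" unfolding K_def using assms(2) by (intro compact_diff) auto
 moreover have "K \<subseteq> \<Omega>"
  using C(3) assms(1) by (auto simp: K_def frontier_def interior_open)
 ultimately obtain \<delta> where "\<delta> > 0" "K \<subseteq> inner_part \<Omega> \<delta>"
  using compact_subset_inner_part assms(1) by blast
 moreover have "\<Omega> \<subseteq> closure \<Omega>" by (rule closure_subset)
 ultimately have "\<Omega> - inner_part \<Omega> \<delta> \<subseteq> (\<Union>p\<in>C. ball p (r p))" by (auto simp: K_def)
 thus ?thesis using C `\<delta> > 0` by blast
qed

lemma discrete_boundary:
 fixes \<Omega> :: "(real^'n::finite) set"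
 assumes "open \<Omega>" "bounded \<Omega>" and ldf: "!!p. p \<in> frontier \<Omega> ==> \<exists>U s. ldf \<Omega> p U s"
  and "G >= 0" "B > 0" "e > 0"
 shows "\<exists>\<delta>>0. \<exists>h0>0. \<forall>h u x. 0 < h --> h <= h0 --> dsol \<Omega> h G B u --> x \<in> \<Omega> - inner_part \<Omega> \<delta> --> abs(u x) <= e"
proof -
 define P where "P p r h0 \<longleftrightarrow> r > 0 & h0 > 0 & (\<forall>h u x. 0 < h --> h <= h0 --> dsol \<Omega> h G B u --> x \<in> \<Omega> --> x \<in> ball p r --> abs(u x) <= e)"
  for p r h0
 have "\<exists>r h0. P p r h0" if p: "p \<in> frontier \<Omega>" for p
 proof -
  obtain U s where U: "ldf \<Omega> p U s" using ldf[OF p] by blast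
  obtain r A h0 where r: "r > 0" "A > 0" "h0 > 0"
   "!!h u x. 0 < h ==> h <= h0 ==> dsol \<Omega> h G B u ==> x \<in> \<Omega> ==> x \<in> ball p r ==> abs(u x) <= A * s x + A * h"
   using discrete_boundary_local[OF U assms(2,4,5)] by auto
  obtain r2 where r2: "r2 > 0" "!!x. x \<in> cball p r2 ==> abs(s x) <= e / (2 * A)"
   using ldf_nbhd(2)[OF U, of "e / (2 * A)"] assms(6) r(2) by auto
  have "P p (min r r2) (min h0 (e / (2 * A)))"
   unfolding P_def
  proof (intro conjI allI impI)
   fix h u x assume h: "0 < h" "h <= min h0 (e / (2 * A))" and u: "dsol \<Omega> h G B u" and x: "x \<in> \<Omega>" "x \<in> ball p (min r r2)"
   have "abs(u x) <= A * s x + A * h" using h u x by (intro r(4)) auto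
   also have "... <= A * (e / (2 * A)) + A * (e / (2 * A))"
    using h x r2(2)[of x] r(2) by (intro add_mono mult_left_mono) auto
   also have "... = e" using r(2) by simp
   finally show "abs(u x) <= e" .
  qed (use r r2 assms(6) in auto)
  thus ?thesis by blast
 qed
 then obtain r h where P: "!!p. p \<in> frontier \<Omega> ==> P p (r p) (h p)" by metis
 have "!!p. p \<in> frontier \<Omega> ==> r p > 0" using P unfolding P_def by simp
 then obtain \<delta> C where C: "\<delta> > 0" "finite C" "C \<subseteq> frontier \<Omega>" "\<Omega> - inner_part \<Omega> \<delta> \<subseteq> (\<Union>p\<in>C. ball p (r p))"
  using frontier_inner_part[OF assms(1,2), of r] by metis
 define h0 where "h0 = Min (insert 1 (h ` C))"
 have h0: "h0 > 0" "!!p. p \<in> C ==> h0 <= h p"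
  using C(2,3) P by (auto simp: h0_def P_def Min_gr_iff)
 have "abs(u x) <= e" if h': "0 < h'" "h' <= h0" "dsol \<Omega> h' G B u" "x \<in> \<Omega> - inner_part \<Omega> \<delta>" for h' u x
 proof -
  obtain p where p: "p \<in> C" "x \<in> ball p (r p)" using C(4) h'(4) by blast
  hence "P p (r p) (h p)" using P C(3) by blast
  thus ?thesis unfolding P_def using h' h0(2)[OF p(1)] p(2) by auto
 qed
 thus ?thesis using C(1) h0(1) by blast
qed

section \<open>The linear Dirichlet problem\<close>

lemma abs_diff_le:
 fixes a b :: real
 shows "abs(a) <= e1 ==> abs(b) <= e2 ==> abs(a - b) <= e1 + e2"
 by linarith

lemma inner_part_mono: "\<delta>' <= \<delta> ==> inner_part \<Omega> \<delta> \<subseteq> inner_part \<Omega> \<delta>'"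
 by (auto simp: inner_part_def subset_iff)

lemma Dlap_shift: "Dlap h (%x. f (x + t)) x = Dlap h f (x + t)"
proof -
 have e: "x + v + t = x + t + v" "x - v + t = x + t - v" for v :: "real^'a" by (simp_all add: algebra_simps)
 show ?thesis unfolding Dlap_def e ..
qed

text \<open>Uniform boundary values phrased through points of \<Omega> only, so that the values of
  \<open>v\<close> on the boundary itself do not enter.\<close>

definition vanishes_at_bdry :: "(real^'n::finite) set => (real^'n => real) => bool" where
 "vanishes_at_bdry \<Omega> v \<longleftrightarrow> (\<forall>e>0. \<exists>\<delta>>0. \<forall>x\<in>\<Omega> - inner_part \<Omega> \<delta>. abs(v x) <= e)"

text \<open>The grid solutions are uniformly Cauchy and their limit is uniformly continuous, both by
  \<open>Dlap_bound\<close>; \<open>ubdd_limit_laplacian\<close> then passes to the limit in the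
  equation. The whole sequence converges, without extracting a subsequence.\<close>

theorem dirichlet:
 fixes \<Omega> :: "(real^'n::finite) set"
 assumes "open \<Omega>" "bounded \<Omega>" and ldf: "!!p. p \<in> frontier \<Omega> ==> \<exists>U s. ldf \<Omega> p U s"
  and "smooth_in \<Omega> g" and G: "!!x. x \<in> \<Omega> ==> abs(g x) <= G" "G >= 0"
  and R: "!!x. x \<in> \<Omega> ==> norm x + 1 <= R"
 shows "\<exists>v. smooth_in \<Omega> v & (\<forall>x\<in>\<Omega>. lap v x = g x) & (\<forall>x\<in>\<Omega>. abs(v x) <= G * R^2) & vanishes_at_bdry \<Omega> v"
proof -
 define Q where "Q h u \<longleftrightarrow> (\<forall>x. x \<notin> \<Omega> --> u x = 0) & (\<forall>x\<in>\<Omega>. Dlap h u x = h^2 * g x) & (\<forall>x\<in>\<Omega>. abs(u x) <= G * R^2)" for h u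
 have "\<exists>u. Q h u" if "0 < h & h <= 1" for h
  unfolding Q_def by (rule Dlap_dirichlet_exists) (use that R G in auto)
 then obtain U where U: "!!h. 0 < h & h <= 1 ==> Q h (U h)" by metis
 define B where "B = G * R^2 + 1"
 have B: "B > 0" using G(2) by (simp add: B_def add_nonneg_pos)
 have ds: "dsol \<Omega> h G B (U h)" if "0 < h" "h <= 1" for h
 proof -
  have q: "Q h (U h)" using U that by simp
  have "abs(Dlap h (U h) x) <= h^2 * G" if "x \<in> \<Omega>" for x
   using q G(1)[OF that] that by (simp add: Q_def abs_mult mult_left_mono)
  thus ?thesis using q by (fastforce simp: dsol_def Q_def B_def)
 qed
 define u where "u k = U (1 / 2 ^ k)" for k :: nat
 have hk: "0 < (1::real) / 2 ^ k" "(1::real) / 2 ^ k <= 1" for k :: nat by auto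
 have uQ: "Q (1 / 2 ^ k) (u k)" for k using U hk[of k] by (simp add: u_def)
 have u_out: "u k x = 0" if "x \<notin> \<Omega>" for k x using uQ[of k] that by (simp add: Q_def)
 have u_eq: "Dlap (1 / 2 ^ k) (u k) x = (1 / 2 ^ k)\<^sup>2 * g x" if "x \<in> \<Omega>" for k x using uQ[of k] that by (simp add: Q_def)
 have u_bd: "abs(u k x) <= G * R^2" if "x \<in> \<Omega>" for k x using uQ[of k] that by (simp add: Q_def)
 have ub: "ubdd \<Omega> u" unfolding u_def
  by (rule discrete_ubdd[OF assms(1,2,4), where B = "G * R^2"]) (use U in "auto simp: Q_def")
 have four: "(4::real) ^ k * (1 / 2 ^ k)\<^sup>2 = 1" for k :: nat
 proof -
  have "(2::real) ^ k * 2 ^ k = 4 ^ k" by (simp flip: power_mult_distrib)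
  thus ?thesis by (simp add: power2_eq_square)
 qed
 have u_eq4: "4 ^ k * Dlap (1 / 2 ^ k) (u k) x = g x" if "x \<in> \<Omega>" for k x
  using u_eq[OF that, of k] four[of k] by (metis mult.assoc mult_1)
 have small: "\<exists>\<delta>>0. \<exists>k0. \<forall>k\<ge>k0. \<forall>x. x \<notin> inner_part \<Omega> \<delta> --> abs(u k x) <= e" if "e > 0" for e
 proof -
  obtain \<delta> h0 where d: "\<delta> > 0" "h0 > 0" "!!h u x. 0 < h ==> h <= h0 ==> dsol \<Omega> h G B u ==> x \<in> \<Omega> - inner_part \<Omega> \<delta> ==> abs(u x) <= e"
   using discrete_boundary[OF assms(1,2) ldf G(2) B `e > 0`] by auto
  obtain k0 where k0: "!!k. k >= k0 ==> 1 / 2 ^ k <= h0" using pow2_small[OF d(2)] by blast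
  have "abs(u k x) <= e" if "k >= k0" "x \<notin> inner_part \<Omega> \<delta>" for k x
  proof (cases "x \<in> \<Omega>")
   case True
   thus ?thesis unfolding u_def
    using d(3)[OF hk(1) k0[OF that(1)] ds[OF hk]] that(2) by simp
  qed (use u_out `e > 0` in simp)
  thus ?thesis using d(1) by blast
 qed
 \<comment> \<open>Near the boundary both functions are small. Inside, \<open>u k\<close> satisfies
   the equation of mesh \<open>j\<close> up to C/4^j, so the difference is controlled by comparison
   at the coarser mesh.\<close>
 have cauchy: "\<exists>j0. \<forall>j\<ge>j0. \<forall>k\<ge>j. \<forall>x. abs(u j x - u k x) <= e" if "e > 0" for e
 proof -
  have "e / 4 > 0" using `e > 0` by simp
  from small[OF this] obtain \<delta> k0 where d: "\<delta> > 0" "!!k x. k >= k0 ==> x \<notin> inner_part \<Omega> \<delta> ==> abs(u k x) <= e / 4"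
   by blast
  note sub = inner_part_subset[OF d(1), of \<Omega>]
  obtain C j1 where C: "C > 0" "!!j k x. j >= j1 ==> k >= j ==> x \<in> inner_part \<Omega> \<delta> ==>
    abs(4 ^ j * Dlap (1/2^j) (u k) x - 4 ^ k * Dlap (1/2^k) (u k) x) <= C / 4 ^ j"
   using ubdd_consistent[OF assms(1) ub compact_inner_part[OF assms(2) d(1)] sub] by blast
  obtain j2 where j2: "!!k. k >= j2 ==> 1 / 2 ^ k <= e / (2 * C * (R^2 + 1))"
   using pow2_small[of "e / (2 * C * (R^2 + 1))"] `e > 0` C(1) by (auto simp: add_nonneg_pos)
  have "abs(u j x - u k x) <= e" if j: "j >= max k0 (max j1 j2)" and k: "k >= j" for j k x
  proof -
   let ?h = "1 / 2 ^ j :: real"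
   have out: "abs(u j y - u k y) <= e / 2" if "y \<notin> inner_part \<Omega> \<delta>" for y
    using abs_diff_le[OF d(2)[of j y] d(2)[of k y]] j k that by simp
   have "abs(u j x - u k x) <= e / 2 + C / 4 ^ j * R^2 | inner_part \<Omega> \<delta> = {}"
   proof (rule Dlap_bound[OF hk])
    show "norm y + 1 <= R" if "y \<in> inner_part \<Omega> \<delta>" for y using R that sub by blast
    show "abs(u j y - u k y) <= e / 2" if "y \<notin> inner_part \<Omega> \<delta>" for y using out[OF that] .
    show "abs(u j y - u k y) <= 2 * (G * R^2)" if "y \<in> inner_part \<Omega> \<delta>" for y
     using abs_diff_le[OF u_bd[of y j] u_bd[of y k]] that sub by auto
    show "abs(Dlap ?h (%a. u j a - u k a) y) <= ?h\<^sup>2 * (C / 4 ^ j)" if y: "y \<in> inner_part \<Omega> \<delta>" for y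
    proof -
     have yO: "y \<in> \<Omega>" using y sub by blast
     have c: "abs(4 ^ j * Dlap ?h (u k) y - g y) <= C / 4 ^ j"
      using C(2)[of j k y] j k y u_eq4[OF yO, of k] by simp
     have "Dlap ?h (%a. u j a - u k a) y = ?h\<^sup>2 * g y - (4 ^ j * ?h\<^sup>2) * Dlap ?h (u k) y"
      unfolding Dlap_diff u_eq[OF yO] four by simp
     also have "... = ?h\<^sup>2 * (g y - 4 ^ j * Dlap ?h (u k) y)" by (simp add: algebra_simps)
     also have "abs(...) <= ?h\<^sup>2 * (C / 4 ^ j)" unfolding abs_mult
      using c by (intro mult_mono) (auto simp: abs_minus_commute)
     finally show ?thesis .
    qed
    show "0 <= C / 4 ^ j" using C(1) by simp
   qed
   moreover have "C / 4 ^ j * R^2 <= e / 2"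
   proof -
    have "1 / (4::real) ^ j <= 1 / 2 ^ j" by (intro divide_left_mono power_mono) auto
    also have "... <= e / (2 * C * (R^2 + 1))" using j2[of j] j by simp
    finally have "C * (1 / 4 ^ j) * R^2 <= C * (e / (2 * C * (R^2 + 1))) * (R^2 + 1)"
     using C(1) `e > 0` by (intro mult_mono) (auto intro!: divide_nonneg_nonneg mult_nonneg_nonneg)
    also have "... = e / 2"
    proof -
     have q: "C * (e / (2 * C * c)) * c = e / 2" if "c > 0" for c using that C(1) by simp
     show ?thesis by (rule q) (simp add: add_nonneg_pos)
    qed
    finally show ?thesis by simp
   qed
   moreover have "a <= e" if "a <= e / 2 + b" "b <= e / 2" for a b using that by linarith
   ultimately show ?thesis using out[of x] `e > 0` by fastforce
  qed
  thus ?thesis by blast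
 qed
 have conv: "convergent (%k. u k x)" for x
 proof -
  have "Cauchy (%k. u k x)"
  proof (rule CauchyI')
   fix e :: real assume "e > 0"
   then obtain j0 where j0: "!!j k x. j >= j0 ==> k >= j ==> abs(u j x - u k x) <= e / 2" using cauchy[of "e/2"] by auto
   have "dist (u m x) (u n x) < e" if "m >= j0" "n > m" for m n
    using j0[of m n x] that `e > 0` by (simp add: dist_real_def)
   thus "\<exists>M. \<forall>m\<ge>M. \<forall>n>m. dist (u m x) (u n x) < e" by blast
  qed
  thus ?thesis by (simp add: Cauchy_convergent_iff)
 qed
 define v where "v x = lim (%k. u k x)" for x
 have lim: "(%k. u k x) \<longlonglongrightarrow> v x" for x using conv[of x] by (simp add: v_def convergent_LIMSEQ_iff)
 have v_bd: "abs(v x) <= G * R^2" if "x \<in> \<Omega>" for x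
  by (rule tendsto_upperbound[OF tendsto_rabs[OF lim]]) (use u_bd[OF that] in auto)
 have v_small: "\<exists>\<delta>>0. \<forall>x. x \<notin> inner_part \<Omega> \<delta> --> abs(v x) <= e" if "e > 0" for e
 proof -
  obtain \<delta> k0 where d: "\<delta> > 0" "!!k x. k >= k0 ==> x \<notin> inner_part \<Omega> \<delta> ==> abs(u k x) <= e"
   using small[OF `e > 0`] by blast
  have "abs(v x) <= e" if "x \<notin> inner_part \<Omega> \<delta>" for x
   by (rule tendsto_upperbound[OF tendsto_rabs[OF lim]]) (use d(2) that in "auto simp: eventually_sequentially")
  thus ?thesis using d(1) by blast
 qed
 \<comment> \<open>A grid solution is not known to be continuous, since different translates of the
   lattice do not interact. Comparing \<open>u k\<close> with its translate by an arbitrary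
   \<open>t\<close> gives a modulus of continuity uniform in large \<open>k\<close>, which the limit
   keeps.\<close>
 have shift: "\<exists>\<tau>>0. \<forall>t x. norm t < \<tau> --> abs(v (x + t) - v x) <= e" if "e > 0" for e
 proof -
  have "e / 4 > 0" using `e > 0` by simp
  from small[OF this] obtain \<delta> k0 where d: "\<delta> > 0" "!!k x. k >= k0 ==> x \<notin> inner_part \<Omega> \<delta> ==> abs(u k x) <= e / 4"
   by blast
  have d2: "\<delta> / 2 > 0" "\<delta> / 4 > 0" using d(1) by auto
  note sub = inner_part_subset[OF d2(1), of \<Omega>] inner_part_subset[OF d2(2), of \<Omega>]
  have "uniformly_continuous_on (inner_part \<Omega> (\<delta>/4)) g"
   using compact_uniformly_continuous[OF _ compact_inner_part[OF assms(2) d2(2)]]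
    continuous_on_subset[OF smooth_in_continuous[OF assms(4)] sub(2)] by blast
  moreover define \<omega> where "\<omega> = e / (2 * (R^2 + 1))"
  moreover have om: "\<omega> > 0" using `e > 0` by (simp add: \<omega>_def add_nonneg_pos)
  ultimately obtain \<tau> where tau: "\<tau> > 0" "!!x y. x \<in> inner_part \<Omega> (\<delta>/4) ==> y \<in> inner_part \<Omega> (\<delta>/4) ==> dist y x < \<tau> ==> dist (g y) (g x) < \<omega>"
   unfolding uniformly_continuous_on_def by blast
  have "abs(v (x + t) - v x) <= e" if t: "norm t < min \<tau> (\<delta>/4)" for t x
  proof -
   have "abs(u k (x + t) - u k x) <= e" if k: "k >= k0" for k
   proof -
    let ?h = "1 / 2 ^ k :: real"
    have out: "abs(u k (y + t) - u k y) <= e / 2" if y: "y \<notin> inner_part \<Omega> (\<delta>/2)" for y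
    proof -
     have "y \<notin> inner_part \<Omega> \<delta>" using y inner_part_mono[of "\<delta>/2" \<delta> \<Omega>] d(1) by auto
     moreover have "y + t \<notin> inner_part \<Omega> \<delta>"
      using inner_part_shift[of "y + t" \<Omega> \<delta> y "\<delta>/2"] y t d(1) by (auto simp: dist_norm)
     ultimately show ?thesis using abs_diff_le[OF d(2)[OF k, of "y + t"] d(2)[OF k, of y]] by simp
    qed
    have "abs(u k (x + t) - u k x) <= e / 2 + \<omega> * R^2 | inner_part \<Omega> (\<delta>/2) = {}"
    proof (rule Dlap_bound[OF hk])
     show "norm y + 1 <= R" if "y \<in> inner_part \<Omega> (\<delta>/2)" for y using R that sub by blast
     show "abs(u k (y + t) - u k y) <= e / 2" if "y \<notin> inner_part \<Omega> (\<delta>/2)" for y using out[OF that] .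
     have st: "y + t \<in> inner_part \<Omega> (\<delta>/4)" if "y \<in> inner_part \<Omega> (\<delta>/2)" for y
      by (rule inner_part_shift[OF that]) (use t d(1) in "auto simp: dist_norm")
     show "abs(u k (y + t) - u k y) <= 2 * (G * R^2)" if y: "y \<in> inner_part \<Omega> (\<delta>/2)" for y
      using abs_diff_le[OF u_bd[of "y + t" k] u_bd[of y k]] y st[OF y] sub by auto
     show "abs(Dlap ?h (%a. u k (a + t) - u k a) y) <= ?h\<^sup>2 * \<omega>" if y: "y \<in> inner_part \<Omega> (\<delta>/2)" for y
     proof -
      have yO: "y \<in> \<Omega>" "y + t \<in> \<Omega>" using y st[OF y] sub by auto
      have "Dlap ?h (%a. u k (a + t) - u k a) y = ?h\<^sup>2 * (g (y + t) - g y)"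
       unfolding Dlap_diff Dlap_shift u_eq[OF yO(1)] u_eq[OF yO(2)] by (simp add: algebra_simps)
      also have "abs(...) <= ?h\<^sup>2 * \<omega>"
      proof -
       have "y \<in> inner_part \<Omega> (\<delta>/4)" using y inner_part_mono[of "\<delta>/4" "\<delta>/2" \<Omega>] d(1) by auto
       hence "dist (g (y + t)) (g y) < \<omega>" using t st[OF y] by (intro tau(2)) (auto simp: dist_norm)
       thus ?thesis unfolding abs_mult by (intro mult_mono) (auto simp: dist_real_def)
      qed
      finally show ?thesis .
     qed
     show "0 <= \<omega>" using om by simp
    qed
    moreover have "\<omega> * R^2 <= e / 2"
    proof -
     have "\<omega> * R^2 <= \<omega> * (R^2 + 1)" using om by (intro mult_left_mono) auto
     also have "... = e / 2"
     proof -
      have q: "e / (2 * c) * c = e / 2" if "c > 0" for c using that by simp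
      show ?thesis unfolding \<omega>_def by (rule q) (simp add: add_nonneg_pos)
     qed
     finally show ?thesis .
    qed
    moreover have "a <= e" if "a <= e / 2 + b" "b <= e / 2" for a b using that by linarith
   ultimately show ?thesis using out[of x] `e > 0` by fastforce
   qed
   hence "\<forall>\<^sub>F k in sequentially. abs(u k (x + t) - u k x) <= e" by (auto simp: eventually_sequentially)
   from tendsto_upperbound[OF tendsto_rabs[OF tendsto_diff[OF lim lim]] this] show ?thesis by simp
  qed
  thus ?thesis using tau(1) d2(2) by (intro exI[of _ "min \<tau> (\<delta>/4)"]) auto
 qed
 have contv: "continuous_on \<Omega> v"
 proof (rule continuous_at_imp_continuous_on, rule ballI)
  fix x
  show "isCont v x"
   unfolding continuous_at_eps_delta
  proof (intro allI impI)
   fix e :: real assume "e > 0"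
   then obtain \<tau> where \<tau>: "\<tau> > 0" "!!t x. norm t < \<tau> ==> abs(v (x + t) - v x) <= e / 2" using shift[of "e/2"] by auto
   have "dist (v y) (v x) < e" if "dist y x < \<tau>" for y
    using \<tau>(2)[of "y - x" x] that `e > 0` by (simp add: dist_norm)
   thus "\<exists>d>0. \<forall>x'. dist x' x < d --> dist (v x') (v x) < e" using \<tau>(1) by blast
  qed
 qed
 have lim4: "(%k. 4 ^ k * Dlap (1/2^k) (u k) x) \<longlonglongrightarrow> g x" if "x \<in> \<Omega>" for x
  using u_eq4[OF that] by simp
 show ?thesis
 proof (intro exI[of _ v] conjI ballI)
  show "smooth_in \<Omega> v" by (rule ubdd_limit_laplacian(1)[OF assms(1) ub lim contv lim4])
  show "lap v x = g x" if "x \<in> \<Omega>" for x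
   by (rule ubdd_limit_laplacian(2)[OF assms(1) ub lim contv lim4 that])
  show "abs(v x) <= G * R^2" if "x \<in> \<Omega>" for x by (rule v_bd[OF that])
  show "vanishes_at_bdry \<Omega> v" unfolding vanishes_at_bdry_def
  proof (intro allI impI)
   fix e :: real assume "e > 0"
   then obtain \<delta> where "\<delta> > 0" "!!x. x \<notin> inner_part \<Omega> \<delta> ==> abs(v x) <= e" using v_small by blast
   thus "\<exists>\<delta>>0. \<forall>x\<in>\<Omega> - inner_part \<Omega> \<delta>. abs(v x) <= e" by auto
  qed
 qed
qed

section \<open>Interior gradient estimate and maximum principle\<close>

text \<open>
 \<open>P \<beta> f\<close> stands for a bound of order \<open>\<beta>\<close>; each derivation lowers the order by \<open>\<delta>\<close>. The boundary
 regularity proof uses it with \<open>\<delta> = 1\<close> for all derivatives, measured in powers of the distance to the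
 boundary, and then, on top of that, with \<open>\<delta> = 0\<close> for tangential derivatives only.
\<close>

locale graded_derivations =
 fixes Dom :: "'p set" and A :: "('p => real) set" and D :: "'k => ('p => real) => 'p => real"
  and P :: "real => ('p => real) => bool" and \<delta> :: real and S :: "'k set"
 assumes A_D: "f \<in> A ==> k \<in> S ==> D k f \<in> A"
  and A_mult: "f \<in> A ==> g \<in> A ==> (%x. f x * g x) \<in> A"
  and D_cong: "k \<in> S ==> (!!x. x \<in> Dom ==> f x = g x) ==> x \<in> Dom ==> D k f x = D k g x"
  and D_add: "k \<in> S ==> f \<in> A ==> g \<in> A ==> x \<in> Dom ==> D k (%x. f x + g x) x = D k f x + D k g x"
  and D_mult: "k \<in> S ==> f \<in> A ==> g \<in> A ==> x \<in> Dom ==>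
    D k (%x. f x * g x) x = D k f x * g x + f x * D k g x"
  and P_cong: "(!!x. x \<in> Dom ==> f x = g x) ==> P \<beta> f ==> P \<beta> g"
  and P_add: "P \<beta> f ==> P \<beta> g ==> P \<beta> (%x. f x + g x)"
  and P_mult: "P \<beta> f ==> P \<gamma> g ==> P (\<beta> + \<gamma>) (%x. f x * g x)"
begin

fun cls :: "nat => real => ('p => real) => bool" where
 "cls 0 \<beta> f = P \<beta> f"
| "cls (Suc m) \<beta> f = (P \<beta> f & (\<forall>k\<in>S. cls m (\<beta> - \<delta>) (D k f)))"

fun Ds :: "'k list => ('p => real) => 'p => real" where
 "Ds [] f = f"
| "Ds (k # ks) f = Ds ks (D k f)"

lemma cls_P: "cls m \<beta> f ==> P \<beta> f"
 by (cases m) auto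

lemma cls_cong: "(!!x. x \<in> Dom ==> f x = g x) ==> cls m \<beta> f ==> cls m \<beta> g"
proof (induction m arbitrary: \<beta> f g)
 case 0
 thus ?case using P_cong by (metis cls.simps(1))
next
 case (Suc m)
 have "P \<beta> g" using Suc.prems P_cong[of f g \<beta>] by auto
 moreover have "cls m (\<beta> - \<delta>) (D k g)" if "k \<in> S" for k
  using Suc.IH[of "D k f" "D k g" "\<beta> - \<delta>"] D_cong[OF that, of f g] Suc.prems that by auto
 ultimately show ?case by simp
qed

lemma cls_Suc_D: "cls (Suc m) \<beta> f ==> cls m \<beta> f"
 by (induction m arbitrary: \<beta> f) auto


lemma cls_add: "f \<in> A ==> g \<in> A ==> cls m \<beta> f ==> cls m \<beta> g ==> cls m \<beta> (%x. f x + g x)"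
proof (induction m arbitrary: \<beta> f g)
 case 0
 thus ?case by (simp add: P_add)
next
 case (Suc m)
 have "cls m (\<beta> - \<delta>) (D k (%x. f x + g x))" if k: "k \<in> S" for k
  by (rule cls_cong[of "%x. D k f x + D k g x"])
    (use Suc k A_D D_add[OF k] in auto)
 thus ?case using Suc.prems by (simp add: P_add)
qed

lemma cls_mult: "f \<in> A ==> g \<in> A ==> cls m \<beta> f ==> cls m \<gamma> g ==> cls m (\<beta> + \<gamma>) (%x. f x * g x)"
proof (induction m arbitrary: \<beta> \<gamma> f g)
 case 0
 thus ?case by (simp add: P_mult)
next
 case (Suc m)
 have "cls m (\<beta> + \<gamma> - \<delta>) (D k (%x. f x * g x))" if k: "k \<in> S" for k
 proof (rule cls_cong[of "%x. D k f x * g x + f x * D k g x"])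
  have 1: "cls m (\<beta> - \<delta> + \<gamma>) (%x. D k f x * g x)"
   using Suc.prems k A_D cls_Suc_D[OF Suc.prems(4)] by (intro Suc.IH) auto
  have 2: "cls m (\<beta> + (\<gamma> - \<delta>)) (%x. f x * D k g x)"
   using Suc.prems k A_D cls_Suc_D[OF Suc.prems(3)] by (intro Suc.IH) auto
  have e: "\<beta> - \<delta> + \<gamma> = \<beta> + \<gamma> - \<delta>" "\<beta> + (\<gamma> - \<delta>) = \<beta> + \<gamma> - \<delta>" by auto
  show "cls m (\<beta> + \<gamma> - \<delta>) (%x. D k f x * g x + f x * D k g x)"
   using 1 2 Suc.prems k A_D unfolding e by (intro cls_add A_mult) auto
 qed (use D_mult[OF k] Suc.prems in auto)
 thus ?case using Suc.prems by (simp add: P_mult)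
qed

lemma cls_compose:
 assumes "u \<in> A" "cls m 0 u"
  and FA: "!!j. (%x. Fs j (u x)) \<in> A" and FP: "!!j. P 0 (%x. Fs j (u x))"
  and FD: "!!j k x. k \<in> S ==> x \<in> Dom ==> D k (%x. Fs j (u x)) x = Fs (Suc j) (u x) * D k u x"
 shows "cls m 0 (%x. Fs j (u x))"
 using assms(2)
proof (induction m arbitrary: j)
 case 0
 thus ?case by (simp add: FP)
next
 case (Suc m)
 have "cls m (0 - \<delta>) (D k (%x. Fs j (u x)))" if k: "k \<in> S" for k
 proof (rule cls_cong[of "%x. Fs (Suc j) (u x) * D k u x"])
  have "cls m (0 + (0 - \<delta>)) (%x. Fs (Suc j) (u x) * D k u x)"
   using k Suc.prems by (intro cls_mult FA A_D assms(1) Suc.IH cls_Suc_D[OF Suc.prems]) auto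
  thus "cls m (0 - \<delta>) (%x. Fs (Suc j) (u x) * D k u x)" by simp
 qed (use FD[OF k] in simp)
 thus ?case by (simp add: FP)
qed

text \<open>\<open>cls\<close> peels off the first derivation, while the regularity arguments
  estimate a new last one. Words in the derivations convert between the two.\<close>

lemma cls_iff_Ds:
 "cls m \<beta> f \<longleftrightarrow> (\<forall>ks. length ks <= m --> set ks \<subseteq> S --> P (\<beta> - \<delta> * real (length ks)) (Ds ks f))"
proof (induction m arbitrary: \<beta> f)
 case 0
 thus ?case by simp
next
 case (Suc m)
 have e: "\<beta> - \<delta> - \<delta> * real n = \<beta> - \<delta> * real (Suc n)" for n by (simp add: algebra_simps)
 show ?case
 proof
  assume L: "cls (Suc m) \<beta> f"
  show "\<forall>ks. length ks <= Suc m --> set ks \<subseteq> S --> P (\<beta> - \<delta> * real (length ks)) (Ds ks f)"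
  proof (intro allI impI)
   fix ks assume "length ks <= Suc m" "set ks \<subseteq> S"
   show "P (\<beta> - \<delta> * real (length ks)) (Ds ks f)"
   proof (cases ks)
    case (Cons k l)
    hence "P (\<beta> - \<delta> - \<delta> * real (length l)) (Ds l (D k f))"
     using L Suc[of "\<beta> - \<delta>"] `length ks <= Suc m` `set ks \<subseteq> S` by simp
    thus ?thesis unfolding e by (simp add: Cons)
   qed (use L in simp)
  qed
 next
  assume R: "\<forall>ks. length ks <= Suc m --> set ks \<subseteq> S --> P (\<beta> - \<delta> * real (length ks)) (Ds ks f)"
  have "cls m (\<beta> - \<delta>) (D k f)" if k: "k \<in> S" for k
   unfolding Suc[of "\<beta> - \<delta>"]
  proof (intro allI impI)
   fix ks assume "length ks <= m" "set ks \<subseteq> S"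
   thus "P (\<beta> - \<delta> - \<delta> * real (length ks)) (Ds ks (D k f))"
    using R[rule_format, of "k # ks"] k unfolding e by simp
  qed
  moreover have "P \<beta> f" using R[rule_format, of "[]"] by simp
  ultimately show "cls (Suc m) \<beta> f" by simp
 qed
qed

lemma Ds_A: "f \<in> A ==> set ks \<subseteq> S ==> Ds ks f \<in> A"
 by (induction ks arbitrary: f) (auto simp: A_D)

end

lemma Dlap_seq:
 fixes f :: "real^'n::finite => real"
 assumes "open U" "smooth_in U f" "x \<in> U"
 shows "(%l. 4 ^ l * Dlap (1 / 2 ^ l) f x) \<longlonglongrightarrow> lap f x"
proof (rule LIMSEQ_I)
 fix e :: real assume "e > 0"
 hence e2: "e / 2 > 0" by simp
 obtain h0 where h0: "h0 > 0" "!!h. 0 < h ==> h <= h0 ==> abs(Dlap h f x - h\<^sup>2 * lap f x) <= e / 2 * h^2"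
  using Dlap_laplacian[OF assms(1,2) _ _ e2, of "{x}"] assms(3) by auto
 obtain m where m: "!!k. k >= m ==> 1 / 2 ^ k <= h0" using pow2_small[OF h0(1)] by blast
 have "norm (4 ^ l * Dlap (1 / 2 ^ l) f x - lap f x) < e" if "l >= m" for l
 proof -
  have four: "(4::real) ^ l * (1 / 2 ^ l)\<^sup>2 = 1"
  proof -
   have "(2::real) ^ l * 2 ^ l = 4 ^ l" by (simp flip: power_mult_distrib)
   thus ?thesis by (simp add: power2_eq_square)
  qed
  have "4 ^ l * Dlap (1 / 2 ^ l) f x - lap f x
    = 4 ^ l * Dlap (1 / 2 ^ l) f x - (4 ^ l * (1 / 2 ^ l)\<^sup>2) * lap f x" unfolding four by simp
  also have "... = 4 ^ l * (Dlap (1 / 2 ^ l) f x - (1 / 2 ^ l)\<^sup>2 * lap f x)" by (simp only: right_diff_distrib mult.assoc)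
  also have "abs(...) <= 4 ^ l * (e / 2 * (1 / 2 ^ l)\<^sup>2)"
   unfolding abs_mult using h0(2)[of "1 / 2 ^ l"] m[OF that] by (intro mult_mono) auto
  also have "... = (4 ^ l * (1 / 2 ^ l)\<^sup>2) * (e / 2)" by (simp only: mult_ac)
  also have "... < e" unfolding four using `e > 0` by simp
  finally show ?thesis by simp
 qed
 thus "\<exists>no. \<forall>n\<ge>no. norm (4 ^ n * Dlap (1 / 2 ^ n) f x - lap f x) < e" by blast
qed

text \<open>Unlike in \<open>Dlap_laplacian\<close>, the error depends on the function only through
  a bound for its pure fourth derivatives. It can therefore be used along a sequence with uniformly
  bounded derivatives.\<close>

lemma Dlap_laplacian_rate:
 fixes f :: "real^'n::finite => real"
 assumes "open U" "smooth_in U f" "cball x r \<subseteq> U" "r > 0" "C >= 0"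
  and bd: "!!i y. y \<in> cball x r ==> abs(pds [i,i,i,i] f y) <= C" and j: "1 / 2 ^ j <= r / 8"
 shows "abs(4 ^ j * Dlap (1 / 2 ^ j) f x - lap f x) <= real CARD('n) * C / 4 ^ j"
proof -
 have xU: "x \<in> U" using assms(3,4) by auto
 have "abs(4 ^ j * Dlap (1/2^j) f x - 4 ^ k * Dlap (1/2^k) f x) <= real CARD('n) * C / 4 ^ j" if "k >= j" for k
 proof (rule Dlap_consistent[OF that assms(5)])
  fix l i assume l: "j < l" "l <= k"
  let ?s = "1 / 2 ^ l :: real"
  have "(2::real) ^ j <= 2 ^ l" using l by (intro power_increasing) auto
  hence "?s <= 1 / 2 ^ j" by (intro divide_left_mono) auto
  hence s: "0 < ?s" "?s <= r / 8" using j by auto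
  have "abs(dlts [(i,?s),(i,?s),(i,?s),(i,?s)] f (x - (2 * ?s) *. i))
    <= C * prod_list (map snd [(i,?s),(i,?s),(i,?s),(i,?s)])"
  proof (rule dlts_bound[OF assms(2)])
   fix y assume "dist (x - (2 * ?s) *. i) y <= sum_list (map snd [(i,?s),(i,?s),(i,?s),(i,?s)])"
   hence "dist (x - (2 * ?s) *. i) y <= 4 * ?s" by simp
   moreover have "dist x y <= 2 * ?s + dist (x - (2 * ?s) *. i) y"
    using dist_triangle[of x y "x - (2 * ?s) *. i"] s(1) by simp
   moreover have "b <= r" if "a <= r / 8" "0 < a" "c <= 4 * a" "b <= 2 * a + c" for a b c :: real using that by linarith
   ultimately have "y \<in> cball x r" using s unfolding mem_cball by blast
   thus "y \<in> U & abs(pds (map fst [(i,?s),(i,?s),(i,?s),(i,?s)]) f y) <= C"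
    using bd[of y i] assms(3) by auto
  qed (use s in auto)
  thus "abs(dlts [(i,?s),(i,?s),(i,?s),(i,?s)] f (x - (2 * ?s) *. i)) <= C * ?s ^ 4"
   by (simp add: numeral_eq_Suc)
 qed
 hence ev: "\<forall>\<^sub>F k in sequentially. abs(4 ^ j * Dlap (1/2^j) f x - 4 ^ k * Dlap (1/2^k) f x) <= real CARD('n) * C / 4 ^ j"
  by (auto simp: eventually_sequentially)
 from tendsto_upperbound[OF tendsto_rabs[OF tendsto_diff[OF tendsto_const Dlap_seq[OF assms(1,2) xU]]] ev]
 show ?thesis by simp
qed

definition Cg :: "'n::finite itself => real" where
 "Cg _ = 3 * real CARD('n) * (4 * real CARD('n) + 1)"


text \<open>The grid estimate with mesh tending to zero. The radius is kept explicit because near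
  the boundary it is taken proportional to the distance function.\<close>

lemma interior_gradient:
 fixes u :: "real^'n::finite => real"
 assumes "open U" "smooth_in U u" "cball x r \<subseteq> U" "r > 0"
  and bd: "!!y. y \<in> cball x r ==> abs(u y) <= M & abs(lap u y) <= K"
 shows "abs(pd i u x) <= Cg TYPE('n) * (M / r + r * K)"
proof -
 let ?N = "real CARD('n)"
 have N: "?N >= 1" using zero_less_card_finite[where 'a='n] by linarith
 define d where "d = r / (3 * ?N)"
 have d: "d > 0" using assms(4) N by (simp add: d_def)
 have M: "M >= 0" "K >= 0" using bd[of x] `r > 0` by auto
 have xU: "x \<in> U" using assms(3,4) by auto
 have cube: "y \<in> cball x r" if "!!j. abs(y $ j - x $ j) <= 3 * d" for y
 proof -
  have "dist x y <= (\<Sum>j\<in>UNIV. abs((y - x) $ j))" using norm_le_l1_cart[of "y - x"] by (simp add: dist_norm norm_minus_commute)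
  also have "... <= (\<Sum>j\<in>(UNIV::'n set). 3 * d)" by (intro sum_mono) (use that in simp)
  also have "... = r" using N by (simp add: d_def)
  finally show ?thesis by simp
 qed
 have lim: "(%k. (u (x + (1 / 2 ^ k) *. i) - u x) / (1 / 2 ^ k)) \<longlonglongrightarrow> pd i u x"
 proof -
  have "((%t. u (x + t *. i)) has_real_derivative pd i u x) (at 0)"
   using line_deriv[of u x 0 i] smooth_in_diff[OF assms(2) xU] by simp
  hence q: "(%h. (u (x + h *. i) - u x) / h) \<midarrow>0\<rightarrow> pd i u x" by (simp add: DERIV_def)
  have "(%k. 1 / 2 ^ k :: real) \<longlonglongrightarrow> 0"
   using LIMSEQ_power_zero[of "1/2::real"] by (simp add: power_one_over)
  thus ?thesis
   by (intro LIMSEQ_SEQ_conv[THEN iffD2, rule_format, OF q]) auto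
 qed
 have "abs(pd i u x) <= (4 * ?N + 1) * (M + e) / d + 2 * d * (K + e)" if "e > 0" for e
 proof -
  obtain h0 where h0: "h0 > 0" "!!h y. 0 < h ==> h <= h0 ==> y \<in> cball x r ==> abs(Dlap h u y - h\<^sup>2 * lap u y) <= e * h^2"
   using Dlap_laplacian[OF assms(1,2) compact_cball assms(3) `e > 0`] by auto
  obtain m where m: "!!k. k >= m ==> 1 / 2 ^ k <= min h0 d" using pow2_small[of "min h0 d"] h0(1) d by auto
  have "abs((u (x + (1 / 2 ^ k) *. i) - u x) / (1 / 2 ^ k)) <= (4 * ?N + 1) * (M + e) / d + 2 * d * (K + e)" if k: "k >= m" for k
  proof -
   let ?h = "1 / 2 ^ k :: real"
   have h: "?h > 0" "?h <= h0" "?h <= d" using m[OF k] by auto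
   have "abs(u (x + ?h *. i) - u x) <= ?h * ((4 * ?N + 1) * (M + e) / d + 2 * d * (K + e))"
   proof (rule discrete_gradient[OF h(1,3)])
    fix y assume "!!j. abs(y $ j - x $ j) <= 3 * d"
    hence y: "y \<in> cball x r" by (rule cube)
    have "abs(h\<^sup>2 * lap u y) <= h^2 * K" for h using bd[OF y] by (simp add: abs_mult mult_left_mono)
    from this[of ?h] have "abs(Dlap ?h u y) <= ?h\<^sup>2 * K + e * ?h\<^sup>2"
     using h0(2)[OF h(1,2) y] by linarith
    thus "abs(u y) <= M + e & abs(Dlap ?h u y) <= ?h\<^sup>2 * (K + e)"
     using bd[OF y] `e > 0` by (simp add: algebra_simps)
   qed (use M `e > 0` in auto)
   hence "abs(u (x + ?h *. i) - u x) / ?h <= ?h * ((4 * ?N + 1) * (M + e) / d + 2 * d * (K + e)) / ?h"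
    using h(1) by (intro divide_right_mono) auto
   moreover have "?h * b / ?h = b" for b by simp
   ultimately show ?thesis by (simp only: abs_div_pos[OF h(1)])
  qed
  hence "\<forall>\<^sub>F k in sequentially. abs((u (x + (1 / 2 ^ k) *. i) - u x) / (1 / 2 ^ k)) <= (4 * ?N + 1) * (M + e) / d + 2 * d * (K + e)"
   by (auto simp: eventually_sequentially)
  from tendsto_upperbound[OF tendsto_rabs[OF lim] this] show ?thesis by simp
 qed
 moreover have "(4 * ?N + 1) * (M + e) / d + 2 * d * (K + e)
   = ((4 * ?N + 1) * M / d + 2 * d * K) + e * ((4 * ?N + 1) / d + 2 * d)" for e
  by (simp add: algebra_simps add_divide_distrib)
 ultimately have "abs(pd i u x) <= ((4 * ?N + 1) * M / d + 2 * d * K) + e * ((4 * ?N + 1) / d + 2 * d)" if "e > 0" for e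
  using that by metis
 hence "abs(pd i u x) <= ((4 * ?N + 1) * M / d + 2 * d * K)"
 proof -
  assume a: "!!e. e > 0 ==> abs(pd i u x) <= ((4 * ?N + 1) * M / d + 2 * d * K) + e * ((4 * ?N + 1) / d + 2 * d)"
  have c: "(4 * ?N + 1) / d + 2 * d > 0" using d N by (intro add_pos_pos divide_pos_pos) auto
  show ?thesis
  proof (rule field_le_epsilon)
   fix e :: real assume "e > 0"
   thus "abs(pd i u x) <= ((4 * ?N + 1) * M / d + 2 * d * K) + e"
    using a[of "e / ((4 * ?N + 1) / d + 2 * d)"] c by simp
  qed
 qed
 also have "(4 * ?N + 1) * M / d = Cg TYPE('n) * (M / r)" using N `r > 0` by (simp add: d_def Cg_def)
 also have "2 * d * K <= Cg TYPE('n) * (r * K)"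
 proof -
  have "2 <= 3 * ?N" using N by linarith
  hence "2 * d <= r * 1" using `r > 0` by (simp add: d_def field_simps)
  also have "... <= r * Cg TYPE('n)"
  proof (rule mult_left_mono)
   have "1 * 1 <= (3 * ?N) * (4 * ?N + 1)" by (rule mult_mono) (use N in linarith)+
   thus "1 <= Cg TYPE('n)" by (simp add: Cg_def)
  qed (use `r > 0` in auto)
  finally have "2 * d * K <= r * Cg TYPE('n) * K" using M by (intro mult_right_mono) auto
  thus ?thesis by (simp add: algebra_simps)
 qed
 finally show ?thesis by (simp add: algebra_simps)
qed

text \<open>At a maximum the second differences are nonpositive, against the strictly positive
  Laplacian. The compact set \<open>K\<close> stands in for boundary values: outside it the sign is
  known, so a positive maximum is attained in it.\<close>

lemma max_principle:
 fixes w :: "real^'n::finite => real"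
 assumes "open D" "smooth_in D w" and lap: "!!x. x \<in> D ==> lap w x > 0"
  and "compact K" "K \<subseteq> D" and out: "!!x. x \<in> D - K ==> w x <= 0" and "x \<in> D"
 shows "w x <= 0"
proof (rule ccontr)
 assume a: "\<not> w x <= 0"
 hence "x \<in> K" using out `x \<in> D` by auto
 have "continuous_on K w" using smooth_in_continuous[OF assms(2)] assms(5) continuous_on_subset by blast
 then obtain z where z: "z \<in> K" "!!y. y \<in> K ==> w y <= w z"
  using continuous_attains_sup[OF assms(4)] `x \<in> K` by (metis empty_iff)
 have wz: "w y <= w z" if "y \<in> D" for y
  using z(2)[of y] z(2)[OF `x \<in> K`] out[of y] a that by force
 have zD: "z \<in> D" using z assms(5) by blast
 obtain r where r: "r > 0" "cball z r \<subseteq> D" using `open D` zD open_contains_cball by blast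
 obtain h0 where h0: "h0 > 0" "!!h. 0 < h ==> h <= h0 ==> abs(Dlap h w z - h\<^sup>2 * lap w z) <= lap w z / 2 * h^2"
  using Dlap_laplacian[OF assms(1,2), of "{z}" "lap w z / 2"] zD lap[OF zD] by auto
 define h where "h = min h0 r"
 have h: "h > 0" "h <= h0" "h <= r" using h0 r by (auto simp: h_def)
 have "Dlap h w z <= 0"
  unfolding Dlap_def
 proof (rule sum_nonpos)
  fix i
  have "z + h *. i \<in> D" "z - h *. i \<in> D" using r(2) h by (auto simp: subset_iff)
  thus "w (z + h *. i) + w (z - h *. i) - 2 * w z <= 0" using wz[of "z + h *. i"] wz[of "z - h *. i"] by simp
 qed
 moreover have "Dlap h w z >= h^2 * lap w z - lap w z / 2 * h^2" using h0(2)[OF h(1,2)] by linarith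
 moreover have "h^2 * lap w z - lap w z / 2 * h^2 = h^2 * (lap w z / 2)" by (simp add: algebra_simps)
 moreover have "h^2 * (lap w z / 2) > 0" using h(1) lap[OF zD] by simp
 ultimately show False by linarith
qed

section \<open>The semilinear equation\<close>

lemma pds_cong:
 assumes "open U" "!!y. y \<in> U ==> f y = g y" "x \<in> U"
 shows "pds is f x = pds is g x"
 using assms(2)
proof (induction "is" arbitrary: f g)
 case (Cons i "is")
 have "pd i f y = pd i g y" if "y \<in> U" for y
  using pd_cong[OF assms(1) that Cons.prems] by simp
 thus ?case using Cons.IH[of "pd i f" "pd i g"] by simp
qed (use assms(3) in simp)

lemma pds_append: "pds (js @ [i]) f = pd i (pds js f)"
 by (induction js arbitrary: f) auto

lemma pds_cmult:
 assumes "open U" "smooth_in U f" "x \<in> U"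
 shows "pds is (%y. c * f y) x = c * pds is f x"
 using assms(2)
proof (induction "is" arbitrary: f)
 case (Cons i "is")
 have "pds is (pd i (%y. c * f y)) x = pds is (%y. c * pd i f y) x"
  by (rule pds_cong[OF assms(1) _ assms(3)]) (use pd_cmult smooth_in_diff[OF Cons.prems] in blast)
 thus ?case using Cons.IH[OF smooth_in_pd[OF Cons.prems]] by simp
qed simp

lemma laplacian_cong:
 assumes "open U" "!!y. y \<in> U ==> f y = g y" "x \<in> U"
 shows "lap f x = lap g x"
 unfolding lap_def
 by (rule sum.cong[OF refl]) (rule pd_cong[OF assms(1,3)], rule pd_cong[OF assms(1)], use assms(2) in auto)

lemma laplacian_add:
 assumes "open U" "smooth_in U f" "smooth_in U g" "x \<in> U"
 shows "lap (%x. f x + g x) x = lap f x + lap g x"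
proof -
 have "pd i (pd i (%x. f x + g x)) x
   = pd i (pd i f) x + pd i (pd i g) x" for i
 proof -
  have "pd i (pd i (%x. f x + g x)) x
    = pd i (%x. pd i f x + pd i g x) x"
   by (rule pd_cong[OF assms(1,4)]) (rule pd_add[OF smooth_in_diff[OF assms(2)] smooth_in_diff[OF assms(3)]])
  also have "... = pd i (pd i f) x + pd i (pd i g) x"
   by (rule pd_add[OF smooth_in_diff[OF smooth_in_pd[OF assms(2)] assms(4)] smooth_in_diff[OF smooth_in_pd[OF assms(3)] assms(4)]])
  finally show ?thesis .
 qed
 thus ?thesis by (simp add: lap_def sum.distrib)
qed

lemma laplacian_const [simp]: "lap (%x. c) x = 0"
 by (simp add: lap_def)

lemma pd_laplacian_commute:
 assumes "open U" "smooth_in U f" "x \<in> U"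
 shows "lap (pd i f) x = pd i (lap f) x"
proof -
 have "pd i (lap f) x = (\<Sum>j\<in>UNIV. pd i (pd j (pd j f)) x)"
  unfolding lap_def[abs_def]
  by (rule pd_sum) (auto intro!: smooth_in_diff[OF _ assms(3)] smooth_in_pd assms(2))
 also have "... = (\<Sum>j\<in>UNIV. pd j (pd j (pd i f)) x)"
 proof (rule sum.cong[OF refl])
  fix j
  have "pd i (pd j (pd j f)) x = pd j (pd i (pd j f)) x"
   by (rule pd_commute[OF assms(1) smooth_in_pd[OF assms(2)] assms(3)])
  also have "... = pd j (pd j (pd i f)) x"
   by (rule pd_cong[OF assms(1,3)]) (rule pd_commute[OF assms(1,2)])
  finally show "pd i (pd j (pd j f)) x = pd j (pd j (pd i f)) x" .
 qed
 finally show ?thesis by (simp add: lap_def)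
qed

lemma laplacian_pds:
 assumes "open U" "smooth_in U f" "x \<in> U"
 shows "lap (pds is f) x = pds is (lap f) x"
 using assms(2)
proof (induction "is" arbitrary: f)
 case (Cons i "is")
 have "lap (pds is (pd i f)) x = pds is (lap (pd i f)) x"
  by (rule Cons.IH[OF smooth_in_pd[OF Cons.prems]])
 also have "... = pds is (pd i (lap f)) x"
  by (rule pds_cong[OF assms(1) _ assms(3)]) (rule pd_laplacian_commute[OF assms(1) Cons.prems])
 finally show ?case by simp
qed simp

lemma smooth_in_sq: "open U ==> smooth_in U (%y. (y - a) \<bullet> (y - a))"
 unfolding inner_vec_def inner_real_def vector_minus_component
 by (intro smooth_in_sum smooth_in_mult smooth_in_diff_fun) auto

lemma laplacian_sq: "lap (%y::real^'n::finite. (y - a) \<bullet> (y - a)) x = 2 * real CARD('n)"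
proof -
 have "(%l. 4 ^ l * Dlap (1 / 2 ^ l) (%y. (y - a) \<bullet> (y - a)) x) \<longlonglongrightarrow> lap (%y. (y - a) \<bullet> (y - a)) x"
  by (rule Dlap_seq[of UNIV]) (auto intro: smooth_in_sq)
 moreover have "4 ^ l * Dlap (1 / 2 ^ l) (%y. (y - a) \<bullet> (y - a)) x = 2 * real CARD('n)" for l
 proof -
  have "(2::real) ^ l * 2 ^ l = 4 ^ l" by (simp flip: power_mult_distrib)
  thus ?thesis unfolding Dlap_sq by (simp add: power2_eq_square)
 qed
 ultimately show ?thesis by (simp add: LIMSEQ_const_iff)
qed

lemma laplacian_cmult:
 assumes "open U" "smooth_in U f" "x \<in> U"
 shows "lap (%y. c * f y) x = c * lap f x"
proof -
 have "pd i (pd i (%y. c * f y)) x = c * pd i (pd i f) x" for i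
  using pds_cmult[OF assms, of "[i,i]" c] by simp
 thus ?thesis by (simp add: lap_def sum_distrib_left)
qed

lemma vanishes_at_bdry_uminus: "vanishes_at_bdry \<Omega> v ==> vanishes_at_bdry \<Omega> (%x. - v x)"
 by (simp add: vanishes_at_bdry_def)

lemma vanishes_at_bdry_diff:
 assumes "vanishes_at_bdry \<Omega> u" "vanishes_at_bdry \<Omega> v"
 shows "vanishes_at_bdry \<Omega> (%x. u x - v x)"
 unfolding vanishes_at_bdry_def
proof (intro allI impI)
 fix e :: real assume "e > 0"
 hence "e / 2 > 0" by simp
 from assms(1)[unfolded vanishes_at_bdry_def, rule_format, OF this] assms(2)[unfolded vanishes_at_bdry_def, rule_format, OF this]
 obtain d1 d2 where d: "d1 > 0" "!!x. x \<in> \<Omega> - inner_part \<Omega> d1 ==> abs(u x) <= e / 2"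
   "d2 > 0" "!!x. x \<in> \<Omega> - inner_part \<Omega> d2 ==> abs(v x) <= e / 2"
  by blast
 have "abs(u x - v x) <= e" if "x \<in> \<Omega> - inner_part \<Omega> (min d1 d2)" for x
  using abs_diff_le[OF d(2)[of x] d(4)[of x]] that inner_part_mono[of "min d1 d2" d1 \<Omega>] inner_part_mono[of "min d1 d2" d2 \<Omega>]
  by auto
 thus "\<exists>\<delta>>0. \<forall>x\<in>\<Omega> - inner_part \<Omega> \<delta>. abs(u x - v x) <= e"
  using d(1,3) by (intro exI[of _ "min d1 d2"]) auto
qed

text \<open>Enlarging both the boundary bound and the bound for the Laplacian by \<open>e\<close>
  gives the strict inequality that \<open>max_principle\<close> asks for; then \<open>e\<close>
  tends to 0.\<close>

lemma dirichlet_estimate: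
 fixes \<Omega> :: "(real^'n::finite) set"
 assumes "open \<Omega>" "bounded \<Omega>" and R: "!!x. x \<in> \<Omega> ==> norm x + 1 <= R"
  and "smooth_in \<Omega> v" "vanishes_at_bdry \<Omega> v" and lap: "!!x. x \<in> \<Omega> ==> abs(lap v x) <= \<omega>" and "x \<in> \<Omega>"
 shows "abs(v x) <= \<omega> * R^2"
proof -
 let ?N = "real CARD('n)"
 have N: "?N >= 1" using zero_less_card_finite[where 'a='n] by linarith
 have om: "\<omega> >= 0" using lap[OF `x \<in> \<Omega>`] by simp
 have one: "v x <= \<omega> * R^2" if sm: "smooth_in \<Omega> v" and van: "vanishes_at_bdry \<Omega> v"
   and lap: "!!x. x \<in> \<Omega> ==> abs(lap v x) <= \<omega>" for v
 proof -
  have "v x <= e + (\<omega> + e) * R^2" if "e > 0" for e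
  proof -
   obtain \<delta> where d: "\<delta> > 0" "!!x. x \<in> \<Omega> - inner_part \<Omega> \<delta> ==> abs(v x) <= e"
    using van `e > 0` unfolding vanishes_at_bdry_def by blast
   define c where "c = \<omega> + e"
   have c: "c > 0" using om `e > 0` by (simp add: c_def)
   define q where "q y = c * ((y - 0) \<bullet> (y - 0)) + (- (e + c * R^2))" for y :: "real^'n"
   have smq: "smooth_in \<Omega> (%y. c * ((y - 0) \<bullet> (y - 0)))"
    by (intro smooth_in_mult smooth_in_sq assms(1)) auto
   have smq': "smooth_in \<Omega> q" unfolding q_def using smq by (intro smooth_in_add assms(1)) auto
   have lapq: "lap q y = c * (2 * ?N)" if "y \<in> \<Omega>" for y
    unfolding q_def using laplacian_add[OF assms(1) smq smooth_in_const that]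
     laplacian_cmult[OF assms(1) smooth_in_sq[OF assms(1)] that, of c 0] laplacian_sq[of 0 y] by simp
   have qle: "q y <= - e" if "y \<in> \<Omega>" for y
   proof -
    have "norm y <= R" using R[OF that] by simp
    hence "y \<bullet> y <= R^2" using power_mono[of "norm y" R 2] by (simp add: power2_norm_eq_inner)
    thus ?thesis using c by (simp add: q_def)
   qed
   have "v x + q x <= 0"
   proof (rule max_principle[OF assms(1) _ _ compact_inner_part[OF assms(2) d(1)] inner_part_subset[OF d(1)] _ `x \<in> \<Omega>`])
    show "smooth_in \<Omega> (%x. v x + q x)" by (rule smooth_in_add[OF assms(1) sm smq'])
    show "lap (%x. v x + q x) y > 0" if "y \<in> \<Omega>" for y
    proof -
     have "lap (%x. v x + q x) y = lap v y + c * (2 * ?N)"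
      using laplacian_add[OF assms(1) sm smq' that] lapq[OF that] by simp
     moreover have "c * 1 <= c * (2 * ?N)" using c N by (intro mult_left_mono) linarith+
     moreover have "lap v y >= - \<omega>" using lap[OF that] by linarith
     ultimately show ?thesis using `e > 0` by (simp add: c_def)
    qed
    show "v y + q y <= 0" if "y \<in> \<Omega> - inner_part \<Omega> \<delta>" for y
     using d(2)[OF that] qle[of y] that by auto
   qed
   moreover have "q x >= - (e + c * R^2)" using c by (simp add: q_def)
   ultimately show ?thesis by (simp add: c_def)
  qed
  moreover have "e + (\<omega> + e) * R^2 = \<omega> * R^2 + e * (1 + R^2)" for e by (simp add: algebra_simps)
  ultimately have a: "v x <= \<omega> * R^2 + e * (1 + R^2)" if "e > 0" for e using that by metis
  show ?thesis
  proof (rule field_le_epsilon)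
   fix e :: real assume "e > 0"
   have p: "1 + R^2 > 0" by (simp add: add_pos_nonneg)
   thus "v x <= \<omega> * R^2 + e" using a[of "e / (1 + R^2)"] `e > 0` by simp
  qed
 qed
 have "lap (%x. - v x) y = - lap v y" if "y \<in> \<Omega>" for y
  using laplacian_cmult[OF assms(1,4) that, of "-1"] by simp
 hence "- v x <= \<omega> * R^2" using assms lap
  by (intro one smooth_in_minus vanishes_at_bdry_uminus) auto
 moreover have "v x <= \<omega> * R^2" by (rule one) (use assms in auto)
 ultimately show ?thesis by linarith
qed

text \<open>All iterates are treated as one function of the pair \<open>(k, x)\<close>, so that the
  calculus of graded derivations yields bounds independent of \<open>k\<close>. Order
  \<open>m\<close> for the iterates gives order \<open>m\<close> for the right sides, and
  \<open>interior_gradient\<close> then supplies the next order.\<close>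

lemma uniform_bounds:
 fixes u :: "nat => real^'n::finite => real"
 assumes "open \<Omega>" and sm: "!!k. smooth_in \<Omega> (u k)"
  and F: "!!j t. t \<in> J ==> (Fs j has_real_derivative Fs (Suc j) t) (at t)"
  and J: "compact J'" "J' \<subseteq> J" "!!k x. x \<in> \<Omega> ==> u k x \<in> J'"
  and eq: "!!k x. x \<in> \<Omega> ==> lap (u (Suc k)) x = c * Fs 0 (u k x)"
  and K: "compact K" "K \<subseteq> \<Omega>"
 shows "\<exists>C>0. \<forall>k. \<forall>x\<in>K. abs(pds is (u k) x) <= C"
proof -
 define D where "D = (%i f. %(k::nat, x). pd i (%y. f (k, y)) (x::real^'n))"
 define A where "A = {f :: nat \<times> (real^'n) => real. \<forall>k. smooth_in \<Omega> (%y. f (k, y))}"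
 define P where "P = (%(\<beta>::real) (f :: nat \<times> (real^'n) => real). \<forall>K. compact K & K \<subseteq> \<Omega> --> (\<exists>C. \<forall>k. \<forall>x\<in>K. abs(f (k, x)) <= C))"
 have PD: "\<exists>C. \<forall>k. \<forall>x\<in>K. abs(f (k, x)) <= C" if "P \<beta> f" "compact K & K \<subseteq> \<Omega>" for \<beta> f K
  using that by (simp add: P_def)
 interpret G: graded_derivations "UNIV \<times> \<Omega>" A D P 0 UNIV
 proof
  fix f g :: "nat \<times> (real^'n) => real" and i x
  show "f \<in> A ==> D i f \<in> A" by (auto simp: A_def D_def intro: smooth_in_pd)
  show "f \<in> A ==> g \<in> A ==> (%x. f x * g x) \<in> A" using assms(1) by (auto simp: A_def intro: smooth_in_mult)
  show "(!!x. x \<in> UNIV \<times> \<Omega> ==> f x = g x) ==> x \<in> UNIV \<times> \<Omega> ==> D i f x = D i g x"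
   by (auto simp: D_def intro!: pd_cong[OF assms(1)])
  show "f \<in> A ==> g \<in> A ==> x \<in> UNIV \<times> \<Omega> ==> D i (%x. f x + g x) x = D i f x + D i g x"
   by (auto simp: D_def A_def intro!: pd_add intro: smooth_in_diff)
  show "f \<in> A ==> g \<in> A ==> x \<in> UNIV \<times> \<Omega> ==> D i (%x. f x * g x) x = D i f x * g x + f x * D i g x"
   by (auto simp: D_def A_def intro!: pd_mult intro: smooth_in_diff)
  fix \<beta> \<gamma> :: real
  show "P \<beta> g" if eq: "!!x. x \<in> UNIV \<times> \<Omega> ==> f x = g x" and pf: "P \<beta> f"
   unfolding P_def
  proof (intro allI impI)
   fix K assume K: "compact K & K \<subseteq> \<Omega>"
   from PD[OF pf K] obtain C where "\<forall>k. \<forall>x\<in>K. abs(f (k, x)) <= C" by blast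
   moreover have "f (k, x) = g (k, x)" if "x \<in> K" for k x using eq[of "(k, x)"] K that by auto
   ultimately show "\<exists>C. \<forall>k. \<forall>x\<in>K. abs(g (k, x)) <= C" by auto
  qed
  show "P \<beta> (%x. f x + g x)" if fg: "P \<beta> f" "P \<beta> g"
   unfolding P_def
  proof (intro allI impI)
   fix K assume K: "compact K & K \<subseteq> \<Omega>"
   from PD[OF fg(1) K] PD[OF fg(2) K] obtain C1 C2 where C: "\<forall>k. \<forall>x\<in>K. abs(f (k, x)) <= C1" "\<forall>k. \<forall>x\<in>K. abs(g (k, x)) <= C2"
    by blast
   have "abs(f (k, x) + g (k, x)) <= C1 + C2" if "x \<in> K" for k x
    by (rule order_trans[OF abs_triangle_ineq add_mono]) (use C that in auto)
   thus "\<exists>C. \<forall>k. \<forall>x\<in>K. abs(f (k, x) + g (k, x)) <= C" by blast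
  qed
  show "P (\<beta> + \<gamma>) (%x. f x * g x)" if fg: "P \<beta> f" "P \<gamma> g"
   unfolding P_def
  proof (intro allI impI)
   fix K assume K: "compact K & K \<subseteq> \<Omega>"
   from PD[OF fg(1) K] PD[OF fg(2) K] obtain C1 C2 where C: "\<forall>k. \<forall>x\<in>K. abs(f (k, x)) <= C1" "\<forall>k. \<forall>x\<in>K. abs(g (k, x)) <= C2"
    by blast
   have "abs(f (k, x) * g (k, x)) <= C1 * C2" if "x \<in> K" for k x
    unfolding abs_mult using C that by (intro mult_mono) (auto intro: order_trans[OF abs_ge_zero])
   thus "\<exists>C. \<forall>k. \<forall>x\<in>K. abs(f (k, x) * g (k, x)) <= C" by blast
  qed
 qed
 define W where "W = (%(k, x). u k x)"
 have Ds: "G.Ds is f (k, x) = pds is (%y. f (k, y)) x" for "is" f k x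
 proof (induction "is" arbitrary: f)
  case (Cons i "is")
  have "(%y. D i f (k, y)) = pd i (%y. f (k, y))" by (simp add: D_def)
  thus ?case using Cons[of "D i f"] by simp
 qed simp
 have WA: "W \<in> A" using sm by (simp add: A_def W_def)
 have FA: "(%x. Fs j (W x)) \<in> A" for j
  unfolding A_def W_def
  using smooth_in_compose_real[where Fs = Fs and J = J and U = \<Omega> and j = j, OF assms(1) F _ sm] J(2,3) by auto
 have FP: "P 0 (%x. Fs j (W x))" for j
 proof -
  have "continuous_on J' (Fs j)" using F J(2) DERIV_isCont by (meson continuous_at_imp_continuous_on subsetD)
  hence "bounded (Fs j ` J')" using J(1) compact_continuous_image compact_imp_bounded by blast
  then obtain C where "\<forall>y\<in>Fs j ` J'. norm y <= C" unfolding bounded_iff by blast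
  thus ?thesis unfolding P_def W_def using J(3) by (intro allI impI exI[of _ C]) auto
 qed
 have FD: "D k (%x. Fs j (W x)) x = Fs (Suc j) (W x) * D k W x" if xD: "x \<in> UNIV \<times> \<Omega>" for j k x
 proof -
  obtain n y where x: "x = (n, y)" "y \<in> \<Omega>" using xD by auto
  have "(Fs j has_real_derivative Fs (Suc j) (u n y)) (at (u n y))" using F J(2,3) x(2) by blast
  from pd_compose_real(1)[OF this smooth_in_diff[OF sm x(2)], of k] show ?thesis by (simp add: D_def W_def x(1))
 qed
 have main: "G.cls m 0 W" for m
 proof (induction m)
  case 0
  have "bounded J'" using J(1) compact_imp_bounded by blast
  then obtain C where "\<forall>y\<in>J'. norm y <= C" unfolding bounded_iff by blast
  hence "P 0 W" unfolding P_def W_def using J(3) by (intro allI impI exI[of _ C]) auto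
  thus ?case by simp
 next
  case (Suc m)
  have clsF: "G.cls m 0 (%x. Fs 0 (W x))"
   by (rule G.cls_compose[where Fs = Fs and u = W]) (use WA Suc FA FP FD in auto)
  show ?case
   unfolding G.cls_iff_Ds
  proof (intro allI impI)
   fix ks :: "'n list" assume len: "length ks <= Suc m"
   show "P (0 - 0 * real (length ks)) (G.Ds ks W)"
   proof (cases "length ks <= m")
    case True
    thus ?thesis using Suc unfolding G.cls_iff_Ds by simp
   next
    case False
    then obtain js i where ks: "ks = js @ [i]" "length js = m"
     using len by (cases ks rule: rev_cases) auto
    have P1: "P 0 (G.Ds js W)" using Suc ks(2) unfolding G.cls_iff_Ds by force
    have P2: "P 0 (G.Ds js (%x. Fs 0 (W x)))" using clsF ks(2) unfolding G.cls_iff_Ds by force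
    show ?thesis
     unfolding P_def
    proof (intro allI impI)
     fix K assume K: "compact K & K \<subseteq> \<Omega>"
     obtain e K' where e: "e > 0" "compact K'" "K' \<subseteq> \<Omega>" "!!x. x \<in> K ==> cball x e \<subseteq> K'"
      using compact_enlarge[of K \<Omega>] K assms(1) by metis
     obtain C1 where C1: "!!k x. x \<in> K' ==> abs(pds js (u k) x) <= C1"
      using PD[OF P1, of K'] e(2,3) unfolding Ds W_def by auto
     obtain C2 where C2: "!!k x. x \<in> K' ==> abs(pds js (%y. Fs 0 (u k y)) x) <= C2"
      using PD[OF P2, of K'] e(2,3) unfolding Ds W_def by auto
     obtain C3 where C3: "!!x. x \<in> K ==> abs(pds ks (u 0) x) <= C3"
      using pds_bounded[OF sm, of K ks] K by blast
     have "abs(pds ks (u k) x) <= max C3 (Cg TYPE('n) * (C1 / e + e * (abs(c) * C2)))" if x: "x \<in> K" for k x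
     proof (cases k)
      case 0
      thus ?thesis using C3[OF x] by simp
     next
      case (Suc k')
      have "abs(pd i (pds js (u k)) x) <= Cg TYPE('n) * (C1 / e + e * (abs(c) * C2))"
      proof (rule interior_gradient[OF assms(1) smooth_in_pds[OF sm]])
       show "cball x e \<subseteq> \<Omega>" using e(3) e(4)[OF x] by blast
       fix y assume y: "y \<in> cball x e"
       hence yK: "y \<in> K'" "y \<in> \<Omega>" using e(3) e(4)[OF x] by auto
       have "lap (pds js (u k)) y = pds js (lap (u k)) y"
        by (rule laplacian_pds[OF assms(1) sm yK(2)])
       also have "... = pds js (%z. c * Fs 0 (u k' z)) y"
        by (rule pds_cong[OF assms(1) _ yK(2)]) (use eq Suc in auto)
       also have "... = c * pds js (%z. Fs 0 (u k' z)) y"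
        by (rule pds_cmult[OF assms(1) _ yK(2)]) (use FA[of 0] in "simp add: A_def W_def")
       finally have "abs(lap (pds js (u k)) y) <= abs(c) * C2"
        using C2[OF yK(1), of k'] by (simp add: abs_mult mult_left_mono)
       thus "abs(pds js (u k) y) <= C1 & abs(lap (pds js (u k)) y) <= abs(c) * C2"
        using C1[OF yK(1)] by blast
      qed (use e in auto)
      thus ?thesis unfolding ks(1) pds_append by simp
     qed
     thus "\<exists>C. \<forall>k. \<forall>x\<in>K. abs(G.Ds ks W (k, x)) <= C"
      unfolding Ds W_def by auto
    qed
   qed
  qed
 qed
 have "P 0 (G.Ds is W)" using main[of "length is"] unfolding G.cls_iff_Ds by force
 from PD[OF this, of K] K obtain C where C: "!!k x. x \<in> K ==> abs(pds is (u k) x) <= C"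
  unfolding Ds W_def by auto
 have "abs(pds is (u k) x) <= abs(C) + 1" if "x \<in> K" for k x
  using C[of x k] that by linarith
 thus ?thesis by (intro exI[of _ "abs(C) + 1"]) auto
qed

text \<open>Makes the limit theorem for grid functions available for the iterates of the semilinear
  equation, which are smooth already.\<close>

lemma pds_bounds_ubdd:
 fixes u :: "nat => real^'n::finite => real"
 assumes "open \<Omega>" and sm: "!!k. smooth_in \<Omega> (u k)"
  and bd: "!!is K. compact K ==> K \<subseteq> \<Omega> ==> \<exists>C>0. \<forall>k. \<forall>x\<in>K. abs(pds is (u k) x) <= C"
 shows "ubdd \<Omega> u"
 unfolding ubdd_def
proof (intro allI impI, elim conjE)
 fix "is" :: "'n list" and K :: "(real^'n) set" assume K: "compact K" "K \<subseteq> \<Omega>"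
 obtain e K' where e: "e > 0" "compact K'" "K' \<subseteq> \<Omega>" "!!x. x \<in> K ==> cball x e \<subseteq> K'"
  using compact_enlarge[OF K(1) assms(1) K(2)] by metis
 obtain C where C: "C > 0" "!!k x. x \<in> K' ==> abs(pds is (u k) x) <= C" using bd[OF e(2,3), of "is"] by blast
 define \<eta> where "\<eta> = e / (real (length is) + 1)"
 have "abs(dlts (zip is ts) (u k) x) <= C * prod_list ts"
  if x: "x \<in> K" and ts: "length ts = length is" "\<forall>t\<in>set ts. 0 < t & t <= \<eta>" for k x ts
 proof -
  have "sum_list ts <= real (length ts) * \<eta>" using ts by (intro sum_list_le_length) auto
  also have "... <= (real (length is) + 1) * (e / (real (length is) + 1))" unfolding ts(1)
   using e(1) by (intro mult_mono) (auto simp: \<eta>_def)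
  also have "... = e"
  proof -
   have q: "c * (e / c) = e" if "c > 0" for c :: real using that by simp
   show ?thesis by (rule q) (simp add: add_nonneg_pos)
  qed
  finally have sum: "sum_list ts <= e" .
  have "abs(dlts (zip is ts) (u k) x) <= C * prod_list (map snd (zip is ts))"
  proof (rule dlts_bound[OF sm])
   show "snd p > 0" if "p \<in> set (zip is ts)" for p
    using that ts(2) set_zip_rightD[of "fst p" "snd p" "is" ts] by auto
   fix y assume "dist x y <= sum_list (map snd (zip is ts))"
   hence "y \<in> K'" using e(4)[OF x] sum by (auto simp: map_snd_zip'[OF ts(1)] subset_iff)
   thus "y \<in> \<Omega> & abs(pds (map fst (zip is ts)) (u k) y) <= C"
    using e(3) C(2) ts(1) by (auto simp: map_fst_zip)
  qed
  thus ?thesis by (simp add: map_snd_zip'[OF ts(1)])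
 qed
 thus "\<exists>C \<eta> k0. \<eta> > 0 & C > 0 \<and>
   (\<forall>k\<ge>k0. \<forall>x\<in>K. \<forall>ts. length ts = length is --> grid_steps k \<eta> ts -->
    abs(dlts (zip is ts) (u k) x) <= C * prod_list ts)"
  using C(1) e(1) by (intro exI[of _ C] exI[of _ \<eta>] exI[of _ 0]) (auto simp: \<eta>_def add_nonneg_pos)
qed

lemma laplacian_diff:
 assumes "open U" "smooth_in U f" "smooth_in U g" "x \<in> U"
 shows "lap (%x. f x - g x) x = lap f x - lap g x"
proof -
 have "lap (%x. f x + (-1) * g x) x = lap f x + lap (%x. (-1) * g x) x"
  by (rule laplacian_add[OF assms(1,2) smooth_in_mult[OF assms(1) smooth_in_const assms(3)] assms(4)])
 thus ?thesis unfolding laplacian_cmult[OF assms(1,3,4)] by simp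
qed

text \<open>Picard iteration starting from 1. Smallness of \<open>c\<close> is used twice: the
  values stay in \<open>[1/2, 3/2]\<close>, and consecutive differences halve. The open interval
  \<open>(1/4, 2)\<close> gives two-sided derivatives also at the end points of the smaller
  one.\<close>

theorem semilinear:
 fixes \<Omega> :: "(real^'n::finite) set" and Fs :: "nat => real => real"
 assumes "open \<Omega>" "bounded \<Omega>" and ldf: "!!p. p \<in> frontier \<Omega> ==> \<exists>U s. ldf \<Omega> p U s"
  and F: "!!j t. t \<in> {1/4<..<2} ==> (Fs j has_real_derivative Fs (Suc j) t) (at t)"
 shows "\<exists>c0>0. \<forall>c. abs(c) <= c0 --> (\<exists>u. smooth_in \<Omega> u \<and>
  (\<forall>x\<in>\<Omega>. u x \<in> {1/2..3/2} & lap u x = c * Fs 0 (u x)) & vanishes_at_bdry \<Omega> (%x. u x - 1))"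
proof -
 let ?J = "{1/4<..<2::real}" and ?J' = "{1/2..3/2::real}"
 have JJ: "?J' \<subseteq> ?J" by auto
 obtain b where b: "b > 0" "!!x. x \<in> \<Omega> ==> norm x <= b" using assms(2) unfolding bounded_pos by blast
 define R where "R = b + 1"
 have R: "norm x + 1 <= R" if "x \<in> \<Omega>" for x using b(2)[OF that] by (simp add: R_def)
 have "R > 0" using b by (simp add: R_def)
 have bdF: "\<exists>M>0. \<forall>t\<in>?J'. abs(Fs j t) <= M" for j
 proof -
  have "continuous_on ?J' (Fs j)"
   by (rule continuous_at_imp_continuous_on, rule ballI, rule DERIV_isCont[OF F]) auto
  hence "bounded (Fs j ` ?J')" using compact_continuous_image compact_Icc compact_imp_bounded by blast
  then obtain M where "M > 0" "\<forall>y\<in>Fs j ` ?J'. norm y <= M" unfolding bounded_pos by blast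
  thus ?thesis by (intro exI[of _ M]) auto
 qed
 obtain M0 where M0: "M0 > 0" "!!t. t \<in> ?J' ==> abs(Fs 0 t) <= M0" using bdF[of 0] by blast
 obtain M1 where M1: "M1 > 0" "!!t. t \<in> ?J' ==> abs(Fs (Suc 0) t) <= M1" using bdF[of "Suc 0"] by blast
 have lip: "abs(Fs 0 a - Fs 0 b) <= M1 * abs(a - b)" if "a \<in> ?J'" "b \<in> ?J'" for a b
 proof -
  have "norm (Fs 0 a - Fs 0 b) <= M1 * norm (a - b)"
  proof (rule field_differentiable_bound[of ?J' "Fs 0" "Fs (Suc 0)"])
   show "(Fs 0 has_field_derivative Fs (Suc 0) z) (at z within ?J')" if "z \<in> ?J'" for z
    by (rule has_field_derivative_at_within[OF F]) (use that in auto)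
  qed (use M1 that in auto)
  thus ?thesis by simp
 qed
 \<comment> \<open>\<open>M0\<close> bounds the right side and thereby the distance from 1,
   \<open>M1\<close> is its Lipschitz constant, and R^2 is the constant of the linear problem; both
   products come out at most 1/2.\<close>
 define c0 where "c0 = 1 / (2 * (M0 + M1) * R^2)"
 have c0: "c0 > 0" using M0 M1 `R > 0` by (simp add: c0_def add_pos_pos)
 have "\<exists>u. smooth_in \<Omega> u & (\<forall>x\<in>\<Omega>. u x \<in> ?J' & lap u x = c * Fs 0 (u x)) & vanishes_at_bdry \<Omega> (%x. u x - 1)"
  if c: "abs(c) <= c0" for c
 proof -
  have cM: "abs(c) * (M0 + M1) * R^2 <= 1/2"
  proof -
   have "abs(c) * ((M0 + M1) * R^2) <= c0 * ((M0 + M1) * R^2)" using c M0 M1 by (intro mult_right_mono) auto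
   also have "... = 1/2" using M0 M1 `R > 0` by (simp add: c0_def)
   finally show ?thesis by (simp add: mult.assoc)
  qed
  have cM0: "abs(c) * M0 * R^2 <= 1/2" and cM1: "abs(c) * M1 * R^2 <= 1/2"
  proof -
   have "abs(c) * M0 * R^2 <= abs(c) * (M0 + M1) * R^2" "abs(c) * M1 * R^2 <= abs(c) * (M0 + M1) * R^2"
    using M0 M1 by (auto intro!: mult_right_mono mult_left_mono)
   thus "abs(c) * M0 * R^2 <= 1/2" "abs(c) * M1 * R^2 <= 1/2" using cM by auto
  qed
  define P where "P u \<longleftrightarrow> smooth_in \<Omega> u & (\<forall>x\<in>\<Omega>. u x \<in> ?J') & vanishes_at_bdry \<Omega> (%x. u x - 1)" for u
  define Q where "Q u u' \<longleftrightarrow> (\<forall>x\<in>\<Omega>. lap u' x = c * Fs 0 (u x))" for u u'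
  have "\<exists>f. \<forall>n::nat. P (f n) & Q (f n) (f (Suc n))"
  proof (rule dependent_nat_choice)
   have "P (%x. 1)" by (auto simp: P_def vanishes_at_bdry_def intro: exI[of _ 1])
   thus "\<exists>u. P u" by (rule exI[of P])
   fix u and n :: nat assume u: "P u"
   have uJ: "u ` \<Omega> \<subseteq> ?J" using u JJ unfolding P_def by blast
   have sm: "smooth_in \<Omega> (%x. c * Fs 0 (u x))"
    using smooth_in_compose_real[where Fs = Fs and J = ?J and U = \<Omega> and j = 0, OF assms(1) F uJ] u
    by (intro smooth_in_mult assms(1)) (auto simp: P_def)
   have bd: "abs(c * Fs 0 (u x)) <= abs(c) * M0" if "x \<in> \<Omega>" for x
    using M0(2)[of "u x"] u that by (auto simp: P_def abs_mult intro: mult_left_mono)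
   obtain v where v: "smooth_in \<Omega> v" "!!x. x \<in> \<Omega> ==> lap v x = c * Fs 0 (u x)"
     "!!x. x \<in> \<Omega> ==> abs(v x) <= abs(c) * M0 * R^2" "vanishes_at_bdry \<Omega> v"
    using dirichlet[OF assms(1,2) ldf sm bd _ R] M0(1) by auto
   have "P (%x. 1 + v x)"
   proof -
    have "1 + v x \<in> ?J'" if "x \<in> \<Omega>" for x using v(3)[OF that] cM0 by auto
    moreover have "smooth_in \<Omega> (%x. 1 + v x)" by (intro smooth_in_add assms(1) v(1)) auto
    ultimately show ?thesis using v(4) by (simp add: P_def)
   qed
   moreover have "Q u (%x. 1 + v x)"
    using laplacian_add[OF assms(1) smooth_in_const v(1)] v(2) by (simp add: Q_def)
   ultimately show "\<exists>u'. P u' & Q u u'" by blast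
  qed
  then obtain u where uP: "!!n. P (u n)" and uQ: "!!n. Q (u n) (u (Suc n))" by blast
  have sm: "smooth_in \<Omega> (u n)" and uJ: "x \<in> \<Omega> ==> u n x \<in> ?J'" and van: "vanishes_at_bdry \<Omega> (%x. u n x - 1)" for n x
   using uP[of n] by (auto simp: P_def)
  have eq: "lap (u (Suc n)) x = c * Fs 0 (u n x)" if "x \<in> \<Omega>" for n x using uQ[of n] that by (simp add: Q_def)
  have vand: "vanishes_at_bdry \<Omega> (%x. u n x - u m x)" for n m
   using vanishes_at_bdry_diff[OF van van, of n m] by simp
  have contr: "abs(u n x - u (Suc n) x) <= 1 / 2 ^ n" if "x \<in> \<Omega>" for n x
   using that
  proof (induction n arbitrary: x)
   case 0
   thus ?case using uJ[of x 0] uJ[of x "Suc 0"] by auto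
  next
   case (Suc n)
   have "abs(u (Suc n) x - u (Suc (Suc n)) x) <= (abs(c) * M1 / 2 ^ n) * R^2"
   proof (rule dirichlet_estimate[OF assms(1,2) R _ vand _ Suc.prems])
    show "smooth_in \<Omega> (%x. u (Suc n) x - u (Suc (Suc n)) x)" by (intro smooth_in_diff_fun assms(1) sm)
    fix y assume y: "y \<in> \<Omega>"
    have "lap (%x. u (Suc n) x - u (Suc (Suc n)) x) y = lap (u (Suc n)) y - lap (u (Suc (Suc n))) y"
     by (rule laplacian_diff[OF assms(1) sm sm y])
    also have "... = c * (Fs 0 (u n y) - Fs 0 (u (Suc n) y))" by (simp add: eq[OF y] algebra_simps)
    also have "abs(...) <= abs(c) * (M1 * (1 / 2 ^ n))"
     unfolding abs_mult using lip[OF uJ uJ, OF y y, of n "Suc n"] Suc.IH[OF y] M1(1)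
     by (intro mult_left_mono order_trans[OF lip[OF uJ uJ, OF y y]]) auto
    finally show "abs(lap (%x. u (Suc n) x - u (Suc (Suc n)) x) y) <= abs(c) * M1 / 2 ^ n" by simp
   qed
   also have "... = (abs(c) * M1 * R^2) / 2 ^ n" by simp
   also have "... <= (1/2) / 2 ^ n" using cM1 by (intro divide_right_mono) auto
   finally show ?case by simp
  qed
  define v where "v x = lim (%n. u n x)" for x
  have close: "abs(u n x - v x) <= 2 / 2 ^ n" if "x \<in> \<Omega>" for n x
  proof -
   have "abs(u n x - lim (%n. u n x)) <= 2 * 1 / 2 ^ n"
    by (rule geometric_limit(2)[of 0 "%n. u n x" 1]) (use contr[OF that] in auto)
   thus ?thesis by (simp add: v_def)
  qed
  have lim: "(%n. u n x) \<longlonglongrightarrow> v x" if "x \<in> \<Omega>" for x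
  proof -
   have "convergent (%n. u n x)"
    by (rule geometric_limit(1)[of 0 "%n. u n x" 1]) (use contr[OF that] in auto)
   thus ?thesis by (simp add: v_def convergent_LIMSEQ_iff)
  qed
  have small: "\<exists>n. \<forall>k\<ge>n. 2 / 2 ^ k <= e" if "e > 0" for e :: real
   using pow2_small[of "e / 2"] that by (auto simp: field_simps)
  have vJ: "v x \<in> ?J'" if "x \<in> \<Omega>" for x
  proof -
   have "closed ?J'" by simp
   thus ?thesis using closed_sequentially[of ?J' "%n. u n x" "v x"] uJ[OF that] lim[OF that] by blast
  qed
  have contv: "continuous_on \<Omega> v"
  proof (rule uniform_limit_theorem[where F = sequentially and f = u])
   show "\<forall>\<^sub>F n in sequentially. continuous_on \<Omega> (u n)" using smooth_in_continuous[OF sm] by simp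
   show "uniform_limit \<Omega> u v sequentially"
   proof (rule uniform_limitI)
    fix e :: real assume "e > 0"
    then obtain n where n: "!!k. k >= n ==> 2 / 2 ^ k <= e / 2" using small[of "e/2"] by auto
    have "dist (u k x) (v x) < e" if "k >= n" "x \<in> \<Omega>" for k x
     using close[OF that(2), of k] n[OF that(1)] `e > 0` by (simp add: dist_real_def)
    thus "\<forall>\<^sub>F n in sequentially. \<forall>x\<in>\<Omega>. dist (u n x) (v x) < e" by (auto simp: eventually_sequentially)
   qed
  qed simp
  have bounds: "\<exists>C>0. \<forall>k. \<forall>x\<in>K. abs(pds is (u k) x) <= C" if "compact K" "K \<subseteq> \<Omega>" for "is" K
   
   using uniform_bounds[where J = ?J and J' = ?J' and Fs = Fs and c = c and u = u and \<Omega> = \<Omega> and K = K] assms(1) sm F JJ uJ eq that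
   by blast
  have ub: "ubdd \<Omega> u" by (rule pds_bounds_ubdd[where u = u]) (use assms(1) sm bounds in blast)+
  \<comment> \<open>The iterates solve no discrete equation. Uniform fourth derivative bounds
    replace \<open>Dlap\<close> by the Laplacian up to an error tending to 0, and the Laplacians
    converge by the recursion.\<close>
  have lim4: "(%k. 4 ^ k * Dlap (1/2^k) (u k) x) \<longlonglongrightarrow> c * Fs 0 (v x)" if x: "x \<in> \<Omega>" for x
  proof -
   obtain r where r: "r > 0" "cball x r \<subseteq> \<Omega>" using x assms(1) open_contains_cball by blast
   have "\<exists>C>0. \<forall>k. \<forall>y\<in>cball x r. abs(pds [i,i,i,i] (u k) y) <= C" for i
    by (rule bounds[OF compact_cball r(2)])
   then obtain C where C: "!!i. C i > 0" "!!i k y. y \<in> cball x r ==> abs(pds [i,i,i,i] (u k) y) <= C i" by metis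
   define C' where "C' = Max (range C)"
   have C': "C' > 0" "!!i. C i <= C'" using C(1) by (auto simp: C'_def Max_gr_iff)
   have "0 < r / 8" using r by simp
   then obtain m where m: "!!k. k >= m ==> 1 / 2 ^ k <= r / 8" using pow2_small by blast
   have near: "abs(4 ^ k * Dlap (1/2^k) (u k) x - lap (u k) x) <= real CARD('n) * C' * (1/4) ^ k" if "k >= m" for k
   proof -
    have "abs(4 ^ k * Dlap (1/2^k) (u k) x - lap (u k) x) <= real CARD('n) * C' / 4 ^ k"
    proof (rule Dlap_laplacian_rate[OF assms(1) sm r(2,1)])
     show "abs(pds [i,i,i,i] (u k) y) <= C'" if "y \<in> cball x r" for i y
      using C(2)[OF that, of i k] C'(2)[of i] by linarith
    qed (use C' m[OF that] in auto)
    thus ?thesis by (simp add: power_one_over)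
   qed
   have z: "(%k. real CARD('n) * C' * (1/4) ^ k) \<longlonglongrightarrow> 0"
    using tendsto_mult_left[OF LIMSEQ_power_zero[of "1/4::real"], of "real CARD('n) * C'"] by simp
   have "(%k. 4 ^ k * Dlap (1/2^k) (u k) x - lap (u k) x) \<longlonglongrightarrow> 0"
    by (rule Lim_null_comparison[OF _ z]) (use near in "auto simp: eventually_sequentially")
   moreover have "(%k. lap (u k) x) \<longlonglongrightarrow> c * Fs 0 (v x)"
   proof -
    have "isCont (Fs 0) (v x)" by (rule DERIV_isCont[OF F]) (use vJ[OF x] in auto)
    hence "(%k. c * Fs 0 (u k x)) \<longlonglongrightarrow> c * Fs 0 (v x)"
     by (intro tendsto_mult_left isCont_tendsto_compose[OF _ lim[OF x]])
    hence "(%k. lap (u (Suc k)) x) \<longlonglongrightarrow> c * Fs 0 (v x)" by (simp add: eq[OF x])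
    thus ?thesis by (rule LIMSEQ_imp_Suc)
   qed
   ultimately have "(%k. (4 ^ k * Dlap (1/2^k) (u k) x - lap (u k) x) + lap (u k) x) \<longlonglongrightarrow> 0 + c * Fs 0 (v x)"
    by (rule tendsto_add)
   thus ?thesis by simp
  qed
  have "vanishes_at_bdry \<Omega> (%x. v x - 1)"
   unfolding vanishes_at_bdry_def
  proof (intro allI impI)
   fix e :: real assume "e > 0"
   hence e2: "e / 2 > 0" by simp
   from small[OF e2] obtain n where n: "2 / 2 ^ n <= e / 2" by blast
   from van[of n, unfolded vanishes_at_bdry_def, rule_format, OF e2]
   obtain \<delta> where d: "\<delta> > 0" "!!x. x \<in> \<Omega> - inner_part \<Omega> \<delta> ==> abs(u n x - 1) <= e / 2" by blast
   have "abs(v x - 1) <= e" if "x \<in> \<Omega> - inner_part \<Omega> \<delta>" for x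
   proof -
    have "abs(u n x - v x) <= e / 2" using close[of x n] n that by auto
    thus ?thesis using d(2)[OF that] by linarith
   qed
   thus "\<exists>\<delta>>0. \<forall>x\<in>\<Omega> - inner_part \<Omega> \<delta>. abs(v x - 1) <= e" using d(1) by blast
  qed
  thus ?thesis
   using ubdd_limit_laplacian[OF assms(1) ub lim contv lim4] vJ by blast
 qed
 thus ?thesis using c0 by blast
qed

section \<open>Scalar curvature of conformally flat metrics\<close>

lemma matrix_inv_scaled:
 fixes c :: real
 assumes "c ~= 0"
 shows "matrix_inv (c *\<^sub>R (mat 1 :: real^'n^'n)) = inverse c *\<^sub>R mat 1"
proof -
 let ?A = "c *\<^sub>R (mat 1 :: real^'n^'n)" and ?B = "inverse c *\<^sub>R (mat 1 :: real^'n^'n)"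
 have AB: "?A ** ?B = mat 1" "?B ** ?A = mat 1"
 proof -
  show "?A ** ?B = mat 1" "?B ** ?A = mat 1"
   using assms by (simp_all add: matrix_scalar_ac flip: scalar_matrix_assoc)
 qed
 hence "invertible ?A" unfolding invertible_def by blast
 hence "?A ** matrix_inv ?A = mat 1"
  unfolding matrix_inv_def invertible_def by (rule someI2_ex) simp
 hence "(?B ** ?A) ** matrix_inv ?A = ?B" by (simp flip: matrix_mul_assoc)
 thus ?thesis using AB(2) by simp
qed


definition kd :: "'n => 'n => real" where
 "kd i j = (if i = j then 1 else 0)"

lemma kd_sum:
 fixes f :: "'n::finite => real"
 shows "(\<Sum>i\<in>UNIV. kd a i * f i) = f a" "(\<Sum>i\<in>UNIV. kd i a * f i) = f a"
  "(\<Sum>i\<in>UNIV. f i * kd a i) = f a" "(\<Sum>i\<in>UNIV. f i * kd i a) = f a"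
 by (simp_all add: kd_def if_distrib if_distribR sum.delta sum.delta' cong: if_cong)

lemma kd_sum2:
 fixes f :: "'n::finite => real"
 shows "(\<Sum>i\<in>UNIV. c * (kd a i * f i)) = c * f a" "(\<Sum>i\<in>UNIV. c * (kd i a * f i)) = c * f a"
 by (simp_all add: kd_sum flip: sum_distrib_left)

lemma christoffel_conformal:
 fixes f :: "real^'n::finite => real"
 assumes "f differentiable (at x)"
 shows "christoffel (conformal_change f flat_metric) k i j x
  = kd j k * pd i f x + kd i k * pd j f x - kd i j * pd k f x"
proof -
 let ?g = "conformal_change f flat_metric"
 have comp: "(%y. ?g y $ a $ b) = (%y. kd a b * exp (2 * f y))" for a b
  by (rule ext) (simp add: conformal_change_def flat_metric_def mat_def kd_def)
 have d2: "(%y. 2 * f y) differentiable (at x)" using assms by simp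
 have e: "pd l (%y. exp (2 * f y)) x = exp (2 * f x) * (2 * pd l f x)"
   "(%y. exp (2 * f y)) differentiable (at x)" for l
  using pd_compose_real(1)[OF DERIV_exp d2, of l] pd_compose_real(2)[OF DERIV_exp d2] pd_cmult[OF assms, of l 2] by auto
 have pdg: "pd l (%y. ?g y $ a $ b) x = kd a b * (exp (2 * f x) * (2 * pd l f x))" for l a b
  unfolding comp using pd_cmult[OF e(2), of l "kd a b"] e(1) by simp
 have inv: "matrix_inv (?g x) $ k $ l = inverse (exp (2 * f x)) * kd k l" for l
  unfolding conformal_change_def flat_metric_def by (subst matrix_inv_scaled) (auto simp: mat_def kd_def)
 have "christoffel ?g k i j x = (1/2) * (\<Sum>l\<in>UNIV. kd k l * (inverse (exp (2 * f x)) *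
    (kd j l * (exp (2 * f x) * (2 * pd i f x)) + kd i l * (exp (2 * f x) * (2 * pd j f x))
    - kd i j * (exp (2 * f x) * (2 * pd l f x)))))"
  unfolding christoffel_def inv pdg by (simp only: mult_ac)
 also have "... = kd j k * pd i f x + kd i k * pd j f x - kd i j * pd k f x"
  unfolding kd_sum(1) by (simp add: field_simps)
 finally show ?thesis .
qed

text \<open>For a multiple of the identity only the diagonal Ricci entries enter. With the
  Christoffel symbols written in Kronecker deltas, every sum contracts to the trace of the Hessian
  or to the squared gradient.\<close>

theorem scalar_curv_conformal:
 fixes f :: "real^'n::finite => real"
 assumes "open U" "smooth_in U f" "x \<in> U"
 shows "scalar_curv (conformal_change f flat_metric) x
  = - exp (- 2 * f x) * (2 * (real CARD('n) - 1) * lap f x + (real CARD('n) - 1) * (real CARD('n) - 2) * grad2 f x)"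
proof -
 let ?g = "conformal_change f flat_metric" and ?N = "real CARD('n)"
 define F where "F i = pd i f x" for i
 define H where "H i j = pd i (pd j f) x" for i j
 have diff: "pd i f differentiable (at x)" for i
  by (rule smooth_in_diff[OF smooth_in_pd[OF assms(2)] assms(3)])
 have chr: "christoffel ?g k i j x = kd j k * F i + kd i k * F j - kd i j * F k" for i j k
  unfolding F_def by (rule christoffel_conformal[OF smooth_in_diff[OF assms(2,3)]])
 have dchr: "pd l (christoffel ?g k i j) x = kd j k * H l i + kd i k * H l j - kd i j * H l k" for i j k l
 proof -
  have "pd l (christoffel ?g k i j) x
    = pd l (%y. kd j k * pd i f y + kd i k * pd j f y - kd i j * pd k f y) x"
   by (rule pd_cong[OF assms(1,3)]) (rule christoffel_conformal[OF smooth_in_diff[OF assms(2)]])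
  also have "... = kd j k * H l i + kd i k * H l j - kd i j * H l k"
  proof -
   have d: "(%y. c * pd i f y) differentiable (at x)" for c i using diff by simp
   have d': "(%y. c * pd i f y + c' * pd j f y) differentiable (at x)" for c c' i j using d by simp
   show ?thesis unfolding H_def
    by (simp add: pd_diff[OF d' d] pd_add[OF d d] pd_cmult[OF diff])
  qed
  finally show ?thesis .
 qed
 have inv: "matrix_inv (?g x) $ j $ k = exp (- 2 * f x) * kd j k" for j k
  unfolding conformal_change_def flat_metric_def by (subst matrix_inv_scaled) (auto simp: mat_def kd_def exp_minus)
 define S where "S = (\<Sum>i\<in>UNIV. F i * F i)"
 define T where "T = (\<Sum>i\<in>UNIV. H i i)"
 have kk: "kd i i = 1" for i :: 'n by (simp add: kd_def)
 have cN: "(\<Sum>i\<in>(UNIV::'n set). c) = ?N * c" for c :: real by simp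
 have sc: "scalar_curv ?g x = exp (- 2 * f x) * (\<Sum>j\<in>UNIV. ricci_curv ?g j j x)"
 proof -
  have "(\<Sum>k\<in>UNIV. matrix_inv (?g x) $ j $ k * ricci_curv ?g j k x) = exp (- 2 * f x) * ricci_curv ?g j j x" for j
  proof -
   have "(\<Sum>k\<in>UNIV. matrix_inv (?g x) $ j $ k * ricci_curv ?g j k x) = (\<Sum>k\<in>UNIV. kd j k * (exp (- 2 * f x) * ricci_curv ?g j k x))"
    unfolding inv by (simp only: mult_ac)
   thus ?thesis by (simp only: kd_sum)
  qed
  thus ?thesis by (simp add: scalar_curv_def sum_distrib_left)
 qed
 have ric: "ricci_curv ?g j j x = (2 - ?N) * H j j - T + (\<Sum>i\<in>UNIV. \<Sum>m\<in>UNIV.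
   christoffel ?g i i m x * christoffel ?g m j j x - christoffel ?g i j m x * christoffel ?g m i j x)" for j
 proof -
  have "(\<Sum>i\<in>UNIV. pd i (christoffel ?g i j j) x) = 2 * H j j - T"
  proof -
   have "(\<Sum>i\<in>UNIV. pd i (christoffel ?g i j j) x) = (\<Sum>i\<in>UNIV. 2 * (kd j i * H i j) - H i i)"
    unfolding dchr kk by (rule sum.cong) auto
   also have "... = 2 * H j j - T" by (simp add: sum_subtractf kd_sum T_def flip: sum_distrib_left)
   finally show ?thesis .
  qed
  moreover have "(\<Sum>i\<in>UNIV. pd j (christoffel ?g i i j) x) = ?N * H j j"
  proof -
   have "(\<Sum>i\<in>UNIV. pd j (christoffel ?g i i j) x) = (\<Sum>i\<in>(UNIV::'n set). H j j)"
    unfolding dchr kk by (rule sum.cong) (auto simp: kd_def)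
   thus ?thesis by simp
  qed
  ultimately show ?thesis
   unfolding ricci_curv_def riemann_curv_def sum.distrib sum_subtractf by (simp add: algebra_simps)
 qed
 have q1: "(\<Sum>j\<in>UNIV. \<Sum>i\<in>UNIV. \<Sum>m\<in>UNIV. christoffel ?g i i m x * christoffel ?g m j j x) = ?N * (2 - ?N) * S"
 proof -
  have "christoffel ?g i i m x * christoffel ?g m j j x = 2 * (kd j m * (F m * F j)) - F m * F m" for i j m
   unfolding chr by (simp add: kd_def)
  hence "(\<Sum>j\<in>UNIV. \<Sum>i\<in>UNIV. \<Sum>m\<in>UNIV. christoffel ?g i i m x * christoffel ?g m j j x)
    = (\<Sum>j\<in>UNIV. \<Sum>i\<in>(UNIV::'n set). 2 * (F j * F j) - S)"
   by (simp add: sum_subtractf kd_sum S_def flip: sum_distrib_left)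
  also have "... = ?N * (2 * S - ?N * S)"
   by (simp add: sum_subtractf S_def sum_distrib_left sum_distrib_right algebra_simps)
  finally show ?thesis by (simp add: algebra_simps)
 qed
 have q2: "(\<Sum>j\<in>UNIV. \<Sum>i\<in>UNIV. \<Sum>m\<in>UNIV. christoffel ?g i j m x * christoffel ?g m i j x) = (2 - ?N) * S"
 proof -
  have e: "christoffel ?g i j m x * christoffel ?g m i j x
    = kd j m * (kd m i * (F j * F i)) + kd m i * (F j * F j) - kd i j * (kd m i * (F j * F m))
    + kd j i * (kd j m * (F m * F i)) + kd j i * (kd m i * (F m * F j)) - kd i j * (F m * F m)
    - kd j m * (F i * F i) - kd m i * (kd j m * (F i * F j)) + kd j m * (kd i j * (F i * F m))" for i j m
   unfolding chr by (simp add: kd_def algebra_simps)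
  have "(\<Sum>m\<in>UNIV. christoffel ?g i j m x * christoffel ?g m i j x)
    = kd j i * (F j * F i) + F j * F j - kd i j * (F j * F i)
    + kd j i * (F j * F i) + kd j i * (F i * F j) - kd i j * S
    - F i * F i - kd j i * (F i * F j) + kd i j * (F i * F j)" for i j
   unfolding e sum.distrib sum_subtractf kd_sum kd_sum2 S_def sum_distrib_left ..
  hence "(\<Sum>j\<in>UNIV. \<Sum>i\<in>UNIV. \<Sum>m\<in>UNIV. christoffel ?g i j m x * christoffel ?g m i j x)
   = (\<Sum>j\<in>UNIV. \<Sum>i\<in>UNIV. 2 * (kd j i * (F i * F j)) + F j * F j - kd j i * S - F i * F i)"
   by (auto simp: kd_def intro!: sum.cong)
  also have "... = (\<Sum>j\<in>UNIV. 2 * (F j * F j) + ?N * (F j * F j) - S - S)"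
   by (simp add: sum_subtractf sum.distrib kd_sum S_def flip: sum_distrib_left)
  also have "... = 2 * S + ?N * S - ?N * S - ?N * S"
   by (simp add: sum_subtractf sum.distrib S_def flip: sum_distrib_left)
  finally show ?thesis by (simp add: algebra_simps)
 qed
 have "(\<Sum>j\<in>UNIV. ricci_curv ?g j j x) = (2 - ?N) * T - ?N * T + (?N * (2 - ?N) * S - (2 - ?N) * S)"
  unfolding ric sum.distrib sum_subtractf q1 q2 by (simp add: T_def sum_subtractf flip: sum_distrib_left)
 also have "T = lap f x" by (simp add: T_def H_def lap_def)
 also have "S = grad2 f x" by (simp add: S_def F_def grad2_def power2_eq_square)
 finally have R: "(\<Sum>j\<in>UNIV. ricci_curv ?g j j x) = (2 - ?N) * lap f x - ?N * lap f x
   + (?N * (2 - ?N) * grad2 f x - (2 - ?N) * grad2 f x)" .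
 show ?thesis unfolding sc R by (simp add: algebra_simps)
qed

section \<open>The boundary as a graph\<close>

lemma smooth_in_inverse:
 assumes "open U" "smooth_in U u" "!!x. x \<in> U ==> u x ~= 0"
 shows "smooth_in U (%x. inverse (u x))"
proof -
 define Fs :: "nat => real => real" where "Fs j t = (-1) ^ j * fact j * inverse (t ^ Suc j)" for j t
 have "(Fs j has_real_derivative Fs (Suc j) t) (at t)" if "t \<in> - {0}" for j t
 proof -
  have "(Fs j has_real_derivative (-1) ^ j * fact j * (- (inverse (t ^ Suc j) * (real (Suc j) * t ^ j) * inverse (t ^ Suc j)))) (at t)"
   unfolding Fs_def using that by (auto intro!: derivative_eq_intros simp del: power_Suc)
  also have "(-1) ^ j * fact j * (- (inverse (t ^ Suc j) * (real (Suc j) * t ^ j) * inverse (t ^ Suc j))) = Fs (Suc j) t"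
   using that by (simp add: Fs_def field_simps)
  finally show ?thesis .
 qed
 moreover have "u ` U \<subseteq> - {0}" using assms(3) by auto
 ultimately have "smooth_in U (%x. Fs 0 (u x))"
  using smooth_in_compose_real[where Fs = Fs and J = "- {0}" and j = 0 and u = u and U = U] assms(1,2) by blast
 thus ?thesis by (simp add: Fs_def)
qed

definition flat_proj :: "'n::finite => real^'n => real^'n => real^'n" where
 "flat_proj i p x = x + (p $ i - x $ i) *. i"

lemma flat_proj_nth: "flat_proj i p x $ j = (if j = i then p $ i else x $ j)"
 by (simp add: flat_proj_def axis_def)

lemma flat_proj_shift: "flat_proj i p (x + t *. i) = flat_proj i p x"
 "j ~= i ==> flat_proj i p (x + t *. j) = flat_proj i p x + t *. j"
 by (auto simp: vec_eq_iff flat_proj_nth axis_def)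

lemma dist_flat_proj: "dist (flat_proj i p x) (flat_proj i p y) <= dist x y"
 unfolding dist_vec_def by (rule L2_set_mono) (auto simp: flat_proj_nth)

lemma flat_proj_self [simp]: "flat_proj i p p = p"
 by (simp add: flat_proj_def)

lemma continuous_flat_proj: "continuous_on S (flat_proj i p)"
 unfolding flat_proj_def by (intro continuous_intros)

text \<open>Functions independent of coordinate \<open>i\<close> live naturally on a set invariant
  under translation along that axis; a ball would cut these lines.\<close>

definition cylinder :: "'n::finite => real^'n => real => (real^'n) set" where
 "cylinder i p R = {x. dist p (flat_proj i p x) < R}"

lemma open_cylinder: "open (cylinder i p R)"
 unfolding cylinder_def by (intro open_Collect_less continuous_intros continuous_flat_proj)

lemma ball_subset_cylinder: "ball p R \<subseteq> cylinder i p R"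
proof
 fix x assume "x \<in> ball p R"
 thus "x \<in> cylinder i p R" using dist_flat_proj[of i p p x] by (simp add: cylinder_def)
qed

text \<open>The implicit function theorem in a form that records on which side of the graph \<Omega>
  lies. \<open>\<sigma> * s\<close> is strictly increasing along axis \<open>i\<close>, so the
  intermediate value theorem finds its zero over each base point; the same monotonicity makes the
  graph Lipschitz, from which differentiability and then smoothness follow.\<close>

theorem ldf_graph:
 fixes p :: "real^'n::finite"
 assumes ldf: "ldf \<Omega> p U s"
 shows "\<exists>i \<sigma> \<phi> R. R > 0 & (\<sigma> = 1 | \<sigma> = -1) & smooth_in (cylinder i p R) \<phi> & (\<forall>x t. \<phi> (x + t *. i) = \<phi> x)
   & \<phi> p = p $ i & \<Omega> \<inter> ball p R = {x \<in> ball p R. \<sigma> * (x $ i - \<phi> x) > 0}"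
proof -
 have U: "open U" "p \<in> U" "smooth_in U s" "s p = 0" "\<Omega> \<inter> U = {x\<in>U. s x > 0}" using ldf by (auto simp: ldf_def)
 obtain i where i: "pd i s p ~= 0" using ldf by (auto simp: ldf_def)
 define \<sigma> where "\<sigma> = sgn (pd i s p)"
 have sg: "\<sigma> = 1 | \<sigma> = -1" using i by (auto simp: \<sigma>_def sgn_if)
 have ss: "\<sigma> * \<sigma> = 1" using sg by auto
 define c where "c = abs(pd i s p) / 2"
 have c: "c > 0" using i by (simp add: c_def)
 have "isCont (pd i s) p"
  using smooth_in_continuous[OF smooth_in_pd[OF U(3)]] U(1,2) by (simp add: continuous_on_eq_continuous_at)
 then obtain d0 where d0: "d0 > 0" "!!y. dist y p < d0 ==> dist (pd i s y) (pd i s p) < c"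
  using c by (metis continuous_at_eps_delta)
 obtain r0 where r0: "r0 > 0" "cball p r0 \<subseteq> U" using U(1,2) open_contains_cball by blast
 define r where "r = min r0 (d0 / 2)"
 have r: "r > 0" "cball p r \<subseteq> U" using r0 d0 by (auto simp: r_def)
 have pos: "\<sigma> * pd i s x >= c" if "x \<in> cball p r" for x
 proof -
  have "abs(pd i s x - pd i s p) < c"
   using d0(2)[of x] that d0(1) by (auto simp: r_def dist_commute dist_real_def)
  thus ?thesis using i c unfolding c_def
   by (cases "pd i s p > 0") (auto simp: \<sigma>_def abs_if split: if_splits)
 qed
 obtain L where L: "L > 0" "!!x y. x \<in> cball p r ==> y \<in> cball p r ==> abs(s x - s y) <= L * dist x y"
  using smooth_lipschitz[OF U(3) r(2)] by blast
 define \<rho> where "\<rho> = r / 2"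
 have \<rho>: "\<rho> > 0" using r by (simp add: \<rho>_def)
 have inr: "z + t *. i \<in> cball p r" if "dist p z <= \<rho>" "abs(t) <= \<rho>" for z t
  using dist_triangle[of p "z + t *. i" z] that by (simp add: \<rho>_def)
 have mono: "\<sigma> * (s (z + t2 *. i) - s (z + t1 *. i)) >= c * (t2 - t1)"
  if z: "dist p z <= \<rho>" and t: "- \<rho> <= t1" "t1 <= t2" "t2 <= \<rho>" for z t1 t2
 proof (cases "t1 = t2")
  case False
  hence lt: "t2 - t1 > 0" using t by simp
  have pt: "z + t1 *. i + q *. i \<in> cball p r" if "0 <= q" "q <= t2 - t1" for q
   using inr[OF z, of "t1 + q"] that t by (simp add: scaleR_left_distrib add.assoc)
  obtain q where q: "0 < q" "q < t2 - t1" "dlt i (t2 - t1) s (z + t1 *. i) = (t2 - t1) * pd i s (z + t1 *. i + q *. i)"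
   using dlt_mvt[OF lt, of s "z + t1 *. i" i] pt r(2) smooth_in_diff[OF U(3)] by blast
  have "\<sigma> * (s (z + t2 *. i) - s (z + t1 *. i)) = (t2 - t1) * (\<sigma> * pd i s (z + t1 *. i + q *. i))"
  proof -
   have e: "z + t1 *. i + (t2 - t1) *. i = z + t2 *. i" by (simp add: algebra_simps)
   have "s (z + t2 *. i) - s (z + t1 *. i) = (t2 - t1) * pd i s (z + t1 *. i + q *. i)"
    using q(3) unfolding dlt_def e .
   thus ?thesis by simp
  qed
  also have "... >= (t2 - t1) * c" using pos[OF pt[of q]] q lt by (intro mult_left_mono) auto
  finally show ?thesis by (simp add: mult.commute)
 qed simp
 \<comment> \<open>Over base points within \<delta>, the values of \<open>s\<close> at the ends of
   the vertical segment differ from those over \<open>p\<close> by at most half of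
   \<open>c * \<rho>\<close>, so their signs persist.\<close>
 define \<delta> where "\<delta> = min \<rho> (c * \<rho> / (2 * L))"
 have \<delta>: "\<delta> > 0" "\<delta> <= \<rho>" using \<rho> c L by (auto simp: \<delta>_def)
 have zero: "\<exists>t. abs(t) <= \<rho> & s (z + t *. i) = 0" if z: "dist p z < \<delta>" for z
 proof -
  have z\<rho>: "dist p z <= \<rho>" using z \<delta>(2) by simp
  have near: "abs(s (z + t *. i) - s (p + t *. i)) <= c * \<rho> / 2" if "abs(t) <= \<rho>" for t
  proof -
   have "abs(s (z + t *. i) - s (p + t *. i)) <= L * dist (z + t *. i) (p + t *. i)"
    by (rule L(2)) (use inr[OF z\<rho> that] inr[of p t] that \<rho> in auto)
   also have "... = L * dist p z" by (simp add: dist_norm norm_minus_commute)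
   also have "... <= L * (c * \<rho> / (2 * L))" using z L(1) by (intro mult_left_mono) (auto simp: \<delta>_def)
   also have "... = c * \<rho> / 2" using L(1) by simp
   finally show ?thesis .
  qed
  have cr: "c * \<rho> > 0" using c \<rho> by simp
  have "\<sigma> * s (p + \<rho> *. i) >= c * \<rho>" "\<sigma> * s (p + (- \<rho>) *. i) <= - (c * \<rho>)"
   using mono[of p 0 \<rho>] mono[of p "- \<rho>" 0] \<rho> U(4) by auto
  hence ends: "\<sigma> * s (z + \<rho> *. i) >= 0" "\<sigma> * s (z + (- \<rho>) *. i) <= 0"
  proof -
   have n: "abs(s (z + \<rho> *. i) - s (p + \<rho> *. i)) <= c * \<rho> / 2"
    "abs(s (z + (- \<rho>) *. i) - s (p + (- \<rho>) *. i)) <= c * \<rho> / 2"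
    using near[of \<rho>] near[of "- \<rho>"] \<rho> by auto
   have "\<sigma> * a >= 0" if "abs(a - b) <= m / 2" "\<sigma> * b >= m" "m > 0" for a b m :: real
    using that sg by (auto simp: abs_if split: if_splits)
   moreover have "\<sigma> * a <= 0" if "abs(a - b) <= m / 2" "\<sigma> * b <= - m" "m > 0" for a b m :: real
    using that sg by (auto simp: abs_if split: if_splits)
   ultimately show "\<sigma> * s (z + \<rho> *. i) >= 0" "\<sigma> * s (z + (- \<rho>) *. i) <= 0"
    using n `\<sigma> * s (p + \<rho> *. i) >= c * \<rho>` `\<sigma> * s (p + (- \<rho>) *. i) <= - (c * \<rho>)` cr by blast+
  qed
  have cont: "continuous_on {- \<rho>..\<rho>} (%t. \<sigma> * s (z + t *. i))"
  proof (intro continuous_intros continuous_on_compose2[OF continuous_on_subset[OF smooth_in_continuous[OF U(3)] r(2)]])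
   show "(%x. z + x *. i) ` {- \<rho>..\<rho>} \<subseteq> cball p r" using inr[OF z\<rho>] by (auto simp del: mem_cball)
  qed
  obtain t where t: "- \<rho> <= t" "t <= \<rho>" "\<sigma> * s (z + t *. i) = 0"
   using IVT'[of "%t. \<sigma> * s (z + t *. i)" "- \<rho>" 0 \<rho>, OF ends(2,1) _ cont] \<rho> by auto
  thus ?thesis using sg by (intro exI[of _ t]) auto
 qed
 define T where "T z = (SOME t. abs(t) <= \<rho> & s (z + t *. i) = 0)" for z
 have T: "abs(T z) <= \<rho>" "s (z + T z *. i) = 0" if "dist p z < \<delta>" for z
  using someI_ex[OF zero[OF that]] unfolding T_def by auto
 define \<phi> where "\<phi> x = p $ i + T (flat_proj i p x)" for x
 define V where "V = cylinder i p \<delta>"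
 have V: "open V" "!!x. x \<in> V ==> dist p (flat_proj i p x) < \<delta>" by (auto simp: V_def open_cylinder) (simp add: cylinder_def)
 define \<Psi> where "\<Psi> x = flat_proj i p x + T (flat_proj i p x) *. i" for x
 have Pn: "\<Psi> x $ j = (if j = i then \<phi> x else x $ j)" for x j
  by (simp add: \<Psi>_def \<phi>_def flat_proj_nth axis_def)
 have P0: "s (\<Psi> x) = 0" "\<Psi> x \<in> cball p r" if "x \<in> V" for x
  unfolding \<Psi>_def using T[OF V(2)[OF that]] inr[of "flat_proj i p x"] V(2)[OF that] \<delta>(2) by auto
 have Tlip: "c * abs(T z - T z') <= L * dist z z'" if z: "dist p z < \<delta>" and z': "dist p z' < \<delta>" for z z'
 proof -
  have \<rho>z: "dist p z <= \<rho>" "dist p z' <= \<rho>" using z z' \<delta>(2) by auto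
  have "c * abs(T z - T z') <= abs(s (z' + T z *. i) - s (z' + T z' *. i))"
  proof (cases "T z' <= T z")
   case True
   hence "c * (T z - T z') <= \<sigma> * (s (z' + T z *. i) - s (z' + T z' *. i))"
    using T(1)[OF z] T(1)[OF z'] by (intro mono[OF \<rho>z(2)]) auto
   thus ?thesis using True sg by auto
  next
   case False
   hence "c * (T z' - T z) <= \<sigma> * (s (z' + T z' *. i) - s (z' + T z *. i))"
    using T(1)[OF z] T(1)[OF z'] by (intro mono[OF \<rho>z(2)]) auto
   thus ?thesis using False sg by (auto simp: abs_minus_commute)
  qed
  also have "... = abs(s (z' + T z *. i) - s (z + T z *. i))" using T(2)[OF z] T(2)[OF z'] by simp
  also have "... <= L * dist (z' + T z *. i) (z + T z *. i)"
   using T(1)[OF z] by (intro L(2) inr \<rho>z) auto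
  also have "... = L * dist z z'" by (simp add: dist_norm norm_minus_commute)
  finally show ?thesis .
 qed
 have philip: "abs(\<phi> x - \<phi> y) <= L / c * dist x y" if "x \<in> V" "y \<in> V" for x y
 proof -
  have "c * abs(\<phi> x - \<phi> y) <= L * dist (flat_proj i p x) (flat_proj i p y)"
   unfolding \<phi>_def using Tlip[OF V(2)[OF that(1)] V(2)[OF that(2)]] by simp
  also have "... <= L * dist x y" using dist_flat_proj L(1) by (intro mult_left_mono) auto
  finally show ?thesis using c by (simp add: field_simps)
 qed
 have phicont: "continuous_on V \<phi>"
  unfolding continuous_on_iff
 proof (intro ballI allI impI)
  fix x e assume x: "x \<in> V" and e: "(0::real) < e"
  have Lc: "L / c > 0" using L c by simp
  have "dist (\<phi> y) (\<phi> x) < e" if "y \<in> V" "dist y x < e / (L / c)" for y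
  proof -
   have "dist (\<phi> y) (\<phi> x) <= L / c * dist y x" using philip[OF that(1) x] by (simp add: dist_real_def)
   also have "... < L / c * (e / (L / c))" using that(2) Lc by (intro mult_strict_left_mono) auto
   also have "... = e" using L(1) c by simp
   finally show ?thesis .
  qed
  thus "\<exists>d>0. \<forall>x'\<in>V. dist x' x < d --> dist (\<phi> x') (\<phi> x) < e"
   using divide_pos_pos[OF e Lc] by blast
 qed
 define W where "W = {x \<in> U. pd i s x ~= 0}"
 have "open W"
 proof -
  have "W = U \<inter> pd i s -` (- {0})" by (auto simp: W_def)
  thus ?thesis
   using continuous_open_preimage[OF smooth_in_continuous[OF smooth_in_pd[OF U(3)]] U(1), of "- {0}"] by auto
 qed
 have PW: "\<Psi> ` V \<subseteq> W"
 proof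
  fix y assume "y \<in> \<Psi> ` V"
  hence y: "y \<in> cball p r" using P0(2) by blast
  hence "pd i s y ~= 0" using pos[OF y] c by auto
  thus "y \<in> W" using y r(2) by (auto simp: W_def)
 qed
 \<comment> \<open>The quotient of implicit differentiation; the entry for \<open>i\<close> is 0
   because \<phi> is constant along that axis.\<close>
 define Rr where "Rr j x = (if j = i then 0 else - (pd j s x * inverse (pd i s x)))" for j x
 have smR: "smooth_in W (Rr j)" for j
 proof -
  have "smooth_in W s" by (rule smooth_in_subset[OF U(3)]) (auto simp: W_def)
  hence "smooth_in W (%x. - (pd j s x * inverse (pd i s x)))"
   using `open W` by (intro smooth_in_minus smooth_in_mult smooth_in_inverse smooth_in_pd) (auto simp: W_def)
  thus ?thesis by (cases "j = i") (simp_all add: Rr_def[abs_def])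
 qed
 have Pcont: "continuous_on V \<Psi>"
  unfolding \<Psi>_def using continuous_on_add[OF continuous_flat_proj[of V i p]
    continuous_on_scaleR[OF continuous_on_diff[OF phicont continuous_on_const[of V "p $ i"]] continuous_on_const[of V "ax i"]]]
  by (simp add: \<phi>_def)
 have der: "((%t. \<phi> (y + t *. j)) has_real_derivative Rr j (\<Psi> y)) (at 0)" if y: "y \<in> V" for y j
 proof (cases "j = i")
  case True
  thus ?thesis by (simp add: Rr_def \<phi>_def flat_proj_shift(1))
 next
  case False
  let ?pi = "pd i s (\<Psi> y)" and ?pj = "pd j s (\<Psi> y)"
  have pi: "abs(?pi) >= c" using pos[OF P0(2)[OF y]] sg by auto
  have D: "(s has_derivative (%v. \<Sum>k\<in>UNIV. v $ k * pd k s (\<Psi> y))) (at (\<Psi> y))"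
   using P0(2)[OF y] r(2) by (intro has_derivative_pd smooth_in_diff[OF U(3)]) auto
  define B where "B = 1 + L / c"
  have B: "B > 0" using L c by (simp add: B_def add_pos_pos)
  have "(%h. (\<phi> (y + h *. j) - \<phi> y) / h) \<midarrow>0\<rightarrow> Rr j (\<Psi> y)"
  proof (rule LIM_I)
   fix e :: real assume e: "e > 0"
   define e' where "e' = e * c / (2 * B)"
   have e': "e' > 0" using e c B by (simp add: e'_def)
   obtain d where d: "d > 0" "!!v. norm v < d ==>
     norm (s (\<Psi> y + v) - s (\<Psi> y) - (\<Sum>k\<in>UNIV. v $ k * pd k s (\<Psi> y))) <= e' * norm v"
   proof -
    from D[unfolded has_derivative_at_alt] e' obtain d where d: "d > 0" "!!z. norm (z - \<Psi> y) < d ==>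
     norm (s z - s (\<Psi> y) - (\<Sum>k\<in>UNIV. (z - \<Psi> y) $ k * pd k s (\<Psi> y))) <= e' * norm (z - \<Psi> y)" by blast
    have "norm (s (\<Psi> y + v) - s (\<Psi> y) - (\<Sum>k\<in>UNIV. v $ k * pd k s (\<Psi> y))) <= e' * norm v" if "norm v < d" for v
     using d(2)[of "\<Psi> y + v"] that by simp
    thus ?thesis using that[OF d(1)] by blast
   qed
   obtain d2 where d2: "d2 > 0" "ball y d2 \<subseteq> V" using V(1) y open_contains_ball by blast
   show "\<exists>q>0. \<forall>h. h ~= 0 & norm (h - 0) < q --> norm ((\<phi> (y + h *. j) - \<phi> y) / h - Rr j (\<Psi> y)) < e"
   proof (intro exI[of _ "min d2 (d / B)"] conjI allI impI)
    show "min d2 (d / B) > 0" using d d2 B by simp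
    fix h :: real assume h: "h ~= 0 & norm (h - 0) < min d2 (d / B)"
    have hV: "y + h *. j \<in> V" using h d2(2) by (auto simp: subset_iff)
    define w where "w = \<phi> (y + h *. j) - \<phi> y"
    define v where "v = h *. j + w *. i"
    have wb: "abs(w) <= L / c * abs(h)" using philip[OF hV y] by (simp add: w_def)
    have "norm v <= norm (h *. j) + norm (w *. i)" unfolding v_def by (rule norm_triangle_ineq)
    hence vb: "norm v <= B * abs(h)" using wb by (simp add: B_def algebra_simps)
    also have "... < B * (d / B)" using h B by (intro mult_strict_left_mono) auto
    also have "... = d" using B by simp
    finally have vd: "norm v < d" .
    have "\<Psi> (y + h *. j) = \<Psi> y + v"
     using False by (auto simp: vec_eq_iff Pn v_def w_def axis_def)
    hence s1: "s (\<Psi> y + v) = 0" using P0(1)[OF hV] by simp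
    have sumv: "(\<Sum>k\<in>UNIV. v $ k * pd k s (\<Psi> y)) = h * ?pj + w * ?pi"
    proof -
     have "v $ k * g = (if k = j then h * g else 0) + (if k = i then w * g else 0)" for k g
      by (simp add: v_def axis_def distrib_right)
     thus ?thesis by (simp add: sum.distrib)
    qed
    have "abs(h * ?pj + w * ?pi) <= e' * norm v"
     using d(2)[OF vd] unfolding s1 P0(1)[OF y] sumv by simp
    also have "... <= e' * (B * abs(h))" using vb e' by (intro mult_left_mono) auto
    finally have "abs(h * ?pj + w * ?pi) <= e' * (B * abs(h))" .
    moreover have "h * ?pj + w * ?pi = (w / h - Rr j (\<Psi> y)) * (h * ?pi)"
    proof -
     have nz: "h ~= 0" "?pi ~= 0" using h pi c by auto
     have "(w / h + a * inverse b) * (h * b) = h * a + w * b" if "b ~= 0" for a b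
      using nz(1) that by (simp add: distrib_right)
     thus ?thesis using nz(2) False by (simp add: Rr_def)
    qed
    ultimately have "abs(w / h - Rr j (\<Psi> y)) * (abs(h) * abs(?pi)) <= e' * (B * abs(h))" by (simp add: abs_mult)
    moreover have "abs(w / h - Rr j (\<Psi> y)) * (abs(h) * c) <= abs(w / h - Rr j (\<Psi> y)) * (abs(h) * abs(?pi))"
     using pi by (intro mult_left_mono) auto
    ultimately have "abs(h) * (abs(w / h - Rr j (\<Psi> y)) * c) <= abs(h) * (e' * B)" by (simp add: algebra_simps)
    hence "abs(w / h - Rr j (\<Psi> y)) * c <= e' * B" using h by simp
    also have "e' * B = e / 2 * c" using B by (simp add: e'_def)
    finally have "abs(w / h - Rr j (\<Psi> y)) <= e / 2" using c by simp
    thus "norm ((\<phi> (y + h *. j) - \<phi> y) / h - Rr j (\<Psi> y)) < e" using e by (simp add: w_def)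
   qed
  qed
  thus ?thesis by (simp add: DERIV_def)
 qed
 have hd: "(\<phi> has_derivative (%v. \<Sum>j\<in>UNIV. v $ j * Rr j (\<Psi> x))) (at x)" if "x \<in> V" for x
 proof (rule has_derivative_partials[OF V(1) der _ that])
  fix j
  show "continuous_on V (%x. Rr j (\<Psi> x))"
   by (rule continuous_on_compose2[OF smooth_in_continuous[OF smR] Pcont PW])
 qed
 have pdphi: "pd j \<phi> x = Rr j (\<Psi> x)" if "x \<in> V" for j x
  using pd_eqI[OF hd[OF that], of j] by (simp add: axis_def if_distrib if_distribR sum.delta cong: if_cong)
 \<comment> \<open>Bootstrapping: the partial derivatives of \<phi> are smooth functions of the
   graph map \<Psi>, whose components are coordinates and \<phi> itself, so each order of smoothness
   gives the next.\<close>
 have "C_k_on k V \<phi>" for k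
 proof (induction k)
  case 0
  thus ?case using phicont by simp
 next
  case (Suc k)
  have "C_k_on k V (pd j \<phi>)" for j
  proof (rule C_k_on_cong[OF V(1)])
   show "C_k_on k V (%x. Rr j (\<Psi> x))"
   proof (rule C_k_on_compose[OF V(1) PW])
    show "C_k_on k W (Rr j)" using smR by (simp add: smooth_in_def)
    show "C_k_on k V (%x. \<Psi> x $ m)" for m
     unfolding Pn using Suc by (cases "m = i") (auto intro: C_k_on_component)
   qed
  qed (use pdphi in simp)
  thus ?case using hd by (auto simp: differentiable_def)
 qed
 hence sm: "smooth_in V \<phi>" by (simp add: smooth_in_def)
 have phip: "\<phi> p = p $ i"
 proof -
  have "c * abs(T p - 0) <= 0"
  proof -
   have dp: "dist p p < \<delta>" using \<delta> by simp
   show ?thesis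
   proof (cases "T p >= 0")
    case True
    have "c * (T p - 0) <= \<sigma> * (s (p + T p *. i) - s (p + 0 *. i))"
     by (rule mono) (use True T(1)[OF dp] \<rho> in auto)
    thus ?thesis using True T(2)[OF dp] U(4) by simp
   next
    case False
    have "c * (0 - T p) <= \<sigma> * (s (p + 0 *. i) - s (p + T p *. i))"
     by (rule mono) (use False T(1)[OF dp] \<rho> in auto)
    thus ?thesis using False T(2)[OF dp] U(4) by simp
   qed
  qed
  thus ?thesis using c by (simp add: \<phi>_def mult_le_0_iff)
 qed
 have equ: "s x > 0 \<longleftrightarrow> \<sigma> * (x $ i - \<phi> x) > 0" if x: "x \<in> ball p \<delta>" for x
 proof -
  let ?z = "flat_proj i p x" and ?t = "x $ i - p $ i"
  have xV: "x \<in> V" using x ball_subset_cylinder[of p \<delta> i] by (auto simp: V_def)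
  have z: "dist p ?z < \<delta>" using V(2)[OF xV] .
  have xz: "x = ?z + ?t *. i" by (simp add: flat_proj_def algebra_simps flip: scaleR_left_distrib)
  have "abs(?t) <= dist p x" using component_le_norm_cart[of "p - x" i] by (simp add: dist_norm)
  hence t: "abs(?t) <= \<rho>" using x \<delta>(2) by simp
  have zr: "dist p ?z <= \<rho>" using z \<delta>(2) by simp
  have diff: "x $ i - \<phi> x = ?t - T ?z" by (simp add: \<phi>_def)
  have up: "\<sigma> * s x >= c * (?t - T ?z)" if "T ?z <= ?t"
   using mono[OF zr, of "T ?z" ?t] that T[OF z] t xz by auto
  have dn: "- (\<sigma> * s x) >= c * (T ?z - ?t)" if "?t <= T ?z"
   using mono[OF zr, of ?t "T ?z"] that T[OF z] t xz by auto
  have "\<sigma> * s x > 0" if "?t > T ?z"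
   using order_less_le_trans[OF mult_pos_pos[OF c, of "?t - T ?z"] up] that by simp
  moreover have "\<sigma> * s x < 0" if "?t < T ?z"
   using order_less_le_trans[OF mult_pos_pos[OF c, of "T ?z - ?t"] dn] that by simp
  moreover have "s x = 0" if "?t = T ?z" using T(2)[OF z] xz that by simp
  ultimately have "\<sigma> * s x > 0 \<longleftrightarrow> ?t > T ?z" "\<sigma> * s x < 0 \<longleftrightarrow> ?t < T ?z"
   by (cases "?t" "T ?z" rule: linorder_cases; force)+
  thus ?thesis unfolding diff using sg by auto
 qed
 have bU: "ball p \<delta> \<subseteq> U" using r \<delta>(2) by (force simp: \<rho>_def subset_iff)
 have "\<Omega> \<inter> ball p \<delta> = {x \<in> ball p \<delta>. \<sigma> * (x $ i - \<phi> x) > 0}"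
  using U(5) bU equ by blast
 moreover have "\<phi> (x + t *. i) = \<phi> x" for x t by (simp add: \<phi>_def flat_proj_shift(1))
 ultimately show ?thesis using \<delta>(1) sg sm phip unfolding V_def by blast
qed

section \<open>Regularity up to the boundary\<close>

lemma powr_ratio:
 fixes x y \<beta> :: real
 assumes "x > 0" "y >= x / 2" "y <= 2 * x"
 shows "y powr \<beta> <= 2 powr abs(\<beta>) * x powr \<beta>"
proof -
 have y: "y > 0" using assms(1,2) by linarith
 have q: "y / x <= 2" "x / y <= 2" "y / x > 0" "x / y > 0" using assms y by (auto simp: field_simps)
 have "(y / x) powr \<beta> <= 2 powr abs(\<beta>)"
 proof (cases "\<beta> >= 0")
  case True
  thus ?thesis using powr_mono2[of \<beta> "y / x" 2] q by simp
 next
  case False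
  have "(y / x) powr \<beta> = (x / y) powr (- \<beta>)"
   using assms(1) y by (simp add: powr_divide powr_minus field_simps)
  also have "... <= 2 powr (- \<beta>)" using powr_mono2[of "- \<beta>" "x / y" 2] q False by simp
  finally show ?thesis using False by simp
 qed
 hence "(y / x) powr \<beta> * x powr \<beta> <= 2 powr abs(\<beta>) * x powr \<beta>" by (intro mult_right_mono) auto
 thus ?thesis using assms(1) y by (simp add: powr_divide)
qed

text \<open>
 Near \<open>p\<close> the domain is \<open>{x. s x > 0}\<close>. The fields \<open>X k\<close> are the coordinate fields of the flattened
 coordinates: they commute, and for \<open>k \<noteq> \<iota>\<close> they are tangential, i.e. they annihilate \<open>s\<close>. The estimates
 are only required on smaller balls (\<open>\<rho> < R\<close>), so that a loss of radius never has to be tracked.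
\<close>

locale bdry_chart =
 fixes \<iota> :: "'n::finite" and \<sigma> :: real and \<phi> :: "real^'n => real" and p :: "real^'n" and R :: real
 assumes R: "R > 0" and sg: "\<sigma> = 1 | \<sigma> = -1"
  and phi_smooth: "smooth_in (cylinder \<iota> p R) \<phi>" and phi_shift: "!!x t. \<phi> (x + t *. \<iota>) = \<phi> x"
begin

definition s :: "real^'n => real" where
 "s x = \<sigma> * (x $ \<iota> - \<phi> x)"

definition dom :: "real => (real^'n) set" where
 "dom \<rho> = {x \<in> ball p \<rho>. s x > 0}"

definition Pd :: "real => (real^'n => real) => bool" where
 "Pd \<beta> f \<longleftrightarrow> (\<forall>\<rho><R. \<exists>C. \<forall>x\<in>dom \<rho>. abs(f x) <= C * s x powr \<beta>)"

definition X :: "'n => (real^'n => real) => real^'n => real" where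
 "X k f x = pd k f x + pd k \<phi> x * pd \<iota> f x"

lemma smooth_phi: "smooth_in (ball p R) \<phi>"
 by (rule smooth_in_subset[OF phi_smooth ball_subset_cylinder])

lemma smooth_s: "smooth_in (ball p R) s"
 unfolding s_def[abs_def] by (intro smooth_in_mult smooth_in_diff_fun smooth_phi) auto

lemma dom_mono: "\<rho> <= \<rho>' ==> dom \<rho> \<subseteq> dom \<rho>'"
 by (auto simp: dom_def)

lemma dom_ball: "dom \<rho> \<subseteq> ball p \<rho>"
 by (auto simp: dom_def)

lemma open_dom: "\<rho> <= R ==> open (dom \<rho>)"
proof -
 assume "\<rho> <= R"
 hence c: "continuous_on (ball p \<rho>) s"
  using smooth_in_continuous[OF smooth_s] continuous_on_subset[of _ s "ball p \<rho>"] by (meson subset_ball)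
 have "dom \<rho> = ball p \<rho> \<inter> s -` {0<..}" by (auto simp: dom_def)
 thus ?thesis using continuous_open_preimage[OF c open_ball, of "{0<..}"] by simp
qed

lemma bounded_on_ball:
 assumes "smooth_in (ball p R) f" "\<rho> < R"
 obtains C where "C > 0" "!!x. x \<in> ball p \<rho> ==> abs(f x) <= C"
proof -
 have "cball p \<rho> \<subseteq> ball p R" using assms(2) by auto
 then obtain C where "\<forall>x\<in>cball p \<rho>. abs(pds [] f x) <= C"
  using pds_bounded[OF assms(1) compact_cball, of p \<rho> "[]"] by auto
 thus ?thesis using that[of "max C 1"] by (auto simp: max.coboundedI1)
qed

lemma PdE:
 assumes "Pd \<beta> f" "\<rho> < R"
 obtains C where "C > 0" "!!x. x \<in> dom \<rho> ==> abs(f x) <= C * s x powr \<beta>"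
proof -
 obtain C where C: "!!x. x \<in> dom \<rho> ==> abs(f x) <= C * s x powr \<beta>" using assms unfolding Pd_def by blast
 have "abs(f x) <= max C 1 * s x powr \<beta>" if "x \<in> dom \<rho>" for x
  using C[OF that] mult_right_mono[of C "max C 1" "s x powr \<beta>"] by simp
 thus ?thesis using that[of "max C 1"] by simp
qed

lemma Pd_mono: "Pd \<beta> f ==> \<gamma> <= \<beta> ==> Pd \<gamma> f"
 unfolding Pd_def
proof (intro allI impI)
 fix \<rho> assume f: "\<forall>\<rho><R. \<exists>C. \<forall>x\<in>dom \<rho>. abs(f x) <= C * s x powr \<beta>" and g: "\<gamma> <= \<beta>" and \<rho>: "\<rho> < R"
 obtain C where C: "C > 0" "!!x. x \<in> dom \<rho> ==> abs(f x) <= C * s x powr \<beta>" using PdE[of \<beta> f \<rho>] f \<rho> unfolding Pd_def by blast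
 obtain S where S: "S > 0" "!!x. x \<in> ball p \<rho> ==> abs(s x) <= S" using bounded_on_ball[OF smooth_s \<rho>] by blast
 have "abs(f x) <= (C * S powr (\<beta> - \<gamma>)) * s x powr \<gamma>" if x: "x \<in> dom \<rho>" for x
 proof -
  have sx: "0 < s x" "s x <= S" using x S(2)[of x] by (auto simp: dom_def)
  have "s x powr \<beta> = s x powr (\<beta> - \<gamma>) * s x powr \<gamma>" by (simp flip: powr_add)
  also have "... <= S powr (\<beta> - \<gamma>) * s x powr \<gamma>" using sx g by (intro mult_right_mono powr_mono2) auto
  finally have "C * s x powr \<beta> <= C * (S powr (\<beta> - \<gamma>) * s x powr \<gamma>)" using C(1) by (intro mult_left_mono) auto
  thus ?thesis using C(2)[OF x] by (simp add: mult.assoc)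
 qed
 thus "\<exists>C. \<forall>x\<in>dom \<rho>. abs(f x) <= C * s x powr \<gamma>" by blast
qed

lemma Pd_coef: "smooth_in (ball p R) f ==> Pd 0 f"
 unfolding Pd_def
proof (intro allI impI)
 fix \<rho> assume f: "smooth_in (ball p R) f" and \<rho>: "\<rho> < R"
 obtain C where "C > 0" "!!x. x \<in> ball p \<rho> ==> abs(f x) <= C" using bounded_on_ball[OF f \<rho>] by blast
 thus "\<exists>C. \<forall>x\<in>dom \<rho>. abs(f x) <= C * s x powr 0" by (auto simp: dom_def)
qed

lemma Pd_cong: "(!!x. x \<in> dom R ==> f x = g x) ==> Pd \<beta> f ==> Pd \<beta> g"
 unfolding Pd_def
proof (intro allI impI)
 fix \<rho> assume e: "!!x. x \<in> dom R ==> f x = g x" and f: "\<forall>\<rho><R. \<exists>C. \<forall>x\<in>dom \<rho>. abs(f x) <= C * s x powr \<beta>" and \<rho>: "\<rho> < R"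
 then obtain C where "\<forall>x\<in>dom \<rho>. abs(f x) <= C * s x powr \<beta>" by blast
 thus "\<exists>C. \<forall>x\<in>dom \<rho>. abs(g x) <= C * s x powr \<beta>"
  using e dom_mono[of \<rho> R] \<rho> by (intro exI[of _ C]) (auto simp: subset_iff)
qed

lemma Pd_add: "Pd \<beta> f ==> Pd \<beta> g ==> Pd \<beta> (%x. f x + g x)"
 unfolding Pd_def[of \<beta> "%x. f x + g x"]
proof (intro allI impI)
 fix \<rho> assume f: "Pd \<beta> f" and g: "Pd \<beta> g" and \<rho>: "\<rho> < R"
 obtain C where C: "!!x. x \<in> dom \<rho> ==> abs(f x) <= C * s x powr \<beta>" using PdE[OF f \<rho>] by blast
 obtain E where E: "!!x. x \<in> dom \<rho> ==> abs(g x) <= E * s x powr \<beta>" using PdE[OF g \<rho>] by blast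
 have "abs(f x + g x) <= (C + E) * s x powr \<beta>" if "x \<in> dom \<rho>" for x
  using C[OF that] E[OF that] by (simp add: distrib_right)
 thus "\<exists>C. \<forall>x\<in>dom \<rho>. abs(f x + g x) <= C * s x powr \<beta>" by blast
qed

lemma Pd_mult: "Pd \<beta> f ==> Pd \<gamma> g ==> Pd (\<beta> + \<gamma>) (%x. f x * g x)"
 unfolding Pd_def[of "\<beta> + \<gamma>" "%x. f x * g x"]
proof (intro allI impI)
 fix \<rho> assume f: "Pd \<beta> f" and g: "Pd \<gamma> g" and \<rho>: "\<rho> < R"
 obtain C where C: "C > 0" "!!x. x \<in> dom \<rho> ==> abs(f x) <= C * s x powr \<beta>" using PdE[OF f \<rho>] by blast
 obtain E where E: "E > 0" "!!x. x \<in> dom \<rho> ==> abs(g x) <= E * s x powr \<gamma>" using PdE[OF g \<rho>] by blast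
 have "abs(f x * g x) <= (C * E) * s x powr (\<beta> + \<gamma>)" if "x \<in> dom \<rho>" for x
 proof -
  have "abs(f x * g x) <= (C * s x powr \<beta>) * (E * s x powr \<gamma>)"
   unfolding abs_mult using C E that by (intro mult_mono) auto
  thus ?thesis by (simp add: powr_add mult_ac)
 qed
 thus "\<exists>C. \<forall>x\<in>dom \<rho>. abs(f x * g x) <= C * s x powr (\<beta> + \<gamma>)" by blast
qed

section \<open>Interior estimates at the scale of the distance to the boundary\<close>

lemma interior_ball:
 assumes \<rho>: "\<rho> < R"
 obtains \<kappa> \<rho>' where "\<kappa> > 0" "\<rho> < \<rho>'" "\<rho>' < R"
  "!!x y. x \<in> dom \<rho> ==> y \<in> cball x (\<kappa> * s x) ==> y \<in> dom \<rho>' & s y >= s x / 2 & s y <= 2 * s x"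
proof -
 define \<rho>' where "\<rho>' = (\<rho> + R) / 2"
 have r: "\<rho> < \<rho>'" "\<rho>' < R" using \<rho> by (auto simp: \<rho>'_def)
 obtain S where S: "S > 0" "!!x. x \<in> ball p \<rho>' ==> abs(s x) <= S" using bounded_on_ball[OF smooth_s r(2)] by blast
 have "cball p \<rho>' \<subseteq> ball p R" using r by auto
 then obtain L where L: "L > 0" "!!x y. x \<in> cball p \<rho>' ==> y \<in> cball p \<rho>' ==> abs(s x - s y) <= L * dist x y"
  using smooth_lipschitz[OF smooth_s] by blast
 define \<kappa> where "\<kappa> = min (1 / (2 * L)) ((\<rho>' - \<rho>) / (2 * S))"
 have k: "\<kappa> > 0" "\<kappa> <= 1 / (2 * L)" "\<kappa> <= (\<rho>' - \<rho>) / (2 * S)" using L S r by (auto simp: \<kappa>_def)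
 show ?thesis
 proof (rule that[OF k(1) r])
  fix x y assume x: "x \<in> dom \<rho>" and y: "y \<in> cball x (\<kappa> * s x)"
  have xr: "dist p x < \<rho>" "s x > 0" using x by (auto simp: dom_def)
  hence "s x <= S" using S(2)[of x] r by auto
  have "dist x y <= \<kappa> * s x" using y by simp
  also have "... <= (\<rho>' - \<rho>) / (2 * S) * S" using k xr S `s x <= S` r by (intro mult_mono) auto
  also have "... = (\<rho>' - \<rho>) / 2" using S by simp
  finally have "dist p y < \<rho>'" using dist_triangle[of p y x] xr r by simp
  have "abs(s x - s y) <= L * dist x y" using xr r `dist p y < \<rho>'` by (intro L(2)) auto
  also have "... <= L * (1 / (2 * L) * s x)"
   using y L(1) mult_right_mono[OF k(2), of "s x"] xr by (intro mult_left_mono) auto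
  also have "... = s x / 2" using L by simp
  finally have "abs(s x - s y) <= s x / 2" .
  hence "s y >= s x / 2 & s y <= 2 * s x & s y > 0" using xr(2) unfolding abs_le_iff by linarith
  thus "y \<in> dom \<rho>' & s y >= s x / 2 & s y <= 2 * s x" using `dist p y < \<rho>'` by (simp add: dom_def)
 qed
qed

text \<open>The interior estimate on the ball of radius \<open>\<kappa> * s x\<close>, on which
  \<open>s\<close> changes at most by a factor 2. Dividing by this radius is the loss of one power
  of \<open>s\<close>.\<close>

lemma gradient_gain:
 assumes w: "smooth_in (dom R) w" and "Pd \<beta> w" "Pd (\<beta> - 2) (lap w)"
 shows "Pd (\<beta> - 1) (pd k w)"
 unfolding Pd_def
proof (intro allI impI)
 fix \<rho> assume "\<rho> < R"
 obtain \<kappa> \<rho>' where k: "\<kappa> > 0" "\<rho> < \<rho>'" "\<rho>' < R"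
  and ib: "!!x y. x \<in> dom \<rho> ==> y \<in> cball x (\<kappa> * s x) ==> y \<in> dom \<rho>' & s y >= s x / 2 & s y <= 2 * s x"
  using interior_ball[OF `\<rho> < R`] by metis
 obtain C where C: "C > 0" "!!x. x \<in> dom \<rho>' ==> abs(w x) <= C * s x powr \<beta>" using PdE[OF assms(2) k(3)] by blast
 obtain E where E: "E > 0" "!!x. x \<in> dom \<rho>' ==> abs(lap w x) <= E * s x powr (\<beta> - 2)" using PdE[OF assms(3) k(3)] by blast
 define C' where "C' = C * 2 powr abs(\<beta>)"
 define E' where "E' = E * 2 powr abs(\<beta> - 2)"
 have "abs(pd k w x) <= (Cg TYPE('n) * (C' / \<kappa> + \<kappa> * E')) * s x powr (\<beta> - 1)" if x: "x \<in> dom \<rho>" for x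
 proof -
  have sx: "s x > 0" using x by (simp add: dom_def)
  have "abs(pd k w x) <= Cg TYPE('n) * ((C' * s x powr \<beta>) / (\<kappa> * s x) + (\<kappa> * s x) * (E' * s x powr (\<beta> - 2)))"
  proof (rule interior_gradient[OF _ w])
   show "open (dom R)" by (simp add: open_dom)
   show "cball x (\<kappa> * s x) \<subseteq> dom R" using ib[OF x] dom_mono[of \<rho>' R] k(3) by force
   show "\<kappa> * s x > 0" using k sx by simp
   fix y assume y: "y \<in> cball x (\<kappa> * s x)"
   have i: "y \<in> dom \<rho>'" "s y >= s x / 2" "s y <= 2 * s x" using ib[OF x y] by auto
   have "C * s y powr \<beta> <= C * (2 powr abs(\<beta>) * s x powr \<beta>)"
    using powr_ratio[OF sx i(2,3)] C(1) by (intro mult_left_mono) auto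
   moreover have "E * s y powr (\<beta> - 2) <= E * (2 powr abs(\<beta> - 2) * s x powr (\<beta> - 2))"
    using powr_ratio[OF sx i(2,3)] E(1) by (intro mult_left_mono) auto
   ultimately show "abs(w y) <= C' * s x powr \<beta> & abs(lap w y) <= E' * s x powr (\<beta> - 2)"
    using C(2)[OF i(1)] E(2)[OF i(1)] by (auto simp: C'_def E'_def)
  qed
  also have "(C' * s x powr \<beta>) / (\<kappa> * s x) + (\<kappa> * s x) * (E' * s x powr (\<beta> - 2)) = (C' / \<kappa> + \<kappa> * E') * s x powr (\<beta> - 1)"
  proof -
   have "s x powr \<beta> = s x powr (\<beta> - 1) * s x" using powr_add[of "s x" "\<beta> - 1" 1] sx by simp
   moreover have "s x powr (\<beta> - 1) = s x powr (\<beta> - 2) * s x" using powr_add[of "s x" "\<beta> - 2" 1] sx by simp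
   moreover have "(c * (a * t)) / (q * t) + (q * t) * (e * b) = (c / q) * a + q * e * (b * t)"
    if "t ~= 0" for a b c q t e :: real using that by (simp add: mult_ac)
   ultimately show ?thesis using sx by (simp add: distrib_right)
  qed
  finally show ?thesis by (simp add: mult.assoc)
 qed
 thus "\<exists>C. \<forall>x\<in>dom \<rho>. abs(pd k w x) <= C * s x powr (\<beta> - 1)" by blast
qed

sublocale W: graded_derivations "dom R" "{f. smooth_in (dom R) f}" pd Pd 1 UNIV
proof
 show "Pd \<beta> f ==> Pd \<beta> g" if "!!x. x \<in> dom R ==> f x = g x" for \<beta> f g using Pd_cong[of f g \<beta>] that by blast
 show "pd k f x = pd k g x" if "!!x. x \<in> dom R ==> f x = g x" "x \<in> dom R" for k f g x
  using pd_cong[OF open_dom that(2), of f g k] that(1) by simp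
 show "pd k (%x. f x + g x) x = pd k f x + pd k g x"
  and "pd k (%x. f x * g x) x = pd k f x * g x + f x * pd k g x"
  if "f \<in> {f. smooth_in (dom R) f}" "g \<in> {f. smooth_in (dom R) f}" "x \<in> dom R" for k f g x
  using that smooth_in_diff[of "dom R" f x] smooth_in_diff[of "dom R" g x] by (auto intro: pd_add pd_mult)
qed (auto intro: smooth_in_pd smooth_in_mult open_dom Pd_add Pd_mult)

text \<open>The class of functions that scale like s^\<beta>: derivatives of order \<open>m\<close>
  are bounded by s to the power \<open>\<beta> - m\<close>.\<close>

definition CW :: "real => (real^'n => real) => bool" where
 "CW \<beta> f \<longleftrightarrow> smooth_in (dom R) f & (\<forall>m. W.cls m \<beta> f)"

lemma CW_smooth: "CW \<beta> f ==> smooth_in (dom R) f"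
 by (simp add: CW_def)

lemma CW_Pd: "CW \<beta> f ==> Pd \<beta> f"
 unfolding CW_def using W.cls_P by blast

lemma CW_cong: "(!!x. x \<in> dom R ==> f x = g x) ==> CW \<beta> f ==> CW \<beta> g"
 unfolding CW_def using smooth_in_cong[OF open_dom, of R f g] W.cls_cong[of f g] by blast

lemma W_mono: "W.cls m \<beta> f ==> \<gamma> <= \<beta> ==> W.cls m \<gamma> f"
proof (induction m arbitrary: \<beta> \<gamma> f)
 case 0
 thus ?case using Pd_mono[of \<beta> f \<gamma>] by simp
next
 case (Suc m)
 have "W.cls m (\<gamma> - 1) (pd k f)" for k
  using Suc.IH[of "\<beta> - 1" "pd k f" "\<gamma> - 1"] Suc.prems by simp
 thus ?case using Suc.prems Pd_mono[of \<beta> f \<gamma>] by simp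
qed

lemma CW_mono: "CW \<beta> f ==> \<gamma> <= \<beta> ==> CW \<gamma> f"
 unfolding CW_def using W_mono[of _ \<beta> f \<gamma>] by blast

lemma CW_add: "CW \<beta> f ==> CW \<beta> g ==> CW \<beta> (%x. f x + g x)"
 unfolding CW_def using W.cls_add[of f g] smooth_in_add[OF open_dom, of R f g] by simp

lemma CW_mult: "CW \<beta> f ==> CW \<gamma> g ==> CW (\<beta> + \<gamma>) (%x. f x * g x)"
 unfolding CW_def using W.cls_mult[of f g] smooth_in_mult[OF open_dom, of R f g] by simp

lemma CW_pd: "CW \<beta> f ==> CW (\<beta> - 1) (pd k f)"
 unfolding CW_def using smooth_in_pd[of "dom R" f k] W.cls.simps(2)[of _ \<beta> f] by blast

lemma CW_coef:
 assumes f: "smooth_in (ball p R) f"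
 shows "CW 0 f"
proof -
 have "W.cls m \<beta> f" if "smooth_in (ball p R) f" "\<beta> <= 0" for m \<beta> f
  using that
 proof (induction m arbitrary: f \<beta>)
  case 0
  thus ?case using Pd_mono[OF Pd_coef] by simp
 next
  case (Suc m)
  have "Pd \<beta> f" using Pd_mono[OF Pd_coef[OF Suc.prems(1)] Suc.prems(2)] .
  moreover have "W.cls m (\<beta> - 1) (pd k f)" for k
   using Suc.IH[OF smooth_in_pd[OF Suc.prems(1)], of "\<beta> - 1"] Suc.prems(2) by simp
  ultimately show ?case by simp
 qed
 thus ?thesis unfolding CW_def using f smooth_in_subset[OF f dom_ball] by auto
qed

lemma CW_coef_mult: "smooth_in (ball p R) a ==> CW \<beta> f ==> CW \<beta> (%x. a x * f x)"
 using CW_mult[OF CW_coef, of a \<beta> f] by simp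

lemma CW_X: "CW \<beta> f ==> CW (\<beta> - 1) (X k f)"
 unfolding X_def[abs_def] by (intro CW_add CW_coef_mult CW_pd smooth_in_pd smooth_phi)

text \<open>An order bound for \<open>w\<close> alone suffices once its Laplacian is under control:
  derivatives of \<open>w\<close> solve the differentiated equation, and
  \<open>gradient_gain\<close> applies to each of them in turn.\<close>

lemma elliptic_gain_cls:
 assumes "smooth_in (dom R) w" "Pd \<beta> w" "W.cls m (\<beta> - 2) (lap w)"
 shows "W.cls (Suc m) \<beta> w"
 using assms
proof (induction m arbitrary: \<beta> w)
 case 0
 thus ?case using gradient_gain[of w \<beta>] by simp
next
 case (Suc m)
 have "W.cls (Suc m) (\<beta> - 1) (pd k w)" for k
 proof (rule Suc.IH)
  show "Pd (\<beta> - 1) (pd k w)" by (rule gradient_gain[OF Suc.prems(1,2) W.cls_P[OF Suc.prems(3)]])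
  have c: "W.cls m (\<beta> - 2 - 1) (pd k (lap w))" using Suc.prems(3) by simp
  have e: "\<beta> - 1 - 2 = \<beta> - 2 - 1" by simp
  show "W.cls m (\<beta> - 1 - 2) (lap (pd k w))"
   unfolding e by (rule W.cls_cong[OF _ c]) (use pd_laplacian_commute[OF open_dom Suc.prems(1)] in auto)
 qed (rule smooth_in_pd[OF Suc.prems(1)])
 thus ?case using Suc.prems(2) by simp
qed

lemma elliptic_gain: "smooth_in (dom R) w ==> Pd \<beta> w ==> CW (\<beta> - 2) (lap w) ==> CW \<beta> w"
 unfolding CW_def using elliptic_gain_cls[of w \<beta>] W.cls_Suc_D by blast


section \<open>The Laplacian in the flattened coordinates\<close>

lemma phi_pd_normal: "x \<in> ball p R ==> pd \<iota> \<phi> x = 0"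
proof -
 assume x: "x \<in> ball p R"
 have "((%t. \<phi> (x + t *. \<iota>)) has_real_derivative pd \<iota> \<phi> x) (at 0)"
  using line_deriv[of \<phi> x 0 \<iota>] smooth_in_diff[OF smooth_phi x] by simp
 hence "((%t. \<phi> x) has_real_derivative pd \<iota> \<phi> x) (at (0::real))" unfolding phi_shift .
 thus ?thesis using DERIV_unique[OF _ DERIV_const] by blast
qed

lemma dphi_pd_normal: "x \<in> ball p R ==> pd \<iota> (pd k \<phi>) x = 0"
 using pd_commute[OF open_ball smooth_phi, of x \<iota> k] pd_cong[OF open_ball, of x p R "pd \<iota> \<phi>" "%_. 0" k] phi_pd_normal
 by simp

lemma smooth_in_X:
 assumes "open U" "U \<subseteq> ball p R" "smooth_in U f"
 shows "smooth_in U (X k f)"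
 unfolding X_def[abs_def]
 by (intro smooth_in_add smooth_in_mult smooth_in_pd smooth_in_subset[OF smooth_phi] assms)

lemma X_cong:
 assumes "open U" "x \<in> U" "!!y. y \<in> U ==> f y = g y"
 shows "X k f x = X k g x"
 unfolding X_def using pd_cong[OF assms] by simp

lemma X_add:
 assumes "f differentiable (at x)" "g differentiable (at x)"
 shows "X k (%x. f x + g x) x = X k f x + X k g x"
 unfolding X_def by (simp add: pd_add[OF assms] algebra_simps)

lemma X_mult:
 assumes "f differentiable (at x)" "g differentiable (at x)"
 shows "X k (%x. f x * g x) x = X k f x * g x + f x * X k g x"
 unfolding X_def by (simp add: pd_mult[OF assms] algebra_simps)

lemma X_sum:
 assumes "finite A" "!!a. a \<in> A ==> f a differentiable (at x)"
 shows "X k (%x. \<Sum>a\<in>A. f a x) x = (\<Sum>a\<in>A. X k (f a) x)"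
 unfolding X_def using assms by (simp add: pd_sum sum.distrib sum_distrib_left)

lemma XX:
 assumes "open U" "U \<subseteq> ball p R" "smooth_in U f" "x \<in> U"
 shows "X j (X k f) x = pd j (pd k f) x + pd j (pd k \<phi>) x * pd \<iota> f x
  + pd k \<phi> x * pd j (pd \<iota> f) x + pd j \<phi> x * pd \<iota> (pd k f) x
  + pd j \<phi> x * pd k \<phi> x * pd \<iota> (pd \<iota> f) x"
proof -
 have d: "pd l f differentiable (at x)" "pd l \<phi> differentiable (at x)" for l
  using assms smooth_in_diff[OF smooth_in_pd[OF assms(3)]] smooth_in_diff[OF smooth_in_pd[OF smooth_phi]] by auto
 have "pd l (X k f) x = pd l (pd k f) x + (pd l (pd k \<phi>) x * pd \<iota> f x
   + pd k \<phi> x * pd l (pd \<iota> f) x)" for l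
  unfolding X_def[abs_def] using d by (simp add: pd_add pd_mult)
 thus ?thesis
  unfolding X_def[of j] using dphi_pd_normal[of x k] assms by (auto simp: algebra_simps)
qed

lemma X_commute:
 assumes "open U" "U \<subseteq> ball p R" "smooth_in U f" "x \<in> U"
 shows "X j (X k f) x = X k (X j f) x"
proof -
 have "x \<in> ball p R" using assms by auto
 thus ?thesis
  unfolding XX[OF assms]
  using pd_commute[OF assms(1,3,4)] pd_commute[OF open_ball smooth_phi, of x j k]
  by (simp add: algebra_simps)
qed

text \<open>The coefficient of \<open>X j (X \<iota> w)\<close> when the Laplacian is written in the
  fields \<open>X\<close>. For \<open>j = \<iota>\<close> it is the excess of the full normal
  coefficient 1 + |grad \<phi>|^2 over the 1 already present in the sum of squares.\<close>

definition bc :: "'n => real^'n => real" where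
 "bc j x = (if j = \<iota> then grad2 \<phi> x else - 2 * pd j \<phi> x)"

lemma smooth_bc: "smooth_in (ball p R) (bc j)"
 unfolding bc_def[abs_def] by (cases "j = \<iota>") (auto intro!: smooth_in_grad2 smooth_phi smooth_in_mult smooth_in_minus smooth_in_pd)

lemma smooth_lap_phi: "smooth_in (ball p R) (%x. - lap \<phi> x)"
 by (intro smooth_in_minus smooth_in_laplacian smooth_phi) auto

lemma smooth_inv_coef: "smooth_in (ball p R) (%x. inverse (1 + grad2 \<phi> x))"
proof (rule smooth_in_inverse)
 have "grad2 \<phi> x >= 0" for x by (simp add: grad2_def sum_nonneg)
 thus "1 + grad2 \<phi> x ~= 0" for x by (metis add_nonneg_eq_0_iff zero_le_one zero_neq_one)
qed (auto intro!: smooth_in_add smooth_in_grad2 smooth_phi)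

lemma laplacian_X:
 assumes "open U" "U \<subseteq> ball p R" "smooth_in U w" "x \<in> U"
 shows "lap w x = (\<Sum>j\<in>UNIV. X j (X j w) x + bc j x * X j (X \<iota> w) x) + (- lap \<phi> x) * X \<iota> w x"
proof -
 have x: "x \<in> ball p R" using assms by auto
 let ?n = "pd \<iota> w" and ?f = "%j. pd j \<phi> x"
 have n: "?f \<iota> = 0" "pd j (pd \<iota> \<phi>) x = 0" for j
  using phi_pd_normal[OF x] dphi_pd_normal[OF x, of j] pd_commute[OF open_ball smooth_phi x, of \<iota> j] by auto
 have Xn: "X \<iota> w x = ?n x" by (simp add: X_def n)
 have X1: "X j (X \<iota> w) x = pd j ?n x + ?f j * pd \<iota> ?n x" for j
  unfolding XX[OF assms] using n by simp
 have X2: "X j (X j w) x = pd j (pd j w) x + pd j (pd j \<phi>) x * ?n x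
   + 2 * (?f j * pd j ?n x) + (?f j)\<^sup>2 * pd \<iota> ?n x" for j
  unfolding XX[OF assms] using pd_commute[OF assms(1,3,4), of \<iota> j] by (simp add: power2_eq_square)
 have "bc j x * X j (X \<iota> w) x = (if j = \<iota> then grad2 \<phi> x * pd \<iota> ?n x else 0)
   - 2 * (?f j * pd j ?n x) - 2 * ((?f j)\<^sup>2 * pd \<iota> ?n x)" for j
  unfolding X1 using n by (simp add: bc_def power2_eq_square algebra_simps)
 hence "(\<Sum>j\<in>UNIV. X j (X j w) x + bc j x * X j (X \<iota> w) x)
   = (\<Sum>j\<in>UNIV. pd j (pd j w) x + pd j (pd j \<phi>) x * ?n x
      - (?f j)\<^sup>2 * pd \<iota> ?n x + (if j = \<iota> then grad2 \<phi> x * pd \<iota> ?n x else 0))"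
  unfolding X2 by (intro sum.cong) auto
 also have "... = lap w x + lap \<phi> x * ?n x - grad2 \<phi> x * pd \<iota> ?n x + grad2 \<phi> x * pd \<iota> ?n x"
  by (simp add: sum.distrib sum_subtractf lap_def grad2_def sum_distrib_right)
 finally show ?thesis by (simp add: Xn)
qed

sublocale V: graded_derivations "dom R" "{f. smooth_in (dom R) f}" X CW 0 "- {\<iota>}"
proof
 show "X k f \<in> {f. smooth_in (dom R) f}" if "f \<in> {f. smooth_in (dom R) f}" for f k
  using that smooth_in_X[OF open_dom dom_ball] by simp
 show "X k f x = X k g x" if "!!x. x \<in> dom R ==> f x = g x" "x \<in> dom R" for k f g x
  using X_cong[OF open_dom that(2), of f g k] that(1) by simp
 show "X k (%x. f x + g x) x = X k f x + X k g x"
  and "X k (%x. f x * g x) x = X k f x * g x + f x * X k g x"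
  if "f \<in> {f. smooth_in (dom R) f}" "g \<in> {f. smooth_in (dom R) f}" "x \<in> dom R" for k f g x
  using that smooth_in_diff[of "dom R" f x] smooth_in_diff[of "dom R" g x] by (auto intro: X_add X_mult)
 show "CW \<beta> f ==> CW \<beta> g" if "!!x. x \<in> dom R ==> f x = g x" for \<beta> f g using CW_cong[of f g \<beta>] that by blast
qed (auto intro: CW_add CW_mult smooth_in_mult open_dom)

lemma V_CW: "V.cls m \<beta> f ==> CW \<beta> f" by (rule V.cls_P)

lemma V_smooth: "V.cls m \<beta> f ==> smooth_in (dom R) f" by (rule CW_smooth[OF V_CW])

lemma V_mono: "V.cls m \<beta> f ==> \<gamma> <= \<beta> ==> V.cls m \<gamma> f"
proof (induction m arbitrary: f)
 case 0
 thus ?case using CW_mono[of \<beta> f \<gamma>] by simp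
next
 case (Suc m)
 have "V.cls m \<gamma> (X k f)" if "k \<in> - {\<iota>}" for k
  using Suc.IH[of "X k f"] Suc.prems that by simp
 thus ?case using Suc.prems CW_mono[of \<beta> f \<gamma>] by simp
qed

lemma V_coef: "smooth_in (ball p R) a ==> V.cls m 0 a"
proof (induction m arbitrary: a)
 case 0
 thus ?case using CW_coef by simp
next
 case (Suc m)
 have "V.cls m 0 (X k a)" for k using Suc.IH[OF smooth_in_X[OF open_ball _ Suc.prems]] by simp
 thus ?case using CW_coef[OF Suc.prems] by simp
qed

lemma V_add: "V.cls m \<beta> f ==> V.cls m \<beta> g ==> V.cls m \<beta> (%x. f x + g x)"
 using V.cls_add[of f g] V_smooth by simp

lemma V_coef_mult: "smooth_in (ball p R) a ==> V.cls m \<beta> f ==> V.cls m \<beta> (%x. a x * f x)"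
 using V.cls_mult[of a f m 0 \<beta>] V_coef[of a m] V_smooth[of m \<beta> f] smooth_in_subset[OF _ dom_ball, of R a] by simp

lemma V_sum: "V.cls m \<beta> (%_. 0) ==> finite A ==> (!!a. a \<in> A ==> V.cls m \<beta> (f a)) ==> V.cls m \<beta> (%x. \<Sum>a\<in>A. f a x)"
proof (induction A rule: infinite_finite_induct)
 case (insert a A)
 thus ?case using V_add[of m \<beta> "f a" "%x. \<Sum>a\<in>A. f a x"] by simp
qed auto

lemma V_zero: "V.cls m \<beta> f ==> V.cls m \<beta> (%_. 0)"
 using V_coef_mult[of "%_. 0" m \<beta> f] by simp

lemma V_cong: "(!!x. x \<in> dom R ==> f x = g x) ==> V.cls m \<beta> f ==> V.cls m \<beta> g"
 by (rule V.cls_cong)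

lemma V_cmult: "V.cls m \<beta> f ==> V.cls m \<beta> (%x. c * f x)"
 by (rule V_coef_mult) auto

lemma V_diff: "V.cls m \<beta> f ==> V.cls m \<beta> g ==> V.cls m \<beta> (%x. f x - g x)"
 using V_add[of m \<beta> f "%x. (- 1) * g x"] V_cmult[of m \<beta> g "- 1"] by simp

lemma V_X_tang: "V.cls (Suc m) \<beta> f ==> k ~= \<iota> ==> V.cls m \<beta> (X k f)"
 by simp

lemma X_commute_dom: "smooth_in (dom R) f ==> x \<in> dom R ==> X j (X k f) x = X k (X j f) x"
 by (rule X_commute[OF open_dom dom_ball]) auto

lemma V_X: "V.cls m \<beta> f ==> V.cls m (\<beta> - 1) (X k f)"
proof (induction m arbitrary: f)
 case 0
 thus ?case using CW_X by simp
next
 case (Suc m)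
 have "V.cls m (\<beta> - 1) (X j (X k f))" if j: "j ~= \<iota>" for j
 proof (rule V_cong)
  show "V.cls m (\<beta> - 1) (X k (X j f))" using Suc.IH[of "X j f"] Suc.prems j by simp
 qed (use X_commute_dom[OF V_smooth[OF Suc.prems]] in auto)
 moreover have "CW (\<beta> - 1) (X k f)" using CW_X[OF V_CW[OF Suc.prems]] .
 ultimately show ?case by simp
qed

text \<open>A tangential field costs at most one order, like any first derivative, so giving up one
  order buys one more tangential derivative.\<close>

lemma V_drop: "V.cls m \<beta> f ==> V.cls (Suc m) (\<beta> - 1) f"
proof (induction m arbitrary: f)
 case 0
 thus ?case using CW_X CW_mono[of \<beta> f "\<beta> - 1"] by simp
next
 case (Suc m)
 have "V.cls (Suc m) (\<beta> - 1) (X j f)" if j: "j ~= \<iota>" for j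
  using Suc.IH[of "X j f"] Suc.prems j by simp
 thus ?case using CW_mono[OF V_CW[OF Suc.prems], of "\<beta> - 1"] V.cls.simps(2)[of "Suc m" "\<beta> - 1" f] by simp
qed

text \<open>Control of the derivatives that appear when a tangential field is commuted with the
  Laplacian; each of them contains the normal field.\<close>

definition second_ok :: "nat => real => (real^'n => real) => bool" where
 "second_ok m \<gamma> w \<longleftrightarrow> smooth_in (dom R) w & (\<forall>j. V.cls m \<gamma> (X j (X \<iota> w))) & V.cls m \<gamma> (X \<iota> w)"

text \<open>The fields commute with each other, and the terms \<open>X j (X j w)\<close> have
  constant coefficients. So the commutator arises only from differentiating \<open>bc\<close> and
  \<open>- lap \<phi>\<close>.\<close>

lemma X_laplacian_commutator:
 assumes w: "smooth_in (dom R) w" and x: "x \<in> dom R"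
 shows "lap (X k w) x = X k (lap w) x
   - ((\<Sum>j\<in>UNIV. X k (bc j) x * X j (X \<iota> w) x) + X k (%x. - lap \<phi> x) x * X \<iota> w x)"
proof -
 note od = open_dom[OF order_refl] and db = dom_ball[of R]
 have sX: "smooth_in (dom R) (X j f)" if "smooth_in (dom R) f" for j f using smooth_in_X[OF od db that] .
 have d: "f differentiable (at x)" if "smooth_in (dom R) f" for f using smooth_in_diff[OF that x] .
 have sb: "smooth_in (dom R) (bc j)" "smooth_in (dom R) (%x. - lap \<phi> x)" for j
  using smooth_in_subset[OF smooth_bc db] smooth_in_subset[OF smooth_lap_phi db] by auto
 let ?R = "%x. (\<Sum>j\<in>UNIV. X j (X j w) x + bc j x * X j (X \<iota> w) x) + (- lap \<phi> x) * X \<iota> w x"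
 have sums: "smooth_in (dom R) (%x. X j (X j w) x + bc j x * X j (X \<iota> w) x)" for j
  by (intro smooth_in_add smooth_in_mult sX sb w od)
 have "X k (lap w) x = X k ?R x"
  by (rule X_cong[OF od x]) (rule laplacian_X[OF od db w])
 also have "... = (\<Sum>j\<in>UNIV. X k (X j (X j w)) x + (X k (bc j) x * X j (X \<iota> w) x + bc j x * X k (X j (X \<iota> w)) x))
   + (X k (%x. - lap \<phi> x) x * X \<iota> w x + (- lap \<phi> x) * X k (X \<iota> w) x)"
 proof -
  have 1: "X k ?R x = X k (%x. \<Sum>j\<in>UNIV. X j (X j w) x + bc j x * X j (X \<iota> w) x) x + X k (%x. (- lap \<phi> x) * X \<iota> w x) x"
   by (intro X_add d smooth_in_sum smooth_in_mult sums sX sb w od)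
  have 2: "X k (%x. \<Sum>j\<in>UNIV. X j (X j w) x + bc j x * X j (X \<iota> w) x) x = (\<Sum>j\<in>UNIV. X k (%x. X j (X j w) x + bc j x * X j (X \<iota> w) x) x)"
   by (intro X_sum d sums) simp
  have 3: "X k (%x. X j (X j w) x + bc j x * X j (X \<iota> w) x) x
    = X k (X j (X j w)) x + (X k (bc j) x * X j (X \<iota> w) x + bc j x * X k (X j (X \<iota> w)) x)" for j
   using X_add[of "X j (X j w)" x "%x. bc j x * X j (X \<iota> w) x" k] X_mult[of "bc j" x "X j (X \<iota> w)" k]
    d[OF sX[OF sX[OF w]]] d[OF sb(1)] d[OF smooth_in_mult[OF od sb(1) sX[OF sX[OF w]]]] by simp
  have 4: "X k (%x. (- lap \<phi> x) * X \<iota> w x) x = X k (%x. - lap \<phi> x) x * X \<iota> w x + (- lap \<phi> x) * X k (X \<iota> w) x"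
   by (intro X_mult d sX sb w)
  show ?thesis unfolding 1 2 3 4 ..
 qed
 also have "(\<Sum>j\<in>UNIV. X k (X j (X j w)) x + (X k (bc j) x * X j (X \<iota> w) x + bc j x * X k (X j (X \<iota> w)) x))
   = (\<Sum>j\<in>UNIV. X j (X j (X k w)) x + bc j x * X j (X \<iota> (X k w)) x) + (\<Sum>j\<in>UNIV. X k (bc j) x * X j (X \<iota> w) x)"
 proof -
  have c: "X k (X j (X i w)) x = X j (X i (X k w)) x" for i j
  proof -
   have "X k (X j (X i w)) x = X j (X k (X i w)) x" by (rule X_commute_dom[OF sX[OF w] x])
   also have "... = X j (X i (X k w)) x" by (rule X_cong[OF od x]) (rule X_commute_dom[OF w])
   finally show ?thesis .
  qed
  show ?thesis unfolding c by (simp add: sum.distrib algebra_simps)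
 qed
 also have "X k (X \<iota> w) x = X \<iota> (X k w) x" by (rule X_commute_dom[OF w x])
 finally show ?thesis unfolding laplacian_X[OF od db sX[OF w] x] by simp
qed

lemma laplacian_word:
 assumes "V.cls (Suc m) \<gamma> (lap w)" "second_ok m \<gamma> w" "length ks <= Suc m" "set ks \<subseteq> - {\<iota>}"
 shows "V.cls (Suc m - length ks) \<gamma> (lap (V.Ds ks w))"
 using assms
proof (induction ks arbitrary: m w)
 case (Cons k ks)
 have w: "smooth_in (dom R) w" and k: "k ~= \<iota>" using Cons.prems by (auto simp: second_ok_def)
 have L: "V.cls m \<gamma> (lap (X k w))"
 proof (rule V_cong)
  have "V.cls m \<gamma> (X j (X \<iota> w))" "V.cls m \<gamma> (X \<iota> w)" for j using Cons.prems(2) by (auto simp: second_ok_def)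
  moreover have "V.cls m \<gamma> (X k (lap w))" using Cons.prems(1) k by simp
  ultimately show "V.cls m \<gamma> (%x. X k (lap w) x
    - ((\<Sum>j\<in>UNIV. X k (bc j) x * X j (X \<iota> w) x) + X k (%x. - lap \<phi> x) x * X \<iota> w x))"
   by (intro V_diff V_add V_sum V_coef_mult smooth_in_X[OF open_ball] smooth_bc smooth_lap_phi) (auto intro: V_zero)
 qed (use X_laplacian_commutator[OF w] in auto)
 show ?case
 proof (cases m)
  case 0
  hence "ks = []" using Cons.prems(3) by simp
  thus ?thesis using L 0 by simp
 next
  case (Suc m')
  have "second_ok m' \<gamma> (X k w)"
   unfolding second_ok_def
  proof (intro conjI allI)
   show "smooth_in (dom R) (X k w)" by (rule smooth_in_X[OF open_dom dom_ball w]) simp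
   have 1: "V.cls (Suc m') \<gamma> (X j (X \<iota> w))" "V.cls (Suc m') \<gamma> (X \<iota> w)" for j using Cons.prems(2) Suc by (auto simp: second_ok_def)
   show "V.cls m' \<gamma> (X \<iota> (X k w))" by (rule V_cong[OF _ V_X_tang[OF 1(2) k]]) (rule X_commute_dom[OF w])
   show "V.cls m' \<gamma> (X j (X \<iota> (X k w)))" for j
   proof (rule V_cong[OF _ V_X_tang[OF 1(1)[of j] k]])
    fix x assume x: "x \<in> dom R"
    have "X k (X j (X \<iota> w)) x = X j (X k (X \<iota> w)) x"
     by (rule X_commute_dom[OF smooth_in_X[OF open_dom dom_ball w] x]) simp
    also have "... = X j (X \<iota> (X k w)) x"
     by (rule X_cong[OF open_dom x]) (use X_commute_dom[OF w] in auto)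
    finally show "X k (X j (X \<iota> w)) x = X j (X \<iota> (X k w)) x" .
   qed
  qed
  thus ?thesis using Cons.IH[of m' "X k w"] L Cons.prems(3,4) Suc by simp
 qed
qed simp

end

section \<open>Barriers built from powers of the distance function\<close>

definition pw :: "real => nat => real => real" where
 "pw a j t = (\<Prod>i<j. a - real i) * t powr (a - real j)"

lemma pw_deriv: "t > 0 ==> (pw a j has_real_derivative pw a (Suc j) t) (at t)"
proof -
 assume t: "t > 0"
 have "((%t. t powr (a - real j)) has_real_derivative (a - real j) * t powr (a - real j - 1)) (at t)"
  using t by (rule has_real_derivative_powr)
 from DERIV_cmult[OF this, of "\<Prod>i<j. a - real i"] show ?thesis
  unfolding pw_def[abs_def] by (simp add: mult.assoc diff_diff_eq add.commute)
qed

lemma pw_simps: "pw a 0 t = t powr a" "pw a (Suc 0) t = a * t powr (a - 1)"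
 "pw a (Suc (Suc 0)) t = a * (a - 1) * t powr (a - 2)"
 by (simp_all add: pw_def)

context bdry_chart
begin

text \<open>A concave profile \<open>Z 0\<close> with its derivatives. As the squared gradient of
  \<open>s\<close> is at least 1, the Laplacian of \<open>Z 0 (s x)\<close> is at most half of
  \<open>Z 2 (s x)\<close> once \<Lambda> bounds that of \<open>s\<close>. The other clauses let the
  profile absorb a quadratic term (\<open>q\<close>), the values away from the boundary
  (\<open>m\<close>) and a right side of order \<gamma>.\<close>

definition barrier_fn :: "real => (nat => real => real) => bool" where
 "barrier_fn \<gamma> Z \<longleftrightarrow> (\<forall>j t. t > 0 --> (Z j has_real_derivative Z (Suc j) t) (at t)) \<and>
   (\<forall>\<Lambda>>0. \<exists>t1>0. \<exists>q>0. \<exists>m>0. \<forall>t. 0 < t --> t < t1 -->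
    \<Lambda> * abs(Z 1 t) <= - Z 2 t / 2 & q <= - Z 2 t & 0 <= Z 0 t & (t1 / 2 <= t --> m <= Z 0 t) & t powr \<gamma> <= 4 * (- Z 2 t))"

lemma grad2_s: "x \<in> ball p R ==> grad2 s x >= 1"
proof -
 assume x: "x \<in> ball p R"
 have d: "\<phi> differentiable (at x)" "(%x::real^'n. x $ \<iota>) differentiable (at x)"
  using smooth_in_diff[OF smooth_phi x] smooth_in_diff[OF smooth_in_component, of x UNIV \<iota>] by auto
 hence "pd \<iota> s x = \<sigma>"
  unfolding s_def[abs_def] using phi_pd_normal[OF x] by (simp add: pd_cmult pd_diff)
 moreover have "\<sigma>\<^sup>2 = 1" using sg by auto
 moreover have "grad2 s x >= (pd \<iota> s x)\<^sup>2" unfolding grad2_def by (rule member_le_sum) auto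
 ultimately show ?thesis by simp
qed

definition vanish_on :: "real => (real^'n => real) => bool" where
 "vanish_on \<rho> w \<longleftrightarrow> (\<forall>e>0. \<exists>\<delta>>0. \<forall>x\<in>dom \<rho>. s x < \<delta> --> abs(w x) <= e)"

text \<open>\<open>A\<close> and \<open>t1\<close> are fixed before \<open>w\<close>, so the bound
  is uniform over all functions with the same \<open>M\<close> and \<open>C\<close>. The difference
  quotients in \<open>flow_gain\<close> rely on this.\<close>

lemma barrier:
 assumes Z: "barrier_fn \<gamma> Z" and \<rho>: "\<rho>' < \<rho>" "\<rho> < R" and "M >= 0" "C >= 0"
 obtains A t1 where "A > 0" "t1 > 0"
  "!!w x. smooth_in (dom \<rho>) w ==> (!!y. y \<in> dom \<rho> ==> abs(w y) <= M & abs(lap w y) <= C * s y powr \<gamma>)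
   ==> vanish_on \<rho> w ==> x \<in> dom \<rho>' ==> s x < t1 ==> abs(w x) <= A * Z 0 (s x)"
proof -
 let ?N = "real CARD('n)"
 obtain \<Lambda> where \<Lambda>: "\<Lambda> > 0" "!!x. x \<in> ball p \<rho> ==> abs(lap s x) <= \<Lambda>"
  using bounded_on_ball[OF smooth_in_laplacian[OF open_ball smooth_s] \<rho>(2)] by blast
 have Zd: "!!j t. t > 0 ==> (Z j has_real_derivative Z (Suc j) t) (at t)" using Z by (simp add: barrier_fn_def)
 from Z \<Lambda>(1) obtain t1 q m where t1: "t1 > 0" "q > 0" "m > 0"
  and tt: "!!t. 0 < t ==> t < t1 ==> \<Lambda> * abs(Z 1 t) <= - Z 2 t / 2 & q <= - Z 2 t & 0 <= Z 0 t & (t1 / 2 <= t --> m <= Z 0 t) & t powr \<gamma> <= 4 * (- Z 2 t)"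
  unfolding barrier_fn_def by blast
 define r1 where "r1 = (\<rho> - \<rho>') / 2"
 have r1: "r1 > 0" using \<rho> by (simp add: r1_def)
 define B where "B = M / r1^2"
 have B: "B >= 0" "B * r1^2 = M" using r1 `M >= 0` by (auto simp: B_def)
 \<comment> \<open>\<open>M / m\<close> dominates \<open>w\<close> where \<open>s\<close> exceeds
   \<open>t1 / 2\<close>, \<open>4 * C\<close> absorbs the right side, and the last term absorbs the
   Laplacian of the quadratic function, its summand 1 making the inequality strict.\<close>
 define A where "A = M / m + 2 * (4 * C + (2 * ?N * B + 1) / q)"
 have pos: "(2 * ?N * B + 1) / q > 0" using B t1 by (intro divide_pos_pos add_nonneg_pos) auto
 have A: "A > 0" "A * m >= M"
 proof -
  have "M / m >= 0" using `M >= 0` t1 by simp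
  thus "A > 0" unfolding A_def using pos `C >= 0` by (intro add_nonneg_pos mult_pos_pos) auto
  have "0 <= 2 * (4 * C + (2 * ?N * B + 1) / q)" using pos `C >= 0` by (intro mult_nonneg_nonneg add_nonneg_nonneg) auto
  hence "M / m * m <= A * m" unfolding A_def using t1 by (intro mult_right_mono) linarith+
  thus "A * m >= M" using t1 by simp
 qed
 have one: "w x <= A * Z 0 (s x)"
  if w: "smooth_in (dom \<rho>) w" and bd: "!!y. y \<in> dom \<rho> ==> abs(w y) <= M & abs(lap w y) <= C * s y powr \<gamma>"
   and van: "vanish_on \<rho> w" and x: "x \<in> dom \<rho>'" and sx: "s x < t1 / 2" for w x
 proof (rule field_le_epsilon)
  fix e :: real assume e: "e > 0"
  obtain \<delta> where \<delta>: "\<delta> > 0" "!!y. y \<in> dom \<rho> ==> s y < \<delta> ==> abs(w y) <= e" using van e unfolding vanish_on_def by blast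
  have xr: "dist p x < \<rho>'" "s x > 0" using x by (auto simp: dom_def)
  have sub: "cball x r1 \<subseteq> ball p \<rho>"
  proof
   fix y assume "y \<in> cball x r1"
   thus "y \<in> ball p \<rho>" using dist_triangle[of p y x] xr \<rho> by (simp add: r1_def)
  qed
  have bR: "ball p \<rho> \<subseteq> ball p R" using \<rho> by auto
  have sc: "continuous_on (ball p \<rho>) s" using continuous_on_subset[OF smooth_in_continuous[OF smooth_s] bR] .
  define D where "D = {y \<in> dom \<rho>. s y < t1}"
  have oD: "open D"
  proof -
   have "D = ball p \<rho> \<inter> s -` {0<..<t1}" by (auto simp: D_def dom_def)
   thus ?thesis using continuous_open_preimage[OF sc open_ball, of "{0<..<t1}"] by simp
  qed
  have D: "D \<subseteq> dom \<rho>" "D \<subseteq> ball p R" "!!y. y \<in> D ==> 0 < s y & s y < t1" using bR by (auto simp: D_def dom_def)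
  \<comment> \<open>Outside \<open>K\<close> one part of the barrier dominates: the quadratic one
    beyond distance \<open>r1\<close>, the constant \<open>e\<close> where
    \<open>s < \<delta>\<close>, and the profile where \<open>s\<close> exceeds
    \<open>t1 / 2\<close>.\<close>
  define K where "K = {y \<in> cball x r1. \<delta> <= s y & s y <= t1 / 2}"
  have K: "compact K"
  proof -
   have "K = cball x r1 \<inter> s -` {\<delta>..t1/2}" by (auto simp: K_def)
   hence "closed K" using continuous_on_closed_vimage[of "cball x r1" s] continuous_on_subset[OF sc sub] by (simp add: Int_commute)
   moreover have "bounded K" by (rule bounded_subset[OF bounded_cball[of x r1]]) (auto simp: K_def)
   ultimately show ?thesis by (simp add: compact_eq_bounded_closed)
  qed
  have KD: "K \<subseteq> D" using sub \<delta>(1) t1(1) by (auto simp: K_def D_def dom_def)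
  have smZ: "smooth_in D (%y. Z 0 (s y))"
   by (rule smooth_in_compose_real[where J = "{0<..}" and Fs = Z, OF oD]) (use Zd D(3) smooth_in_subset[OF smooth_s D(2)] in auto)
  define v where "v y = w y - (A * Z 0 (s y) + (B * ((y - x) \<bullet> (y - x)) + e))" for y
  have smq: "smooth_in D (%y. B * ((y - x) \<bullet> (y - x)) + e)" "smooth_in D (%y. B * ((y - x) \<bullet> (y - x)))"
   by (intro smooth_in_add smooth_in_mult smooth_in_sq oD smooth_in_const)+
  have smA: "smooth_in D (%y. A * Z 0 (s y))" by (intro smooth_in_mult smZ oD smooth_in_const)
  have smw: "smooth_in D w" by (rule smooth_in_subset[OF w D(1)])
  have "v x <= 0"
  proof (rule max_principle[OF oD _ _ K KD])
   show "smooth_in D v" unfolding v_def[abs_def] by (intro smooth_in_diff_fun smooth_in_add smA smq smw oD)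
   show "x \<in> D" using x sx \<rho> dom_mono[of \<rho>' \<rho>] t1 by (auto simp: D_def)
   fix y assume y: "y \<in> D"
   have sy: "0 < s y" "s y < t1" using D(3)[OF y] by auto
   note T = tt[OF sy]
   have lz: "lap (%y. Z 0 (s y)) y = Z 1 (s y) * lap s y + Z 2 (s y) * grad2 s y"
    unfolding grad2_def
    using laplacian_compose[OF oD smooth_in_subset[OF smooth_s D(2)] y, of "Z 0" "Z 1" "Z 2 (s y)"] Zd[of _ 0] Zd[of "s y" 1] D(3) sy
    by (simp add: numeral_2_eq_2)
   have ls: "abs(lap s y) <= \<Lambda>" using \<Lambda>(2)[of y] D(1) y dom_ball[of \<rho>] by blast
   have "Z 1 (s y) * lap s y <= abs(Z 1 (s y)) * abs(lap s y)" unfolding abs_mult[symmetric] by (rule abs_ge_self)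
   also have "... <= abs(Z 1 (s y)) * \<Lambda>" using ls by (intro mult_left_mono) auto
   finally have "Z 1 (s y) * lap s y <= abs(Z 1 (s y)) * \<Lambda>" .
   moreover have "Z 2 (s y) * grad2 s y <= Z 2 (s y) * 1"
    using grad2_s[of y] D(2) y T t1(2) by (intro mult_left_mono_neg) auto
   ultimately have lz2: "lap (%y. Z 0 (s y)) y <= Z 2 (s y) / 2" unfolding lz using T by (simp add: mult.commute)
   have lv: "lap v y = lap w y - (A * lap (%y. Z 0 (s y)) y + 2 * ?N * B)"
    unfolding v_def[abs_def] using smw smA smq smZ y
    by (simp add: laplacian_diff[OF oD] laplacian_add[OF oD] laplacian_cmult[OF oD] laplacian_sq smooth_in_sq smooth_in_add oD)
   have "A * lap (%y. Z 0 (s y)) y <= A * (Z 2 (s y) / 2)" using lz2 A by (intro mult_left_mono) auto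
   moreover have "A * (- Z 2 (s y) / 2) >= (4 * C + (2 * ?N * B + 1) / q) * (- Z 2 (s y))"
   proof -
    have "0 <= M / m * (- Z 2 (s y) / 2)" using T t1 `M >= 0` by (intro mult_nonneg_nonneg) auto
    thus ?thesis unfolding A_def by (simp add: algebra_simps)
   qed
   moreover have "(2 * ?N * B + 1) / q * (- Z 2 (s y)) >= (2 * ?N * B + 1) / q * q"
    using T pos by (intro mult_left_mono) auto
   moreover have "(2 * ?N * B + 1) / q * q = 2 * ?N * B + 1" using t1(2) by simp
   moreover have "abs(lap w y) <= C * (4 * (- Z 2 (s y)))"
    using bd[of y] D(1) y T `C >= 0` mult_left_mono[of "s y powr \<gamma>" "4 * (- Z 2 (s y))" C] by auto
   ultimately show "lap v y > 0" unfolding lv by (simp add: algebra_simps abs_le_iff)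
  next
   fix y assume y: "y \<in> D - K"
   have yd: "y \<in> dom \<rho>" and sy: "0 < s y" "s y < t1" using y D by auto
   note T = tt[OF sy]
   have AZ: "A * Z 0 (s y) >= 0" using A T by simp
   have Bq: "B * ((y - x) \<bullet> (y - x)) >= 0" using B by simp
   have wM: "w y <= M" using bd[OF yd] by linarith
   consider "dist x y > r1" | "s y < \<delta>" | "s y > t1 / 2" using y unfolding K_def by force
   thus "v y <= 0"
   proof cases
    case 1
    have "r1^2 <= (y - x) \<bullet> (y - x)"
    proof -
     have "r1 <= norm (y - x)" using 1 by (simp add: dist_norm norm_minus_commute)
     thus ?thesis using r1 power_mono[of r1 "norm (y - x)" 2] by (simp add: power2_norm_eq_inner)
    qed
    hence "M <= B * ((y - x) \<bullet> (y - x))" using B mult_left_mono by metis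
    thus ?thesis unfolding v_def using AZ wM e by simp
   next
    case 2
    thus ?thesis unfolding v_def using \<delta>(2)[OF yd] AZ Bq by simp
   next
    case 3
    hence "A * m <= A * Z 0 (s y)" using T A by (intro mult_left_mono) auto
    thus ?thesis unfolding v_def using A(2) Bq wM e by simp
   qed
  qed
  thus "w x <= A * Z 0 (s x) + e" by (simp add: v_def)
 qed
 show ?thesis
 proof (rule that[of A "t1 / 2"])
  fix w x assume w: "smooth_in (dom \<rho>) w" and bd: "!!y. y \<in> dom \<rho> ==> abs(w y) <= M & abs(lap w y) <= C * s y powr \<gamma>"
   and van: "vanish_on \<rho> w" and x: "x \<in> dom \<rho>'" "s x < t1 / 2"
  have od: "open (dom \<rho>)" using \<rho> by (simp add: open_dom)
  have lm: "lap (%y. - w y) y = - lap w y" if "y \<in> dom \<rho>" for y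
   using laplacian_cmult[OF od w that, of "-1"] by simp
  have "- w x <= A * Z 0 (s x)"
   by (rule one[of "%y. - w y"]) (use bd van x lm smooth_in_minus[OF od w] in "auto simp: vanish_on_def")
  thus "abs(w x) <= A * Z 0 (s x)" using one[OF w bd van x] by simp
 qed (use A t1 in auto)
qed

text \<open>For the square root the negative second derivative is t^(-3/2)/4, which beats both the
  first derivative and a right side of order -1 near 0. The price is a bound of order 1/2
  only.\<close>

lemma barrier_fn_sqrt: "barrier_fn (-1) (pw (1/2))"
 unfolding barrier_fn_def
proof (intro conjI allI impI)
 fix \<Lambda> :: real assume L: "\<Lambda> > 0"
 define t1 where "t1 = min 1 (1 / (4 * \<Lambda>))"
 have t1: "t1 > 0" "t1 <= 1" "t1 <= 1 / (4 * \<Lambda>)" using L by (auto simp: t1_def)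
 show "\<exists>t1>0. \<exists>q>0. \<exists>m>0. \<forall>t. 0 < t --> t < t1 -->
    \<Lambda> * abs(pw (1/2) 1 t) <= - pw (1/2) 2 t / 2 & q <= - pw (1/2) 2 t & 0 <= pw (1/2) 0 t & (t1 / 2 <= t --> m <= pw (1/2) 0 t) & t powr (-1) <= 4 * (- pw (1/2) 2 t)"
 proof (rule exI[where x = t1], rule conjI[OF t1(1)], rule exI[where x = "1/4"], rule conjI, simp,
   rule exI[where x = "(t1 / 2) powr (1/2)"], intro conjI allI impI)
  fix t :: real assume t: "0 < t" "t < t1"
  have p2: "pw (1/2) 2 t = - (1/4) * t powr (-3/2)" by (simp add: pw_simps numeral_2_eq_2)
  have p1: "pw (1/2) 1 t = 1/2 * t powr (-1/2)" by (simp add: pw_simps)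
  have e: "t powr (-1/2) = t * t powr (-3/2)" using powr_add[of t 1 "-3/2"] t by simp
  have tp: "t powr (-3/2) > 0" using t by simp
  have "4 * \<Lambda> * t <= 4 * \<Lambda> * (1 / (4 * \<Lambda>))" using t t1 L by (intro mult_left_mono) auto
  hence "4 * \<Lambda> * t <= 1" using L by simp
  hence "(4 * \<Lambda> * t) * t powr (-3/2) <= 1 * t powr (-3/2)" using tp by (intro mult_right_mono) auto
  thus "\<Lambda> * abs(pw (1/2) 1 t) <= - pw (1/2) 2 t / 2" unfolding p1 p2 e using t by (simp add: abs_mult)
  have o: "1 <= t powr (-3/2)" "t powr (-1) <= t powr (-3/2)" using t t1 powr_mono'[of "-3/2" 0 t] powr_mono'[of "-3/2" "-1" t] by auto
  thus "1/4 <= - pw (1/2) 2 t" "t powr (-1) <= 4 * (- pw (1/2) 2 t)" unfolding p2 by auto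
  show "0 <= pw (1/2) 0 t" by (simp add: pw_simps)
  show "(t1 / 2) powr (1/2) <= pw (1/2) 0 t" if "t1 / 2 <= t" using that t1 by (simp add: pw_simps powr_mono2)
 qed (use t1 in auto)
qed (auto intro: pw_deriv)

text \<open>A linear profile has no concavity. Subtracting t^(3/2) supplies a second derivative of
  order -1/2, while near 0 the profile stays between t/2 and t.\<close>

lemma barrier_fn_lin: "barrier_fn (-1/2) (%j t. pw 1 j t - pw (3/2) j t)"
 unfolding barrier_fn_def
proof (intro conjI allI impI)
 fix \<Lambda> :: real assume L: "\<Lambda> > 0"
 define t1 where "t1 = min (1/4) (1 / (16 * \<Lambda>\<^sup>2))"
 have t1: "t1 > 0" "t1 <= 1/4" "t1 <= 1 / (16 * \<Lambda>\<^sup>2)" using L by (auto simp: t1_def)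
 show "\<exists>t1>0. \<exists>q>0. \<exists>m>0. \<forall>t. 0 < t --> t < t1 -->
    \<Lambda> * abs(pw 1 1 t - pw (3/2) 1 t) <= - (pw 1 2 t - pw (3/2) 2 t) / 2 & q <= - (pw 1 2 t - pw (3/2) 2 t) & 0 <= pw 1 0 t - pw (3/2) 0 t
    & (t1 / 2 <= t --> m <= pw 1 0 t - pw (3/2) 0 t) & t powr (-1/2) <= 4 * (- (pw 1 2 t - pw (3/2) 2 t))"
 proof (rule exI[where x = t1], rule conjI[OF t1(1)], rule exI[where x = "3/4"], rule conjI, simp,
   rule exI[where x = "t1 / 4"], intro conjI allI impI)
  fix t :: real assume t: "0 < t" "t < t1"
  have p2: "pw 1 2 t - pw (3/2) 2 t = - (3/4) * t powr (-1/2)" by (simp add: pw_simps numeral_2_eq_2)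
  have p1: "pw 1 1 t - pw (3/2) 1 t = 1 - 3/2 * t powr (1/2)" using t by (simp add: pw_simps)
  have "t powr (3/2) = t * t powr (1/2)" using powr_add[of t 1 "1/2"] t by simp
  hence p0: "pw 1 0 t - pw (3/2) 0 t = t * (1 - t powr (1/2))" using t by (simp add: pw_simps right_diff_distrib)
  have sq: "t powr (1/2) = sqrt t" using t by (simp add: powr_half_sqrt)
  have half: "t powr (1/2) <= 1/2" "t powr (1/2) >= 0"
   unfolding sq using t t1 real_sqrt_le_mono[of t "1/4"] by (auto simp: real_sqrt_divide)
  have one: "1 <= t powr (-1/2)" using t t1 powr_mono'[of "-1/2" 0 t] by auto
  have L4: "4 * \<Lambda> <= t powr (-1/2)"
  proof -
   have "sqrt t <= sqrt (1 / (16 * \<Lambda>\<^sup>2))" using t t1 by simp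
   also have "... = 1 / (4 * \<Lambda>)" using L by (simp add: real_sqrt_divide real_sqrt_mult)
   finally have "4 * \<Lambda> <= 1 / sqrt t" using L t by (simp add: field_simps)
   moreover have "t powr (-1/2) = 1 / sqrt t" using powr_minus[of t "1/2"] unfolding sq inverse_eq_divide by simp
   ultimately show ?thesis by simp
  qed
  have "\<Lambda> * abs(pw 1 1 t - pw (3/2) 1 t) <= \<Lambda> * 1" unfolding p1 using half L by (intro mult_left_mono) (auto simp: abs_le_iff)
  thus "\<Lambda> * abs(pw 1 1 t - pw (3/2) 1 t) <= - (pw 1 2 t - pw (3/2) 2 t) / 2" unfolding p2 using L4 L by linarith
  show "3/4 <= - (pw 1 2 t - pw (3/2) 2 t)" "t powr (-1/2) <= 4 * (- (pw 1 2 t - pw (3/2) 2 t))" unfolding p2 using one by auto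
  have h2: "t * (1/2) <= t * (1 - t powr (1/2))" using half t by (intro mult_left_mono) auto
  show "0 <= pw 1 0 t - pw (3/2) 0 t" unfolding p0 using h2 t by linarith
  show "t1 / 4 <= pw 1 0 t - pw (3/2) 0 t" if "t1 / 2 <= t" unfolding p0 using h2 that by linarith
 qed (use t1 in auto)
qed (auto intro!: DERIV_diff pw_deriv)

text \<open>Away from the boundary \<open>s\<close> is bounded below, so boundedness already gives
  every order there and only a thin layer matters.\<close>

lemma Pd_near:
 assumes "Pd 0 f" "\<beta> >= 0"
  and near: "!!\<rho>. \<rho> < R ==> \<exists>C t1. t1 > 0 & (\<forall>x\<in>dom \<rho>. s x < t1 --> abs(f x) <= C * s x powr \<beta>)"
 shows "Pd \<beta> f"
 unfolding Pd_def
proof (intro allI impI)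
 fix \<rho> assume \<rho>: "\<rho> < R"
 obtain M where M: "M > 0" "!!x. x \<in> dom \<rho> ==> abs(f x) <= M * s x powr 0" using PdE[OF assms(1) \<rho>] by blast
 obtain C t1 where C: "t1 > 0" "!!x. x \<in> dom \<rho> ==> s x < t1 ==> abs(f x) <= C * s x powr \<beta>" using near[OF \<rho>] by blast
 have "abs(f x) <= (abs(C) + M * t1 powr (- \<beta>)) * s x powr \<beta>" if x: "x \<in> dom \<rho>" for x
 proof (cases "s x < t1")
  case True
  have "C * s x powr \<beta> <= (abs(C) + M * t1 powr (- \<beta>)) * s x powr \<beta>"     proof (rule mult_right_mono)
   have "0 <= M * t1 powr (- \<beta>)" using M(1) by simp
   thus "C <= abs(C) + M * t1 powr (- \<beta>)" by linarith
  qed simp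
  thus ?thesis using C(2)[OF x True] by linarith
 next
  case False
  have sx: "s x > 0" using x by (simp add: dom_def)
  have "1 = t1 powr (- \<beta>) * t1 powr \<beta>" using C(1) by (simp flip: powr_add)
  also have "... <= t1 powr (- \<beta>) * s x powr \<beta>" using False C(1) assms(2) by (intro mult_left_mono powr_mono2) auto
  finally have "M * 1 <= M * (t1 powr (- \<beta>) * s x powr \<beta>)" using M by (intro mult_left_mono) auto
  moreover have "abs(f x) <= M" using M(2)[OF x] sx by simp
  moreover have "0 <= abs(C) * s x powr \<beta>" by simp
  ultimately show ?thesis unfolding distrib_right mult.assoc by linarith
 qed
 thus "\<exists>C. \<forall>x\<in>dom \<rho>. abs(f x) <= C * s x powr \<beta>" by blast
qed

lemma barrier_linear:
 assumes w: "smooth_in (dom R) w" "Pd 0 w" "Pd (-1/2) (lap w)" and van: "!!\<rho>. \<rho> < R ==> vanish_on \<rho> w"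
 shows "Pd 1 w"
proof (rule Pd_near[OF w(2)])
 fix \<rho>' assume "\<rho>' < R"
 define \<rho> where "\<rho> = (\<rho>' + R) / 2"
 have \<rho>: "\<rho>' < \<rho>" "\<rho> < R" using `\<rho>' < R` by (auto simp: \<rho>_def)
 obtain M where M: "M > 0" "!!x. x \<in> dom \<rho> ==> abs(w x) <= M * s x powr 0" using PdE[OF w(2) \<rho>(2)] by blast
 obtain C where C: "C > 0" "!!x. x \<in> dom \<rho> ==> abs(lap w x) <= C * s x powr (-1/2)" using PdE[OF w(3) \<rho>(2)] by blast
 obtain A t1 where A: "A > 0" "t1 > 0"
  and b: "!!w x. smooth_in (dom \<rho>) w ==> (!!y. y \<in> dom \<rho> ==> abs(w y) <= M & abs(lap w y) <= C * s y powr (-1/2))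
   ==> vanish_on \<rho> w ==> x \<in> dom \<rho>' ==> s x < t1 ==> abs(w x) <= A * (pw 1 0 (s x) - pw (3/2) 0 (s x))"
  using barrier[OF barrier_fn_lin \<rho>, of M C] M(1) C(1) by (metis less_imp_le)
 have "abs(w x) <= A * s x powr 1" if x: "x \<in> dom \<rho>'" "s x < t1" for x
 proof -
  have "abs(w x) <= A * (pw 1 0 (s x) - pw (3/2) 0 (s x))"
  proof (rule b[OF smooth_in_subset[OF w(1) dom_mono] _ van[OF \<rho>(2)] x])
   fix y assume y: "y \<in> dom \<rho>"
   thus "abs(w y) <= M & abs(lap w y) <= C * s y powr (-1/2)" using M(2)[OF y] C(2)[OF y] by (auto simp: dom_def)
  qed (use \<rho> in simp)
  also have "... <= A * s x powr 1" using A by (intro mult_left_mono) (auto simp: pw_simps)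
  finally show ?thesis .
 qed
 thus "\<exists>C t1. t1 > 0 & (\<forall>x\<in>dom \<rho>'. s x < t1 --> abs(w x) <= C * s x powr 1)" using A(2) by blast
qed simp


text \<open>The flow of \<open>X k\<close>: translation by \<open>t\<close> along axis
  \<open>k\<close> in the flattened coordinates. For tangential \<open>k\<close> it preserves
  \<open>s\<close>, hence weights and boundary.\<close>

definition flow :: "'n => real => real^'n => real^'n" where
 "flow k t x = x + t *. k + (\<phi> (x + t *. k) - \<phi> x) *. \<iota>"

lemma flow_nth: "k ~= \<iota> ==> flow k t x $ j = (if j = \<iota> then x $ \<iota> + (\<phi> (x + t *. k) - \<phi> x) else x $ j + (if j = k then t else 0))"
 by (simp add: flow_def axis_def)

lemma phi_flow: "\<phi> (flow k t x) = \<phi> (x + t *. k)"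
 unfolding flow_def by (rule phi_shift)

lemma s_flow: "k ~= \<iota> ==> s (flow k t x) = s x"
 by (simp add: s_def phi_flow flow_nth)

lemma dphi_flow: "flow k t x \<in> ball p R ==> pd j \<phi> (flow k t x) = pd j \<phi> (x + t *. k)"
proof -
 assume b: "flow k t x \<in> ball p R"
 let ?v = "(\<phi> (x + t *. k) - \<phi> x) *. \<iota>"
 have "\<phi> differentiable (at (x + t *. k + ?v))"
  using smooth_in_diff[OF smooth_phi b] by (simp add: flow_def)
 from pd_shift(1)[OF this, of j] show ?thesis by (simp add: phi_shift flow_def)
qed

definition flows :: "'n => real => real => real => bool" where
 "flows k t \<rho> \<rho>' \<longleftrightarrow> (\<forall>x\<in>dom \<rho>. flow k t x \<in> dom \<rho>' & x + t *. k \<in> ball p R)"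

lemma flows_exists:
 assumes "k ~= \<iota>" "\<rho> < \<rho>'" "\<rho>' < R"
 obtains t0 where "t0 > 0" "!!t. abs(t) <= t0 ==> flows k t \<rho> \<rho>'"
proof -
 have "cball p \<rho>' \<subseteq> ball p R" using assms by auto
 then obtain L where L: "L > 0" "!!x y. x \<in> cball p \<rho>' ==> y \<in> cball p \<rho>' ==> abs(\<phi> x - \<phi> y) <= L * dist x y"
  using smooth_lipschitz[OF smooth_phi] by blast
 define t0 where "t0 = (\<rho>' - \<rho>) / (1 + L)"
 have t0: "t0 > 0" "t0 * (1 + L) = \<rho>' - \<rho>" using L assms by (auto simp: t0_def)
 show ?thesis
 proof (rule that[OF t0(1)])
  fix t :: real assume t: "abs(t) <= t0"
  have tb: "abs(t) * (1 + L) <= \<rho>' - \<rho>" using mult_right_mono[OF t, of "1 + L"] t0 L by simp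
  have "abs(t) * 1 <= abs(t) * (1 + L)" using L by (intro mult_left_mono) auto
  hence t1: "abs(t) <= \<rho>' - \<rho>" using tb by linarith
  show "flows k t \<rho> \<rho>'"
   unfolding flows_def
  proof (intro ballI conjI)
   fix x assume x: "x \<in> dom \<rho>"
   have xr: "dist p x < \<rho>" "s x > 0" using x by (auto simp: dom_def)
   let ?y = "x + t *. k"
   have y: "dist p ?y < \<rho>'" using dist_triangle[of p ?y x] xr t1 by simp
   thus "?y \<in> ball p R" using assms by simp
   have "abs(\<phi> ?y - \<phi> x) <= L * dist ?y x" using y xr assms by (intro L(2)) auto
   hence f: "abs(\<phi> ?y - \<phi> x) <= L * abs(t)" by simp
   have "dist x (x + v) = norm v" for v by (simp add: dist_norm)
   hence "dist x (flow k t x) = norm (t *. k + (\<phi> ?y - \<phi> x) *. \<iota>)" unfolding flow_def add.assoc .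
   also have "... <= norm (t *. k) + norm ((\<phi> ?y - \<phi> x) *. \<iota>)" by (rule norm_triangle_ineq)
   also have "... <= abs(t) + L * abs(t)" using f by simp
   also have "... <= \<rho>' - \<rho>" using tb by (simp add: algebra_simps)
   finally have "dist p (flow k t x) < \<rho>'" using dist_triangle[of p "flow k t x" x] xr by simp
   thus "flow k t x \<in> dom \<rho>'" using xr s_flow[OF assms(1)] by (simp add: dom_def)
  qed
 qed
qed

lemma flow_deriv:
 assumes "x + t *. k \<in> ball p R" "flow k t x \<in> ball p R" "f differentiable (at (flow k t x))"
 shows "((%t. f (flow k t x)) has_real_derivative X k f (flow k t x)) (at t)"
proof -
 let ?d = "pd k \<phi> (x + t *. k)"
 have "((%t. \<phi> (x + t *. k)) has_real_derivative ?d) (at t)"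
  by (rule line_deriv[OF smooth_in_diff[OF smooth_phi assms(1)]])
 hence p: "((%t. \<phi> (x + t *. k)) has_derivative (%h. ?d * h)) (at t)"
  by (simp add: has_field_derivative_def)
 have fl: "((%t. flow k t x) has_derivative (%h. h *. k + (?d * h) *. \<iota>)) (at t)"
  unfolding flow_def[abs_def] by (rule derivative_eq_intros p refl)+ simp
 have "((%t. f (flow k t x)) has_derivative
   (%h. \<Sum>i\<in>UNIV. (h *. k + (?d * h) *. \<iota>) $ i * pd i f (flow k t x))) (at t)"
  by (rule has_derivative_compose[OF fl has_derivative_pd[OF assms(3)]])
 moreover have "(\<Sum>i\<in>UNIV. (h *. k + (?d * h) *. \<iota>) $ i * pd i f (flow k t x)) = X k f (flow k t x) * h" for h
 proof -
  have e: "(h *. k + (?d * h) *. \<iota>) $ i * g = (if i = k then h * g else 0) + (if i = \<iota> then ?d * h * g else 0)" for i g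
   by (simp add: axis_def distrib_right)
  show ?thesis unfolding e by (simp add: sum.distrib X_def dphi_flow[OF assms(2)] distrib_left mult_ac)
 qed
 ultimately show ?thesis by (simp add: has_field_derivative_def)
qed

lemma flow_zero: "flow k 0 x = x"
 by (simp add: flow_def)

lemma flow_lip:
 assumes f: "smooth_in (dom R) f" "Pd \<beta> (X k f)" and k: "k ~= \<iota>" and \<rho>: "\<rho> < R"
 obtains C t0 where "C > 0" "t0 > 0" "!!t x. 0 < t ==> t <= t0 ==> x \<in> dom \<rho> ==> abs(f (flow k t x) - f x) <= t * (C * s x powr \<beta>)"
proof -
 define \<rho>' where "\<rho>' = (\<rho> + R) / 2"
 have r: "\<rho> < \<rho>'" "\<rho>' < R" using \<rho> by (auto simp: \<rho>'_def)
 obtain t0 where t0: "t0 > 0" "!!t. abs(t) <= t0 ==> flows k t \<rho> \<rho>'" using flows_exists[OF k r] by blast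
 obtain C where C: "C > 0" "!!x. x \<in> dom \<rho>' ==> abs(X k f x) <= C * s x powr \<beta>" using PdE[OF f(2) r(2)] by blast
 show ?thesis
 proof (rule that[OF C(1) t0(1)])
  fix t x assume t: "0 < t" "t <= t0" and x: "x \<in> dom \<rho>"
  have fl: "flow k q x \<in> dom \<rho>'" "x + q *. k \<in> ball p R" if "0 <= q" "q <= t" for q
   using t0(2)[of q] that t x unfolding flows_def by auto
  obtain q where q: "0 < q" "q < t" "f (flow k t x) - f (flow k 0 x) = (t - 0) * X k f (flow k q x)"
  proof -
   have "\<exists>q>0. q < t & f (flow k t x) - f (flow k 0 x) = (t - 0) * X k f (flow k q x)"
   proof (rule MVT2[OF t(1)])
    fix q assume q: "0 <= q" "q <= t"
    have "flow k q x \<in> dom R" using fl(1)[OF q] dom_mono[of \<rho>' R] r by auto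
    thus "((%t. f (flow k t x)) has_real_derivative X k f (flow k q x)) (at q)"
     using fl(2)[OF q] dom_ball[of R] smooth_in_diff[OF f(1)] by (intro flow_deriv) auto
   qed
   thus ?thesis using that by blast
  qed
  have "abs(X k f (flow k q x)) <= C * s x powr \<beta>" using C(2)[OF fl(1)[of q]] q s_flow[OF k] by simp
  thus "abs(f (flow k t x) - f x) <= t * (C * s x powr \<beta>)"
   using q(3) t by (simp add: flow_zero abs_mult mult_left_mono)
 qed
qed

lemma flow_comp_smooth:
 assumes k: "k ~= \<iota>" and fl: "flows k t \<rho> R" and "\<rho> <= R" and f: "smooth_in (dom R) f"
 shows "smooth_in (dom \<rho>) (%x. f (flow k t x))"
  and "x \<in> dom \<rho> ==> X j (%x. f (flow k t x)) x = X j f (flow k t x)"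
proof -
 have od: "open (dom \<rho>)" using open_dom assms by blast
 have ran: "flow k t x \<in> dom R" "x + t *. k \<in> ball p R" if "x \<in> dom \<rho>" for x using fl that by (auto simp: flows_def)
 have db: "dom \<rho> \<subseteq> ball p R" using assms(3) by (auto simp: dom_def)
 have sh: "smooth_in (dom \<rho>) (%x. \<phi> (x + t *. k))"
  by (rule smooth_in_compose[OF od _ smooth_phi]) (use ran in "auto intro!: smooth_in_add od")
 have sm0: "smooth_in (dom \<rho>) \<phi>" by (rule smooth_in_subset[OF smooth_phi db])
 have comp: "smooth_in (dom \<rho>) (%x. flow k t x $ j)" for j
  unfolding flow_nth[OF k] using sh sm0 od by (cases "j = \<iota>") (auto intro!: smooth_in_add smooth_in_diff_fun)
 show "smooth_in (dom \<rho>) (%x. f (flow k t x))"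
  by (rule smooth_in_compose[OF od _ f comp]) (use ran in auto)
 assume x: "x \<in> dom \<rho>"
 have dc: "(%x. flow k t x $ j) differentiable (at x)" for j by (rule smooth_in_diff[OF comp x])
 have df: "f differentiable (at (flow k t x))" by (rule smooth_in_diff[OF f ran(1)[OF x]])
 define q where "q i = pd i \<phi> (x + t *. k) - pd i \<phi> x" for i
 have pdc: "pd i (%x. flow k t x $ j) x = (if i = j then 1 else 0) + (if j = \<iota> then q i else 0)" for i j
 proof (cases "j = \<iota>")
  case True
  have d: "(%x. \<phi> (x + t *. k)) differentiable (at x)" "\<phi> differentiable (at x)" "(%x::real^'n. x $ \<iota>) differentiable (at x)"
   using smooth_in_diff[OF sh x] smooth_in_diff[OF sm0 x] smooth_in_diff[OF smooth_in_component, of x UNIV \<iota>] by auto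
  have "pd i (%x. \<phi> (x + t *. k)) x = pd i \<phi> (x + t *. k)"
   by (rule pd_shift(1)) (use smooth_in_diff[OF smooth_phi ran(2)[OF x]] in simp)
  thus ?thesis unfolding flow_nth[OF k] using True d by (simp add: pd_add pd_diff q_def)
 next
  case False
  have d: "(%x::real^'n. x $ j) differentiable (at x)"
   using smooth_in_diff[OF smooth_in_component, of x UNIV j] by auto
  show ?thesis unfolding flow_nth[OF k] using False d by (simp add: pd_add)
 qed
 have pdf: "pd i (%x. f (flow k t x)) x = pd i f (flow k t x) + q i * pd \<iota> f (flow k t x)" for i
 proof -
  have "pd i (%x. f (flow k t x)) x = (\<Sum>j\<in>UNIV. ((if i = j then 1 else 0) + (if j = \<iota> then q i else 0)) * pd j f (flow k t x))"
   unfolding pd_compose(1)[OF df dc] pdc ..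
  also have "... = (\<Sum>j\<in>UNIV. (if i = j then pd j f (flow k t x) else 0) + (if j = \<iota> then q i * pd j f (flow k t x) else 0))"
   by (intro sum.cong) (auto simp: distrib_right)
  finally show ?thesis by (simp add: sum.distrib)
 qed
 have "x + t *. k \<in> ball p R" "x \<in> ball p R" "flow k t x \<in> ball p R" using ran[OF x] x db dom_ball[of R] by auto
 hence "q \<iota> = 0" "pd j \<phi> (flow k t x) = pd j \<phi> (x + t *. k)"
  by (simp_all add: q_def phi_pd_normal dphi_flow)
 thus "X j (%x. f (flow k t x)) x = X j f (flow k t x)"
  unfolding X_def pdf by (simp add: q_def algebra_simps)
qed

text \<open>The flow commutes with every field \<open>X\<close>, so the defect only contains the
  change of the coefficients between \<open>x\<close> and \<open>flow k t x\<close>. These changes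
  are of order \<open>t\<close> and stay bounded after division by \<open>t\<close>.\<close>

lemma laplacian_flow:
 assumes k: "k ~= \<iota>" and fl: "flows k t \<rho> R" and "\<rho> <= R" and f: "smooth_in (dom R) f" and x: "x \<in> dom \<rho>"
 shows "lap (%x. f (flow k t x)) x = lap f (flow k t x)
  - ((\<Sum>j\<in>UNIV. (bc j (flow k t x) - bc j x) * X j (X \<iota> f) (flow k t x))
    + (- lap \<phi> (flow k t x) - - lap \<phi> x) * X \<iota> f (flow k t x))"
proof -
 have od: "open (dom \<rho>)" using open_dom assms by blast
 have db: "dom \<rho> \<subseteq> ball p R" using assms(3) by (auto simp: dom_def)
 have sX: "smooth_in (dom R) (X j f)" for j by (rule smooth_in_X[OF open_dom dom_ball f]) simp
 have XX: "X i (X j (%x. f (flow k t x))) x = X i (X j f) (flow k t x)" for i j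
 proof -
  have "X i (X j (%x. f (flow k t x))) x = X i (%x. X j f (flow k t x)) x"
   by (rule X_cong[OF od x]) (rule flow_comp_smooth(2)[OF k fl assms(3) f])
  also have "... = X i (X j f) (flow k t x)" by (rule flow_comp_smooth(2)[OF k fl assms(3) sX x])
  finally show ?thesis .
 qed
 have L1: "lap (%x. f (flow k t x)) x
   = (\<Sum>j\<in>UNIV. X j (X j f) (flow k t x) + bc j x * X j (X \<iota> f) (flow k t x)) + (- lap \<phi> x) * X \<iota> f (flow k t x)"
  unfolding laplacian_X[OF od db flow_comp_smooth(1)[OF k fl assms(3) f] x] XX flow_comp_smooth(2)[OF k fl assms(3) f x] ..
 have "flow k t x \<in> dom R" using fl x by (auto simp: flows_def)
 note L2 = laplacian_X[OF open_dom[OF order_refl] dom_ball f this]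
 show ?thesis unfolding L1 L2 by (simp add: sum.distrib sum_subtractf algebra_simps)
qed

text \<open>\<open>X k y\<close> is not known to vanish at the boundary, so the barrier cannot be
  applied to it. The difference quotient of \<open>y\<close> along the flow does vanish, because
  \<open>y\<close> is of order 1 and \<open>s\<close> is constant along the flow; its bounds do not
  depend on \<open>t\<close>, and \<open>t\<close> tends to 0 at the end.\<close>

lemma flow_gain:
 assumes y: "CW 1 y" and L: "V.cls 1 (-1) (lap y)" and k: "k ~= \<iota>"
 shows "Pd (1/2) (X k y)"
proof (rule Pd_near)
 have sy: "smooth_in (dom R) y" by (rule CW_smooth[OF y])
 have Xy: "Pd 0 (X j y)" for j using CW_Pd[OF CW_X[OF y, of j]] by simp
 thus "Pd 0 (X k y)" .
 fix \<rho>' assume "\<rho>' < R"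
 define \<rho> where "\<rho> = (\<rho>' + R) / 2"
 have \<rho>: "\<rho>' < \<rho>" "\<rho> < R" using `\<rho>' < R` by (auto simp: \<rho>_def)
 define \<rho>1 where "\<rho>1 = (\<rho> + R) / 2"
 have \<rho>1: "\<rho> < \<rho>1" "\<rho>1 < R" using \<rho> by (auto simp: \<rho>1_def)
 have dm: "dom \<rho> \<subseteq> dom \<rho>1" "dom \<rho>1 \<subseteq> dom R" using \<rho>1 by (auto intro!: dom_mono)
 have cb: "smooth_in (dom R) a" "Pd 0 (X k a)" if "smooth_in (ball p R) a" for a
  using smooth_in_subset[OF that dom_ball] Pd_coef[OF smooth_in_X[OF open_ball _ that]] by auto
 obtain ta where ta: "ta > 0" "!!t. abs(t) <= ta ==> flows k t \<rho> \<rho>1" using flows_exists[OF k \<rho>1] by blast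
 obtain M tb where M: "M > 0" "tb > 0" "!!t x. 0 < t ==> t <= tb ==> x \<in> dom \<rho> ==> abs(y (flow k t x) - y x) <= t * (M * s x powr 0)"
  using flow_lip[OF sy Xy k \<rho>(2)] by metis
 have sl: "smooth_in (dom R) (lap y)" by (rule smooth_in_laplacian[OF open_dom sy]) simp
 have "Pd (-1) (X k (lap y))" using L k by (auto intro: CW_Pd)
 from flow_lip[OF sl this k \<rho>(2)] obtain E te where E: "E > 0" "te > 0"
  "!!t x. 0 < t ==> t <= te ==> x \<in> dom \<rho> ==> abs(lap y (flow k t x) - lap y x) <= t * (E * s x powr (-1))" by metis
 have "\<forall>j. \<exists>C t0. C > 0 & t0 > 0 & (\<forall>t x. 0 < t --> t <= t0 --> x \<in> dom \<rho> --> abs(bc j (flow k t x) - bc j x) <= t * (C * s x powr 0))"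
  using flow_lip[OF cb[OF smooth_bc] k \<rho>(2)] by metis
 then obtain C tc where C: "!!j. C j > 0" "!!j. tc j > 0"
  "!!j t x. 0 < t ==> t <= tc j ==> x \<in> dom \<rho> ==> abs(bc j (flow k t x) - bc j x) <= t * (C j * s x powr 0)" by metis
 obtain G tg where G: "G > 0" "tg > 0"
  "!!t x. 0 < t ==> t <= tg ==> x \<in> dom \<rho> ==> abs(- lap \<phi> (flow k t x) - - lap \<phi> x) <= t * (G * s x powr 0)"
  using flow_lip[OF cb[OF smooth_lap_phi] k \<rho>(2)] by metis
 have "\<forall>j. \<exists>H>0. \<forall>x\<in>dom \<rho>1. abs(X j (X \<iota> y) x) <= H * s x powr (-1)"
 proof
  fix j
  have "Pd (-1) (X j (X \<iota> y))" using CW_Pd[OF CW_X[OF CW_X[OF y]]] by simp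
  thus "\<exists>H>0. \<forall>x\<in>dom \<rho>1. abs(X j (X \<iota> y) x) <= H * s x powr (-1)" using PdE[OF _ \<rho>1(2)] by metis
 qed
 then obtain H where H: "!!j. H j > 0" "!!j x. x \<in> dom \<rho>1 ==> abs(X j (X \<iota> y) x) <= H j * s x powr (-1)" by metis
 obtain J where J: "J > 0" "!!x. x \<in> dom \<rho>1 ==> abs(X \<iota> y x) <= J * s x powr (-1)"
  using PdE[OF Pd_mono[OF Xy, of "-1" \<iota>] \<rho>1(2)] by auto
 obtain Y where Y: "Y > 0" "!!x. x \<in> dom \<rho>1 ==> abs(y x) <= Y * s x powr 1" using PdE[OF CW_Pd[OF y] \<rho>1(2)] by blast
 define t0 where "t0 = Min (insert ta (insert tb (insert te (insert tg (range tc)))))"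
 have t0: "t0 > 0" "t0 <= ta" "t0 <= tb" "t0 <= te" "t0 <= tg" "t0 <= tc j" for j
 proof -
  let ?S = "insert ta (insert tb (insert te (insert tg (range tc))))"
  have f: "finite ?S" "?S ~= {}" by auto
  show "t0 > 0" unfolding t0_def Min_gr_iff[OF f] using ta(1) M(2) E(2) G(2) C(2) by blast
  show "t0 <= ta" "t0 <= tb" "t0 <= te" "t0 <= tg" "t0 <= tc j" unfolding t0_def by (rule Min_le[OF f(1)], blast)+
 qed
 \<comment> \<open>\<open>E\<close> bounds the difference quotient of the Laplacian; the products
   bound the quotients of the coefficients times the derivatives at the moved point. All
   contributions are of order -1.\<close>
 define K where "K = E + ((\<Sum>j\<in>UNIV. C j * H j) + G * J)"
 have K: "K >= 0" unfolding K_def using E C H G J by (intro add_nonneg_nonneg sum_nonneg mult_nonneg_nonneg) (auto intro: less_imp_le)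
 obtain A t1 where A: "A > 0" "t1 > 0"
  and bar: "!!w x. smooth_in (dom \<rho>) w ==> (!!y. y \<in> dom \<rho> ==> abs(w y) <= M & abs(lap w y) <= K * s y powr (-1))
   ==> vanish_on \<rho> w ==> x \<in> dom \<rho>' ==> s x < t1 ==> abs(w x) <= A * pw (1/2) 0 (s x)"
  using barrier[OF barrier_fn_sqrt \<rho>, of M K] M(1) K by (metis less_imp_le)
 have main: "abs((y (flow k t x) - y x) / t) <= A * s x powr (1/2)" if t: "0 < t" "t <= t0" and x: "x \<in> dom \<rho>'" "s x < t1" for t x
 proof -
  have fl: "flows k t \<rho> \<rho>1" "flows k t \<rho> R" using ta(2)[of t] t t0(2) dm(2) by (auto simp: flows_def)
  have \<rho>R: "\<rho> <= R" "\<rho> < R" using \<rho> by auto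
  have od: "open (dom \<rho>)" by (rule open_dom[OF \<rho>R(1)])
  have syd: "smooth_in (dom \<rho>) y" by (rule smooth_in_subset[OF sy dom_mono[OF \<rho>R(1)]])
  note fs = flow_comp_smooth(1)[OF k fl(2) \<rho>R(1) sy]
  define w where "w x = (1 / t) * (y (flow k t x) - y x)" for x
  have sw: "smooth_in (dom \<rho>) w" unfolding w_def[abs_def] by (intro smooth_in_mult smooth_in_diff_fun fs syd od smooth_in_const)
  have "abs(w x) <= A * pw (1/2) 0 (s x)"
  proof (rule bar[OF sw _ _ x])
   fix z assume z: "z \<in> dom \<rho>"
   have sz: "s z > 0" using z by (simp add: dom_def)
   have fz: "flow k t z \<in> dom \<rho>1" using fl(1) z by (auto simp: flows_def)
   have wb: "abs(w z) <= M" using M(3)[OF t(1) _ z] t t0(3) sz by (simp add: w_def abs_mult field_simps)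
   let ?S = "(\<Sum>j\<in>UNIV. (bc j (flow k t z) - bc j z) * X j (X \<iota> y) (flow k t z))"
   let ?T = "(- lap \<phi> (flow k t z) - - lap \<phi> z) * X \<iota> y (flow k t z)"
   have "lap w z = 1 / t * (lap (%x. y (flow k t x)) z - lap y z)"
    unfolding w_def[abs_def] using laplacian_cmult[OF od smooth_in_diff_fun[OF od fs syd] z, of "1 / t"] laplacian_diff[OF od fs syd z] by simp
   also have "... = 1 / t * (lap y (flow k t z) - lap y z - (?S + ?T))"
    unfolding laplacian_flow[OF k fl(2) \<rho>R(1) sy z] by (simp add: algebra_simps)
   finally have lw: "lap w z = 1 / t * (lap y (flow k t z) - lap y z - (?S + ?T))" .
   have S: "abs(?S) <= t * ((\<Sum>j\<in>UNIV. C j * H j) * s z powr (-1))"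
   proof -
    have "abs(?S) <= (\<Sum>j\<in>UNIV. abs((bc j (flow k t z) - bc j z) * X j (X \<iota> y) (flow k t z)))" by (rule sum_abs)
    also have "... <= (\<Sum>j\<in>UNIV. (t * C j) * (H j * s z powr (-1)))"
    proof (rule sum_mono)
     fix j
     have "abs(bc j (flow k t z) - bc j z) <= t * C j" using C(3)[OF t(1) _ z, of j] order_trans[OF t(2) t0(6)[of j]] sz by simp
     moreover have "abs(X j (X \<iota> y) (flow k t z)) <= H j * s z powr (-1)" using H(2)[OF fz, of j] by (simp add: s_flow[OF k])
     ultimately show "abs((bc j (flow k t z) - bc j z) * X j (X \<iota> y) (flow k t z)) <= (t * C j) * (H j * s z powr (-1))"
      unfolding abs_mult using t C(1)[of j] by (intro mult_mono) (auto intro: less_imp_le)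
    qed
    finally have "abs(?S) <= t * ((\<Sum>j\<in>UNIV. C j * H j) * P)" if "P = s z powr (-1)" for P
     unfolding that[symmetric] by (simp add: sum_distrib_left sum_distrib_right mult_ac)
    thus ?thesis by blast
   qed
   have T: "abs(?T) <= t * (G * J * s z powr (-1))"
   proof -
    have "abs(?T) <= (t * G) * (J * s z powr (-1))"
     unfolding abs_mult using G(3)[OF t(1) _ z] order_trans[OF t(2) t0(5)] sz J(2)[OF fz] t G(1) by (intro mult_mono) (auto simp: s_flow[OF k])
    thus ?thesis by (simp add: mult_ac)
   qed
   have EE: "abs(lap y (flow k t z) - lap y z) <= t * (E * s z powr (-1))" using E(3)[OF t(1) _ z] order_trans[OF t(2) t0(4)] by simp
   have "abs(lap y (flow k t z) - lap y z - (?S + ?T)) <= t * (K * s z powr (-1))"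
   proof -
    have "t * (K * s z powr (-1)) = t * (E * s z powr (-1)) + (t * ((\<Sum>j\<in>UNIV. C j * H j) * s z powr (-1)) + t * (G * J * s z powr (-1)))"
     unfolding K_def by (simp add: algebra_simps)
    thus ?thesis using EE S T by linarith
   qed
   hence "abs(lap w z) <= K * s z powr (-1)" unfolding lw abs_mult using t(1) by (simp add: field_simps)
   thus "abs(w z) <= M & abs(lap w z) <= K * s z powr (-1)" using wb by simp
  next
   show "vanish_on \<rho> w"
    unfolding vanish_on_def
   proof (intro allI impI)
    fix e :: real assume e: "e > 0"
    \<comment> \<open>This \<delta> degenerates as \<open>t\<close> tends to 0, which is harmless:
      the constants of \<open>barrier\<close> do not depend on the rate of vanishing.\<close>
    define \<delta> where "\<delta> = e * t / (2 * Y)"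
    have \<delta>: "\<delta> > 0" using e t Y by (simp add: \<delta>_def)
    have "abs(w z) <= e" if z: "z \<in> dom \<rho>" "s z < \<delta>" for z
    proof -
     have sz: "s z > 0" using z by (simp add: dom_def)
     have "abs(y z) <= Y * s z" "abs(y (flow k t z)) <= Y * s z"
      using Y(2)[of z] Y(2)[of "flow k t z"] dm(1) z fl(1) sz by (auto simp: flows_def s_flow[OF k])
     hence "abs(y (flow k t z) - y z) <= 2 * Y * s z" by linarith
     also have "... <= 2 * Y * \<delta>" using z Y by simp
     also have "... = t * e" using Y by (simp add: \<delta>_def)
     finally show ?thesis using t(1) by (simp add: w_def abs_mult field_simps)
    qed
    thus "\<exists>\<delta>>0. \<forall>x\<in>dom \<rho>. s x < \<delta> --> abs(w x) <= e" using \<delta> by blast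
   qed
  qed
  thus ?thesis by (simp add: w_def pw_simps)
 qed
 have "abs(X k y x) <= A * s x powr (1/2)" if x: "x \<in> dom \<rho>'" "s x < t1" for x
 proof -
  have xR: "x \<in> dom R" using x(1) dom_mono[of \<rho>' R] `\<rho>' < R` by auto
  have "((%t. y (flow k t x)) has_real_derivative X k y (flow k 0 x)) (at 0)"
   using flow_deriv[of x 0 k y] xR dom_ball[of R] smooth_in_diff[OF sy xR] by (auto simp: flow_zero)
  hence l: "(%t. (y (flow k t x) - y x) / t) \<midarrow>0\<rightarrow> X k y x" by (simp add: DERIV_def flow_zero)
  hence "((%t. (y (flow k t x) - y x) / t) \<longlongrightarrow> X k y x) (at_right 0)"
   by (rule tendsto_within_subset) simp
  hence "((%t. abs((y (flow k t x) - y x) / t)) \<longlongrightarrow> abs(X k y x)) (at_right 0)" by (rule tendsto_rabs)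
  moreover have "\<forall>\<^sub>F t in at_right 0. abs((y (flow k t x) - y x) / t) <= A * s x powr (1/2)"
   unfolding eventually_at_right_field using main x t0(1) by (intro exI[of _ t0]) auto
  ultimately show ?thesis by (rule tendsto_upperbound) simp
 qed
 thus "\<exists>C t1. t1 > 0 & (\<forall>x\<in>dom \<rho>'. s x < t1 --> abs(X k y x) <= C * s x powr (1/2))" using A(2) by blast
qed simp


section \<open>Normal derivatives\<close>

definition Vinf :: "real => (real^'n => real) => bool" where
 "Vinf \<beta> f \<longleftrightarrow> (\<forall>m. V.cls m \<beta> f)"

text \<open>Tangential derivatives are built into the bound \<open>Vinf\<close> to every order, so
  only applications of the normal field remain to be counted.\<close>

sublocale N: graded_derivations "dom R" "{f. smooth_in (dom R) f}" X Vinf 0 "{\<iota>}"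
proof
 show "Vinf \<beta> f ==> Vinf \<beta> g" if "!!x. x \<in> dom R ==> f x = g x" for \<beta> f g
  using V_cong[of f g _ \<beta>] that unfolding Vinf_def by blast
 show "Vinf \<beta> f ==> Vinf \<beta> g ==> Vinf \<beta> (%x. f x + g x)" for \<beta> f g
  using V_add[of _ \<beta> f g] unfolding Vinf_def by blast
 show "Vinf \<beta> f ==> Vinf \<gamma> g ==> Vinf (\<beta> + \<gamma>) (%x. f x * g x)" for \<beta> \<gamma> f g
  using V.cls_mult[of f g _ \<beta> \<gamma>] V_smooth[of 0 \<beta> f] V_smooth[of 0 \<gamma> g] unfolding Vinf_def by blast
 show "X k f \<in> {f. smooth_in (dom R) f}" if "f \<in> {f. smooth_in (dom R) f}" for f k
  using that smooth_in_X[OF open_dom dom_ball] by simp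
 show "X k f x = X k g x" if "!!x. x \<in> dom R ==> f x = g x" "x \<in> dom R" for k f g x
  using X_cong[OF open_dom that(2), of f g k] that(1) by simp
 show "X k (%x. f x + g x) x = X k f x + X k g x"
  and "X k (%x. f x * g x) x = X k f x * g x + f x * X k g x"
  if "f \<in> {f. smooth_in (dom R) f}" "g \<in> {f. smooth_in (dom R) f}" "x \<in> dom R" for k f g x
  using that smooth_in_diff[of "dom R" f x] smooth_in_diff[of "dom R" g x] by (auto intro: X_add X_mult)
qed (auto intro: smooth_in_mult open_dom)

lemma N_Vinf: "N.cls m \<beta> f ==> Vinf \<beta> f" by (rule N.cls_P)

lemma N_smooth: "N.cls m \<beta> f ==> smooth_in (dom R) f"
 using N_Vinf[of m \<beta> f] V_smooth[of 0 \<beta> f] unfolding Vinf_def by blast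

lemma N_cong: "(!!x. x \<in> dom R ==> f x = g x) ==> N.cls m \<beta> f ==> N.cls m \<beta> g"
 by (rule N.cls_cong)

lemma VinfI: "(!!m. V.cls m \<beta> f) ==> Vinf \<beta> f"
 and VinfD: "Vinf \<beta> f ==> V.cls m \<beta> f"
 by (simp_all add: Vinf_def)

lemma Vinf_X_tang: "Vinf \<beta> f ==> k ~= \<iota> ==> Vinf \<beta> (X k f)"
 by (rule VinfI, rule V_X_tang, rule VinfD)

lemma N_X_tang: "N.cls m 0 f ==> k ~= \<iota> ==> N.cls m 0 (X k f)"
proof (induction m arbitrary: f)
 case 0
 thus ?case by (simp add: Vinf_X_tang)
next
 case (Suc m)
 have "N.cls m 0 (X \<iota> (X k f))"
 proof (rule N_cong)
  show "N.cls m 0 (X k (X \<iota> f))" using Suc.IH[of "X \<iota> f"] Suc.prems by simp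
 qed (use X_commute_dom[OF N_smooth[OF Suc.prems(1)]] in auto)
 moreover have "Vinf 0 (X k f)" by (rule Vinf_X_tang[OF N_Vinf[OF Suc.prems(1)] Suc.prems(2)])
 ultimately show ?case by simp
qed

lemma N_coef: "smooth_in (ball p R) a ==> N.cls m 0 a"
proof (induction m arbitrary: a)
 case 0
 thus ?case using VinfI[OF V_coef] by simp
next
 case (Suc m)
 have "N.cls m 0 (X \<iota> a)" using Suc.IH[OF smooth_in_X[OF open_ball _ Suc.prems]] by simp
 thus ?case using VinfI[OF V_coef[OF Suc.prems]] by simp
qed

lemma N_add: "N.cls m 0 f ==> N.cls m 0 g ==> N.cls m 0 (%x. f x + g x)"
 using N.cls_add[of f g m 0] N_smooth[of m 0] by simp

lemma N_coef_mult: "smooth_in (ball p R) a ==> N.cls m 0 f ==> N.cls m 0 (%x. a x * f x)"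
 using N.cls_mult[of a f m 0 0] N_coef[of a m] N_smooth[of m 0 f] smooth_in_subset[OF _ dom_ball, of R a] by simp

lemma N_diff: "N.cls m 0 f ==> N.cls m 0 g ==> N.cls m 0 (%x. f x - g x)"
 using N_add[of m f "%x. (- 1) * g x"] N_coef_mult[of "%_. - 1" m g] by simp

lemma N_sum: "finite A ==> (!!a. a \<in> A ==> N.cls m 0 (f a)) ==> N.cls m 0 (%x. \<Sum>a\<in>A. f a x)"
proof (induction A rule: finite_induct)
 case empty
 thus ?case using N_coef[of "%_. 0" m] by simp
next
 case (insert a A)
 thus ?case using N_add[of m "f a" "%x. \<Sum>a\<in>A. f a x"] by simp
qed

fun Xs :: "'n list => (real^'n => real) => real^'n => real" where
 "Xs [] f = f"
| "Xs (k # ks) f = Xs ks (X k f)"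

text \<open>The Laplacian solved for the one second derivative without a tangential field; every
  second order term left on the right contains a tangential one.\<close>

lemma X_normal_second:
 assumes "smooth_in (dom R) w" "x \<in> dom R"
 shows "X \<iota> (X \<iota> w) x = inverse (1 + grad2 \<phi> x) *
  (lap w x - ((\<Sum>j\<in>- {\<iota>}. X j (X j w) x + bc j x * X j (X \<iota> w) x) + (- lap \<phi> x) * X \<iota> w x))"
proof -
 have g: "1 + grad2 \<phi> x > 0" by (simp add: grad2_def sum_nonneg add_pos_nonneg)
 have "(\<Sum>j\<in>UNIV. X j (X j w) x + bc j x * X j (X \<iota> w) x)
   = (X \<iota> (X \<iota> w) x + bc \<iota> x * X \<iota> (X \<iota> w) x) + (\<Sum>j\<in>- {\<iota>}. X j (X j w) x + bc j x * X j (X \<iota> w) x)"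
  by (simp add: sum.remove[of UNIV \<iota>] Compl_eq_Diff_UNIV)
 hence "lap w x = (1 + grad2 \<phi> x) * X \<iota> (X \<iota> w) x
   + ((\<Sum>j\<in>- {\<iota>}. X j (X j w) x + bc j x * X j (X \<iota> w) x) + (- lap \<phi> x) * X \<iota> w x)"
  unfolding laplacian_X[OF open_dom[OF order_refl] dom_ball assms] by (simp add: bc_def algebra_simps)
 thus ?thesis using g by simp
qed

lemma Pd_vanish:
 assumes "Pd \<beta> w" "\<beta> > 0" "\<rho> < R"
 shows "vanish_on \<rho> w"
 unfolding vanish_on_def
proof (intro allI impI)
 fix e :: real assume e: "e > 0"
 obtain C where C: "C > 0" "!!x. x \<in> dom \<rho> ==> abs(w x) <= C * s x powr \<beta>" using PdE[OF assms(1,3)] by blast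
 have "abs(w x) <= e" if x: "x \<in> dom \<rho>" "s x < (e / C) powr (1 / \<beta>)" for x
 proof -
  have "s x powr \<beta> <= ((e / C) powr (1 / \<beta>)) powr \<beta>" using x assms(2) by (intro powr_mono2) (auto simp: dom_def)
  also have "... = e / C" using e C assms(2) by (simp add: powr_powr)
  finally have "C * s x powr \<beta> <= C * (e / C)" using C by (intro mult_left_mono) auto
  thus ?thesis using C(2)[OF x(1)] C(1) by simp
 qed
 thus "\<exists>\<delta>>0. \<forall>x\<in>dom \<rho>. s x < \<delta> --> abs(w x) <= e" using e C by (intro exI[of _ "(e / C) powr (1 / \<beta>)"]) auto
qed

lemma V_Ds_append: "V.Ds (ks @ [k]) f = X k (V.Ds ks f)"
 by (induction ks arbitrary: f) auto

lemma V_SucI: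
 assumes "V.cls m \<gamma> z" "\<beta> <= \<gamma>" and "!!ks k. length ks = m ==> set ks \<subseteq> - {\<iota>} ==> k ~= \<iota> ==> CW \<beta> (X k (V.Ds ks z))"
 shows "V.cls (Suc m) \<beta> z"
 unfolding V.cls_iff_Ds
proof (intro allI impI)
 fix ks assume ks: "length ks <= Suc m" "set ks \<subseteq> - {\<iota>}"
 show "CW (\<beta> - 0 * real (length ks)) (V.Ds ks z)"
 proof (cases "length ks <= m")
  case True
  hence "CW \<gamma> (V.Ds ks z)" using assms(1)[unfolded V.cls_iff_Ds] ks by auto
  thus ?thesis using CW_mono[of \<gamma> "V.Ds ks z" \<beta>] assms(2) by simp
 next
  case False
  hence "ks ~= []" by auto
  then obtain ks' k where k: "ks = ks' @ [k]" by (cases ks rule: rev_cases) auto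
  hence "length ks' = m" "set ks' \<subseteq> - {\<iota>}" "k ~= \<iota>" using False ks by auto
  thus ?thesis using assms(3)[of ks' k] by (simp add: k V_Ds_append)
 qed
qed

text \<open>
 One more tangential derivative \<open>w\<close> of a solution vanishing on the boundary: a priori \<open>w\<close> is only
 bounded. Its Laplacian is of order \<open>-1\<close>, so difference quotients along the flow and the barrier
 \<open>sqrt s\<close> give order \<open>1/2\<close>. The equation then improves the second normal derivatives, the Laplacian of
 \<open>w\<close> becomes of order \<open>-1/2\<close>, and the barrier \<open>s - s powr (3/2)\<close> gives order \<open>1\<close>.
\<close>

lemma tangential_step:
 assumes Vm: "V.cls m 1 z" and L: "V.cls (Suc m) 0 (lap z)"
 shows "V.cls (Suc m) 1 z"
proof -
 have z: "smooth_in (dom R) z" by (rule V_smooth[OF Vm])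
 have sD: "smooth_in (dom R) (V.Ds ks z)" if "set ks \<subseteq> - {\<iota>}" for ks using V.Ds_A[of z ks] z that by simp
 have D1: "CW 1 (V.Ds ks z)" if "length ks = m" "set ks \<subseteq> - {\<iota>}" for ks
  using Vm[unfolded V.cls_iff_Ds, rule_format, of ks] that by simp
 have Xn: "V.cls m 0 (X \<iota> z)" using V_X[OF Vm] by simp
 have ok1: "second_ok m (-1) z"
  unfolding second_ok_def
 proof (intro conjI allI z)
  show "V.cls m (-1) (X \<iota> z)" by (rule V_mono[OF Xn]) simp
  show "V.cls m (-1) (X j (X \<iota> z))" for j using V_X[OF Xn, of j] by simp
 qed
 have sX: "smooth_in (dom R) (X k f)" if "smooth_in (dom R) f" for k f using smooth_in_X[OF open_dom dom_ball that] by simp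
 have LX: "CW \<gamma> (lap (X k (V.Ds ks z)))"
  if ok: "second_ok m \<gamma> z" "\<gamma> <= 0" and ks: "length ks = m" "set ks \<subseteq> - {\<iota>}" "k ~= \<iota>" for \<gamma> ks k
  using laplacian_word[OF V_mono[OF L ok(2)] ok(1), of "ks @ [k]"] ks by (simp add: V_Ds_append)
 have half: "V.cls (Suc m) (1/2) z"
 proof (rule V_SucI[OF Vm])
  fix ks k assume ks: "length ks = m" "set ks \<subseteq> - {\<iota>}" and k: "k ~= \<iota>"
  have "V.cls (Suc m - length ks) (-1) (lap (V.Ds ks z))"
   by (rule laplacian_word[OF V_mono[OF L] ok1]) (use ks in auto)
  hence 1: "V.cls 1 (-1) (lap (V.Ds ks z))" using ks(1) by simp
  show "CW (1/2) (X k (V.Ds ks z))"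
  proof (rule elliptic_gain[OF sX[OF sD[OF ks(2)]]])
   show "Pd (1/2) (X k (V.Ds ks z))" by (rule flow_gain[OF D1[OF ks] 1 k])
   show "CW (1/2 - 2) (lap (X k (V.Ds ks z)))" by (rule CW_mono[OF LX[OF ok1 _ ks k]]) auto
  qed
 qed simp
 have ok2: "second_ok m (-1/2) z"
  unfolding second_ok_def
 proof (intro conjI allI z)
  show n1: "V.cls m (-1/2) (X \<iota> z)" by (rule V_mono[OF Xn]) simp
  have tj: "V.cls m (1/2) (X j z)" if "j ~= \<iota>" for j using V_X_tang[OF half that] .
  have n2: "V.cls m (-1/2) (X j (X \<iota> z))" if j: "j ~= \<iota>" for j
  proof (rule V_cong)
   show "V.cls m (-1/2) (X \<iota> (X j z))" using V_X[OF tj[OF j], of \<iota>] by simp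
  qed (use X_commute_dom[OF z] in auto)
  have n3: "V.cls m (-1/2) (X j (X j z))" if j: "j ~= \<iota>" for j using V_X[OF tj[OF j], of j] by simp
  have "V.cls m (-1/2) (X \<iota> (X \<iota> z))"
  proof (rule V_cong)
   have L': "V.cls m (-1/2) (lap z)" by (rule V_mono[OF V.cls_Suc_D[OF L]]) simp
   show "V.cls m (-1/2) (%x. inverse (1 + grad2 \<phi> x) *
     (lap z x - ((\<Sum>j\<in>- {\<iota>}. X j (X j z) x + bc j x * X j (X \<iota> z) x) + (- lap \<phi> x) * X \<iota> z x)))"
    by (intro V_coef_mult V_diff V_add V_sum L' n1 n2 n3 smooth_inv_coef smooth_bc smooth_lap_phi V_zero[OF n1]) auto
  qed (use X_normal_second[OF z] in simp)
  thus "V.cls m (-1/2) (X j (X \<iota> z))" for j using n2 by (cases "j = \<iota>") auto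
 qed
 show ?thesis
 proof (rule V_SucI[OF Vm])
  fix ks k assume ks: "length ks = m" "set ks \<subseteq> - {\<iota>}" and k: "k ~= \<iota>"
  let ?w = "X k (V.Ds ks z)"
  have LW: "CW (-1/2) (lap ?w)" by (rule LX[OF ok2 _ ks k]) simp
  have hw: "CW (1/2) ?w"
   using half[unfolded V.cls_iff_Ds, rule_format, of "ks @ [k]"] ks k by (simp add: V_Ds_append)
  show "CW 1 ?w"
  proof (rule elliptic_gain[OF CW_smooth[OF hw]])
   show "Pd 1 ?w"
   proof (rule barrier_linear[OF CW_smooth[OF hw] _ CW_Pd[OF LW]])
    show "Pd 0 ?w" by (rule Pd_mono[OF CW_Pd[OF hw]]) simp
    show "vanish_on \<rho> ?w" if "\<rho> < R" for \<rho> by (rule Pd_vanish[OF CW_Pd[OF hw] _ that]) simp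
   qed
   show "CW (1 - 2) (lap ?w)" by (rule CW_mono[OF LW]) simp
  qed
 qed simp
qed

theorem boundary_regularity:
 assumes z: "smooth_in (dom R) z" and eq: "!!x. x \<in> dom R ==> lap z x = c * Gs 0 (z x)"
  and van: "!!\<rho>. \<rho> < R ==> vanish_on \<rho> z"
  and J: "!!j t. t \<in> J ==> (Gs j has_real_derivative Gs (Suc j) t) (at t)" "compact J'" "J' \<subseteq> J" "!!x. x \<in> dom R ==> z x \<in> J'"
 shows "Pd 0 (Xs ks z)"
proof -
 have sG: "smooth_in (dom R) (%x. Gs j (z x))" for j
  by (rule smooth_in_compose_real[where J = J and Fs = Gs, OF open_dom[OF order_refl] J(1) _ z]) (use J in auto)
 have bdd: "Pd 0 (%x. g (z x))" if g: "continuous_on J' g" for g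
 proof -
  have "bounded (g ` J')" by (intro compact_imp_bounded compact_continuous_image g J(2))
  then obtain B where B: "!!t. t \<in> J' ==> abs(g t) <= B" unfolding bounded_real by blast
  show ?thesis
   unfolding Pd_def
  proof (intro allI impI exI[of _ B] ballI)
   fix \<rho> x assume "\<rho> < R" "x \<in> dom \<rho>"
   hence "x \<in> dom R" using dom_mono[of \<rho> R] by auto
   thus "abs(g (z x)) <= B * s x powr 0" using B[OF J(4)] by (auto simp: dom_def)
  qed
 qed
 have cG: "continuous_on J' (Gs j)" for j
  using J(1,3) by (intro continuous_at_imp_continuous_on) (auto intro: DERIV_isCont)
 have P0: "Pd 0 z" using bdd[OF continuous_on_id] by simp
 have PG: "Pd 0 (%x. Gs j (z x))" for j by (rule bdd[OF cG])
 have zd: "z differentiable (at x)" if "x \<in> dom R" for x by (rule smooth_in_diff[OF z that])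
 have pdG: "pd k (%x. Gs j (z x)) x = Gs (Suc j) (z x) * pd k z x" if "x \<in> dom R" for k j x
  using pd_compose_real(1)[OF J(1) zd[OF that]] J(3,4) that by auto
 have WG: "W.cls m 0 (%x. Gs j (z x))" if "W.cls m 0 z" for m j
  by (rule W.cls_compose[where Fs = Gs]) (use z that sG PG pdG in auto)
 have Wl: "W.cls m 0 (lap z)" if "W.cls m 0 z" for m
 proof (rule W.cls_cong)
  have "W.cls m (0 + 0) (%x. c * Gs 0 (z x))"
   using W.cls_mult[of "%_. c" "%x. Gs 0 (z x)" m 0 0] CW_coef[of "%_. c"] sG WG[OF that] unfolding CW_def by simp
  thus "W.cls m 0 (%x. c * Gs 0 (z x))" by simp
 qed (use eq in simp)
 \<comment> \<open>From boundedness alone: the chain rule for the right side and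
   \<open>elliptic_gain_cls\<close> alternate, giving all derivatives with the weights of order
   0.\<close>
 have Wz: "W.cls m 0 z" for m
 proof (induction m)
  case (Suc m)
  show ?case by (rule elliptic_gain_cls[OF z P0 W_mono[OF Wl[OF Suc]]]) simp
 qed (simp add: P0)
 have CG: "CW 0 (%x. Gs j (z x))" for j unfolding CW_def using sG WG[OF Wz] by blast
 have sl: "smooth_in (dom R) (lap z)" by (rule smooth_in_laplacian[OF open_dom z]) simp
 have Cl: "CW 0 (lap z)" unfolding CW_def using sl Wl[OF Wz] by blast
 \<comment> \<open>The boundary condition enters here and raises the order from 0 to 1.\<close>
 have C1: "CW 1 z"
 proof (rule elliptic_gain[OF z])
  show "Pd 1 z" by (rule barrier_linear[OF z P0 Pd_mono[OF CW_Pd[OF Cl]] van]) auto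
  show "CW (1 - 2) (lap z)" by (rule CW_mono[OF Cl]) simp
 qed
 have XG: "X k (%x. Gs j (z x)) x = Gs (Suc j) (z x) * X k z x" if "x \<in> dom R" for k j x
  unfolding X_def pdG[OF that] by (simp add: algebra_simps)
 have VG: "V.cls m 0 (%x. Gs j (z x))" if "V.cls m 0 z" for m j
  by (rule V.cls_compose[where Fs = Gs]) (use z that sG CG XG in auto)
 have Vl: "V.cls m 0 (lap z)" if "V.cls m 0 z" for m
  by (rule V_cong[OF _ V_cmult[of m 0 "%x. Gs 0 (z x)" c, OF VG[OF that]]]) (use eq in simp)
 \<comment> \<open>Dropping one order pays for one more tangential derivative of the right side,
   which \<open>tangential_step\<close> needs in order 0 only; the step then restores order
   1.\<close>
 have V1: "V.cls m 1 z" for m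
 proof (induction m)
  case (Suc m)
  have "V.cls (Suc m) 0 z" using V_drop[OF Suc] by simp
  from tangential_step[OF Suc Vl[OF this]] show ?case .
 qed (simp add: C1)
 have V0: "V.cls m 0 z" for m using V_mono[OF V1] by simp
 have NG: "N.cls m 0 (%x. Gs j (z x))" if "N.cls m 0 z" for m j
  by (rule N.cls_compose[where Fs = Gs]) (use z that sG VG[OF V0] XG in "auto simp: Vinf_def")
 have Nl: "N.cls m 0 (lap z)" if "N.cls m 0 z" for m
  by (rule N_cong[OF _ N_coef_mult[of "%_. c" m "%x. Gs 0 (z x)", OF _ NG[OF that]]]) (use eq in auto)
 \<comment> \<open>Order 1 for all tangential derivatives makes the first normal derivative bounded.
   Higher ones follow from \<open>X_normal_second\<close>, whose right side has one normal
   derivative less.\<close>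
 have N1: "N.cls (Suc m) 0 z" for m
 proof (induction m)
  case 0
  have "V.cls m 0 (X \<iota> z)" for m using V_X[OF V1, of m \<iota>] by simp
  thus ?case using VinfI[OF V0] VinfI[of 0 "X \<iota> z"] by simp
 next
  case (Suc m)
  have Nz: "N.cls m 0 z" by (rule N.cls_Suc_D[OF Suc])
  have Nn: "N.cls m 0 (X \<iota> z)" using Suc by simp
  have "N.cls m 0 (X \<iota> (X \<iota> z))"
  proof (rule N_cong)
   show "N.cls m 0 (%x. inverse (1 + grad2 \<phi> x) *
     (lap z x - ((\<Sum>j\<in>- {\<iota>}. X j (X j z) x + bc j x * X j (X \<iota> z) x) + (- lap \<phi> x) * X \<iota> z x)))"
    by (intro N_coef_mult N_diff N_add N_sum Nl[OF Nz] Nn N_X_tang Nz smooth_inv_coef smooth_bc smooth_lap_phi) auto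
  qed (use X_normal_second[OF z] in simp)
  thus ?case using Suc N_Vinf[OF Nn] by simp
 qed
 have Xg: "\<forall>m. N.cls m 0 (X k f)" if "\<forall>m. N.cls m 0 f" for k f
  using N_X_tang[of _ f k] that N.cls.simps(2)[of _ 0 f] by (cases "k = \<iota>") (auto simp del: N.cls.simps)
 have "\<forall>m. N.cls m 0 f ==> \<forall>m. N.cls m 0 (Xs ks f)" for f
  by (induction ks arbitrary: f) (auto simp del: N.cls.simps intro: Xg[rule_format])
 moreover have "\<forall>m. N.cls m 0 z" using N1 N.cls_Suc_D by blast
 ultimately have "Vinf 0 (Xs ks z)" using N_Vinf by blast
 hence "V.cls 0 0 (Xs ks z)" unfolding Vinf_def by blast
 thus ?thesis using CW_Pd by simp
qed

end

section \<open>Extension across a hyperplane\<close>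

text \<open>The Taylor coefficients of the entire function given by the product of all factors 1 -
  z/2^j, j \<ge> 0.\<close>

fun sb :: "nat => real" where
 "sb 0 = 1"
| "sb (Suc k) = - sb k * (1/2) ^ k / (1 - (1/2) ^ Suc k)"

lemma sb_ratio: "abs(sb (Suc k)) <= 2 * (1/2) ^ k * abs(sb k)"
proof -
 have h: "(1/2::real) ^ Suc k <= 1/2" using power_le_one[of "1/2::real" k] by simp
 have "abs(sb (Suc k)) = abs(sb k) * (1/2) ^ k / (1 - (1/2) ^ Suc k)"
  using h by (simp add: abs_mult)
 also have "... <= abs(sb k) * (1/2) ^ k / (1/2)" using h by (intro divide_left_mono) auto
 finally show ?thesis by (simp add: mult_ac)
qed

text \<open>The ratios of consecutive coefficients decay geometrically, so every \<open>B\<close> is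
  admissible. The values \<open>B = 2^j\<close> give the moments of order \<open>j\<close> at the
  points 2^k.\<close>

lemma sb_summable_abs:
 fixes B :: real
 assumes "B > 0"
 shows "summable (%k. abs(sb k) * B ^ k)"
proof -
 obtain N where N: "(1/2::real) ^ N < 1 / (4 * B)" using real_arch_pow_inv[of "1 / (4 * B)" "1/2"] assms by auto
 show ?thesis
 proof (rule summable_ratio_test[of "1/2" N])
  fix n assume n: "n >= N"
  have "(1/2::real) ^ n <= (1/2) ^ N" using n by (intro power_decreasing) auto
  hence "(1/2::real) ^ n <= 1 / (4 * B)" using N by linarith
  hence "2 * (1/2::real) ^ n * B <= 2 * (1 / (4 * B)) * B" using assms by (intro mult_right_mono mult_left_mono) auto
  hence h: "2 * (1/2::real) ^ n * B <= 1/2" using assms by simp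
  have "abs(sb (Suc n)) * B ^ Suc n <= (2 * (1/2) ^ n * abs(sb n)) * B ^ Suc n"
   using sb_ratio[of n] assms by (intro mult_right_mono) auto
  also have "... = (2 * (1/2) ^ n * B) * (abs(sb n) * B ^ n)" by simp
  also have "... <= 1/2 * (abs(sb n) * B ^ n)" using h assms by (intro mult_right_mono) auto
  finally show "norm (abs(sb (Suc n)) * B ^ Suc n) <= 1/2 * norm (abs(sb n) * B ^ n)" using assms by (simp add: abs_mult)
 qed simp
qed

lemma sb_summable: "summable (%k. sb k * z ^ k)"
proof (rule summable_comparison_test'[where N = 0])
 show "summable (%k. abs(sb k) * (abs(z) + 1) ^ k)" by (rule sb_summable_abs) simp
 show "norm (sb k * z ^ k) <= abs(sb k) * (abs(z) + 1) ^ k" for k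
  by (simp add: abs_mult power_abs mult_left_mono power_mono)
qed

definition sG :: "real => real" where
 "sG z = (\<Sum>k. sb k * z ^ k)"

text \<open>This functional equation makes \<open>sG\<close> vanish at every \<open>2 ^ j\<close>.\<close>

lemma sG_eq: "sG z = (1 - z) * sG (z / 2)"
proof -
 have e: "sb (Suc n) * z ^ Suc n = sb (Suc n) * (z / 2) ^ Suc n - z * (sb n * (z / 2) ^ n)" for n
 proof -
  have nz: "1 - (1/2::real) ^ Suc n ~= 0" using power_le_one[of "1/2::real" n] by simp
  hence "sb (Suc n) * (1 - (1/2) ^ Suc n) = - sb n * (1/2) ^ n" by simp
  hence "sb (Suc n) = sb (Suc n) * (1/2) ^ Suc n - sb n * (1/2) ^ n" unfolding right_diff_distrib by linarith
  hence "sb (Suc n) * z ^ Suc n = (sb (Suc n) * (1/2) ^ Suc n - sb n * (1/2) ^ n) * z ^ Suc n" by metis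
  also have "... = sb (Suc n) * ((1/2) ^ Suc n * z ^ Suc n) - z * (sb n * ((1/2) ^ n * z ^ n))"
   by (simp add: algebra_simps)
  finally show ?thesis by (simp only: power_mult_distrib[symmetric] times_divide_eq_left mult_1_left)
 qed
 have "sG z = 1 + (\<Sum>n. sb (Suc n) * z ^ Suc n)"
  using suminf_split_head[OF sb_summable[of z]] by (simp add: sG_def)
 also have "(\<Sum>n. sb (Suc n) * z ^ Suc n) = (\<Sum>n. sb (Suc n) * (z / 2) ^ Suc n) - (\<Sum>n. z * (sb n * (z / 2) ^ n))"
  unfolding e by (intro suminf_diff[symmetric] summable_mult sb_summable) (use summable_Suc_iff[of "%n. sb n * (z / 2) ^ n"] sb_summable in blast)
 also have "(\<Sum>n. sb (Suc n) * (z / 2) ^ Suc n) = sG (z / 2) - 1"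
  using suminf_split_head[OF sb_summable[of "z / 2"]] by (simp add: sG_def)
 also have "(\<Sum>n. z * (sb n * (z / 2) ^ n)) = z * sG (z / 2)"
  unfolding sG_def by (rule suminf_mult[OF sb_summable])
 finally show ?thesis by (simp add: algebra_simps)
qed

lemma sG_pow2: "sG (2 ^ j) = 0"
proof (induction j)
 case 0
 thus ?case using sG_eq[of 1] by simp
next
 case (Suc j)
 thus ?case using sG_eq[of "2 ^ Suc j"] by simp
qed

text \<open>Otherwise the functional equation produces zeros at all higher powers of 1/2,
  accumulating at 0, where the value is 1.\<close>

lemma sG_half: "sG (1/2) ~= 0"
proof
 assume h: "sG (1/2) = 0"
 have z: "sG ((1/2) ^ Suc m) = 0" for m
 proof (induction m)
  case (Suc m)
  have "(1/2::real) ^ Suc m ~= 1" using power_le_one[of "1/2::real" m] by simp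
  thus ?case using sG_eq[of "(1/2) ^ Suc m"] Suc by simp
 qed (simp add: h)
 have "isCont sG 0" unfolding sG_def[abs_def] by (rule isCont_powser_converges_everywhere[OF sb_summable])
 moreover have "(%m. (1/2::real) ^ Suc m) \<longlonglongrightarrow> 0" using LIMSEQ_Suc[OF LIMSEQ_power_zero[of "1/2::real"]] by simp
 ultimately have "(%m. sG ((1/2) ^ Suc m)) \<longlonglongrightarrow> sG 0" by (rule isCont_tendsto_compose)
 hence "sG 0 = 0" unfolding z using LIMSEQ_unique tendsto_const by blast
 moreover have "sG 0 = 1" unfolding sG_def by (simp add: powser_zero)
 ultimately show False by simp
qed

text \<open>Seeley's moment conditions. At the points \<open>- l k\<close>, with
  \<open>l k = 2 ^ (m + k)\<close>, the coefficients \<open>sb k\<close> have all moments zero,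
  because \<open>sG\<close> vanishes at the powers of 2. After division by \<open>1 + l k\<close>
  consecutive moments differ by such a zero moment, so they all equal \<open>S\<close>, and dividing
  by \<open>S\<close> normalises them to 1.\<close>

lemma reflection_coefficients:
 obtains c l :: "nat => real" where "!!k. l k > 0" "!!j. summable (%k. abs(c k) * l k ^ j)" "!!j. (\<Sum>k. c k * (- l k) ^ j) = 1"
proof -
 have sa: "summable (%k. abs(sb k))" using sb_summable_abs[of 1] by simp
 have gh: "abs(sG (1/2)) > 0" using sG_half by simp
 define T where "T = (\<Sum>k. abs(sb k)) + 1"
 have T: "T > 0" using suminf_nonneg[OF sa] by (simp add: T_def)
 obtain m where m: "(1/2::real) ^ m < abs(sG (1/2)) / T"
  using real_arch_pow_inv[of "abs(sG (1/2)) / T" "1/2"] gh T by auto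
 define l where "l k = (2::real) ^ (m + k)" for k
 have l: "l k > 0" for k by (simp add: l_def)
 have sl: "summable (%k. abs(sb k) * l k ^ j)" for j
 proof -
  have "summable (%k. (2 ^ m) ^ j * (abs(sb k) * (2 ^ j) ^ k))" by (intro summable_mult sb_summable_abs) simp
  moreover have "(2 ^ m) ^ j * (abs(sb k) * (2 ^ j) ^ k) = abs(sb k) * l k ^ j" for k
  proof -
   have "((2::real) ^ k) ^ j = (2 ^ j) ^ k" by (simp add: mult.commute flip: power_mult)
   thus ?thesis by (simp add: l_def power_add power_mult_distrib)
  qed
  ultimately show ?thesis by simp
 qed
 define S where "S = (\<Sum>k. sb k / (1 + l k))"
 have fr: "abs(x / (1 + l k)) <= abs(x)" for x k
 proof -
  have "abs(x / (1 + l k)) = abs(x) / (1 + l k)" using l[of k] by simp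
  also have "... <= abs(x) / 1" by (rule divide_left_mono) (use l[of k] in auto)
  finally show ?thesis by simp
 qed
 have s1: "summable (%k. sb k / (1 + l k) * (- l k) ^ j)" for j
 proof (rule summable_comparison_test'[OF sl[of j], of 0])
  fix k
  have "abs(sb k / (1 + l k)) * l k ^ j <= abs(sb k) * l k ^ j" using l[of k] by (intro mult_right_mono fr) auto
  thus "norm (sb k / (1 + l k) * (- l k) ^ j) <= abs(sb k) * l k ^ j" using l[of k] by (simp add: abs_mult power_abs)
 qed
 \<comment> \<open>\<open>2 ^ m / (1 + l k)\<close> is within (1/2)^m of (1/2)^k, so
   \<open>2 ^ m * S\<close> approximates \<open>sG (1/2)\<close>, which is not 0; \<open>m\<close>
   was chosen to make this close enough.\<close>
 have S0: "S ~= 0"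
 proof
  assume S: "S = 0"
  have d: "abs(sb k * (1/2) ^ k - 2 ^ m * (sb k / (1 + l k))) <= (1/2) ^ m * abs(sb k)" for k
  proof -
   have "(1/2) ^ k - 2 ^ m / (1 + l k) = (1/2) ^ k / (1 + l k)"
   proof -
    have "(1/2::real) ^ k * l k = 2 ^ m" by (simp add: l_def power_add power_one_over)
    hence "(1/2::real) ^ k * (1 + l k) - 2 ^ m = (1/2) ^ k" by (simp add: distrib_left)
    hence "((1/2::real) ^ k * (1 + l k) - 2 ^ m) / (1 + l k) = (1/2) ^ k / (1 + l k)" by simp
    thus ?thesis using l[of k] by (simp add: diff_divide_distrib)
   qed
   moreover have "sb k * (1/2) ^ k - 2 ^ m * (sb k / (1 + l k)) = sb k * ((1/2) ^ k - 2 ^ m / (1 + l k))" by (simp add: right_diff_distrib)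
   moreover have "(1/2) ^ k / (1 + l k) <= (1/2::real) ^ m"
   proof -
    have "(1/2::real) ^ k / (1 + l k) <= 1 / l k"
     using l[of k] by (intro frac_le) (auto intro: power_le_one)
    also have "... <= 1 / 2 ^ m" unfolding l_def by (intro divide_left_mono power_increasing) auto
    finally show ?thesis by (simp add: power_one_over)
   qed
   moreover have "0 <= (1/2::real) ^ k / (1 + l k)" using l[of k] by simp
   moreover have "abs(a * b) <= c * abs(a)" if "0 <= b" "b <= c" for a b c :: real
    using that mult_right_mono[of b c "abs(a)"] by (simp add: abs_mult mult.commute)
   ultimately show ?thesis by metis
  qed
  have sd: "summable (%k. (1/2) ^ m * abs(sb k))" by (intro summable_mult sa)
  have sk: "summable (%k. 2 ^ m * (sb k / (1 + l k)))" using s1[of 0] by (intro summable_mult) simp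
  have "sG (1/2) = sG (1/2) - 2 ^ m * S" using S by simp
  also have "... = (\<Sum>k. sb k * (1/2) ^ k - 2 ^ m * (sb k / (1 + l k)))"
   unfolding sG_def S_def using suminf_mult[of "%k. sb k / (1 + l k)" "2 ^ m"] suminf_diff[OF sb_summable[of "1/2"] sk] s1[of 0] by simp
  also have "abs(...) <= (\<Sum>k. (1/2) ^ m * abs(sb k))"
  proof -
   have sab: "summable (%k. abs(sb k * (1/2) ^ k - 2 ^ m * (sb k / (1 + l k))))"
    by (rule summable_comparison_test'[OF sd, of 0]) (use d in simp)
   show ?thesis by (rule order_trans[OF summable_rabs[OF sab] suminf_le[OF d sab sd]])
  qed
  also have "... = (1/2) ^ m * (T - 1)" unfolding T_def using suminf_mult[OF sa] by simp
  also have "... <= (1/2) ^ m * T" by simp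
  also have "... < abs(sG (1/2))" using m T by (simp add: field_simps)
  finally show False by simp
 qed
 have A: "(\<Sum>k. sb k / (1 + l k) * (- l k) ^ j) = S" for j
 proof (induction j)
  case (Suc j)
  have "sb k / (1 + l k) * (- l k) ^ Suc j = sb k / (1 + l k) * (- l k) ^ j - (- (2 ^ m)) ^ j * (sb k * (2 ^ j) ^ k)" for k
  proof -
   have W: "(- l k) ^ j = (- (2 ^ m)) ^ j * (2 ^ j) ^ k"
   proof -
    have "((2::real) ^ k) ^ j = (2 ^ j) ^ k" by (simp add: mult.commute flip: power_mult)
    moreover have "(- l k) ^ j = (- (2 ^ m)) ^ j * ((2::real) ^ k) ^ j" by (simp add: l_def power_add flip: power_mult_distrib)
    ultimately show ?thesis by simp
   qed
   have "a / (1 + l k) * (w * - l k) = a / (1 + l k) * w - a * w" for a w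
    using l[of k] by (simp add: field_simps)
   from this[of "sb k" "(- l k) ^ j"] show ?thesis unfolding power_Suc2 using W by (metis mult.left_commute)
  qed
  hence "(\<Sum>k. sb k / (1 + l k) * (- l k) ^ Suc j) = (\<Sum>k. sb k / (1 + l k) * (- l k) ^ j) - (\<Sum>k. (- (2 ^ m)) ^ j * (sb k * (2 ^ j) ^ k))"
   using suminf_diff[OF s1[of j] summable_mult[OF sb_summable[of "2 ^ j"], of "(- (2 ^ m)) ^ j"]] by simp
  also have "(\<Sum>k. (- (2 ^ m)) ^ j * (sb k * (2 ^ j) ^ k)) = 0"
   using suminf_mult[OF sb_summable[of "2 ^ j"], of "(- (2 ^ m)) ^ j"] sG_pow2[of j] by (simp add: sG_def)
  finally show ?case using Suc by simp
 qed (simp add: S_def)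
 show ?thesis
 proof (rule that[of l "%k. sb k / (1 + l k) / S"])
  show "summable (%k. abs(sb k / (1 + l k) / S) * l k ^ j)" for j
  proof (rule summable_comparison_test'[OF summable_mult[OF sl[of j], of "1 / abs(S)"], of 0])
   fix k
   have "1 / abs(S) * (abs(sb k / (1 + l k)) * l k ^ j) <= 1 / abs(S) * (abs(sb k) * l k ^ j)"
    using l[of k] by (intro mult_left_mono mult_right_mono fr) auto
   thus "norm (abs(sb k / (1 + l k) / S) * l k ^ j) <= 1 / abs(S) * (abs(sb k) * l k ^ j)"
    using l[of k] by (simp add: abs_mult power_abs mult.commute[of "abs(S)"])
  qed
  show "(\<Sum>k. sb k / (1 + l k) / S * (- l k) ^ j) = 1" for j
  proof -
   have "(\<Sum>k. sb k / (1 + l k) / S * (- l k) ^ j) = (\<Sum>k. (sb k / (1 + l k) * (- l k) ^ j) / S)" by simp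
   also have "... = S / S" using suminf_divide[OF s1[of j], of S] A[of j] by simp
   finally show ?thesis using S0 by simp
  qed
 qed (rule l)
qed

text \<open>In the normal direction the mean value theorem applies on each side of the hyperplane up
  to \<open>x\<close>. In a tangential direction the line lies inside the hyperplane, so the
  estimate is made on parallel lines off it and passed to the limit by continuity of
  \<open>F\<close>.\<close>

lemma directional_derivative_across_hyperplane:
 fixes F :: "real^'n::finite => real"
 assumes C: "open C" and F: "continuous_on C F" and G: "continuous_on C G"
  and off: "!!x. x \<in> C ==> x $ \<iota> ~= 0 ==> ((%t. F (x + t *. i)) has_real_derivative G x) (at 0)"
  and x: "x \<in> C" "x $ \<iota> = 0"
 shows "((%t. F (x + t *. i)) has_real_derivative G x) (at 0)"
proof -
 have offt: "((%t. F (y + t *. i)) has_real_derivative G (y + t *. i)) (at t)"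
  if "y + t *. i \<in> C" "(y + t *. i) $ \<iota> ~= 0" for y t
 proof -
  have "((%u. F ((y + t *. i) + (u - t) *. i)) has_real_derivative G (y + t *. i) * 1) (at t)"
   by (rule DERIV_chain2[where g = "%u. u - t"]) (use off[OF that] in "auto intro!: derivative_eq_intros")
  moreover have "(y + t *. i) + (u - t) *. i = y + u *. i" for u by (simp add: algebra_simps)
  ultimately show ?thesis by simp
 qed
 have key: "\<exists>\<delta>>0. \<forall>t. t ~= 0 --> abs(t) < \<delta> --> abs(F (x + t *. i) - F x - t * G x) <= abs(t) * e" if e: "e > 0" for e
 proof -
  have "isCont G x" using G C x(1) continuous_on_eq_continuous_at by blast
  then obtain d1 where d1: "d1 > 0" "!!y. dist y x < d1 ==> abs(G y - G x) < e"
   using e unfolding continuous_at_eps_delta dist_real_def by blast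
  obtain d2 where d2: "d2 > 0" "ball x d2 \<subseteq> C" using C x(1) open_contains_ball by blast
  define d where "d = min d1 d2"
  have d: "d > 0" "!!y. dist x y < d ==> y \<in> C & abs(G y - G x) < e"
   using d1 d2 by (auto simp: d_def dist_commute subset_iff)
  have seg: "abs(F (y + b *. i) - F (y + a *. i) - (b - a) * G x) <= (b - a) * e"
   if ab: "a < b" and inn: "!!t. a <= t ==> t <= b ==> dist x (y + t *. i) < d"
    and nz: "!!t. a < t ==> t < b ==> (y + t *. i) $ \<iota> ~= 0" for y a b
  proof -
   have "\<exists>z>a. z < b & F (y + b *. i) - F (y + a *. i) = (b - a) * G (y + z *. i)"
   proof -
    have cn: "continuous_on {a..b} (%t. F (y + t *. i))"
     by (rule continuous_on_compose2[OF F]) (use inn d(2) in "auto intro!: continuous_intros")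
    have df: "(%t. F (y + t *. i)) differentiable (at t)" if "a < t" "t < b" for t
    proof -
     have "((%t. F (y + t *. i)) has_real_derivative G (y + t *. i)) (at t)"
      by (rule offt) (use that inn[of t] d(2) nz in auto)
     thus ?thesis unfolding real_differentiable_def by blast
    qed
    from MVT[OF ab cn df] obtain l z where z: "a < z" "z < b" "((%t. F (y + t *. i)) has_real_derivative l) (at z)"
      "F (y + b *. i) - F (y + a *. i) = (b - a) * l"
     by blast
    have "l = G (y + z *. i)"
     by (rule DERIV_unique[OF z(3) offt]) (use z inn[of z] d(2) nz in auto)
    thus ?thesis using z by blast
   qed
   then obtain z where z: "a < z" "z < b" "F (y + b *. i) - F (y + a *. i) = (b - a) * G (y + z *. i)" by blast
   hence "F (y + b *. i) - F (y + a *. i) - (b - a) * G x = (b - a) * (G (y + z *. i) - G x)"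
    by (simp add: algebra_simps)
   moreover have "abs(G (y + z *. i) - G x) <= e" using d(2)[OF inn[of z]] z by auto
   ultimately show ?thesis using ab by (simp add: abs_mult mult_left_mono)
  qed
  have seg2: "abs(F (y + t *. i) - F y - t * G x) <= abs(t) * e"
   if t: "t ~= 0" "abs(t) < d / 2" and y: "dist x y < d / 2"
    and nz: "!!r. r ~= 0 ==> (y + r *. i) $ \<iota> ~= 0" for y t
  proof -
   have inn: "dist x (y + r *. i) < d" if "abs(r) <= abs(t)" for r
    using dist_triangle[of x "y + r *. i" y] that t y by simp
   show ?thesis
   proof (cases "t > 0")
    case True
    thus ?thesis using seg[of 0 t y] inn nz by simp
   next
    case False
    hence "abs(F (y + 0 *. i) - F (y + t *. i) - (0 - t) * G x) <= (0 - t) * e"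
    proof (intro seg)
     show "dist x (y + r *. i) < d" if "t <= r" "r <= 0" for r by (rule inn) (use that in simp)
     show "(y + r *. i) $ \<iota> ~= 0" if "t < r" "r < 0" for r by (rule nz) (use that in simp)
    qed (use t False in simp)
    thus ?thesis using False by (simp add: abs_le_iff)
   qed
  qed
  have "abs(F (x + t *. i) - F x - t * G x) <= abs(t) * e" if t: "t ~= 0" "abs(t) < d / 2" for t
  proof (cases "i = \<iota>")
   case True
   thus ?thesis using seg2[OF t, of x] d(1) x(2) by (simp add: axis_def)
  next
   case False
   have sh: "(%k. z + (1 / real (Suc k)) *. \<iota>) \<longlonglongrightarrow> z" for z :: "real^'n"
    using tendsto_add[OF tendsto_const[of z] tendsto_scaleR[OF lim_1_over_n[THEN LIMSEQ_Suc] tendsto_const[of "ax \<iota>"]]] by simp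
   have cF: "(%k. F (z + (1 / real (Suc k)) *. \<iota>)) \<longlonglongrightarrow> F z" if "dist x z < d" for z
    using isCont_tendsto_compose[OF _ sh] F C d(2)[OF that] continuous_on_eq_continuous_at by blast
   have l: "(%k. abs(F ((x + t *. i) + (1 / real (Suc k)) *. \<iota>) - F (x + (1 / real (Suc k)) *. \<iota>) - t * G x))
     \<longlonglongrightarrow> abs(F (x + t *. i) - F x - t * G x)"
    by (intro tendsto_intros cF) (use t d(1) in auto)
   obtain N where N: "!!k. k >= N ==> 1 / real (Suc k) < d / 2"
    using LIMSEQ_Suc[OF lim_1_over_n[where 'a = real]] d(1) unfolding lim_sequentially dist_real_def
    by (metis abs_of_nonneg diff_zero half_gt_zero of_nat_0_le_iff zero_le_divide_1_iff)
   have "\<forall>\<^sub>F k in sequentially. abs(F ((x + t *. i) + (1 / real (Suc k)) *. \<iota>) - F (x + (1 / real (Suc k)) *. \<iota>) - t * G x) <= abs(t) * e"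
    unfolding eventually_sequentially
   proof (intro exI[of _ N] allI impI)
    fix k assume k: "N <= k"
    let ?y = "x + (1 / real (Suc k)) *. \<iota>"
    have "abs(F (?y + t *. i) - F ?y - t * G x) <= abs(t) * e"
    proof (rule seg2[OF t])
     show "dist x ?y < d / 2" unfolding dist_step using N[OF k] by simp
     show "(?y + r *. i) $ \<iota> ~= 0" for r using x(2) False by (simp add: axis_def)
    qed
    thus "abs(F ((x + t *. i) + (1 / real (Suc k)) *. \<iota>) - F ?y - t * G x) <= abs(t) * e"
     by (simp add: add_ac)
   qed
   thus ?thesis by (rule tendsto_upperbound[OF l]) simp
  qed
  thus ?thesis using d(1) half_gt_zero by blast
 qed
 have "(%t. (F (x + t *. i) - F x) / t) \<midarrow>0\<rightarrow> G x"
 proof (rule LIM_I)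
  fix e :: real assume "e > 0"
  then obtain \<delta> where \<delta>: "\<delta> > 0" "!!t. t ~= 0 ==> abs(t) < \<delta> ==> abs(F (x + t *. i) - F x - t * G x) <= abs(t) * (e / 2)"
   using key[of "e / 2"] by auto
  have "abs((F (x + t *. i) - F x) / t - G x) < e" if t: "t ~= 0" "abs(t) < \<delta>" for t
  proof -
   have "(F (x + t *. i) - F x) / t - G x = (F (x + t *. i) - F x - t * G x) / t" using t by (simp add: diff_divide_distrib)
   hence "abs((F (x + t *. i) - F x) / t - G x) = abs(F (x + t *. i) - F x - t * G x) / abs(t)" by simp
   also have "... <= (abs(t) * (e / 2)) / abs(t)" using \<delta>(2)[OF t] by (intro divide_right_mono) auto
   also have "... < e" using t `e > 0` by simp
   finally show ?thesis .
  qed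
  thus "\<exists>s>0. \<forall>t. t ~= 0 & norm (t - 0) < s --> norm ((F (x + t *. i) - F x) / t - G x) < e"
   using \<delta>(1) by (intro exI[of _ \<delta>]) auto
 qed
 thus ?thesis by (simp add: DERIV_def)
qed

section \<open>The Seeley extension from a half space\<close>

locale half_ext =
 fixes \<iota> :: "'n::finite" and C :: "(real^'n) set" and c l :: "nat => real"
 assumes C: "open C" "convex C" and shift: "!!x t. x \<in> C ==> x + t *. \<iota> \<in> C"
  and l_pos: "!!k. l k > 0" and c_summable: "!!j. summable (%k. abs(c k) * l k ^ j)"
  and c_sum: "!!j. (\<Sum>k. c k * (- l k) ^ j) = 1"
begin

definition up :: "(real^'n) set" where
 "up = {x \<in> C. x $ \<iota> > 0}"

text \<open>Reflected points may run off to infinity with \<open>k\<close>, so global bounds for all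
  derivatives are what makes the reflected series and its termwise derivatives converge.\<close>

definition FB :: "(real^'n => real) => bool" where
 "FB f \<longleftrightarrow> smooth_in up f & (\<forall>ks. \<exists>B. \<forall>x\<in>up. abs(pds ks f x) <= B)"

definition mirror :: "nat => real^'n => real^'n" where
 "mirror k x = x - ((1 + l k) * x $ \<iota>) *. \<iota>"

text \<open>Supplies values on the hyperplane. \<open>f\<close> is given only above it; a bounded
  gradient on the convex set \<open>up\<close> makes it Lipschitz and hence extendable to the
  closure.\<close>

definition bar :: "(real^'n => real) => real^'n => real" where
 "bar f = (SOME g. (\<exists>L. L-lipschitz_on (closure up) g) & (\<forall>x\<in>up. g x = f x))"

text \<open>
 \<open>E j f\<close> is the extension appropriate when \<open>f\<close> is a \<open>j\<close>-th normal derivative, so that derivatives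
 of extensions are again extensions. The part of \<open>C\<close> below the hyperplane is covered by the
 reflections \<open>mirror k\<close>.
\<close>

definition E :: "nat => (real^'n => real) => real^'n => real" where
 "E j f x = (if x $ \<iota> <= 0 then \<Sum>k. c k * (- l k) ^ j * bar f (mirror k x) else bar f x)"

lemma open_up: "open up"
proof -
 have "up = C \<inter> {x. x $ \<iota> > 0}" by (auto simp: up_def)
 moreover have "open {x::real^'n. x $ \<iota> > 0}" by (intro open_Collect_less continuous_intros)
 ultimately show ?thesis using C(1) by (simp add: open_Int)
qed

lemma convex_up: "convex up"
proof -
 have "up = C \<inter> {x. inner (ax \<iota>) x > 0}" by (auto simp: up_def inner_axis_axis inner_axis')
 thus ?thesis using C(2) by (simp add: convex_Int convex_halfspace_gt)
qed

lemma mirror_nth: "mirror k x $ i = (if i = \<iota> then - l k * x $ \<iota> else x $ i)"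
 by (simp add: mirror_def axis_def algebra_simps)

lemma mirror_up: "x \<in> C ==> x $ \<iota> < 0 ==> mirror k x \<in> up"
 using shift[of x "- ((1 + l k) * x $ \<iota>)"] l_pos[of k] by (simp add: up_def mirror_nth mult_pos_neg) (simp add: mirror_def)

lemma mirror_0: "x $ \<iota> = 0 ==> mirror k x = x"
 by (simp add: mirror_def)

lemma mirror_step: "mirror k (x + t *. i) = mirror k x + (if i = \<iota> then - l k * t else t) *. i"
 by (auto simp: vec_eq_iff mirror_nth axis_def algebra_simps)

lemma FB_pd: "FB f ==> FB (pd i f)"
 unfolding FB_def using smooth_in_pd[of up f i] pds.simps(2)[of i _ f] by metis

lemma half_closure: "x \<in> C ==> x $ \<iota> >= 0 ==> x \<in> closure up"
 unfolding closure_approachable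
proof (intro allI impI)
 fix e :: real assume x: "x \<in> C" "x $ \<iota> >= 0" and e: "e > 0"
 have "x + (e / 2) *. \<iota> \<in> up" using shift[OF x(1)] x(2) e by (simp add: up_def axis_def)
 thus "\<exists>y\<in>up. dist y x < e" using e by (intro bexI[of _ "x + (e / 2) *. \<iota>"]) auto
qed

lemma FB_lipschitz:
 assumes "FB f"
 shows "\<exists>L. L-lipschitz_on up f"
proof -
 have "\<forall>i. \<exists>B. \<forall>x\<in>up. abs(pd i f x) <= B"
 proof
  fix i
  have "\<exists>B. \<forall>x\<in>up. abs(pds [i] f x) <= B" using assms unfolding FB_def by blast
  thus "\<exists>B. \<forall>x\<in>up. abs(pd i f x) <= B" by simp
 qed
 then obtain B where B: "!!i x. x \<in> up ==> abs(pd i f x) <= B i" by metis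
 define L where "L = (\<Sum>i\<in>UNIV. abs(B i))"
 have L: "L >= 0" by (simp add: L_def sum_nonneg)
 have sm: "smooth_in up f" using assms by (simp add: FB_def)
 have "norm (f x - f y) <= L * norm (x - y)" if xy: "x \<in> up" "y \<in> up" for x y
 proof (rule differentiable_bound[OF convex_up _ _ xy])
  fix z assume z: "z \<in> up"
  show "(f has_derivative (%v. \<Sum>i\<in>UNIV. v $ i * pd i f z)) (at z within up)"
   by (rule has_derivative_at_withinI[OF has_derivative_pd[OF smooth_in_diff[OF sm z]]])
  show "onorm (%v. \<Sum>i\<in>UNIV. v $ i * pd i f z) <= L"
  proof (rule onorm_bound[OF L])
   fix v :: "real^'n"
   have "norm (\<Sum>i\<in>UNIV. v $ i * pd i f z) <= (\<Sum>i\<in>UNIV. norm (v $ i * pd i f z))" by (rule norm_sum)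
   also have "... <= (\<Sum>i\<in>UNIV. norm v * abs(B i))"
   proof (rule sum_mono)
    fix i
    show "norm (v $ i * pd i f z) <= norm v * abs(B i)"
     unfolding real_norm_def abs_mult using B[OF z, of i] component_le_norm_cart[of v i] by (intro mult_mono) auto
   qed
   finally show "norm (\<Sum>i\<in>UNIV. v $ i * pd i f z) <= L * norm v" by (simp add: L_def sum_distrib_left mult.commute)
  qed
 qed
 hence "L-lipschitz_on up f" using L by (intro lipschitz_onI) (auto simp: dist_norm)
 thus ?thesis by blast
qed

lemma bar:
 assumes "FB f"
 obtains L where "L >= 0" "!!x y. x \<in> closure up ==> y \<in> closure up ==> abs(bar f x - bar f y) <= L * dist x y"
  "!!x. x \<in> up ==> bar f x = f x"
proof -
 obtain L0 where "L0-lipschitz_on up f" using FB_lipschitz[OF assms] by blast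
 hence "\<exists>g. (\<exists>L. L-lipschitz_on (closure up) g) & (\<forall>x\<in>up. g x = f x)"
  using lipschitz_extend_closure[of L0 up f] by blast
 from someI_ex[OF this] obtain L where L: "L-lipschitz_on (closure up) (bar f)" and e: "\<forall>x\<in>up. bar f x = f x"
  unfolding bar_def[symmetric] by blast
 show ?thesis
  by (rule that[of L]) (use L e in "auto simp: lipschitz_on_def dist_real_def")
qed

lemma E_up: "FB f ==> x \<in> up ==> E j f x = f x"
 using bar[of f] by (auto simp: E_def up_def)

lemma E_low:
 assumes "FB f" "x \<in> C" "x $ \<iota> < 0"
 shows "E j f x = (\<Sum>k. c k * (- l k) ^ j * f (mirror k x))"
proof -
 have "bar f (mirror k x) = f (mirror k x)" for k using bar[OF assms(1)] mirror_up[OF assms(2,3)] by metis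
 thus ?thesis using assms(3) by (simp add: E_def)
qed

text \<open>On the hyperplane every mirror point is the point itself, and the moment condition of
  index \<open>j\<close> turns the sum into \<open>bar f x\<close>. Below, the series is Lipschitz
  because the Lipschitz constants of the reflections are summable against the weights.\<close>

lemma E_continuous:
 assumes f: "FB f"
 shows "continuous_on C (E j f)"
proof -
 obtain L where L: "L >= 0" "!!x y. x \<in> closure up ==> y \<in> closure up ==> abs(bar f x - bar f y) <= L * dist x y"
  and e: "!!x. x \<in> up ==> bar f x = f x" using bar[OF f] by metis
 have "\<exists>B. \<forall>x\<in>up. abs(pds [] f x) <= B" using f unfolding FB_def by blast
 then obtain B where B: "!!x. x \<in> up ==> abs(f x) <= B" by auto
 define low where "low x = (\<Sum>k. c k * (- l k) ^ j * bar f (mirror k x))" for x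
 have sm: "summable (%k. c k * (- l k) ^ j * bar f (mirror k x))" if x: "x \<in> C" "x $ \<iota> <= 0" for x
 proof (rule summable_comparison_test'[OF summable_mult2[OF c_summable[of j], of "B + abs(bar f x)"], of 0])
  fix k
  have "abs(bar f (mirror k x)) <= B + abs(bar f x)"
  proof (cases "x $ \<iota> = 0")
   case True
   have "mirror 0 (x - ax \<iota>) \<in> up" using shift[OF x(1), of "-1"] True by (intro mirror_up) (auto simp: axis_def)
   hence "B >= 0" using B by force
   thus ?thesis using True by (simp add: mirror_0)
  next
   case False
   hence "mirror k x \<in> up" using mirror_up[OF x(1)] x(2) by simp
   thus ?thesis using B e by force
  qed
  hence "abs(c k) * l k ^ j * abs(bar f (mirror k x)) <= abs(c k) * l k ^ j * (B + abs(bar f x))"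
   using l_pos[of k] by (intro mult_left_mono) auto
  thus "norm (c k * (- l k) ^ j * bar f (mirror k x)) <= abs(c k) * l k ^ j * (B + abs(bar f x))"
   using l_pos[of k] by (simp add: abs_mult power_abs)
 qed
 define M where "M = (\<Sum>k. (2 * (abs(c k) * l k ^ j) + abs(c k) * l k ^ Suc j) * L)"
 have sM: "summable (%k. (2 * (abs(c k) * l k ^ j) + abs(c k) * l k ^ Suc j) * L)"
  by (intro summable_mult2 summable_add summable_mult c_summable)
 have M: "M >= 0" unfolding M_def using L(1) l_pos by (intro suminf_nonneg[OF sM] mult_nonneg_nonneg add_nonneg_nonneg) (auto intro: less_imp_le)
 have rcl: "mirror k x \<in> closure up" if "x \<in> C" "x $ \<iota> <= 0" for k x
 proof (rule half_closure)
  show "mirror k x \<in> C" using shift[OF that(1), of "- ((1 + l k) * x $ \<iota>)"] by (simp add: mirror_def)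
  show "0 <= mirror k x $ \<iota>" using that(2) l_pos[of k] by (simp add: mirror_nth mult_nonneg_nonpos)
 qed
 have lowlip: "abs(low x - low y) <= M * dist x y" if x: "x \<in> C" "x $ \<iota> <= 0" and y: "y \<in> C" "y $ \<iota> <= 0" for x y
 proof -
  have d: "abs(c k * (- l k) ^ j * bar f (mirror k x) - c k * (- l k) ^ j * bar f (mirror k y))
    <= (2 * (abs(c k) * l k ^ j) + abs(c k) * l k ^ Suc j) * L * dist x y" for k
  proof -
   have "mirror k x - mirror k y = (x - y) - ((1 + l k) * (x - y) $ \<iota>) *. \<iota>"
    by (simp add: mirror_def algebra_simps)
   hence "dist (mirror k x) (mirror k y) <= norm (x - y) + norm (((1 + l k) * (x - y) $ \<iota>) *. \<iota>)"
    unfolding dist_norm by (metis norm_triangle_ineq4)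
   also have "norm (((1 + l k) * (x - y) $ \<iota>) *. \<iota>) <= (1 + l k) * norm (x - y)"
    using l_pos[of k] component_le_norm_cart[of "x - y" \<iota>] by (simp add: abs_mult mult_left_mono)
   finally have r: "dist (mirror k x) (mirror k y) <= (2 + l k) * dist x y" by (simp add: dist_norm algebra_simps)
   have "abs(bar f (mirror k x) - bar f (mirror k y)) <= L * dist (mirror k x) (mirror k y)"
    by (rule L(2)) (use rcl x y in auto)
   also have "... <= L * ((2 + l k) * dist x y)" using r L(1) by (intro mult_left_mono) auto
   finally have b: "abs(bar f (mirror k x) - bar f (mirror k y)) <= L * ((2 + l k) * dist x y)" .
   have "abs(c k * (- l k) ^ j * bar f (mirror k x) - c k * (- l k) ^ j * bar f (mirror k y))
     = abs(c k) * l k ^ j * abs(bar f (mirror k x) - bar f (mirror k y))"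
    using l_pos[of k] by (simp add: abs_mult power_abs flip: right_diff_distrib)
   also have "... <= abs(c k) * l k ^ j * (L * ((2 + l k) * dist x y))" using b l_pos[of k] by (intro mult_left_mono) auto
   finally show ?thesis by (simp add: algebra_simps)
  qed
  have sd: "summable (%k. (2 * (abs(c k) * l k ^ j) + abs(c k) * l k ^ Suc j) * L * dist x y)" by (rule summable_mult2[OF sM])
  have sab: "summable (%k. abs(c k * (- l k) ^ j * bar f (mirror k x) - c k * (- l k) ^ j * bar f (mirror k y)))"
   by (rule summable_comparison_test'[OF sd, of 0]) (use d in simp)
  have "low x - low y = (\<Sum>k. c k * (- l k) ^ j * bar f (mirror k x) - c k * (- l k) ^ j * bar f (mirror k y))"
   unfolding low_def by (rule suminf_diff[OF sm[OF x] sm[OF y]])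
  hence "abs(low x - low y) <= (\<Sum>k. (2 * (abs(c k) * l k ^ j) + abs(c k) * l k ^ Suc j) * L * dist x y)"
   using order_trans[OF summable_rabs[OF sab] suminf_le[OF d sab sd]] by metis
  moreover have "M * dist x y = (\<Sum>k. (2 * (abs(c k) * l k ^ j) + abs(c k) * l k ^ Suc j) * L * dist x y)"
   unfolding M_def by (rule suminf_mult2[OF sM])
  ultimately show ?thesis by metis
 qed
 have "continuous_on C (%x. if x $ \<iota> <= 0 then low x else bar f x)"
 proof (rule continuous_on_cases_le)
  have "M-lipschitz_on {x \<in> C. x $ \<iota> <= 0} low" using lowlip M by (intro lipschitz_onI) (auto simp: dist_real_def)
  thus "continuous_on {x \<in> C. x $ \<iota> <= 0} low" by (rule lipschitz_on_continuous_on)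
  have "L-lipschitz_on {x \<in> C. 0 <= x $ \<iota>} (bar f)" using L half_closure by (intro lipschitz_onI) (auto simp: dist_real_def)
  thus "continuous_on {x \<in> C. 0 <= x $ \<iota>} (bar f)" by (rule lipschitz_on_continuous_on)
  show "continuous_on C (%x. x $ \<iota>)" by (intro continuous_intros)
  fix x assume x: "x \<in> C" "x $ \<iota> = 0"
  have "summable (%k. c k * (- l k) ^ j)"
   by (rule summable_comparison_test'[OF c_summable[of j], of 0]) (simp add: abs_mult power_abs less_imp_le[OF l_pos])
  thus "low x = bar f x" unfolding low_def mirror_0[OF x(2)] using suminf_mult2[of "%k. c k * (- l k) ^ j" "bar f x"] c_sum[of j] by simp
 qed
 thus ?thesis unfolding E_def low_def .
qed

text \<open>A normal derivative of a reflected term produces the factor \<open>- l k\<close>, which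
  raises the index \<open>j\<close>; a tangential one leaves it. Off the hyperplane this is the
  chain rule and termwise differentiation, and on it continuity of both extensions decides.\<close>

lemma E_deriv:
 assumes f: "FB f" and x: "x \<in> C"
 shows "((%t. E j f (x + t *. i)) has_real_derivative E (if i = \<iota> then Suc j else j) (pd i f) x) (at 0)"
proof -
 let ?j = "if i = \<iota> then Suc j else j"
 have sm: "smooth_in up f" using f by (simp add: FB_def)
 have ct: "open ((%t. x + t *. i) -` S)" if "open S" for x and S :: "(real^'n) set"
  using continuous_open_vimage[OF that, of "%t. x + t *. i"] by (intro open_vimage that continuous_intros)
 have off: "((%t. E j f (x + t *. i)) has_real_derivative E ?j (pd i f) x) (at 0)"
  if x: "x \<in> C" and nz: "x $ \<iota> ~= 0" for x
 proof (cases "x $ \<iota> > 0")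
  case True
  hence xu: "x \<in> up" using x by (simp add: up_def)
  have "((%t. f (x + t *. i)) has_real_derivative pd i f x) (at 0)"
   using line_deriv[of f x 0 i] smooth_in_diff[OF sm xu] by simp
  thus ?thesis unfolding E_up[OF FB_pd[OF f] xu]
   by (rule has_field_derivative_transform_within_open[OF _ ct[OF open_up]]) (use xu E_up[OF f] in auto)
 next
  case False
  hence neg: "x $ \<iota> < 0" using nz by simp
  define Lo where "Lo = {x \<in> C. x $ \<iota> < 0}"
  have oLo: "open Lo"
  proof -
   have "Lo = C \<inter> {x. x $ \<iota> < 0}" by (auto simp: Lo_def)
   moreover have "open {x::real^'n. x $ \<iota> < 0}" by (intro open_Collect_less continuous_intros)
   ultimately show ?thesis using C(1) by (simp add: open_Int)
  qed
  have "x \<in> Lo" using x neg by (simp add: Lo_def)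
  then obtain d where d: "d > 0" "ball x d \<subseteq> Lo" using oLo open_contains_ball by blast
  have inLo: "x + t *. i \<in> C" "(x + t *. i) $ \<iota> < 0" if "t \<in> ball 0 d" for t
  proof -
   have "x + t *. i \<in> Lo" by (rule subsetD[OF d(2)]) (use that in simp)
   thus "x + t *. i \<in> C" "(x + t *. i) $ \<iota> < 0" unfolding Lo_def by blast+
  qed
  have "\<exists>B. \<forall>x\<in>up. abs(pds [] f x) <= B" "\<exists>B. \<forall>x\<in>up. abs(pds [i] f x) <= B" using f unfolding FB_def by blast+
  then obtain B B' where B: "!!x. x \<in> up ==> abs(f x) <= B" "!!x. x \<in> up ==> abs(pd i f x) <= B'" by auto
  define h where "h n t = c n * (- l n) ^ j * f (mirror n (x + t *. i))" for n t
  define h' where "h' n t = c n * (- l n) ^ ?j * pd i f (mirror n (x + t *. i))" for n t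
  have hd: "(h n has_field_derivative h' n t) (at t)" if t: "t \<in> ball 0 d" for n t
  proof -
   let ?q = "if i = \<iota> then - l n else 1"
   have e: "mirror n (x + t *. i) = mirror n x + (?q * t) *. i" for t unfolding mirror_step by simp
   have "mirror n x + (?q * t) *. i \<in> up" using mirror_up[OF inLo[OF t], of n] unfolding e .
   hence "((%t. f (mirror n x + t *. i)) has_real_derivative pd i f (mirror n x + (?q * t) *. i)) (at (?q * t))"
    by (intro line_deriv smooth_in_diff[OF sm])
   hence "((%t. f (mirror n x + (?q * t) *. i)) has_real_derivative pd i f (mirror n x + (?q * t) *. i) * ?q) (at t)"
    by (rule DERIV_chain2) (auto intro!: derivative_eq_intros)
   from DERIV_cmult[OF this, of "c n * (- l n) ^ j"] show ?thesis
    unfolding h_def[abs_def] h'_def e by (auto simp: mult_ac split: if_splits)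
  qed
  have hb: "norm (h' n t) <= abs(c n) * l n ^ ?j * B'" "norm (h n t) <= abs(c n) * l n ^ j * B" if t: "t \<in> ball 0 d" for n t
  proof -
   have u: "mirror n (x + t *. i) \<in> up" by (rule mirror_up[OF inLo[OF t]])
   have "abs(c n) * l n ^ k * abs(a) <= abs(c n) * l n ^ k * b" if "abs(a) <= b" for a b k
    using that l_pos[of n] by (intro mult_left_mono) auto
   from this[OF B(1)[OF u], of j] this[OF B(2)[OF u], of ?j]
   show "norm (h' n t) <= abs(c n) * l n ^ ?j * B'" "norm (h n t) <= abs(c n) * l n ^ j * B"
    unfolding h_def h'_def real_norm_def abs_mult power_abs using l_pos[of n] by simp_all
  qed
  have "((%t. \<Sum>n. h n t) has_field_derivative (\<Sum>n. h' n 0)) (at 0)"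
  proof (rule has_field_derivative_series'(2)[where S = "ball 0 d" and x0 = 0])
   show "(h n has_field_derivative h' n t) (at t within ball 0 d)" if "t \<in> ball 0 d" for n t
    by (rule has_field_derivative_at_within[OF hd[OF that]])
   show "uniformly_convergent_on (ball 0 d) (%n t. \<Sum>i<n. h' i t)"
    by (rule Weierstrass_m_test'[OF hb(1) summable_mult2[OF c_summable]])
   show "summable (%n. h n 0)"
    by (rule summable_comparison_test'[OF summable_mult2[OF c_summable], of 0 _ j B]) (use hb(2)[of 0] d(1) in auto)
  qed (use d(1) in auto)
  thus ?thesis
  proof (rule has_field_derivative_transform_within_open[THEN DERIV_cong])
   show "(\<Sum>n. h n t) = E j f (x + t *. i)" if "t \<in> ball 0 d" for t
    unfolding h_def by (rule E_low[OF f inLo[OF that], symmetric])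
   show "(\<Sum>n. h' n 0) = E ?j (pd i f) x"
    unfolding h'_def using E_low[OF FB_pd[OF f] x neg, of ?j] by simp
  qed (use d(1) in auto)
 qed
 show ?thesis
  using off[OF x] directional_derivative_across_hyperplane[OF C(1) E_continuous[OF f] E_continuous[OF FB_pd[OF f]] off x]
  by blast
qed

theorem E_smooth:
 assumes "FB f"
 shows "smooth_in C (E 0 f)"
proof (rule smooth_in_coinduct[where P = "%g. \<exists>f j. FB f & g = E j f"])
 have D: "(E j f has_derivative (%v. \<Sum>i\<in>UNIV. v $ i * E (if i = \<iota> then Suc j else j) (pd i f) x)) (at x)"
  if f: "FB f" and x: "x \<in> C" for f j x
  by (rule has_derivative_partials[OF C(1) E_deriv[OF f] E_continuous[OF FB_pd[OF f]] x])
 show "g differentiable at x" if "\<exists>f j. FB f & g = E j f" "x \<in> C" for g x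
  using that D unfolding differentiable_def by blast
 show "\<exists>h. (\<exists>f j. FB f & h = E j f) & (\<forall>x\<in>C. pd i g x = h x)" if g: "\<exists>f j. FB f & g = E j f" for g i
 proof -
  obtain f j where f: "FB f" "g = E j f" using g by blast
  have "pd i g x = E (if i = \<iota> then Suc j else j) (pd i f) x" if "x \<in> C" for x
  proof -
   have e: "(ax i :: real^'n) $ k * a = (if k = i then a else 0)" for k a by (simp add: axis_def)
   show ?thesis unfolding f(2) pd_eqI[OF D[OF f(1) that]] e by simp
  qed
  thus ?thesis using FB_pd[OF f(1), of i] by blast
 qed
qed (use assms C(1) in auto)

end

section \<open>The conformal factor\<close>

lemma convex_cylinder: "convex (cylinder i p r)"
proof -
 have "flat_proj i p (u *\<^sub>R x + v *\<^sub>R y) = u *\<^sub>R flat_proj i p x + v *\<^sub>R flat_proj i p y" if "u + v = 1" for u v x y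
 proof -
  have "p $ i = u * p $ i + v * p $ i" using that by (simp flip: distrib_right)
  thus ?thesis by (simp add: vec_eq_iff flat_proj_nth)
 qed
 hence "u *\<^sub>R x + v *\<^sub>R y \<in> cylinder i p r" if "x \<in> cylinder i p r" "y \<in> cylinder i p r" "0 <= u" "0 <= v" "u + v = 1" for u v x y
  using convexD[OF convex_ball[of p r], of "flat_proj i p x" "flat_proj i p y" u v] that by (simp add: cylinder_def)
 thus ?thesis by (intro convexI) auto
qed

context bdry_chart
begin

text \<open>The reflections may stretch by arbitrarily large factors, so \<open>half_ext\<close>
  works on a domain unbounded in the normal direction, whereas the chart is bounded. \<Theta>
  therefore not only maps the half space to one side of the graph but also compresses the half line
  to \<open>(0, r)\<close> by r t/(1 + t).\<close>

lemma chart_extension: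
 assumes f: "smooth_in (dom R) f" "!!ks. Pd 0 (Xs ks f)" and phip: "\<phi> p = p $ \<iota>"
 shows "\<exists>U h. open U & p \<in> U & U \<subseteq> ball p R & smooth_in U h & (\<forall>x\<in>U. s x > 0 --> h x = f x)"
proof -
 define \<rho> where "\<rho> = R / 2"
 have \<rho>: "0 < \<rho>" "\<rho> < R" using R by (auto simp: \<rho>_def)
 have "cball p \<rho> \<subseteq> ball p R" using \<rho> by auto
 then obtain L where L: "L > 0" "!!x y. x \<in> cball p \<rho> ==> y \<in> cball p \<rho> ==> abs(\<phi> x - \<phi> y) <= L * dist x y"
  using smooth_lipschitz[OF smooth_phi] by blast
 \<comment> \<open>A point over the base ball of radius \<open>r\<close> and at height below
   \<open>r\<close> above the graph lies within \<open>r + r + L * r\<close> of \<open>p\<close>, as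
   \<open>L\<close> bounds the slope of the graph; this has to stay below \<rho>.\<close>
 define r where "r = \<rho> / (3 + L)"
 have r: "r > 0" "r * (3 + L) = \<rho>" using \<rho> L by (auto simp: r_def)
 hence r2: "r + r + L * r < \<rho>" "r <= \<rho>" using mult_pos_pos[OF L(1) r(1)] by (auto simp: algebra_simps)
 define C where "C = cylinder \<iota> p r"
 obtain l c :: "nat => real" where cl: "!!k. l k > 0" "!!j. summable (%k. abs(c k) * l k ^ j)" "!!j. (\<Sum>k. c k * (- l k) ^ j) = 1"
 proof -
  fix thesis
  assume A: "!!l c :: nat => real. (!!k. l k > 0) ==> (!!j. summable (%k. abs(c k) * l k ^ j)) ==> (!!j. (\<Sum>k. c k * (- l k) ^ j) = 1) ==> thesis"
  show thesis by (rule reflection_coefficients) (rule A)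
 qed
 interpret H: half_ext \<iota> C c l
 proof
  show "open C" "convex C" by (auto simp: C_def open_cylinder convex_cylinder)
  show "x + t *. \<iota> \<in> C" if "x \<in> C" for x t using that by (simp add: C_def cylinder_def flat_proj_shift)
 qed (rule cl)+
 define \<Theta> where "\<Theta> y = flat_proj \<iota> p y + (\<sigma> * (r * y $ \<iota> * inverse (1 + y $ \<iota>)) + (\<phi> y - p $ \<iota>)) *. \<iota>" for y
 have Tn: "\<Theta> y $ j = (if j = \<iota> then \<sigma> * (r * y $ \<iota> * inverse (1 + y $ \<iota>)) + \<phi> y else y $ j)" for y j
  by (simp add: \<Theta>_def flat_proj_nth axis_def)
 have Tshift: "\<Theta> y = y + (\<Theta> y $ \<iota> - y $ \<iota>) *. \<iota>" for y by (simp add: vec_eq_iff Tn axis_def)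
 have phiT: "\<phi> (\<Theta> y) = \<phi> y" for y using phi_shift[of y "\<Theta> y $ \<iota> - y $ \<iota>"] Tshift[of y] by metis
 have phif: "\<phi> (flat_proj \<iota> p y) = \<phi> y" for y unfolding flat_proj_def by (rule phi_shift)
 have sT: "s (\<Theta> y) = r * y $ \<iota> * inverse (1 + y $ \<iota>)" for y
  using sg by (auto simp: s_def phiT Tn)
 have eta: "0 < r * t * inverse (1 + t)" "r * t * inverse (1 + t) < r" if "t > 0" for t
  using that r by (auto simp: field_simps)
 have upD: "dist p (flat_proj \<iota> p y) < r" "y $ \<iota> > 0" if "y \<in> H.up" for y
 proof -
  have "y \<in> C & y $ \<iota> > 0" using that by (simp add: H.up_def)
  thus "dist p (flat_proj \<iota> p y) < r" "y $ \<iota> > 0" by (auto simp: C_def cylinder_def)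
 qed
 have Tdom: "\<Theta> y \<in> dom \<rho>" if y: "y \<in> H.up" for y
 proof -
  note yy = upD[OF y]
  have "abs(\<phi> (flat_proj \<iota> p y) - \<phi> p) <= L * dist (flat_proj \<iota> p y) p" using yy r2 \<rho> by (intro L(2)) auto
  also have "... <= L * r" using yy L by (intro mult_left_mono) (auto simp: dist_commute)
  finally have b: "abs(\<phi> y - p $ \<iota>) <= L * r" by (simp add: phif phip)
  have "abs(\<sigma> * (r * y $ \<iota> * inverse (1 + y $ \<iota>))) < r" using eta[OF yy(2)] sg by auto
  hence q: "abs(\<sigma> * (r * y $ \<iota> * inverse (1 + y $ \<iota>)) + (\<phi> y - p $ \<iota>)) <= r + L * r" using b by linarith
  have "dist p (\<Theta> y) <= dist p (flat_proj \<iota> p y) + dist (flat_proj \<iota> p y) (\<Theta> y)" by (rule dist_triangle)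
  also have "dist (flat_proj \<iota> p y) (\<Theta> y) <= r + L * r" unfolding \<Theta>_def using q by simp
  finally have "dist p (\<Theta> y) < \<rho>" using yy r2 by linarith
  thus ?thesis using sT[of y] eta[OF yy(2)] by (simp add: dom_def)
 qed
 have TR: "\<Theta> y \<in> dom R" "\<Theta> y \<in> ball p R" if "y \<in> H.up" for y
  using Tdom[OF that] dom_mono[of \<rho> R] dom_ball[of R] \<rho> by auto
 have one: "1 + y $ \<iota> ~= 0" if "y \<in> H.up" for y using that by (auto simp: H.up_def)
 define w :: "real^'n => real" where "w y = inverse (1 + y $ \<iota>)" for y
 have sw: "smooth_in H.up w"
  unfolding w_def[abs_def] by (intro smooth_in_inverse smooth_in_add H.open_up smooth_in_const smooth_in_component one)
 have sphi: "smooth_in H.up \<phi>"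
 proof (rule smooth_in_subset[OF phi_smooth])
  show "H.up \<subseteq> cylinder \<iota> p R"
  proof
   fix y assume "y \<in> H.up"
   thus "y \<in> cylinder \<iota> p R" using upD(1)[of y] r2 \<rho> by (simp add: cylinder_def)
  qed
 qed
 have sTc: "smooth_in H.up (%y. \<Theta> y $ j)" for j
 proof (cases "j = \<iota>")
  case True
  have "smooth_in H.up (%y. \<sigma> * (r * y $ \<iota> * w y) + \<phi> y)"
   by (intro smooth_in_add smooth_in_mult smooth_in_const smooth_in_component sw sphi H.open_up)
  thus ?thesis using True by (simp add: Tn w_def)
 qed (simp add: Tn)
 have pdw: "pd i w y = (if i = \<iota> then - (w y * w y) else 0)" if "y \<in> H.up" for i y
 proof -
  have d: "(%y::real^'n. 1 + y $ \<iota>) differentiable (at y)" "(%y::real^'n. y $ \<iota>) differentiable (at y)"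
   using smooth_in_diff[OF smooth_in_component, of y UNIV \<iota>] by auto
  have "(inverse has_real_derivative - (inverse (1 + y $ \<iota>) * inverse (1 + y $ \<iota>))) (at (1 + y $ \<iota>))"
   using DERIV_inverse'[OF DERIV_ident one[OF that]] by simp
  from pd_compose_real(1)[OF this d(1), of i] show ?thesis
   unfolding w_def[abs_def] using d by (simp add: pd_add)
 qed
 have dphiT: "pd i \<phi> (\<Theta> y) = pd i \<phi> y" if y: "y \<in> H.up" for i y
 proof -
  let ?v = "(\<Theta> y $ \<iota> - y $ \<iota>) *. \<iota>"
  have "\<phi> differentiable (at (y + ?v))" using smooth_in_diff[OF smooth_phi TR(2)[OF y]] Tshift[of y] by simp
  from pd_shift(1)[OF this, of i] show ?thesis using Tshift[of y] by (simp add: phi_shift)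
 qed
 \<comment> \<open>The derivative of r t/(1 + t), which is \<open>r\<close> times the square of
   \<open>w\<close>, with the orientation \<sigma>.\<close>
 define a where "a y = \<sigma> * r * (w y * w y)" for y
 have pdT: "pd i (%y. g (\<Theta> y)) y = (if i = \<iota> then a y * X i g (\<Theta> y) else X i g (\<Theta> y))"
  if g: "smooth_in (dom R) g" and y: "y \<in> H.up" for g i y
 proof -
  have dg: "g differentiable (at (\<Theta> y))" by (rule smooth_in_diff[OF g TR(1)[OF y]])
  have dc: "(%y. \<Theta> y $ j) differentiable (at y)" for j by (rule smooth_in_diff[OF sTc y])
  have pc: "pd i (%y. \<Theta> y $ j) y = (if j = \<iota> then (if i = \<iota> then a y else 0) + pd i \<phi> y else if i = j then 1 else 0)" for j
  proof (cases "j = \<iota>")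
   case True
   have dd: "(%y::real^'n. y $ \<iota>) differentiable (at y)" "w differentiable (at y)" "\<phi> differentiable (at y)"
    using smooth_in_diff[OF smooth_in_component, of y UNIV \<iota>] smooth_in_diff[OF sw y] smooth_in_diff[OF sphi y] by auto
   have "(%y. \<Theta> y $ j) = (%y. (\<sigma> * r) * (y $ \<iota> * w y) + \<phi> y)" using True by (auto simp: Tn w_def)
   moreover have "pd i (%y. (\<sigma> * r) * (y $ \<iota> * w y) + \<phi> y) y
     = \<sigma> * r * ((if i = \<iota> then 1 else 0) * w y + y $ \<iota> * (if i = \<iota> then - (w y * w y) else 0)) + pd i \<phi> y"
    using dd by (simp add: pd_add pd_mult pd_cmult pdw[OF y])
   moreover have "w y + y $ \<iota> * - (w y * w y) = w y * w y"
   proof -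
    have "w y * (w y * (1 + y $ \<iota>)) = w y" using one[OF y] by (simp add: w_def)
    thus ?thesis by (simp add: algebra_simps)
   qed
   ultimately show ?thesis using True by (auto simp: a_def)
  qed (simp add: Tn)
  have "pd i (%y. g (\<Theta> y)) y
    = (\<Sum>j\<in>UNIV. (if j = \<iota> then ((if i = \<iota> then a y else 0) + pd i \<phi> y) * pd j g (\<Theta> y) else 0)
      + (if j = i then (if i = \<iota> then 0 else pd j g (\<Theta> y)) else 0))"
   unfolding pd_compose(1)[OF dg dc] pc by (intro sum.cong) auto
  also have "... = ((if i = \<iota> then a y else 0) + pd i \<phi> y) * pd \<iota> g (\<Theta> y) + (if i = \<iota> then 0 else pd i g (\<Theta> y))"
   by (simp add: sum.distrib)
  finally show ?thesis using phi_pd_normal[OF TR(2)[OF y]] dphiT[OF y]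
   by (simp add: X_def algebra_simps)
 qed
 \<comment> \<open>By \<open>pdT\<close> a partial derivative of a function composed with \<Theta>
   is a field \<open>X\<close> applied before composition, times \<open>a\<close> in the normal
   direction. Boundedness of all derivatives thus reduces to that of \<open>Xs ks f\<close> and of
   the derivatives of \<open>a\<close>.\<close>
 interpret B: graded_derivations H.up "{f. smooth_in H.up f}" pd "%\<beta> f. \<exists>B. \<forall>x\<in>H.up. abs(f x) <= B" 0 UNIV
 proof
  show "pd k f x = pd k g x" if "!!x. x \<in> H.up ==> f x = g x" "x \<in> H.up" for k f g x
   using pd_cong[OF H.open_up that(2), of f g k] that(1) by simp
  show "pd k (%x. f x + g x) x = pd k f x + pd k g x"
   and "pd k (%x. f x * g x) x = pd k f x * g x + f x * pd k g x"
   if "f \<in> {f. smooth_in H.up f}" "g \<in> {f. smooth_in H.up f}" "x \<in> H.up" for k f g x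
   using that smooth_in_diff[of H.up f x] smooth_in_diff[of H.up g x] by (auto intro: pd_add pd_mult)
  show "\<exists>B. \<forall>x\<in>H.up. abs(f x + g x) <= B" if "\<exists>B. \<forall>x\<in>H.up. abs(f x) <= B" "\<exists>B. \<forall>x\<in>H.up. abs(g x) <= B" for f g :: "real^'n => real"
  proof -
   from that obtain A B where "\<forall>x\<in>H.up. abs(f x) <= A" "\<forall>x\<in>H.up. abs(g x) <= B" by blast
   hence "\<forall>x\<in>H.up. abs(f x + g x) <= A + B" by (meson abs_triangle_ineq add_mono order_trans)
   thus ?thesis by blast
  qed
  show "\<exists>B. \<forall>x\<in>H.up. abs(f x * g x) <= B" if "\<exists>B. \<forall>x\<in>H.up. abs(f x) <= B" "\<exists>B. \<forall>x\<in>H.up. abs(g x) <= B" for f g :: "real^'n => real"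
  proof -
   from that obtain A B where AB: "!!x. x \<in> H.up ==> abs(f x) <= A" "!!x. x \<in> H.up ==> abs(g x) <= B" by blast
   have "abs(f x * g x) <= A * B" if "x \<in> H.up" for x
    unfolding abs_mult using AB(1)[OF that] AB(2)[OF that] by (intro mult_mono) auto
   thus ?thesis by blast
  qed
  show "\<exists>B. \<forall>x\<in>H.up. abs(g x) <= B" if "!!x. x \<in> H.up ==> f x = g x" "\<exists>B. \<forall>x\<in>H.up. abs(f x) <= B" for f g :: "real^'n => real"
   using that by metis
 qed (auto intro: smooth_in_pd smooth_in_mult H.open_up)
 have cc: "B.cls m 0 (%x. k)" for m k
  by (induction m arbitrary: k) auto
 have cw: "B.cls m 0 w" for m
 proof (induction m)
  case 0
  have "abs(w y) <= 1" if "y \<in> H.up" for y using that by (auto simp: w_def H.up_def divide_simps)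
  thus ?case by auto
 next
  case (Suc m)
  have b: "\<exists>B. \<forall>x\<in>H.up. abs(w x) <= B" using B.cls_P[OF Suc] .
  have "B.cls m 0 (pd i w)" for i
  proof (rule B.cls_cong)
   have "B.cls m (0 + 0) (%y. (if i = \<iota> then -1 else 0) * w y)" using cc[of m "if i = \<iota> then -1 else 0"] Suc sw by (intro B.cls_mult) auto
   hence "B.cls m (0 + 0) (%y. ((if i = \<iota> then -1 else 0) * w y) * w y)"
    using Suc sw by (intro B.cls_mult) (auto intro!: smooth_in_mult smooth_in_minus H.open_up)
   thus "B.cls m 0 (%y. ((if i = \<iota> then -1 else 0) * w y) * w y)" by simp
  qed (use pdw in auto)
  thus ?case using b by simp
 qed
 have ca: "B.cls m 0 a" for m
 proof -
  have "B.cls m (0 + (0 + 0)) (%y. \<sigma> * r * (w y * w y))"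
   using cc[of m "\<sigma> * r"] cw sw by (intro B.cls_mult) (auto intro!: smooth_in_mult H.open_up)
  thus ?thesis by (simp add: a_def[abs_def])
 qed
 have sa: "smooth_in H.up a" unfolding a_def[abs_def] by (intro smooth_in_mult smooth_in_const sw H.open_up)
 have sgT: "smooth_in H.up (%y. g (\<Theta> y))" if "smooth_in (dom R) g" for g
  by (rule smooth_in_compose[OF H.open_up _ that sTc]) (use TR in auto)
 have cT: "B.cls m 0 (%y. g (\<Theta> y))" if "smooth_in (dom R) g" "!!ks. Pd 0 (Xs ks g)" for m g
  using that
 proof (induction m arbitrary: g)
  case (0 g)
  have "Pd 0 g" using 0(2)[of "[]"] by simp
  then obtain M where M: "!!x. x \<in> dom \<rho> ==> abs(g x) <= M * s x powr 0" using PdE[OF _ \<rho>(2)] by blast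
  have "abs(g (\<Theta> y)) <= M" if "y \<in> H.up" for y
   using M[OF Tdom[OF that]] Tdom[OF that] by (simp add: dom_def)
  thus ?case by auto
 next
  case (Suc m g)
  have "Pd 0 g" using Suc.prems(2)[of "[]"] by simp
  then obtain M where M: "!!x. x \<in> dom \<rho> ==> abs(g x) <= M * s x powr 0" using PdE[OF _ \<rho>(2)] by blast
  have Mb: "abs(g (\<Theta> y)) <= M" if "y \<in> H.up" for y
   using M[OF Tdom[OF that]] Tdom[OF that] by (simp add: dom_def)
  have "B.cls m 0 (pd i (%y. g (\<Theta> y)))" for i
  proof -
   have sX: "smooth_in (dom R) (X i g)" by (rule smooth_in_X[OF open_dom dom_ball Suc.prems(1)]) simp
   have X: "B.cls m 0 (%y. X i g (\<Theta> y))"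
    by (rule Suc.IH[OF sX]) (use Suc.prems(2)[of "i # _"] in simp)
   have "B.cls m (0 + 0) (%y. a y * X i g (\<Theta> y))" using ca X sa sgT[OF sX] by (intro B.cls_mult) auto
   hence "B.cls m 0 (%y. if i = \<iota> then a y * X i g (\<Theta> y) else X i g (\<Theta> y))" using X by (cases "i = \<iota>") auto
   thus ?thesis by (rule B.cls_cong[rotated]) (use pdT[OF Suc.prems(1)] in simp)
  qed
  thus ?case using Mb by auto
 qed
 have Ds: "B.Ds ks g = pds ks g" for ks g by (induction ks arbitrary: g) auto
 have FB: "H.FB (%y. f (\<Theta> y))"
  unfolding H.FB_def
 proof (intro conjI allI sgT f(1))
  fix ks
  show "\<exists>B. \<forall>x\<in>H.up. abs(pds ks (%y. f (\<Theta> y)) x) <= B"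
   using cT[OF f, of "length ks", unfolded B.cls_iff_Ds, rule_format, of ks] by (simp add: Ds)
 qed
 let ?E = "H.E 0 (%y. f (\<Theta> y))"
 \<comment> \<open>The inverse of \<Theta> on the side \<open>s > 0\<close>. The formula makes sense
   for \<open>s \<le> 0\<close> as well, so the extension is defined on a full neighbourhood of
   \<open>p\<close>.\<close>
 define \<Lambda> where "\<Lambda> x = flat_proj \<iota> p x + (s x * inverse (r - s x) - p $ \<iota>) *. \<iota>" for x
 have Ln: "\<Lambda> x $ j = (if j = \<iota> then s x * inverse (r - s x) else x $ j)" for x j
  by (simp add: \<Lambda>_def flat_proj_nth axis_def)
 define U where "U = {x \<in> ball p r. s x < r}"
 have rR: "ball p r \<subseteq> ball p R" using r2 \<rho> by auto
 have oU: "open U"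
 proof -
  have "U = ball p r \<inter> s -` {..<r}" by (auto simp: U_def)
  thus ?thesis using continuous_open_preimage[OF continuous_on_subset[OF smooth_in_continuous[OF smooth_s] rR] open_ball, of "{..<r}"] by simp
 qed
 have UR: "U \<subseteq> ball p R" using rR by (auto simp: U_def)
 have LC: "\<Lambda> ` U \<subseteq> C"
 proof
  fix z assume "z \<in> \<Lambda> ` U"
  then obtain x where x: "x \<in> U" "z = \<Lambda> x" by blast
  have "flat_proj \<iota> p z = flat_proj \<iota> p x" using x(2) by (simp add: vec_eq_iff flat_proj_nth Ln)
  thus "z \<in> C" using x(1) ball_subset_cylinder[of p r \<iota>] by (auto simp: C_def cylinder_def U_def)
 qed
 have sL: "smooth_in U (%x. \<Lambda> x $ j)" for j
 proof (cases "j = \<iota>")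
  case True
  have sU: "smooth_in U s" by (rule smooth_in_subset[OF smooth_s UR])
  have "smooth_in U (%x. s x * inverse (r - s x))"
   by (intro smooth_in_mult smooth_in_inverse smooth_in_diff_fun smooth_in_const sU oU) (auto simp: U_def)
  thus ?thesis using True by (simp add: Ln)
 qed (simp add: Ln)
 have "?E (\<Lambda> x) = f x" if x: "x \<in> U" "s x > 0" for x
 proof -
  have rs: "r - s x > 0" using x(1) by (simp add: U_def)
  have Lu: "\<Lambda> x \<in> H.up" using LC x rs by (auto simp: H.up_def Ln)
  have "s x * inverse (r - s x) = s x / (r - s x)" by (simp add: divide_inverse)
  moreover have "r * (q / d) * inverse (1 + q / d) = q" if "d > 0" "d + q = r" for q d
  proof -
   have "1 + q / d = r / d" using that by (simp add: field_simps)
   thus ?thesis using that r(1) by simp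
  qed
  ultimately have e: "r * (\<Lambda> x $ \<iota>) * inverse (1 + \<Lambda> x $ \<iota>) = s x" using rs by (simp add: Ln)
  have "\<Lambda> x = x + (\<Lambda> x $ \<iota> - x $ \<iota>) *. \<iota>" by (simp add: vec_eq_iff Ln axis_def)
  hence pl: "\<phi> (\<Lambda> x) = \<phi> x" using phi_shift[of x] by metis
  have "\<Theta> (\<Lambda> x) $ j = x $ j" for j
  proof (cases "j = \<iota>")
   case True
   hence "\<Theta> (\<Lambda> x) $ j = \<sigma> * s x + \<phi> x" unfolding Tn e pl by simp
   also have "... = x $ \<iota>" using sg by (auto simp: s_def)
   finally show ?thesis using True by simp
  qed (simp add: Tn Ln)
  hence "\<Theta> (\<Lambda> x) = x" by (simp add: vec_eq_iff)
  thus ?thesis using H.E_up[OF FB Lu] by simp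
 qed
 moreover have "smooth_in U (%x. ?E (\<Lambda> x))" by (rule smooth_in_compose[OF oU LC H.E_smooth[OF FB] sL])
 moreover have "p \<in> U" using r(1) by (simp add: U_def s_def phip)
 ultimately show ?thesis using oU UR by blast
qed

lemma local_extension:
 assumes gr: "\<Omega> \<inter> ball p R = {x \<in> ball p R. \<sigma> * (x $ \<iota> - \<phi> x) > 0}" and phip: "\<phi> p = p $ \<iota>"
  and u: "smooth_in \<Omega> u" "vanishes_at_bdry \<Omega> (%x. u x - 1)"
  and eq: "!!x. x \<in> \<Omega> ==> u x \<in> {1/2..3/2} & lap u x = c * Fs 0 (u x)"
  and F: "!!j t. t \<in> {1/4<..<2} ==> (Fs j has_real_derivative Fs (Suc j) t) (at t)"
 shows "\<exists>U h. open U & p \<in> U & smooth_in U h & (\<forall>x\<in>U \<inter> \<Omega>. h x = u x)"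
proof -
 have dO: "x \<in> dom \<rho> \<longleftrightarrow> x \<in> \<Omega> & x \<in> ball p \<rho>" if "\<rho> <= R" for x \<rho>
 proof -
  have b: "x \<in> ball p R" if "x \<in> ball p \<rho>" using that `\<rho> <= R` by simp
  have "x \<in> \<Omega> \<longleftrightarrow> s x > 0" if "x \<in> ball p R"
  proof -
   have "x \<in> \<Omega> \<inter> ball p R \<longleftrightarrow> x \<in> ball p R & \<sigma> * (x $ \<iota> - \<phi> x) > 0" by (simp only: gr mem_Collect_eq)
   thus ?thesis using that by (simp add: s_def)
  qed
  thus ?thesis using b by (auto simp: dom_def simp del: mem_ball)
 qed
 define z where "z x = u x - 1" for x
 have su: "smooth_in (dom R) u" by (rule smooth_in_subset[OF u(1)]) (use dO in auto)
 have z: "smooth_in (dom R) z"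
  unfolding z_def[abs_def] by (intro smooth_in_diff_fun open_dom su smooth_in_const) simp
 have lz: "lap z x = c * Fs 0 (1 + z x)" if "x \<in> dom R" for x
  using laplacian_diff[OF open_dom su smooth_in_const that, of 1] eq[of x] dO[of R x] that by (simp add: z_def[abs_def])
 \<comment> \<open>Moving from \<open>x\<close> along the axis by \<open>s x\<close> reaches the
   graph, so \<open>x\<close> has distance at most \<open>s x\<close> from a point outside
   \<Omega>.\<close>
 have van: "vanish_on \<rho> z" if \<rho>: "\<rho> < R" for \<rho>
  unfolding vanish_on_def
 proof (intro allI impI)
  fix e :: real assume "e > 0"
  then obtain \<delta> where \<delta>: "\<delta> > 0" "!!x. x \<in> \<Omega> - inner_part \<Omega> \<delta> ==> abs(u x - 1) <= e" using u(2) unfolding vanishes_at_bdry_def by blast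
  have "abs(z x) <= e" if x: "x \<in> dom \<rho>" "s x < min \<delta> (R - \<rho>)" for x
  proof -
   have sx: "s x > 0" "dist p x < \<rho>" using x by (auto simp: dom_def)
   let ?y = "x + (- \<sigma> * s x) *. \<iota>"
   have d: "dist x ?y = s x" unfolding dist_step using sg sx by auto
   have sy: "s ?y = 0" using sg phi_shift[of x "- \<sigma> * s x"] by (auto simp: s_def axis_def)
   have yb: "?y \<in> ball p R" using dist_triangle[of p ?y x] d sx x by simp
   have "?y \<notin> dom R" unfolding dom_def using sy by (simp only: mem_Collect_eq less_irrefl simp_thms)
   hence "?y \<notin> \<Omega>" using dO[OF order_refl, of ?y] yb by blast
   moreover have "?y \<in> ball x \<delta>" unfolding mem_ball d using x by simp
   ultimately have "x \<notin> inner_part \<Omega> \<delta>" unfolding inner_part_def by blast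
   thus ?thesis using \<delta>(2)[of x] dO[of \<rho> x] \<rho> x(1) by (simp add: z_def)
  qed
  thus "\<exists>\<delta>>0. \<forall>x\<in>dom \<rho>. s x < \<delta> --> abs(z x) <= e" using \<delta>(1) \<rho> by (intro exI[of _ "min \<delta> (R - \<rho>)"]) auto
 qed
 have G: "((%t. Fs j (1 + t)) has_real_derivative Fs (Suc j) (1 + t)) (at t)" if "t \<in> {-3/4<..<1}" for j t
  using DERIV_shift[of "Fs j" "Fs (Suc j) (1 + t)" t 1] F[of "1 + t" j] that by (simp add: add.commute)
 have zJ: "z x \<in> {-1/2..1/2}" if "x \<in> dom R" for x using eq[of x] dO[of R x] that by (auto simp: z_def)
 have P: "Pd 0 (Xs ks z)" for ks
  by (rule boundary_regularity[where Gs = "%j t. Fs j (1 + t)" and J = "{-3/4<..<1}" and J' = "{-1/2..1/2}", OF z lz van G _ _ zJ]) auto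
 from chart_extension[OF z P phip] obtain U h where B: "open U & p \<in> U & U \<subseteq> ball p R & smooth_in U h & (\<forall>x\<in>U. s x > 0 --> h x = z x)"
  by (elim exE)
 from B have U: "open U" "p \<in> U" "U \<subseteq> ball p R" "smooth_in U h" "\<forall>x\<in>U. s x > 0 --> h x = z x"
  by - (elim conjE, assumption)+
 have "smooth_in U (%x. h x + 1)" by (intro smooth_in_add U smooth_in_const)
 moreover have "h x + 1 = u x" if "x \<in> U \<inter> \<Omega>" for x
 proof -
  have "x \<in> \<Omega> \<inter> ball p R" using U(3) that by blast
  hence "s x > 0" unfolding gr s_def by blast
  thus ?thesis using U(5)[rule_format, of x] that by (simp add: z_def)
 qed
 ultimately show ?thesis using U(1,2) by (intro exI[of _ U] exI[of _ "%x. h x + 1"]) simp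
qed

end

lemma solution_extends:
 fixes \<Omega> :: "(real^'n::finite) set"
 assumes ldf: "ldf \<Omega> p V d" and u: "smooth_in \<Omega> u" "vanishes_at_bdry \<Omega> (%x. u x - 1)"
  and eq: "!!x. x \<in> \<Omega> ==> u x \<in> {1/2..3/2} & lap u x = c * Fs 0 (u x)"
  and F: "!!j t. t \<in> {1/4<..<2} ==> (Fs j has_real_derivative Fs (Suc j) t) (at t)"
 shows "\<exists>U h. open U & p \<in> U & smooth_in U h & (\<forall>x\<in>U \<inter> \<Omega>. h x = u x)"
proof -
 from ldf_graph[OF ldf] obtain \<iota> \<sigma> \<phi> R where A: "R > 0 & (\<sigma> = 1 | \<sigma> = -1) & smooth_in (cylinder \<iota> p R) \<phi>
  & (\<forall>x t. \<phi> (x + t *. \<iota>) = \<phi> x) & \<phi> p = p $ \<iota> & \<Omega> \<inter> ball p R = {x \<in> ball p R. \<sigma> * (x $ \<iota> - \<phi> x) > 0}"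
  by (elim exE)
 hence bc: "bdry_chart \<iota> \<sigma> \<phi> p R" by (simp add: bdry_chart_def)
 show ?thesis
  by (rule bdry_chart.local_extension[where \<iota> = \<iota> and \<sigma> = \<sigma> and \<phi> = \<phi> and R = R and c = c and Fs = Fs, OF bc _ _ u])
   (simp_all only: A eq F)
qed

text \<open>The substitution is \<open>f = \<kappa> * ln u\<close> with \<kappa> = 2/(n - 2). The
  gradient of \<open>u\<close> cancels because \<open>(N - 2) * \<kappa> = 2\<close>, and the
  curvature becomes \<open>- 2 * (N - 1) * \<kappa>\<close> times the Laplacian of \<open>u\<close>
  divided by u^q, where \<open>q = 1 + 2 * \<kappa>\<close>.\<close>

lemma conformal_factor:
 fixes \<Omega> :: "(real^'n::finite) set"
 assumes n: "CARD('n) >= 3" and dom: "bounded_smooth_domain \<Omega>"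
 shows "\<exists>c0>0. \<forall>c. abs(c) <= c0 --> (\<exists>f. smooth_fun_on (closure \<Omega>) f & (\<forall>x\<in>frontier \<Omega>. f x = 0) \<and>
  (\<forall>x\<in>\<Omega>. scalar_curv (conformal_change f flat_metric) x = c))"
proof -
 define N where "N = real CARD('n)"
 have N: "N >= 3" using n by (simp add: N_def)
 define q where "q = (N + 2) / (N - 2)"
 define \<kappa> where "\<kappa> = 2 / (N - 2)"
 have \<kappa>: "\<kappa> > 0" "(N - 2) * \<kappa> = 2" "q = 1 + 2 * \<kappa>" using N by (auto simp: \<kappa>_def q_def field_simps)
 have op: "open \<Omega>" "bounded \<Omega>" using dom by (auto simp: bounded_smooth_domain_def)
 have ldf: "\<exists>U s. ldf \<Omega> p U s" if "p \<in> frontier \<Omega>" for p by (rule ldf_exists[OF dom that])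
 have F: "(pw q j has_real_derivative pw q (Suc j) t) (at t)" if "t \<in> {1/4<..<2}" for j t
  using that by (intro pw_deriv) auto
 obtain c0 where c0: "c0 > 0" and sol: "!!c. abs(c) <= c0 ==> \<exists>u. smooth_in \<Omega> u \<and>
  (\<forall>x\<in>\<Omega>. u x \<in> {1/2..3/2} & lap u x = c * pw q 0 (u x)) & vanishes_at_bdry \<Omega> (%x. u x - 1)"
  using semilinear[where Fs = "pw q", OF op ldf F] by blast
 have m: "2 * (N - 1) * \<kappa> > 0" using N \<kappa> by simp
 have main: "\<exists>f. smooth_fun_on (closure \<Omega>) f & (\<forall>x\<in>frontier \<Omega>. f x = 0) \<and>
  (\<forall>x\<in>\<Omega>. scalar_curv (conformal_change f flat_metric) x = - (2 * (N - 1) * \<kappa>) * c)" if c: "abs(c) <= c0" for c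
 proof -
  obtain u where u: "smooth_in \<Omega> u" and eq: "!!x. x \<in> \<Omega> ==> u x \<in> {1/2..3/2} & lap u x = c * pw q 0 (u x)"
   and van: "vanishes_at_bdry \<Omega> (%x. u x - 1)" using sol[OF c] by blast
  have up: "u x > 0" if "x \<in> \<Omega>" for x using eq[OF that] by auto
  define Ls where "Ls j t = (case j of 0 => \<kappa> * ln t | Suc i => \<kappa> * pw (-1) i t)" for j :: nat and t :: real
  have Ld: "(Ls j has_real_derivative Ls (Suc j) t) (at t)" if t: "t \<in> {0<..}" for j t
  proof (cases j)
   case 0
   have "((%t. \<kappa> * ln t) has_real_derivative \<kappa> * (1 / t)) (at t)" using t by (auto intro!: derivative_eq_intros)
   moreover have "t powr (-1) = 1 / t" using t by (simp add: powr_minus_divide)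
   ultimately show ?thesis by (simp add: 0 Ls_def[abs_def] pw_simps)
  next
   case (Suc i)
   thus ?thesis using DERIV_cmult[OF pw_deriv[of t "-1" i], of \<kappa>] t by (simp add: Ls_def[abs_def])
  qed
  have smL: "smooth_in U (%x. \<kappa> * ln (v x))" if "open U" "smooth_in U v" "!!x. x \<in> U ==> v x > 0" for U and v :: "real^'n => real"
   using smooth_in_compose_real[where J = "{0<..}" and Fs = Ls and j = 0, OF that(1) Ld _ that(2)] that(3) by (auto simp: Ls_def)
  define f where "f x = (if x \<in> \<Omega> then \<kappa> * ln (u x) else 0)" for x
  have fr: "x \<notin> \<Omega>" if "x \<in> frontier \<Omega>" for x using that op(1) by (simp add: frontier_def interior_open)
  have sf: "smooth_in \<Omega> f"
   by (rule smooth_in_cong[OF op(1) _ smL[OF op(1) u up]]) (simp add: f_def)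
  have "smooth_fun_on (closure \<Omega>) f"
   unfolding smooth_fun_on_def smooth_in_def[symmetric]
  proof
   fix p assume p: "p \<in> closure \<Omega>"
   show "\<exists>U h. open U & p \<in> U & smooth_in U h & (\<forall>y\<in>U \<inter> closure \<Omega>. h y = f y)"
   proof (cases "p \<in> \<Omega>")
    case True
    thus ?thesis using op(1) sf by blast
   next
    case False
    hence pf: "p \<in> frontier \<Omega>" using p op(1) by (simp add: frontier_def interior_open)
    then obtain V d where "ldf \<Omega> p V d" using ldf by blast
    from solution_extends[where Fs = "pw q" and u = u, OF this u van eq F] obtain U h where
     U: "open U" "p \<in> U" "smooth_in U h" "!!x. x \<in> U ==> x \<in> \<Omega> ==> h x = u x"
     by blast
    \<comment> \<open>\<open>h\<close> is only known to agree with \<open>u\<close> inside \<Omega>;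
      its value 1 on the boundary follows from its continuity and the uniform boundary values of
      \<open>u\<close>.\<close>
    have h1: "h y = 1" if y: "y \<in> U" "y \<in> frontier \<Omega>" for y
    proof (rule ccontr)
     assume "h y ~= 1"
     hence e: "abs(h y - 1) / 3 > 0" by simp
     have "isCont h y" using smooth_in_continuous[OF U(3)] U(1) y(1) continuous_on_eq_continuous_at by blast
     then obtain d1 where d1: "d1 > 0" "!!x. dist x y < d1 ==> abs(h x - h y) < abs(h y - 1) / 3"
      using e unfolding continuous_at_eps_delta dist_real_def by blast
     obtain d2 where d2: "d2 > 0" "!!x. x \<in> \<Omega> - inner_part \<Omega> d2 ==> abs(u x - 1) <= abs(h y - 1) / 3"
      using van e unfolding vanishes_at_bdry_def by blast
     obtain d3 where d3: "d3 > 0" "ball y d3 \<subseteq> U" using U(1) y(1) open_contains_ball by blast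
     have "y \<in> closure \<Omega>" using y(2) by (simp add: frontier_def)
     then obtain x where x: "x \<in> \<Omega>" "dist x y < min d1 (min d2 d3)"
      using d1 d2 d3 unfolding closure_approachable by (metis min_less_iff_conj)
     have "y \<in> ball x d2" using x(2) by simp
     hence "x \<notin> inner_part \<Omega> d2" using fr[OF y(2)] by (auto simp: inner_part_def)
     hence ux: "abs(u x - 1) <= abs(h y - 1) / 3" using d2(2) x(1) by blast
     have "x \<in> U" using x(2) d3(2) by (auto simp: dist_commute)
     hence hu: "h x = u x" using U(4) x(1) by blast
     have hh: "abs(h x - h y) < abs(h y - 1) / 3" using d1(2) x(2) by simp
     have "False" if "abs(a - 1) <= abs(b - 1) / 3" "abs(a - b) < abs(b - 1) / 3" for a b :: real
      using that by (auto simp: abs_if split: if_splits)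
     thus False using ux hh unfolding hu by blast
    qed
    \<comment> \<open>The logarithm needs positivity, which holds near \<open>p\<close> because
      \<open>h p = 1\<close>.\<close>
    define U' where "U' = {x \<in> U. h x > 0}"
    have oU': "open U'"
    proof -
     have "U' = U \<inter> h -` {0<..}" by (auto simp: U'_def)
     thus ?thesis using continuous_open_preimage[OF smooth_in_continuous[OF U(3)] U(1), of "{0<..}"] by simp
    qed
    have "smooth_in U' (%x. \<kappa> * ln (h x))" by (rule smL[OF oU' smooth_in_subset[OF U(3)]]) (auto simp: U'_def)
    moreover have "p \<in> U'" using U(2) h1[OF U(2) pf] by (simp add: U'_def)
    moreover have "\<kappa> * ln (h y) = f y" if y: "y \<in> U' \<inter> closure \<Omega>" for y
    proof (cases "y \<in> \<Omega>")
     case True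
     thus ?thesis using U(4)[of y] y by (simp add: f_def U'_def)
    next
     case False
     hence "y \<in> frontier \<Omega>" using y op(1) by (simp add: frontier_def interior_open)
     thus ?thesis using h1[of y] y False by (simp add: f_def U'_def)
    qed
    ultimately show ?thesis using oU' by blast
   qed
  qed
  moreover have "\<forall>x\<in>frontier \<Omega>. f x = 0" using fr by (simp add: f_def)
  moreover have "scalar_curv (conformal_change f flat_metric) x = - (2 * (N - 1) * \<kappa>) * c" if x: "x \<in> \<Omega>" for x
  proof -
   have fx: "f y = Ls 0 (u y)" if "y \<in> \<Omega>" for y using that by (simp add: f_def Ls_def)
   define U where "U = u x"
   have U0: "U > 0" using up[OF x] by (simp add: U_def)
   have L1: "Ls (Suc 0) U = \<kappa> / U" "Ls (Suc (Suc 0)) U = - \<kappa> / U^2"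
    using U0 by (auto simp: Ls_def pw_simps powr_minus_divide powr_numeral)
   have lf: "lap f x = \<kappa> / U * lap u x - \<kappa> / U^2 * grad2 u x"
   proof -
    have "lap f x = lap (%y. Ls 0 (u y)) x" by (rule laplacian_cong[OF op(1) fx x])
    also have "... = Ls (Suc 0) U * lap u x + Ls (Suc (Suc 0)) U * grad2 u x"
     unfolding grad2_def U_def using laplacian_compose[OF op(1) u x, of "Ls 0" "Ls (Suc 0)" "Ls (Suc (Suc 0)) (u x)"] Ld up x by simp
    finally show ?thesis by (simp add: L1)
   qed
   have gf: "grad2 f x = (\<kappa> / U)\<^sup>2 * grad2 u x"
   proof -
    have "pd i f x = \<kappa> / U * pd i u x" for i
    proof -
     have "pd i f x = pd i (%y. Ls 0 (u y)) x" by (rule pd_cong[OF op(1) x fx])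
     also have "... = Ls (Suc 0) U * pd i u x"
      unfolding U_def using pd_compose_real(1)[OF Ld smooth_in_diff[OF u x]] up[OF x] by simp
     finally show ?thesis by (simp add: L1)
    qed
    thus ?thesis by (simp add: grad2_def power_mult_distrib power_divide sum_distrib_left)
   qed
   have ex: "exp (- 2 * f x) = U powr (- 2 * \<kappa>)" using U0 x by (simp add: f_def U_def powr_def)
   have lu: "lap u x = c * U powr (1 + 2 * \<kappa>)" using eq[OF x] by (simp add: U_def pw_simps \<kappa>(3))
   have up1: "U powr (- 2 * \<kappa>) * (1 / U) * U powr (1 + 2 * \<kappa>) = 1"
    using U0 by (simp add: powr_add powr_minus field_simps)
   have "2 * (N - 1) * lap f x + (N - 1) * (N - 2) * grad2 f x
     = 2 * (N - 1) * (\<kappa> / U * lap u x) - 2 * (N - 1) * (\<kappa> / U^2 * grad2 u x) + (N - 1) * (((N - 2) * \<kappa>) * (\<kappa> / U^2 * grad2 u x))"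
   proof -
    have "(\<kappa> / U)\<^sup>2 * g = \<kappa> * (\<kappa> / U^2 * g)" for g by (simp add: power2_eq_square)
    moreover have "2 * (N - 1) * (A - B) + (N - 1) * (N - 2) * (\<kappa> * B) = 2 * (N - 1) * A - 2 * (N - 1) * B + (N - 1) * (((N - 2) * \<kappa>) * B)" for A B
     by (simp add: algebra_simps)
    ultimately show ?thesis unfolding lf gf by simp
   qed
   also have "... = 2 * (N - 1) * \<kappa> * (1 / U * lap u x)"
   proof -
    have "2 * (N - 1) * (\<kappa> / U * a) - 2 * (N - 1) * B + (N - 1) * (2 * B) = 2 * (N - 1) * \<kappa> * (1 / U * a)" for a B
    proof -
     have "(N - 1) * (2 * B) = 2 * (N - 1) * B" by simp
     hence lin: "2 * (N - 1) * (\<kappa> / U * a) - 2 * (N - 1) * B + (N - 1) * (2 * B) = 2 * (N - 1) * (\<kappa> / U * a)" by linarith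
     have e: "\<kappa> / U * a = \<kappa> * (1 / U * a)" by simp
     show ?thesis using lin unfolding e by (simp only: mult.assoc)
    qed
    thus ?thesis unfolding \<kappa>(2) .
   qed
   finally have "scalar_curv (conformal_change f flat_metric) x = - (U powr (- 2 * \<kappa>)) * (2 * (N - 1) * \<kappa> * (1 / U * (c * U powr (1 + 2 * \<kappa>))))"
    unfolding scalar_curv_conformal[OF op(1) sf x, folded N_def] ex lu by simp
   also have "... = - (2 * (N - 1) * \<kappa>) * c * (U powr (- 2 * \<kappa>) * (1 / U) * U powr (1 + 2 * \<kappa>))"      proof -
    have "- P * (M * (I * (c * Q))) = - M * c * (P * I * Q)" for P M I Q :: real by (simp add: mult_ac)
    thus ?thesis .
   qed
   finally show ?thesis unfolding up1 by simp
  qed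
  ultimately show ?thesis by blast
 qed
 \<comment> \<open>\<open>M\<close> is positive and \<open>c\<close> ranges over a symmetric
   interval, so both signs of the curvature are reached, each from a \<open>c\<close> of the
   opposite sign.\<close>
 obtain M where M: "M > 0" and mainM: "!!c. abs(c) <= c0 ==> \<exists>f. smooth_fun_on (closure \<Omega>) f & (\<forall>x\<in>frontier \<Omega>. f x = 0) \<and>
  (\<forall>x\<in>\<Omega>. scalar_curv (conformal_change f flat_metric) x = - M * c)"
  using m main by blast
 show ?thesis
 proof (intro exI[of _ "M * c0"] conjI allI impI)
  show "M * c0 > 0" using M c0 by simp
  fix c assume c: "abs(c) <= M * c0"
  have "abs(- c / M) <= c0" using c M by (simp add: divide_le_eq mult.commute)
  moreover have "- M * (- c / M) = c" using M by simp
  ultimately show "\<exists>f. smooth_fun_on (closure \<Omega>) f & (\<forall>x\<in>frontier \<Omega>. f x = 0) \<and>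
   (\<forall>x\<in>\<Omega>. scalar_curv (conformal_change f flat_metric) x = c)" using mainM[of "- c / M"] by simp
 qed
qed

theorem theorem3:
  fixes \<Omega> :: "(real^'n::finite) set"
  assumes "CARD('n) \<ge> 3"
    and "bounded_smooth_domain \<Omega>"
  shows "(\<exists>f c. smooth_fun_on (closure \<Omega>) f \<and> (\<forall>x\<in>frontier \<Omega>. f x = 0) \<and> c > 0 \<and>
            (\<forall>x\<in>\<Omega>. scalar_curv (conformal_change f flat_metric) x = c)) \<and>
         (\<exists>f c. smooth_fun_on (closure \<Omega>) f \<and> (\<forall>x\<in>frontier \<Omega>. f x = 0) \<and> c < 0 \<and>
            (\<forall>x\<in>\<Omega>. scalar_curv (conformal_change f flat_metric) x = c))"
proof -
 obtain c0 where c0: "c0 > 0" and ex: "!!c. abs(c) <= c0 ==> \<exists>f. smooth_fun_on (closure \<Omega>) f & (\<forall>x\<in>frontier \<Omega>. f x = 0) \<and>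
  (\<forall>x\<in>\<Omega>. scalar_curv (conformal_change f flat_metric) x = c)" using conformal_factor[OF assms] by blast
 obtain f where "smooth_fun_on (closure \<Omega>) f & (\<forall>x\<in>frontier \<Omega>. f x = 0) \<and>
  (\<forall>x\<in>\<Omega>. scalar_curv (conformal_change f flat_metric) x = c0)" using ex[of c0] c0 by auto
 moreover obtain g where "smooth_fun_on (closure \<Omega>) g & (\<forall>x\<in>frontier \<Omega>. g x = 0) \<and>
  (\<forall>x\<in>\<Omega>. scalar_curv (conformal_change g flat_metric) x = - c0)" using ex[of "- c0"] c0 by auto
 moreover have "- c0 < 0" using c0 by simp
 ultimately show ?thesis using c0 by blast
qed

end
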